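(* Let $n>2m$. Then the space $\mathcal H_{n,m}^{U_{O_n}}$ of $U_{O_n}$-invariant harmonic polynomials is a subalgebra of $\mathcal P(M_{n,m})$. Hence the algebra $\mathcal P(M_{n,m})^{U_{O_n}}$ is isomorphic to a tensor product $$\mathcal P(M_{n,m})^{U_{O_n}}\simeq\mathcal H_{n,m}^{U_{O_n}}\otimes\mathcal S(\mathfrak{sp}_{2m}^{(2,0)})$$ of the algebras $\mathcal H_{n,m}^{U_{O_n}}$ and $\mathcal S(\mathfrak{sp}_{2m}^{(2,0)})$. Furthermore, the algebra $\mathcal H_{n,m}^{U_{O_n}}$ is isomorphic (as a representation of $GL_m$) to the subalgebra $\mathcal R^+(GL_m/U_m)$ of $\mathcal R(GL_m/U_m)$ defined by the polynomial representations.
   Context: Everything is over $\mathbb C$. $M_{n,m}$ is the space of $n\times m$ matrices with coordinates $x_{ij}$ and $\mathcal P(M_{n,m})$ its polynomial algebra. $O_n=\{g\in GL_n:gJg^t=J\}$, where $J$ is the antidiagonal matrix of ones; $O_n\times GL_m$ acts by $(g,h)\cdot f(x)=f(g^txh)$. $U_k\subset GL_k$ is the upper triangular unipotent subgroup and $U_{O_n}=U_n\cap O_n$, a maximal unipotent subgroup of $O_n$. Set $r^2_{ij}=\sum_{s=1}^n x_{si}x_{n-s+1,j}$ and $\Delta_{ij}=\sum_{s=1}^n\frac{\partial^2}{\partial x_{si}\partial x_{n-s+1,j}}$ ($1\le i\le j\le m$). $\mathfrak{sp}_{2m}^{(2,0)}=\mathrm{Span}\{r^2_{ij}\}$ and $\mathcal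 S(\cdot)$ denotes the symmetric algebra. $\mathcal H_{n,m}=\{f\in\mathcal P(M_{n,m}):\Delta_{ij}f=0\text{ for all }i,j\}$ is the space of $O_n$-harmonic polynomials. $\mathcal R(GL_m/U_m)$ is the algebra of regular functions on $GL_m/U_m$, which under left translation by $GL_m$ is the direct sum of one copy of each irreducible rational representation of $GL_m$; $\mathcal R^+(GL_m/U_m)$ is the subalgebra that is the sum of the polynomial irreducible representations $F^\lambda_{(m)}$, $\lambda$ a partition with at most $m$ parts. *)

theory Defs
  imports
    "Jordan_Normal_Form.VS_Connect"
    "HOL-Algebra.Subrings"
    "HOL-Algebra.QuotRing"
    "HOL-Library.Poly_Mapping"
begin

text \<open>
  All vector spaces and algebras are over the complex numbers, i.e. over \<open>class_ring :: complex ring\<close>,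
  and are records of type \<open>(complex, _) module\<close>.  Row and column indices start at 0, as usual for
  \<open>Jordan_Normal_Form.Matrix\<close>.
\<close>

section \<open>Algebras\<close>

definition subalg :: "'a set \<Rightarrow> (complex, 'a) module \<Rightarrow> bool" where
  "subalg S A \<longleftrightarrow> subring S A \<and> VectorSpace.subspace class_ring S A"

definition alg_iso :: "(complex, 'a) module \<Rightarrow> (complex, 'b) module \<Rightarrow> ('a \<Rightarrow> 'b) set" where
  "alg_iso A B =
    {\<phi> \<in> ring_iso A B. \<forall>c. \<forall>x \<in> carrier A. \<phi> (c \<odot>\<^bsub>A\<^esub> x) = c \<odot>\<^bsub>B\<^esub> \<phi> x}"

definition quot_alg :: "(complex, 'a) module \<Rightarrow> 'a set \<Rightarrow> (complex, 'a set) module" where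
  "quot_alg A I =
    \<lparr>carrier = carrier (A Quot I), mult = mult (A Quot I), one = one (A Quot I),
     zero = zero (A Quot I), add = add (A Quot I),
     smult = (\<lambda>c X. \<Union>x\<in>X. I +>\<^bsub>A\<^esub> (c \<odot>\<^bsub>A\<^esub> x))\<rparr>"

subsection \<open>Polynomial algebras\<close>

type_synonym 'v cpoly = "('v \<Rightarrow>\<^sub>0 nat) \<Rightarrow>\<^sub>0 complex"

definition const_poly :: "complex \<Rightarrow> 'v cpoly" where
  "const_poly c = Poly_Mapping.single 0 c"

definition var :: "'v \<Rightarrow> 'v cpoly" where
  "var v = Poly_Mapping.single (Poly_Mapping.single v 1) 1"

definition poly_alg :: "'v set \<Rightarrow> (complex, 'v cpoly) module" where
  "poly_alg I =
    \<lparr>carrier = {p. \<forall>\<mu> \<in> Poly_Mapping.keys p. Poly_Mapping.keys \<mu> \<subseteq> I}, mult = (*), one = 1, zero = 0, add = (+),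
     smult = (\<lambda>c p. const_poly c * p)\<rparr>"

text \<open>\<open>poly_eval \<iota> \<sigma> p\<close> substitutes \<open>\<sigma> v\<close> for the variable \<open>v\<close>, the coefficients being embedded by \<open>\<iota>\<close>.\<close>

definition poly_eval :: "(complex \<Rightarrow> 'b::comm_semiring_1) \<Rightarrow> ('v \<Rightarrow> 'b) \<Rightarrow> 'v cpoly \<Rightarrow> 'b" where
  "poly_eval \<iota> \<sigma> p = (\<Sum>\<mu>\<in>Poly_Mapping.keys p. \<iota> (Poly_Mapping.lookup p \<mu>) * (\<Prod>v\<in>Poly_Mapping.keys \<mu>. \<sigma> v ^ Poly_Mapping.lookup \<mu> v))"

text \<open>In the next definition the coefficient vanishes whenever the subtraction of exponents truncates.\<close>

definition pderiv_var :: "'v \<Rightarrow> 'v cpoly \<Rightarrow> 'v cpoly" where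
  "pderiv_var v p =
    (\<Sum>\<mu>\<in>Poly_Mapping.keys p. Poly_Mapping.single (\<mu> - Poly_Mapping.single v 1)
                    (of_nat (Poly_Mapping.lookup \<mu> v) * Poly_Mapping.lookup p \<mu>))"

subsection \<open>Tensor products\<close>

text \<open>
  The vector space freely spanned by \<open>carrier A \<times> carrier B\<close>, with the product
  \<open>(a, b) (a', b') = (a a', b b')\<close> on basis elements.
\<close>

definition free_pairs_alg ::
  "(complex, 'a) module \<Rightarrow> (complex, 'b) module \<Rightarrow> (complex, ('a \<times> 'b) \<Rightarrow>\<^sub>0 complex) module" where
  "free_pairs_alg A B =
    \<lparr>carrier = {f. Poly_Mapping.keys f \<subseteq> carrier A \<times> carrier B},
     mult = (\<lambda>f g. \<Sum>(a, b)\<in>Poly_Mapping.keys f. \<Sum>(a', b')\<in>Poly_Mapping.keys g.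
               Poly_Mapping.single (a \<otimes>\<^bsub>A\<^esub> a', b \<otimes>\<^bsub>B\<^esub> b') (Poly_Mapping.lookup f (a, b) * Poly_Mapping.lookup g (a', b'))),
     one = Poly_Mapping.single (\<one>\<^bsub>A\<^esub>, \<one>\<^bsub>B\<^esub>) 1,
     zero = 0,
     add = (+),
     smult = (\<lambda>c f. Poly_Mapping.map ((*) c) f)\<rparr>"

definition bilinear_relations ::
  "(complex, 'a) module \<Rightarrow> (complex, 'b) module \<Rightarrow> (('a \<times> 'b) \<Rightarrow>\<^sub>0 complex) set" where
  "bilinear_relations A B =
    {Poly_Mapping.single (a \<oplus>\<^bsub>A\<^esub> a', b) 1 - Poly_Mapping.single (a, b) 1 - Poly_Mapping.single (a', b) 1
      | a a' b. a \<in> carrier A \<and> a' \<in> carrier A \<and> b \<in> carrier B} \<union>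
    {Poly_Mapping.single (a, b \<oplus>\<^bsub>B\<^esub> b') 1 - Poly_Mapping.single (a, b) 1 - Poly_Mapping.single (a, b') 1
      | a b b'. a \<in> carrier A \<and> b \<in> carrier B \<and> b' \<in> carrier B} \<union>
    {Poly_Mapping.single (c \<odot>\<^bsub>A\<^esub> a, b) 1 - Poly_Mapping.single (a, b) c
      | c a b. a \<in> carrier A \<and> b \<in> carrier B} \<union>
    {Poly_Mapping.single (a, c \<odot>\<^bsub>B\<^esub> b) 1 - Poly_Mapping.single (a, b) c
      | c a b. a \<in> carrier A \<and> b \<in> carrier B}"

text \<open>
  The linear span of the bilinear relations is already an ideal, so the quotient below is the usual
  tensor product of vector spaces with the usual product.
\<close>

definition tensor_alg ::
  "(complex, 'a) module \<Rightarrow> (complex, 'b) module \<Rightarrow> (complex, (('a \<times> 'b) \<Rightarrow>\<^sub>0 complex) set) module" where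
  "tensor_alg A B =
    quot_alg (free_pairs_alg A B) (Idl\<^bsub>free_pairs_alg A B\<^esub> (bilinear_relations A B))"

subsection \<open>Symmetric algebras\<close>

text \<open>
  The symmetric algebra of a vector space \<open>V\<close> as the commutative algebra generated by symbols \<open>var v\<close>
  for all vectors \<open>v\<close> of \<open>V\<close>, subject to the relations making \<open>v \<mapsto> var v\<close> linear.  Only the
  vector space structure of the record \<open>V\<close> is used.
\<close>

definition linear_relations :: "(complex, 'v) module \<Rightarrow> 'v cpoly set" where
  "linear_relations V =
    {var (v \<oplus>\<^bsub>V\<^esub> w) - var v - var w | v w. v \<in> carrier V \<and> w \<in> carrier V} \<union>
    {var (c \<odot>\<^bsub>V\<^esub> v) - const_poly c * var v | c v. v \<in> carrier V}"

definition sym_alg :: "(complex, 'v) module \<Rightarrow> (complex, 'v cpoly set) module" where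
  "sym_alg V =
    quot_alg (poly_alg (carrier V)) (Idl\<^bsub>poly_alg (carrier V)\<^esub> (linear_relations V))"

section \<open>Matrix groups and representations\<close>

definition GL :: "nat \<Rightarrow> complex mat monoid" where
  "GL k = units_of (ring_mat TYPE(complex) k ())"

definition antidiag :: "nat \<Rightarrow> complex mat" where
  "antidiag k = mat k k (\<lambda>(i, j). if i + j = k - 1 then 1 else 0)"

definition orth :: "nat \<Rightarrow> complex mat set" where
  "orth k = {g \<in> carrier (GL k). g * antidiag k * transpose_mat g = antidiag k}"

definition unip :: "nat \<Rightarrow> complex mat set" where
  "unip k = {g \<in> carrier (GL k). upper_triangular g \<and> (\<forall>i<k. g $$ (i, i) = 1)}"

definition unip_orth :: "nat \<Rightarrow> complex mat set" where
  "unip_orth k = unip k \<inter> orth k"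

definition representation ::
  "complex mat monoid \<Rightarrow> (complex, 'v) module \<Rightarrow> (complex mat \<Rightarrow> 'v \<Rightarrow> 'v) \<Rightarrow> bool" where
  "representation G V \<rho> \<longleftrightarrow>
    (\<forall>g \<in> carrier G. linear_map class_ring V V (\<rho> g)) \<and>
    (\<forall>v \<in> carrier V. \<rho> \<one>\<^bsub>G\<^esub> v = v) \<and>
    (\<forall>g \<in> carrier G. \<forall>h \<in> carrier G. \<forall>v \<in> carrier V. \<rho> (g \<otimes>\<^bsub>G\<^esub> h) v = \<rho> g (\<rho> h v))"

definition irreducible_rep ::
  "complex mat monoid \<Rightarrow> (complex, 'v) module \<Rightarrow> (complex mat \<Rightarrow> 'v \<Rightarrow> 'v) \<Rightarrow> bool" where
  "irreducible_rep G V \<rho> \<longleftrightarrow>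
    representation G V \<rho> \<and> carrier V \<noteq> {\<zero>\<^bsub>V\<^esub>} \<and>
    (\<forall>W. VectorSpace.subspace class_ring W V \<and> (\<forall>g \<in> carrier G. \<rho> g ` W \<subseteq> W)
          \<longrightarrow> W = {\<zero>\<^bsub>V\<^esub>} \<or> W = carrier V)"

definition complex_line :: "(complex, complex) module" where
  "complex_line =
    \<lparr>carrier = UNIV, mult = (*), one = 1, zero = 0, add = (+), smult = (*)\<rparr>"

text \<open>The functions \<open>h \<mapsto> \<phi> (\<rho> h v)\<close>, with \<open>\<phi>\<close> a linear functional, are the matrix coefficients of \<open>\<rho>\<close>.\<close>

definition polynomial_rep ::
  "nat \<Rightarrow> (complex, 'v) module \<Rightarrow> (complex mat \<Rightarrow> 'v \<Rightarrow> 'v) \<Rightarrow> bool" where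
  "polynomial_rep m V \<rho> \<longleftrightarrow>
    representation (GL m) V \<rho> \<and> vectorspace.fin_dim class_ring V \<and>
    (\<forall>\<phi> \<in> LinearCombinations.module_hom class_ring V complex_line. \<forall>v \<in> carrier V.
       \<exists>p \<in> carrier (poly_alg ({0..<m} \<times> {0..<m})).
         \<forall>h \<in> carrier (GL m). \<phi> (\<rho> h v) = poly_eval id (\<lambda>ij. h $$ ij) p)"

definition rep_iso ::
  "complex mat monoid \<Rightarrow> (complex, 'v) module \<Rightarrow> (complex mat \<Rightarrow> 'v \<Rightarrow> 'v) \<Rightarrow>
   (complex, 'w) module \<Rightarrow> (complex mat \<Rightarrow> 'w \<Rightarrow> 'w) \<Rightarrow> ('v \<Rightarrow> 'w) set" where
  "rep_iso G V \<rho> W \<tau> =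
    {\<phi>. representation G V \<rho> \<and> representation G W \<tau> \<and>
        linear_map class_ring V W \<phi> \<and> bij_betw \<phi> (carrier V) (carrier W) \<and>
        (\<forall>g \<in> carrier G. \<forall>v \<in> carrier V. \<phi> (\<rho> g v) = \<tau> g (\<phi> v))}"

section \<open>Harmonic polynomials on matrices\<close>

abbreviation P_mat :: "nat \<Rightarrow> nat \<Rightarrow> (complex, (nat \<times> nat) cpoly) module" where
  "P_mat n m \<equiv> poly_alg ({0..<n} \<times> {0..<m})"

text \<open>The action \<open>((g, h) \<cdot> f) (x) = f (g\<^sup>t x h)\<close>, with \<open>x\<close> the matrix of variables.\<close>

definition act ::
  "nat \<Rightarrow> nat \<Rightarrow> complex mat \<Rightarrow> complex mat \<Rightarrow> (nat \<times> nat) cpoly \<Rightarrow> (nat \<times> nat) cpoly" where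
  "act n m g h f =
    poly_eval const_poly
      (\<lambda>ij. (map_mat const_poly (transpose_mat g) * mat n m var * map_mat const_poly h) $$ ij) f"

definition r2 :: "nat \<Rightarrow> nat \<Rightarrow> nat \<Rightarrow> (nat \<times> nat) cpoly" where
  "r2 n i j = (\<Sum>s<n. var (s, i) * var (n - 1 - s, j))"

definition Laplacian :: "nat \<Rightarrow> nat \<Rightarrow> nat \<Rightarrow> (nat \<times> nat) cpoly \<Rightarrow> (nat \<times> nat) cpoly" where
  "Laplacian n i j f = (\<Sum>s<n. pderiv_var (s, i) (pderiv_var (n - 1 - s, j) f))"

definition sp20 :: "nat \<Rightarrow> nat \<Rightarrow> (nat \<times> nat) cpoly set" where
  "sp20 n m = LinearCombinations.module.span class_ring (P_mat n m) {r2 n i j | i j. i \<le> j \<and> j < m}"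

definition harmonics :: "nat \<Rightarrow> nat \<Rightarrow> (nat \<times> nat) cpoly set" where
  "harmonics n m =
    {f \<in> carrier (P_mat n m). \<forall>i j. i \<le> j \<and> j < m \<longrightarrow> Laplacian n i j f = 0}"

definition U_invariants :: "nat \<Rightarrow> nat \<Rightarrow> (nat \<times> nat) cpoly set" where
  "U_invariants n m = {f \<in> carrier (P_mat n m). \<forall>u \<in> unip_orth n. act n m u (1\<^sub>m m) f = f}"

definition PU_alg :: "nat \<Rightarrow> nat \<Rightarrow> (complex, (nat \<times> nat) cpoly) module" where
  "PU_alg n m = P_mat n m\<lparr>carrier := U_invariants n m\<rparr>"

definition HU_alg :: "nat \<Rightarrow> nat \<Rightarrow> (complex, (nat \<times> nat) cpoly) module" where
  "HU_alg n m = P_mat n m\<lparr>carrier := harmonics n m \<inter> U_invariants n m\<rparr>"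

definition sp20_space :: "nat \<Rightarrow> nat \<Rightarrow> (complex, (nat \<times> nat) cpoly) module" where
  "sp20_space n m = P_mat n m\<lparr>carrier := sp20 n m\<rparr>"

section \<open>Regular functions on \<open>GL\<^sub>m / U\<^sub>m\<close>\<close>

text \<open>
  Regular functions on \<open>GL\<^sub>m\<close> are the functions \<open>p / det\<^sup>k\<close> with \<open>p\<close> a polynomial in the matrix
  entries.  They are represented by functions that are \<open>undefined\<close> outside \<open>GL\<^sub>m\<close>.
\<close>

definition R_GL :: "nat \<Rightarrow> (complex, complex mat \<Rightarrow> complex) module" where
  "R_GL m =
    \<lparr>carrier = {f \<in> extensional (carrier (GL m)).
        \<exists>p \<in> carrier (poly_alg ({0..<m} \<times> {0..<m})). \<exists>k::nat.
          \<forall>g \<in> carrier (GL m). f g = poly_eval id (\<lambda>ij. g $$ ij) p / det g ^ k},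
     mult = (\<lambda>f f'. \<lambda>g\<in>carrier (GL m). f g * f' g),
     one = (\<lambda>g\<in>carrier (GL m). 1),
     zero = (\<lambda>g\<in>carrier (GL m). 0),
     add = (\<lambda>f f'. \<lambda>g\<in>carrier (GL m). f g + f' g),
     smult = (\<lambda>c f. \<lambda>g\<in>carrier (GL m). c * f g)\<rparr>"

text \<open>Functions on \<open>GL\<^sub>m / U\<^sub>m\<close> are identified with the functions on \<open>GL\<^sub>m\<close> constant on cosets \<open>g U\<^sub>m\<close>.\<close>

definition R_GL_mod_U :: "nat \<Rightarrow> (complex, complex mat \<Rightarrow> complex) module" where
  "R_GL_mod_U m =
    R_GL m\<lparr>carrier := {f \<in> carrier (R_GL m). \<forall>g \<in> carrier (GL m). \<forall>u \<in> unip m. f (g * u) = f g}\<rparr>"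

definition left_translation ::
  "nat \<Rightarrow> complex mat \<Rightarrow> (complex mat \<Rightarrow> complex) \<Rightarrow> complex mat \<Rightarrow> complex" where
  "left_translation m h f = (\<lambda>g\<in>carrier (GL m). f (inv\<^bsub>GL m\<^esub> h * g))"

text \<open>
  The representations \<open>F\<^sup>\<lambda>\<close>, with \<open>\<lambda>\<close> a partition with at most \<open>m\<close> parts, are up to isomorphism
  the irreducible polynomial representations of \<open>GL\<^sub>m\<close>.  The elements of \<open>R_plus m\<close> are polynomial
  functions of \<open>g\<^sup>-\<^sup>1\<close>, since \<open>GL\<^sub>m\<close> acts by left translation.
\<close>

definition R_plus :: "nat \<Rightarrow> (complex mat \<Rightarrow> complex) set" where
  "R_plus m =
    LinearCombinations.module.span class_ring (R_GL_mod_U m)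
      (\<Union>{W. VectorSpace.subspace class_ring W (R_GL_mod_U m) \<and>
            irreducible_rep (GL m) (R_GL_mod_U m\<lparr>carrier := W\<rparr>) (left_translation m) \<and>
            polynomial_rep m (R_GL_mod_U m\<lparr>carrier := W\<rparr>) (left_translation m)})"

definition R_plus_alg :: "nat \<Rightarrow> (complex, complex mat \<Rightarrow> complex) module" where
  "R_plus_alg m = R_GL_mod_U m\<lparr>carrier := R_plus m\<rparr>"

end

theory Submission
  imports Defs "Jordan_Normal_Form.Schur_Decomposition"
begin

text \<open>
  Where the top \<open>m\<close> rows of \<open>x\<close> form an invertible matrix \<open>t\<close>, the group \<open>U\<^sub>O\<^sub>n\<close> moves \<open>x\<close> to a
  canonical point that depends only on \<open>t\<close> and on the values of the quadratic invariants
  \<open>r\<^sup>2\<^sub>i\<^sub>j\<close>.  So an invariant polynomial becomes, after multiplication by a power of \<open>det t\<close>, a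
  polynomial in \<open>t\<close> and the \<open>r\<^sup>2\<^sub>i\<^sub>j\<close>; as \<open>n > 2m\<close>, the values of the \<open>r\<^sup>2\<^sub>i\<^sub>j\<close> can be prescribed
  freely even where \<open>t\<close> has corank one, so this power can be cancelled.  Hence the invariants are a polynomial
  ring in the \<open>r\<^sup>2\<^sub>i\<^sub>j\<close> over the ring \<open>L\<close> of those polynomials in \<open>t\<close> that are invariant under
  left multiplication of \<open>t\<close> by the transposes of \<open>U\<^sub>m\<close>.  The elements of \<open>L\<close> are harmonic,
  because the top rows pair to zero under \<open>J\<close>; and an invariant harmonic polynomial lies in \<open>L\<close>, since for the Fischer inner product the harmonics are
  orthogonal to the ideal of the \<open>r\<^sup>2\<^sub>i\<^sub>j\<close>.

  Evaluating an element of \<open>L\<close> on \<open>GL\<^sub>m\<close> at the inverse matrix with its rows reversed gives an injective homomorphism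
  into \<open>R(GL\<^sub>m/U\<^sub>m)\<close>.  Its image contains every polynomial representation, as \<open>F(g)\<close> is the matrix
  coefficient of \<open>g\<^sup>-\<^sup>1 F\<close> at the unit.  Conversely \<open>L\<close> is a sum of irreducible polynomial representations,
  by the Fischer inner product once more: the adjoint of the action of \<open>h\<close> is that of its conjugate
  transpose, so orthogonal complements of invariant subspaces are invariant.
\<close>

section \<open>Substitution into polynomials\<close>

text \<open>The delicate step is the cancellation of det t. Divisibility by det t is reached through
  the pencil t + x 1, whose determinant is monic in x: division leaves no denominators, and the
  remainder can be tested at its roots. This is why matrices of corank one are the right test
  points: if t has distinct eigenvalues, every singular member of its pencil has corank one. The
  strict inequality n > 2m is decisive at such points. If v spans the kernel of t, the top and
  bottom rows together contribute 0 to the value v^T s v of the form s with entries r^2_ij. A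
  nonempty middle block adds a form w w^T and so makes this value arbitrary. The tensor product and
  the symmetric algebra are explicit quotients of free objects, so injectivity of the multiplication
  map comes from a normal form of their elements modulo the relations. On the side of GL_m,
  \<open>R_plus\<close> is a span of finite-dimensional subrepresentations, whereas L is
  infinite-dimensional; the filtration of L by degree mediates between the two.\<close>

definition mon_eval :: "('v \<Rightarrow> 'b::comm_monoid_mult) \<Rightarrow> ('v \<Rightarrow>\<^sub>0 nat) \<Rightarrow> 'b" where
  "mon_eval \<sigma> \<mu> = (\<Prod>v\<in>Poly_Mapping.keys \<mu>. \<sigma> v ^ Poly_Mapping.lookup \<mu> v)"

lemma mon_eval_superset:
  assumes "finite V" "Poly_Mapping.keys \<mu> \<subseteq> V"
  shows "mon_eval \<sigma> \<mu> = (\<Prod>v\<in>V. \<sigma> v ^ Poly_Mapping.lookup \<mu> v)"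
  unfolding mon_eval_def
  by (rule prod.mono_neutral_left) (use assms in \<open>auto simp: in_keys_iff\<close>)

lemma mon_eval_0 [simp]: "mon_eval \<sigma> 0 = 1"
  by (simp add: mon_eval_def)

lemma mon_eval_add: "mon_eval \<sigma> (\<mu> + \<nu>) = mon_eval \<sigma> \<mu> * mon_eval \<sigma> \<nu>"
proof -
  let ?V = "Poly_Mapping.keys \<mu> \<union> Poly_Mapping.keys \<nu>"
  have "mon_eval \<sigma> (\<mu> + \<nu>) = (\<Prod>v\<in>?V. \<sigma> v ^ Poly_Mapping.lookup (\<mu> + \<nu>) v)"
    by (rule mon_eval_superset) (use keys_add[of \<mu> \<nu>] in auto)
  also have "\<dots> = (\<Prod>v\<in>?V. \<sigma> v ^ Poly_Mapping.lookup \<mu> v) * (\<Prod>v\<in>?V. \<sigma> v ^ Poly_Mapping.lookup \<nu> v)"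
    by (simp add: lookup_add power_add prod.distrib)
  also have "\<dots> = mon_eval \<sigma> \<mu> * mon_eval \<sigma> \<nu>"
    by (simp add: mon_eval_superset[of ?V])
  finally show ?thesis .
qed

lemma mon_eval_single [simp]: "mon_eval \<sigma> (Poly_Mapping.single v k) = \<sigma> v ^ k"
  by (simp add: mon_eval_def)

lemma mon_eval_cong:
  "(\<And>v. v \<in> Poly_Mapping.keys \<mu> \<Longrightarrow> \<sigma> v = \<tau> v) \<Longrightarrow> mon_eval \<sigma> \<mu> = mon_eval \<tau> \<mu>"
  by (simp add: mon_eval_def)

lemma poly_mapping_sum_singles:
  "p = (\<Sum>\<mu>\<in>Poly_Mapping.keys p. Poly_Mapping.single \<mu> (Poly_Mapping.lookup p \<mu>))"
proof (rule poly_mapping_eqI)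
  fix k
  have "Poly_Mapping.lookup (\<Sum>\<mu>\<in>Poly_Mapping.keys p. Poly_Mapping.single \<mu> (Poly_Mapping.lookup p \<mu>)) k
    = (\<Sum>\<mu>\<in>Poly_Mapping.keys p. if \<mu> = k then Poly_Mapping.lookup p \<mu> else 0)"
    by (simp add: lookup_sum lookup_single when_def)
  then show "Poly_Mapping.lookup p k = Poly_Mapping.lookup (\<Sum>\<mu>\<in>Poly_Mapping.keys p. Poly_Mapping.single \<mu> (Poly_Mapping.lookup p \<mu>)) k"
    by (auto simp: sum.delta in_keys_iff)
qed

lemma poly_mapping_additive_induct [case_names zero single add]:
  assumes "P 0" "\<And>k c. P (Poly_Mapping.single k c)" "\<And>p q. P p \<Longrightarrow> P q \<Longrightarrow> P (p + q)"
  shows "P (p :: 'a \<Rightarrow>\<^sub>0 'b::comm_monoid_add)"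
proof -
  have "P (\<Sum>\<mu>\<in>A. Poly_Mapping.single \<mu> (Poly_Mapping.lookup p \<mu>))" if "finite A" for A
    using that by induction (auto intro: assms)
  then show ?thesis
    using poly_mapping_sum_singles[of p] finite_keys[of p] by metis
qed

text \<open>One account of substitution serves three coefficient embeddings: numbers (values at
  points), constant polynomials (substitution of polynomials for variables) and constant univariate
  polynomials (restriction to a curve).\<close>

locale coeff_hom =
  fixes \<iota> :: "complex \<Rightarrow> 'b::comm_ring_1"
  assumes map_1: "\<iota> 1 = 1" and map_add: "\<iota> (a + b) = \<iota> a + \<iota> b" and map_mult: "\<iota> (a * b) = \<iota> a * \<iota> b"
begin

lemma map_0: "\<iota> 0 = 0"
  using map_add[of 0 0] by simp

lemma poly_eval_superset:
  assumes "finite A" "Poly_Mapping.keys p \<subseteq> A"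
  shows "poly_eval \<iota> \<sigma> p = (\<Sum>\<mu>\<in>A. \<iota> (Poly_Mapping.lookup p \<mu>) * mon_eval \<sigma> \<mu>)"
  unfolding poly_eval_def mon_eval_def[symmetric]
  by (rule sum.mono_neutral_left) (use assms in \<open>auto simp: in_keys_iff map_0\<close>)

lemma poly_eval_0: "poly_eval \<iota> \<sigma> 0 = 0"
  by (simp add: poly_eval_def)

lemma poly_eval_add: "poly_eval \<iota> \<sigma> (p + q) = poly_eval \<iota> \<sigma> p + poly_eval \<iota> \<sigma> q"
proof -
  let ?A = "Poly_Mapping.keys p \<union> Poly_Mapping.keys q"
  have "poly_eval \<iota> \<sigma> (p + q) = (\<Sum>\<mu>\<in>?A. \<iota> (Poly_Mapping.lookup (p + q) \<mu>) * mon_eval \<sigma> \<mu>)"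
    by (rule poly_eval_superset) (use keys_add[of p q] in auto)
  also have "\<dots> = (\<Sum>\<mu>\<in>?A. \<iota> (Poly_Mapping.lookup p \<mu>) * mon_eval \<sigma> \<mu>) + (\<Sum>\<mu>\<in>?A. \<iota> (Poly_Mapping.lookup q \<mu>) * mon_eval \<sigma> \<mu>)"
    by (simp add: lookup_add map_add distrib_right sum.distrib)
  also have "\<dots> = poly_eval \<iota> \<sigma> p + poly_eval \<iota> \<sigma> q"
    by (simp add: poly_eval_superset[of ?A])
  finally show ?thesis .
qed

lemma poly_eval_single: "poly_eval \<iota> \<sigma> (Poly_Mapping.single \<mu> c) = \<iota> c * mon_eval \<sigma> \<mu>"
  using poly_eval_superset[of "{\<mu>}" "Poly_Mapping.single \<mu> c" \<sigma>] by simp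

lemma poly_eval_mult: "poly_eval \<iota> \<sigma> (p * q) = poly_eval \<iota> \<sigma> p * poly_eval \<iota> \<sigma> q"
proof (induction p rule: poly_mapping_additive_induct)
  case (single \<mu> a)
  show ?case
  proof (induction q rule: poly_mapping_additive_induct)
    case (single \<nu> b)
    show ?case by (simp add: mult_single poly_eval_single mon_eval_add map_mult mult_ac)
  qed (simp_all add: poly_eval_0 poly_eval_add distrib_left)
qed (simp_all add: poly_eval_0 poly_eval_add distrib_right)

lemma poly_eval_const: "poly_eval \<iota> \<sigma> (const_poly c) = \<iota> c"
  by (simp add: const_poly_def poly_eval_single)

lemma poly_eval_1: "poly_eval \<iota> \<sigma> 1 = 1"
  using poly_eval_const[of \<sigma> 1] by (simp add: const_poly_def map_1)

lemma poly_eval_var: "poly_eval \<iota> \<sigma> (var v) = \<sigma> v"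
  by (simp add: var_def poly_eval_single map_1)

lemma poly_eval_sum: "poly_eval \<iota> \<sigma> (sum f A) = (\<Sum>a\<in>A. poly_eval \<iota> \<sigma> (f a))"
  by (induction A rule: infinite_finite_induct) (auto simp: poly_eval_0 poly_eval_add)

lemma poly_eval_prod: "poly_eval \<iota> \<sigma> (prod f A) = (\<Prod>a\<in>A. poly_eval \<iota> \<sigma> (f a))"
  by (induction A rule: infinite_finite_induct) (auto simp: poly_eval_1 poly_eval_mult)

lemma poly_eval_power: "poly_eval \<iota> \<sigma> (p ^ k) = poly_eval \<iota> \<sigma> p ^ k"
  by (induction k) (auto simp: poly_eval_1 poly_eval_mult)

lemma poly_eval_uminus: "poly_eval \<iota> \<sigma> (- p) = - poly_eval \<iota> \<sigma> p"
  using poly_eval_add[of \<sigma> p "- p"] by (simp add: poly_eval_0 eq_neg_iff_add_eq_0 add.commute)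

lemma poly_eval_diff: "poly_eval \<iota> \<sigma> (p - q) = poly_eval \<iota> \<sigma> p - poly_eval \<iota> \<sigma> q"
  using poly_eval_add[of \<sigma> p "- q"] by (simp add: poly_eval_uminus)

lemma poly_eval_mon: "poly_eval \<iota> \<sigma> (mon_eval \<tau> \<mu>) = mon_eval (\<lambda>v. poly_eval \<iota> \<sigma> (\<tau> v)) \<mu>"
  by (simp add: mon_eval_def poly_eval_prod poly_eval_power)

lemmas poly_eval_simps = poly_eval_0 poly_eval_1 poly_eval_add poly_eval_mult poly_eval_const
  poly_eval_var poly_eval_sum poly_eval_prod poly_eval_power poly_eval_uminus poly_eval_diff

end

lemma const_poly_0 [simp]: "const_poly 0 = 0" and const_poly_1 [simp]: "const_poly 1 = 1"
  by (simp_all add: const_poly_def)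

lemma const_poly_add: "const_poly (a + b) = const_poly a + const_poly b"
  by (simp add: const_poly_def single_add)

lemma const_poly_mult: "const_poly (a * b) = const_poly a * const_poly b"
  by (simp add: const_poly_def mult_single)

definition ev :: "('v \<Rightarrow> complex) \<Rightarrow> 'v cpoly \<Rightarrow> complex" where
  "ev = poly_eval id"

interpretation ev: coeff_hom "id :: complex \<Rightarrow> complex"
  rewrites "poly_eval (id :: complex \<Rightarrow> complex) = ev"
  by unfold_locales (auto simp: ev_def)

interpretation subst: coeff_hom "const_poly :: complex \<Rightarrow> 'v cpoly"
  by unfold_locales (auto simp: const_poly_add const_poly_mult)

interpretation upoly: coeff_hom "\<lambda>c :: complex. [:c:]"
  by unfold_locales (auto simp: one_pCons)

lemma lookup_const_mult:
  "Poly_Mapping.lookup (const_poly c * p) \<mu> = c * Poly_Mapping.lookup p \<mu>"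
proof (induction p rule: poly_mapping_additive_induct)
  case (single k a)
  then show ?case by (simp add: const_poly_def mult_single lookup_single when_def)
qed (simp_all add: lookup_add distrib_left)

lemma poly_eval_eq: "poly_eval \<iota> \<sigma> p = (\<Sum>\<mu>\<in>Poly_Mapping.keys p. \<iota> (Poly_Mapping.lookup p \<mu>) * mon_eval \<sigma> \<mu>)"
  by (simp add: poly_eval_def mon_eval_def)

text \<open>A ring map compatible with the coefficients passes through the sum of monomials. This
  yields both evaluation after substitution and evaluation along a curve.\<close>

lemma poly_eval_hom:
  fixes \<iota> :: "complex \<Rightarrow> 'a::comm_ring_1" and \<kappa> :: "complex \<Rightarrow> 'b::comm_ring_1" and \<sigma> :: "'v \<Rightarrow> 'a"
  assumes "coeff_hom \<iota>" "coeff_hom \<kappa>" and h: "\<And>c. h (\<iota> c) = \<kappa> c" "\<And>a b. h (a + b) = h a + h b" "\<And>a b. h (a * b) = h a * h b"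
  shows "h (poly_eval \<iota> \<sigma> p) = poly_eval \<kappa> (\<lambda>v. h (\<sigma> v)) p"
proof -
  interpret i: coeff_hom \<iota> by fact
  interpret k: coeff_hom \<kappa> by fact
  have h0: "h 0 = 0" using h(1)[of 0] by (simp add: i.map_0 k.map_0)
  have h1: "h 1 = 1" using h(1)[of 1] by (simp add: i.map_1 k.map_1)
  have hs: "h (sum f A) = (\<Sum>a\<in>A. h (f a))" for f :: "('v \<Rightarrow>\<^sub>0 nat) \<Rightarrow> 'a" and A
    by (induction A rule: infinite_finite_induct) (auto simp: h0 h)
  have hp: "h (prod f A) = (\<Prod>a\<in>A. h (f a))" for f :: "'v \<Rightarrow> 'a" and A
    by (induction A rule: infinite_finite_induct) (auto simp: h1 h)
  have hw: "h (x ^ k) = h x ^ k" for x k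
    by (induction k) (auto simp: h1 h)
  show ?thesis
    by (simp add: poly_eval_def hs h hp hw)
qed

lemma ev_subst: "ev \<sigma> (poly_eval const_poly \<tau> p) = ev (\<lambda>v. ev \<sigma> (\<tau> v)) p"
  by (rule poly_eval_hom[where h = "ev \<sigma>", OF subst.coeff_hom_axioms ev.coeff_hom_axioms, folded ev_def])
    (simp_all add: ev.poly_eval_const ev.poly_eval_add ev.poly_eval_mult)

lemma poly_upoly: "poly (poly_eval (\<lambda>c. [:c:]) \<tau> p) x = ev (\<lambda>v. poly (\<tau> v) x) p"
  by (rule poly_eval_hom[where h = "\<lambda>p. poly p x", OF upoly.coeff_hom_axioms ev.coeff_hom_axioms, folded ev_def]) simp_all

section \<open>Polynomial algebras\<close>

definition polys :: "'v set \<Rightarrow> 'v cpoly set" where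
  "polys I = carrier (poly_alg I)"

lemma polys_iff: "p \<in> polys I \<longleftrightarrow> (\<forall>\<mu> \<in> Poly_Mapping.keys p. Poly_Mapping.keys \<mu> \<subseteq> I)"
  by (simp add: polys_def poly_alg_def)

lemma polys_mono: "I \<subseteq> J \<Longrightarrow> polys I \<subseteq> polys J"
  unfolding polys_iff subset_iff by blast

lemma polys_UNIV: "p \<in> polys UNIV"
  by (simp add: polys_iff)

lemma const_in_polys [simp]: "const_poly c \<in> polys I"
  by (auto simp: polys_iff const_poly_def split: if_splits)

lemma zero_in_polys [simp]: "0 \<in> polys I" and one_in_polys [simp]: "1 \<in> polys I"
  by (auto simp: polys_iff)

lemma var_in_polys [simp]: "v \<in> I \<Longrightarrow> var v \<in> polys I"
  by (auto simp: polys_iff var_def)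

lemma add_in_polys: "p \<in> polys I \<Longrightarrow> q \<in> polys I \<Longrightarrow> p + q \<in> polys I"
  using keys_add[of p q] by (auto simp: polys_iff)

lemma uminus_in_polys: "p \<in> polys I \<Longrightarrow> - p \<in> polys I"
  by (auto simp: polys_iff in_keys_iff)

lemma diff_in_polys: "p \<in> polys I \<Longrightarrow> q \<in> polys I \<Longrightarrow> p - q \<in> polys I"
  using add_in_polys[of p I "- q"] uminus_in_polys[of q I] by simp

lemma mult_in_polys:
  assumes "p \<in> polys I" "q \<in> polys I"
  shows "p * q \<in> polys I"
  unfolding polys_iff
proof
  fix \<mu> assume "\<mu> \<in> Poly_Mapping.keys (p * q)"
  then obtain a b where ab: "a \<in> Poly_Mapping.keys p" "b \<in> Poly_Mapping.keys q" "\<mu> = a + b"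
    using keys_mult[of p q] by blast
  then show "Poly_Mapping.keys \<mu> \<subseteq> I"
    using assms keys_add[of a b] unfolding polys_iff by blast
qed

lemma sum_in_polys: "(\<And>a. a \<in> A \<Longrightarrow> f a \<in> polys I) \<Longrightarrow> sum f A \<in> polys I"
  by (induction A rule: infinite_finite_induct) (auto intro: add_in_polys)

lemma prod_in_polys: "(\<And>a. a \<in> A \<Longrightarrow> f a \<in> polys I) \<Longrightarrow> prod f A \<in> polys I"
  by (induction A rule: infinite_finite_induct) (auto intro: mult_in_polys)

lemma power_in_polys: "p \<in> polys I \<Longrightarrow> p ^ k \<in> polys I"
  by (induction k) (auto intro: mult_in_polys)

lemma mon_in_polys: "(\<And>v. v \<in> Poly_Mapping.keys \<mu> \<Longrightarrow> \<tau> v \<in> polys I) \<Longrightarrow> mon_eval \<tau> \<mu> \<in> polys I"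
  unfolding mon_eval_def by (auto intro!: prod_in_polys power_in_polys)

lemma subst_in_polys:
  assumes "p \<in> polys I" "\<And>v. v \<in> I \<Longrightarrow> \<tau> v \<in> polys J"
  shows "poly_eval const_poly \<tau> p \<in> polys J"
  unfolding poly_eval_eq
  using assms by (auto intro!: sum_in_polys mult_in_polys mon_in_polys simp: polys_iff[of p])

lemma ev_eq: "ev \<sigma> p = (\<Sum>\<mu>\<in>Poly_Mapping.keys p. Poly_Mapping.lookup p \<mu> * mon_eval \<sigma> \<mu>)"
  by (simp add: ev_def poly_eval_eq)

lemma poly_eval_cong:
  assumes "p \<in> polys I" "\<And>v. v \<in> I \<Longrightarrow> \<sigma> v = \<tau> v"
  shows "poly_eval \<iota> \<sigma> p = poly_eval \<iota> \<tau> p"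
  unfolding poly_eval_eq using assms
  by (intro sum.cong arg_cong2[where f = "(*)"] mon_eval_cong refl) (auto simp: polys_iff)

lemma mon_eval_var: "mon_eval var \<mu> = Poly_Mapping.single \<mu> (1::complex)"
proof (induction \<mu> rule: poly_mapping_additive_induct)
  case (single v k)
  show ?case
  proof (induction k)
    case (Suc k)
    have "Poly_Mapping.single v (Suc k) = Poly_Mapping.single v 1 + Poly_Mapping.single v k"
      by (simp flip: single_add)
    then show ?case
      using Suc by (simp add: mon_eval_add mult_single var_def)
  qed simp
next
  case (add \<mu> \<nu>)
  then show ?case by (simp add: mon_eval_add mult_single)
qed simp

lemma subst_var: "poly_eval const_poly var p = p"
proof (induction p rule: poly_mapping_additive_induct)
  case (single k c)
  then show ?case by (simp add: subst.poly_eval_single mon_eval_var mult_single) (simp add: const_poly_def mult_single)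
qed (auto simp: subst.poly_eval_simps)

text \<open>Every polynomial arises from constants by additions and by multiplications with one
  variable at a time. Regularity, the chain rule and adjoints are all checked in this way on single
  variables.\<close>

lemma polys_induct [consumes 1, case_names const var add]:
  assumes p: "p \<in> polys I"
    and const: "\<And>c. P (const_poly c)"
    and var: "\<And>v p. v \<in> I \<Longrightarrow> p \<in> polys I \<Longrightarrow> P p \<Longrightarrow> P (var v * p)"
    and add: "\<And>p q. p \<in> polys I \<Longrightarrow> q \<in> polys I \<Longrightarrow> P p \<Longrightarrow> P q \<Longrightarrow> P (p + q)"
  shows "P p"
proof -
  have pow: "P (var v ^ k * q) \<and> var v ^ k * q \<in> polys I" if "P q" "q \<in> polys I" "v \<in> I" for v k q
    by (induction k) (use that in \<open>auto intro!: mult_in_polys var simp: mult.assoc\<close>)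
  have prd: "P ((\<Prod>v\<in>A. var v ^ Poly_Mapping.lookup \<mu> v) * const_poly c) \<and>
      (\<Prod>v\<in>A. var v ^ Poly_Mapping.lookup \<mu> v) * const_poly c \<in> polys I"
    if "finite A" "A \<subseteq> I" for A \<mu> c
    using that
    by (induction A) (use pow in \<open>auto simp: const mult.assoc\<close>)
  have "P (\<Sum>\<mu>\<in>A. const_poly (Poly_Mapping.lookup p \<mu>) * mon_eval var \<mu>) \<and>
     (\<Sum>\<mu>\<in>A. const_poly (Poly_Mapping.lookup p \<mu>) * mon_eval var \<mu>) \<in> polys I" if "finite A" "A \<subseteq> Poly_Mapping.keys p" for A
    using that
  proof (induction A)
    case empty
    then show ?case using const[of 0] by simp
  next
    case (insert \<mu> A)
    have "P (mon_eval var \<mu> * const_poly (Poly_Mapping.lookup p \<mu>)) \<and>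
       mon_eval var \<mu> * const_poly (Poly_Mapping.lookup p \<mu>) \<in> polys I"
      unfolding mon_eval_def by (rule prd) (use p insert in \<open>auto simp: polys_iff\<close>)
    then show ?case using insert by (simp add: add add_in_polys mult.commute)
  qed
  from this[of "Poly_Mapping.keys p"] show ?thesis
    using subst_var[of p] by (simp add: poly_eval_eq)
qed

lemmas ev_cong = poly_eval_cong[where \<iota> = id, folded ev_def]

section \<open>Polynomials as functions\<close>

text \<open>Positional notation: a base larger than all exponents separates the monomials.\<close>

lemma exists_separating_weight:
  fixes K :: "('v \<Rightarrow>\<^sub>0 nat) set"
  assumes "finite V" "finite K"
  shows "\<exists>e :: 'v \<Rightarrow> nat. \<forall>\<mu>\<in>K. \<forall>\<nu>\<in>K.
    (\<Sum>v\<in>V. Poly_Mapping.lookup \<mu> v * e v) = (\<Sum>v\<in>V. Poly_Mapping.lookup \<nu> v * e v) \<longrightarrow>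
    (\<forall>v\<in>V. Poly_Mapping.lookup \<mu> v = Poly_Mapping.lookup \<nu> v)"
  using assms(1)
proof induction
  case (insert x V)
  then obtain e where e: "\<And>\<mu> \<nu>. \<mu> \<in> K \<Longrightarrow> \<nu> \<in> K \<Longrightarrow>
    (\<Sum>v\<in>V. Poly_Mapping.lookup \<mu> v * e v) = (\<Sum>v\<in>V. Poly_Mapping.lookup \<nu> v * e v) \<Longrightarrow>
    (\<forall>v\<in>V. Poly_Mapping.lookup \<mu> v = Poly_Mapping.lookup \<nu> v)" by blast
  define N where "N = Suc (\<Sum>\<mu>\<in>K. Poly_Mapping.lookup \<mu> x)"
  have N: "Poly_Mapping.lookup \<mu> x < N" if "\<mu> \<in> K" for \<mu>
    using that assms(2) member_le_sum[of \<mu> K "\<lambda>\<mu>. Poly_Mapping.lookup \<mu> x"] by (simp add: N_def)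
  define e' where "e' v = (if v = x then 1 else N * e v)" for v
  have e': "(\<Sum>v\<in>insert x V. Poly_Mapping.lookup \<mu> v * e' v) =
      Poly_Mapping.lookup \<mu> x + N * (\<Sum>v\<in>V. Poly_Mapping.lookup \<mu> v * e v)" for \<mu>
  proof -
    have "(\<Sum>v\<in>V. Poly_Mapping.lookup \<mu> v * e' v) = (\<Sum>v\<in>V. N * (Poly_Mapping.lookup \<mu> v * e v))"
      by (rule sum.cong) (use insert in \<open>auto simp: e'_def\<close>)
    then show ?thesis using insert by (simp add: e'_def sum_distrib_left)
  qed
  have "\<forall>v\<in>insert x V. Poly_Mapping.lookup \<mu> v = Poly_Mapping.lookup \<nu> v"
    if "\<mu> \<in> K" "\<nu> \<in> K" "(\<Sum>v\<in>insert x V. Poly_Mapping.lookup \<mu> v * e' v) = (\<Sum>v\<in>insert x V. Poly_Mapping.lookup \<nu> v * e' v)" for \<mu> \<nu>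
  proof -
    let ?A = "\<lambda>\<mu>. \<Sum>v\<in>V. Poly_Mapping.lookup \<mu> v * e v"
    have eq: "Poly_Mapping.lookup \<mu> x + N * ?A \<mu> = Poly_Mapping.lookup \<nu> x + N * ?A \<nu>"
      using that(3) by (simp only: e')
    have x: "Poly_Mapping.lookup \<mu> x = Poly_Mapping.lookup \<nu> x"
      using arg_cong[OF eq, of "\<lambda>k. k mod N"] N that by simp
    with eq have "N * ?A \<mu> = N * ?A \<nu>" by simp
    moreover have "N > 0" by (simp add: N_def)
    ultimately have "?A \<mu> = ?A \<nu>" by simp
    with e[OF that(1,2)] x show ?thesis by auto
  qed
  then show ?case by blast
qed simp

text \<open>Along the monomial curve v -> z ^ e v each monomial of \<open>K\<close> becomes its own
  power of z, so distinct monomials cannot cancel.\<close>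

lemma exists_separating_curve:
  fixes K :: "('v \<Rightarrow>\<^sub>0 nat) set"
  assumes "finite K"
  shows "\<exists>e :: 'v \<Rightarrow> nat. inj_on (\<lambda>\<mu>. \<Sum>v\<in>Poly_Mapping.keys \<mu>. Poly_Mapping.lookup \<mu> v * e v) K"
proof -
  let ?V = "\<Union>\<mu>\<in>K. Poly_Mapping.keys \<mu>"
  obtain e :: "'v \<Rightarrow> nat" where e: "\<forall>\<mu>\<in>K. \<forall>\<nu>\<in>K.
    (\<Sum>v\<in>?V. Poly_Mapping.lookup \<mu> v * e v) = (\<Sum>v\<in>?V. Poly_Mapping.lookup \<nu> v * e v) \<longrightarrow>
    (\<forall>v\<in>?V. Poly_Mapping.lookup \<mu> v = Poly_Mapping.lookup \<nu> v)"
    using exists_separating_weight[of ?V K] assms by auto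
  have s: "(\<Sum>v\<in>Poly_Mapping.keys \<mu>. Poly_Mapping.lookup \<mu> v * e v) = (\<Sum>v\<in>?V. Poly_Mapping.lookup \<mu> v * e v)" if "\<mu> \<in> K" for \<mu>
    by (rule sum.mono_neutral_left) (use that assms in \<open>auto simp: in_keys_iff\<close>)
  have "\<mu> = \<nu>" if "\<mu> \<in> K" "\<nu> \<in> K" "(\<Sum>v\<in>Poly_Mapping.keys \<mu>. Poly_Mapping.lookup \<mu> v * e v) = (\<Sum>v\<in>Poly_Mapping.keys \<nu>. Poly_Mapping.lookup \<nu> v * e v)" for \<mu> \<nu>
  proof (rule poly_mapping_eqI)
    fix v
    show "Poly_Mapping.lookup \<mu> v = Poly_Mapping.lookup \<nu> v"
    proof (cases "v \<in> ?V")
      case True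
      then show ?thesis using e that(1,2) that(3)[unfolded s[OF that(1)] s[OF that(2)]] by blast
    next
      case False
      then show ?thesis using that(1,2) by (auto simp: in_keys_iff)
    qed
  qed
  then show ?thesis by (intro exI[of _ e] inj_onI) blast
qed

text \<open>On a common separating curve both polynomials restrict to nonzero univariate
  polynomials, whose product has only finitely many roots.\<close>

lemma exists_common_nonroot:
  fixes p q :: "'v cpoly"
  assumes "p \<noteq> 0" "q \<noteq> 0"
  shows "\<exists>\<sigma>. ev \<sigma> p \<noteq> 0 \<and> ev \<sigma> q \<noteq> 0"
proof -
  let ?K = "Poly_Mapping.keys p \<union> Poly_Mapping.keys q"
  let ?w = "\<lambda>e \<mu>. \<Sum>v\<in>Poly_Mapping.keys \<mu>. Poly_Mapping.lookup \<mu> v * e v"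
  obtain e :: "'v \<Rightarrow> nat" where e: "inj_on (?w e) ?K"
    using exists_separating_curve[of ?K] by auto
  define c where "c r = (\<Sum>\<mu>\<in>Poly_Mapping.keys r. Polynomial.monom (Poly_Mapping.lookup r \<mu>) (?w e \<mu>))" for r :: "'v cpoly"
  have ev: "ev (\<lambda>v. z ^ e v) r = poly (c r) z" for z and r :: "'v cpoly"
    by (simp add: ev_eq c_def poly_sum poly_monom mon_eval_def power_sum mult.commute flip: power_mult)
  have nz: "c r \<noteq> 0" if "r \<noteq> 0" "Poly_Mapping.keys r \<subseteq> ?K" for r
  proof -
    obtain \<mu> where m: "\<mu> \<in> Poly_Mapping.keys r" using \<open>r \<noteq> 0\<close> keys_eq_empty by blast
    have "Polynomial.coeff (c r) (?w e \<mu>) = (\<Sum>\<nu>\<in>Poly_Mapping.keys r. if \<nu> = \<mu> then Poly_Mapping.lookup r \<nu> else 0)"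
      unfolding c_def coeff_sum
      by (rule sum.cong) (use e that m in \<open>auto simp: coeff_monom dest!: inj_onD\<close>)
    also have "\<dots> \<noteq> 0" using m by (auto simp: in_keys_iff)
    finally show ?thesis by auto
  qed
  have "c p * c q \<noteq> 0" using nz[of p] nz[of q] assms by auto
  then have "finite {z. poly (c p * c q) z = 0}" by (rule poly_roots_finite)
  then obtain z where "poly (c p * c q) z \<noteq> 0"
    using infinite_UNIV_char_0[where 'a = complex] by (metis (mono_tags, lifting) UNIV_eq_I mem_Collect_eq)
  then show ?thesis using ev by (intro exI[of _ "\<lambda>v. z ^ e v"]) auto
qed

text \<open>Zariski density of the complement of a hypersurface. Several identities below are first
  proved only where some determinant is nonzero.\<close>

lemma cpoly_eqI_dense:
  assumes "d \<noteq> 0" "\<And>\<sigma>. ev \<sigma> d \<noteq> 0 \<Longrightarrow> ev \<sigma> p = ev \<sigma> q"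
  shows "p = q"
proof (rule ccontr)
  assume "p \<noteq> q"
  then obtain \<sigma> where "ev \<sigma> (p - q) \<noteq> 0" "ev \<sigma> d \<noteq> 0"
    using exists_common_nonroot[of "p - q" d] assms(1) by auto
  then show False using assms(2)[of \<sigma>] by (simp add: ev.poly_eval_simps)
qed

lemma cpoly_eqI: "(\<And>\<sigma>. ev \<sigma> p = ev \<sigma> q) \<Longrightarrow> p = q"
  by (rule cpoly_eqI_dense[of 1]) auto

text \<open>Polynomial dependence stated for functions of the point, so that determinants, adjugates
  and quadratic values are recognised as polynomial without an explicit polynomial being written
  down.\<close>

definition polyfun :: "'v set \<Rightarrow> (('v \<Rightarrow> complex) \<Rightarrow> complex) \<Rightarrow> bool" where
  "polyfun I g \<longleftrightarrow> (\<exists>p \<in> polys I. \<forall>\<sigma>. g \<sigma> = ev \<sigma> p)"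

lemma polyfun_ev: "p \<in> polys I \<Longrightarrow> polyfun I (\<lambda>\<sigma>. ev \<sigma> p)"
  by (auto simp: polyfun_def)

lemma polyfun_const [simp]: "polyfun I (\<lambda>\<sigma>. c)"
  unfolding polyfun_def by (rule bexI[of _ "const_poly c"]) (auto simp: ev.poly_eval_simps)

lemma polyfun_var: "v \<in> I \<Longrightarrow> polyfun I (\<lambda>\<sigma>. \<sigma> v)"
  unfolding polyfun_def by (rule bexI[of _ "var v"]) (auto simp: ev.poly_eval_simps)

lemma polyfun_add:
  assumes "polyfun I f" "polyfun I g"
  shows "polyfun I (\<lambda>\<sigma>. f \<sigma> + g \<sigma>)"
proof -
  obtain p q where "p \<in> polys I" "q \<in> polys I" "\<forall>\<sigma>. f \<sigma> = ev \<sigma> p" "\<forall>\<sigma>. g \<sigma> = ev \<sigma> q"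
    using assms unfolding polyfun_def by blast
  then show ?thesis
    unfolding polyfun_def by (intro bexI[of _ "p + q"]) (simp_all add: ev.poly_eval_add add_in_polys)
qed

lemma polyfun_mult:
  assumes "polyfun I f" "polyfun I g"
  shows "polyfun I (\<lambda>\<sigma>. f \<sigma> * g \<sigma>)"
proof -
  obtain p q where "p \<in> polys I" "q \<in> polys I" "\<forall>\<sigma>. f \<sigma> = ev \<sigma> p" "\<forall>\<sigma>. g \<sigma> = ev \<sigma> q"
    using assms unfolding polyfun_def by blast
  then show ?thesis
    unfolding polyfun_def by (intro bexI[of _ "p * q"]) (simp_all add: ev.poly_eval_mult mult_in_polys)
qed

lemma polyfun_uminus: "polyfun I f \<Longrightarrow> polyfun I (\<lambda>\<sigma>. - f \<sigma>)"
  using polyfun_mult[OF polyfun_const[of I "-1"]] by simp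

lemma polyfun_diff: "polyfun I f \<Longrightarrow> polyfun I g \<Longrightarrow> polyfun I (\<lambda>\<sigma>. f \<sigma> - g \<sigma>)"
  using polyfun_add[OF _ polyfun_uminus] by fastforce

lemma polyfun_sum: "(\<And>a. a \<in> A \<Longrightarrow> polyfun I (f a)) \<Longrightarrow> polyfun I (\<lambda>\<sigma>. \<Sum>a\<in>A. f a \<sigma>)"
  by (induction A rule: infinite_finite_induct) (auto intro: polyfun_add)

lemma polyfun_prod: "(\<And>a. a \<in> A \<Longrightarrow> polyfun I (f a)) \<Longrightarrow> polyfun I (\<lambda>\<sigma>. \<Prod>a\<in>A. f a \<sigma>)"
  by (induction A rule: infinite_finite_induct) (auto intro: polyfun_mult)

lemma polyfun_power: "polyfun I f \<Longrightarrow> polyfun I (\<lambda>\<sigma>. f \<sigma> ^ k)"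
  by (induction k) (auto intro: polyfun_mult)

lemma polyfun_compose:
  assumes "p \<in> polys J" "\<And>v. v \<in> J \<Longrightarrow> polyfun I (\<lambda>\<sigma>. h \<sigma> v)"
  shows "polyfun I (\<lambda>\<sigma>. ev (h \<sigma>) p)"
  using assms(1)
  by (induction p rule: polys_induct)
    (auto simp: ev.poly_eval_simps intro: polyfun_add polyfun_mult assms(2))

lemma polyfun_det:
  assumes "\<And>\<sigma>. A \<sigma> \<in> carrier_mat k k" "\<And>i j. i < k \<Longrightarrow> j < k \<Longrightarrow> polyfun I (\<lambda>\<sigma>. A \<sigma> $$ (i, j))"
  shows "polyfun I (\<lambda>\<sigma>. det (A \<sigma>))"
  unfolding det_def'[OF assms(1)]
  by (auto intro!: polyfun_sum polyfun_mult polyfun_prod assms(2) simp: permutes_in_image)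

lemma polyfun_zero_dense:
  assumes "polyfun I f" "polyfun J d" "d \<sigma>0 \<noteq> 0" "\<And>\<sigma>. d \<sigma> \<noteq> 0 \<Longrightarrow> f \<sigma> = 0"
  shows "f \<sigma> = 0"
proof -
  obtain p q where "\<And>\<sigma>. f \<sigma> = ev \<sigma> p" "\<And>\<sigma>. d \<sigma> = ev \<sigma> q"
    using assms(1,2) by (auto simp: polyfun_def)
  moreover from this assms(3) have "q \<noteq> 0" by (auto simp: ev.poly_eval_0)
  ultimately have "p = 0" using cpoly_eqI_dense[of q p 0] assms(4) by (auto simp: ev.poly_eval_0)
  then show ?thesis using \<open>\<And>\<sigma>. f \<sigma> = ev \<sigma> p\<close> by (simp add: ev.poly_eval_0)
qed

text \<open>This takes the place of a limit: a univariate polynomial with infinitely many zeros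
  vanishes at every parameter.\<close>

lemma polyfun_curve:
  assumes "polyfun I f"
  shows "\<exists>w. \<forall>x. f (\<lambda>v. poly (c v) x) = poly w x"
proof -
  obtain p where "\<And>\<sigma>. f \<sigma> = ev \<sigma> p" using assms by (auto simp: polyfun_def)
  then show ?thesis
    by (intro exI[of _ "poly_eval (\<lambda>c. [:c:]) c p"]) (simp add: poly_upoly)
qed

section \<open>The orthogonal group and its maximal unipotent subgroup\<close>

lemma GL_carrier: "g \<in> carrier (GL k) \<longleftrightarrow> g \<in> carrier_mat k k \<and> det g \<noteq> 0"
proof
  assume "g \<in> carrier (GL k)"
  then have u: "g \<in> Units (ring_mat TYPE(complex) k ())"
    by (simp add: GL_def units_of_def)
  then show "g \<in> carrier_mat k k \<and> det g \<noteq> 0"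
    using unit_imp_det_non_zero[OF u] by (auto simp: Units_def ring_mat_def)
next
  assume "g \<in> carrier_mat k k \<and> det g \<noteq> 0"
  then show "g \<in> carrier (GL k)"
    using det_non_zero_imp_unit[of g k "()"] by (simp add: GL_def units_of_def)
qed

lemma det_upper_unitriangular:
  assumes "upper_triangular u" "u \<in> carrier_mat k k" "\<And>i. i < k \<Longrightarrow> u $$ (i, i) = (1::complex)"
  shows "det u = 1"
proof -
  have "det u = (\<Prod>i = 0..<k. u $$ (i, i))"
    using det_upper_triangular[OF assms(1,2)] assms(2) by (simp add: prod_list_diag_prod)
  also have "\<dots> = (\<Prod>i = 0..<k. 1)" by (rule prod.cong) (use assms(3) in auto)
  finally show ?thesis by simp
qed

lemma mat_mult_entry:
  assumes "A \<in> carrier_mat a b" "B \<in> carrier_mat b c" "i < a" "j < c"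
  shows "(A * B) $$ (i, j) = (\<Sum>k<b. A $$ (i, k) * B $$ (k, j))"
  using assms by (auto simp: scalar_prod_def atLeast0LessThan intro!: sum.cong)

text \<open>Right multiplication by \<open>antidiag\<close> reverses the columns, so column k is
  paired with column n - 1 - k.\<close>

lemma orth_entry:
  assumes u: "u \<in> carrier_mat n n" and ij: "i < n" "j < n"
  shows "(u * antidiag n * transpose_mat u) $$ (i, j) = (\<Sum>k<n. u $$ (i, k) * u $$ (j, n - 1 - k))"
proof -
  have J: "antidiag n \<in> carrier_mat n n" by (simp add: antidiag_def)
  have 1: "(u * antidiag n) $$ (i, l) = u $$ (i, n - 1 - l)" if "l < n" for l
  proof -
    have "(u * antidiag n) $$ (i, l) = (\<Sum>k<n. u $$ (i, k) * antidiag n $$ (k, l))"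
      by (rule mat_mult_entry[OF u J]) (use ij that in auto)
    also have "\<dots> = (\<Sum>k<n. if k = n - 1 - l then u $$ (i, k) else 0)"
      by (rule sum.cong) (use that in \<open>auto simp: antidiag_def\<close>)
    also have "\<dots> = u $$ (i, n - 1 - l)" using that by simp
    finally show ?thesis .
  qed
  have "(u * antidiag n * transpose_mat u) $$ (i, j) = (\<Sum>l<n. (u * antidiag n) $$ (i, l) * transpose_mat u $$ (l, j))"
    by (rule mat_mult_entry[of _ n n _ n]) (use u J ij in auto)
  also have "\<dots> = (\<Sum>l<n. u $$ (i, n - 1 - l) * u $$ (j, l))"
    by (rule sum.cong) (use 1 u ij in auto)
  also have "\<dots> = (\<Sum>k<n. u $$ (i, k) * u $$ (j, n - 1 - k))"
    by (rule sum.reindex_bij_witness[of _ "\<lambda>k. n - 1 - k" "\<lambda>k. n - 1 - k"]) auto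
  finally show ?thesis .
qed

lemma unip_orthI:
  assumes "\<And>i. i < n \<Longrightarrow> f i i = 1" "\<And>i k. k < i \<Longrightarrow> i < n \<Longrightarrow> f i k = 0"
    and "\<And>i j. i < n \<Longrightarrow> j < n \<Longrightarrow> (\<Sum>k<n. f i k * f j (n - 1 - k)) = (if i + j = n - 1 then 1 else 0)"
  shows "mat n n (\<lambda>(i, k). f i k) \<in> unip_orth n"
proof -
  let ?u = "mat n n (\<lambda>(i, k). f i k)"
  have u: "?u \<in> carrier_mat n n" by simp
  have ut: "upper_triangular ?u"
    using assms(2) by (auto simp: upper_triangular_def)
  have "det ?u = 1"
    by (rule det_upper_unitriangular[OF ut u]) (use assms(1) in auto)
  then have GL: "?u \<in> carrier (GL n)" by (simp add: GL_carrier)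
  have "?u * antidiag n * transpose_mat ?u = antidiag n"
  proof (rule eq_matI)
    fix i j assume "i < dim_row (antidiag n)" "j < dim_col (antidiag n)"
    then have ij: "i < n" "j < n" by (auto simp: antidiag_def)
    have "(?u * antidiag n * transpose_mat ?u) $$ (i, j) = (\<Sum>k<n. f i k * f j (n - 1 - k))"
      by (subst orth_entry[OF u ij]) (use ij in \<open>auto intro!: sum.cong\<close>)
    then show "(?u * antidiag n * transpose_mat ?u) $$ (i, j) = antidiag n $$ (i, j)"
      using assms(3)[OF ij] ij by (simp add: antidiag_def)
  qed (auto simp: antidiag_def)
  then show ?thesis
    using GL ut assms(1) by (auto simp: unip_orth_def unip_def orth_def)
qed

lemma unip_orthD:
  assumes "u \<in> unip_orth n"
  shows "u \<in> carrier_mat n n" "\<And>i. i < n \<Longrightarrow> u $$ (i, i) = 1" "\<And>i k. k < i \<Longrightarrow> i < n \<Longrightarrow> u $$ (i, k) = 0"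
    and "\<And>i j. i < n \<Longrightarrow> j < n \<Longrightarrow> (\<Sum>k<n. u $$ (i, k) * u $$ (j, n - 1 - k)) = (if i + j = n - 1 then 1 else 0)"
proof -
  have u: "u \<in> carrier_mat n n" "u * antidiag n * transpose_mat u = antidiag n" "upper_triangular u" "\<forall>i<n. u $$ (i,i) = 1"
    using assms by (auto simp: unip_orth_def unip_def orth_def GL_carrier)
  show "u \<in> carrier_mat n n" "\<And>i. i < n \<Longrightarrow> u $$ (i, i) = 1" "\<And>i k. k < i \<Longrightarrow> i < n \<Longrightarrow> u $$ (i, k) = 0"
    using u by (auto simp: upper_triangular_def)
  fix i j assume ij: "i < n" "j < n"
  show "(\<Sum>k<n. u $$ (i, k) * u $$ (j, n - 1 - k)) = (if i + j = n - 1 then 1 else 0)"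
    using orth_entry[OF u(1) ij] u(2) ij by (simp add: antidiag_def)
qed

lemma sum_lessThan_refl: "(\<Sum>k<n. f (n - 1 - k)) = (\<Sum>k<(n::nat). f k :: 'a::comm_monoid_add)"
  by (rule sum.reindex_bij_witness[of _ "\<lambda>k. n - 1 - k" "\<lambda>k. n - 1 - k"]) auto

lemma sum_middle_refl:
  fixes m n :: nat
  shows "(\<Sum>k\<in>{m..<n-m}. f (n - 1 - k)) = (\<Sum>k\<in>{m..<n-m}. f k :: 'a::comm_monoid_add)"
  by (rule sum.reindex_bij_witness[of _ "\<lambda>k. n - 1 - k" "\<lambda>k. n - 1 - k"]) auto

text \<open>The last block is indexed by reflection, so that the form J pairs it with the first
  block index by index and pairs the middle block with itself.\<close>

lemma sum_three_blocks:
  fixes f :: "nat \<Rightarrow> 'a::comm_monoid_add"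
  assumes "2 * m \<le> n"
  shows "(\<Sum>k<n. f k) = (\<Sum>k<m. f k) + (\<Sum>k\<in>{m..<n-m}. f k) + (\<Sum>k<m. f (n - 1 - k))"
proof -
  have "{..<n} = ({..<m} \<union> {m..<n-m}) \<union> {n-m..<n}" using assms by auto
  then have "(\<Sum>k<n. f k) = (\<Sum>k\<in>({..<m} \<union> {m..<n-m}) \<union> {n-m..<n}. f k)" by simp
  also have "\<dots> = (\<Sum>k<m. f k) + (\<Sum>k\<in>{m..<n-m}. f k) + (\<Sum>k\<in>{n-m..<n}. f k)"
    by (subst sum.union_disjoint, (use assms in auto)[3])+ simp
  also have "(\<Sum>k\<in>{n-m..<n}. f k) = (\<Sum>k<m. f (n - 1 - k))"
    by (rule sum.reindex_bij_witness[of _ "\<lambda>k. n - 1 - k" "\<lambda>k. n - 1 - k"]) (use assms in auto)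
  finally show ?thesis .
qed

section \<open>Values of the quadratic invariants at a point\<close>

definition quad :: "nat \<Rightarrow> (nat \<times> nat \<Rightarrow> complex) \<Rightarrow> nat \<Rightarrow> nat \<Rightarrow> complex" where
  "quad n \<sigma> i j = (\<Sum>s<n. \<sigma> (s, i) * \<sigma> (n - 1 - s, j))"

lemma quad_sym: "quad n \<sigma> i j = quad n \<sigma> j i"
proof -
  have "quad n \<sigma> i j = (\<Sum>k<n. (\<lambda>s. \<sigma> (n - 1 - s, j) * \<sigma> (s, i)) k)"
    unfolding quad_def by (simp add: mult.commute)
  also have "\<dots> = (\<Sum>k<n. \<sigma> (n - 1 - (n - 1 - k), j) * \<sigma> (n - 1 - k, i))"
    by (rule sum_lessThan_refl[symmetric])
  also have "\<dots> = quad n \<sigma> j i"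
    unfolding quad_def by (rule sum.cong) auto
  finally show ?thesis .
qed

lemma ev_r2: "ev \<sigma> (r2 n i j) = quad n \<sigma> i j"
  by (simp add: r2_def quad_def ev.poly_eval_simps)

lemma quad_blocks:
  assumes "2 * m \<le> n"
  shows "quad n \<sigma> i j = (\<Sum>k<m. \<sigma> (k, i) * \<sigma> (n - 1 - k, j)) + (\<Sum>k\<in>{m..<n-m}. \<sigma> (k, i) * \<sigma> (n - 1 - k, j))
    + (\<Sum>k<m. \<sigma> (k, j) * \<sigma> (n - 1 - k, i))"
proof -
  have "(\<Sum>k<m. \<sigma> (n - 1 - k, i) * \<sigma> (n - 1 - (n - 1 - k), j)) = (\<Sum>k<m. \<sigma> (k, j) * \<sigma> (n - 1 - k, i))"
    by (rule sum.cong) (use assms in auto)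
  then show ?thesis unfolding quad_def sum_three_blocks[OF assms] by simp
qed

text \<open>In matrix terms, t^T G t = 0 with t q = 1 forces G = 0, by multiplication with q^T and
  q. It turns a condition on a group element into one on quadratic forms.\<close>

lemma bilinear_sum_zero_imp:
  fixes G :: "nat \<Rightarrow> nat \<Rightarrow> complex"
  assumes q: "\<And>i j. i < m \<Longrightarrow> j < m \<Longrightarrow> (\<Sum>l<m. t i l * q l j) = (if i = j then 1 else 0)"
    and H: "\<And>\<alpha> \<beta>. \<alpha> < m \<Longrightarrow> \<beta> < m \<Longrightarrow> (\<Sum>i<m. \<Sum>j<m. t i \<alpha> * t j \<beta> * G i j) = 0"
    and ab: "a < m" "b < m"
  shows "G a b = 0"
proof -
  have "(\<Sum>\<alpha><m. \<Sum>\<beta><m. q \<alpha> a * q \<beta> b * (\<Sum>i<m. \<Sum>j<m. t i \<alpha> * t j \<beta> * G i j)) = 0"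
    using H by simp
  also have "(\<Sum>\<alpha><m. \<Sum>\<beta><m. q \<alpha> a * q \<beta> b * (\<Sum>i<m. \<Sum>j<m. t i \<alpha> * t j \<beta> * G i j))
    = (\<Sum>\<alpha><m. \<Sum>\<beta><m. \<Sum>i<m. \<Sum>j<m. (t i \<alpha> * q \<alpha> a) * (t j \<beta> * q \<beta> b) * G i j)"
    by (simp add: sum_distrib_left mult_ac)
  also have "\<dots> = (\<Sum>\<alpha><m. \<Sum>i<m. \<Sum>\<beta><m. \<Sum>j<m. (t i \<alpha> * q \<alpha> a) * (t j \<beta> * q \<beta> b) * G i j)"
    by (intro sum.cong refl sum.swap)
  also have "\<dots> = (\<Sum>i<m. \<Sum>\<alpha><m. \<Sum>\<beta><m. \<Sum>j<m. (t i \<alpha> * q \<alpha> a) * (t j \<beta> * q \<beta> b) * G i j)"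
    by (rule sum.swap)
  also have "\<dots> = (\<Sum>i<m. \<Sum>\<alpha><m. \<Sum>j<m. \<Sum>\<beta><m. (t i \<alpha> * q \<alpha> a) * (t j \<beta> * q \<beta> b) * G i j)"
    by (intro sum.cong refl sum.swap)
  also have "\<dots> = (\<Sum>i<m. \<Sum>j<m. \<Sum>\<alpha><m. \<Sum>\<beta><m. (t i \<alpha> * q \<alpha> a) * (t j \<beta> * q \<beta> b) * G i j)"
    by (intro sum.cong refl sum.swap)
  also have "\<dots> = (\<Sum>i<m. \<Sum>j<m. (\<Sum>\<alpha><m. t i \<alpha> * q \<alpha> a) * (\<Sum>\<beta><m. t j \<beta> * q \<beta> b) * G i j)"
    by (simp only: sum_product) (simp only: sum_distrib_right)
  also have "\<dots> = (\<Sum>i<m. \<Sum>j<m. if i = a then if j = b then G i j else 0 else 0)"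
    by (intro sum.cong refl) (use q ab in auto)
  also have "\<dots> = (\<Sum>i<m. if i = a then G i b else 0)"
    by (intro sum.cong refl) (use ab in auto)
  also have "\<dots> = G a b"
    using ab by simp
  finally show ?thesis .
qed

text \<open>
  With respect to the block sizes \<open>m\<close>, \<open>n - 2 m\<close>, \<open>m\<close>, the matrix \<open>B\<close> is strictly block lower
  triangular with blocks \<open>b\<close>, \<open>c\<close>, \<open>d\<close>, and \<open>1 + B\<close> is the transpose of the group element.
\<close>

lemma unip_orth_transitive:
  fixes \<sigma> \<tau> :: "nat \<times> nat \<Rightarrow> complex"
  assumes mn: "2 * m \<le> n"
    and q: "\<And>i j. i < m \<Longrightarrow> j < m \<Longrightarrow> (\<Sum>l<m. \<sigma> (i, l) * q l j) = (if i = j then 1 else 0)"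
      "\<And>i j. i < m \<Longrightarrow> j < m \<Longrightarrow> (\<Sum>l<m. q i l * \<sigma> (l, j)) = (if i = j then 1 else 0)"
    and top: "\<And>i j. i < m \<Longrightarrow> j < m \<Longrightarrow> \<tau> (i, j) = \<sigma> (i, j)"
    and mid: "\<And>i j. m \<le> i \<Longrightarrow> i < n - m \<Longrightarrow> j < m \<Longrightarrow> \<tau> (i, j) = 0"
    and quad: "\<And>i j. i < m \<Longrightarrow> j < m \<Longrightarrow> quad n \<tau> i j = quad n \<sigma> i j"
  shows "\<exists>u\<in>unip_orth n. \<forall>i<n. \<forall>j<m. (\<Sum>k<n. u $$ (k, i) * \<sigma> (k, j)) = \<tau> (i, j)"
proof -
  let ?M = "{m..<n-m}"
  let ?r = "\<lambda>i. n - 1 - i"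
  \<comment> \<open>The middle rows of (1 + B) x are x_2 + b t, with t the top and x_2 the middle
    block of x, so clearing them forces b = - x_2 t^-1.\<close>
  define b where "b i k = - (\<Sum>l<m. \<sigma> (i, l) * q l k)" for i k
  \<comment> \<open>Orthogonality of the mixed blocks forces d = - J b^T J.\<close>
  define d where "d i k = - b (?r k) (?r i)" for i k
  \<comment> \<open>What c t has to supply in the last rows once d has acted on the middle rows;
    hence c = e t^-1 below.\<close>
  define e where "e i l = \<tau> (i, l) - \<sigma> (i, l) - (\<Sum>k\<in>?M. d i k * \<sigma> (k, l))" for i l
  define c where "c i k = (\<Sum>l<m. e i l * q l k)" for i k
  have right_inv: "(\<Sum>k<m. (\<Sum>l<m. h l * q l k) * \<sigma> (k, j)) = h j" if "j < m" for h j
  proof -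
    have "(\<Sum>k<m. (\<Sum>l<m. h l * q l k) * \<sigma> (k, j)) = (\<Sum>k<m. \<Sum>l<m. h l * (q l k * \<sigma> (k, j)))"
      by (simp add: sum_distrib_right mult.assoc)
    also have "\<dots> = (\<Sum>l<m. \<Sum>k<m. h l * (q l k * \<sigma> (k, j)))" by (rule sum.swap)
    also have "\<dots> = (\<Sum>l<m. h l * (\<Sum>k<m. q l k * \<sigma> (k, j)))" by (simp add: sum_distrib_left)
    also have "\<dots> = (\<Sum>l<m. if l = j then h l else 0)" by (intro sum.cong refl) (use q that in auto)
    also have "\<dots> = h j" using that by simp
    finally show ?thesis .
  qed
  have b_mult: "(\<Sum>k<m. b i k * \<sigma> (k, j)) = - \<sigma> (i, j)" if "j < m" for i j
    using right_inv[OF that, of "\<lambda>l. \<sigma> (i, l)"] by (simp add: b_def sum_negf)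
  have c_mult: "(\<Sum>k<m. c i k * \<sigma> (k, j)) = e i j" if "j < m" for i j
    using right_inv[OF that, of "e i"] by (simp add: c_def)
  define B where "B i k = (if i < m then 0 else if i < n - m then (if k < m then b i k else 0)
    else if k < m then c i k else if k < n - m then d i k else 0)" for i k
  \<comment> \<open>The one nontrivial orthogonality condition, in the corner block. Multiplied by
    t^T and t, it becomes the equality of the quadratic values of the two points.\<close>
  have G: "c (?r i) j + c (?r j) i + (\<Sum>k\<in>?M. b k i * b (?r k) j) = 0" if "i < m" "j < m" for i j
  proof (rule bilinear_sum_zero_imp[where m = m and t = "\<lambda>i j. \<sigma> (i, j)" and q = q, OF q(1) _ that])
    fix \<alpha> \<beta> assume ab: "\<alpha> < m" "\<beta> < m"
    have E: "(\<Sum>i<m. \<Sum>j<m. \<sigma> (i, \<alpha>) * \<sigma> (j, \<beta>) * (\<Sum>k\<in>?M. b k i * b (?r k) j))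
      = (\<Sum>k\<in>?M. \<sigma> (k, \<alpha>) * \<sigma> (?r k, \<beta>))"
    proof -
      have "(\<Sum>i<m. \<Sum>j<m. \<sigma> (i, \<alpha>) * \<sigma> (j, \<beta>) * (\<Sum>k\<in>?M. b k i * b (?r k) j))
        = (\<Sum>i<m. \<Sum>j<m. \<Sum>k\<in>?M. (b k i * \<sigma> (i, \<alpha>)) * (b (?r k) j * \<sigma> (j, \<beta>)))"
        by (simp add: sum_distrib_left mult_ac)
      also have "\<dots> = (\<Sum>i<m. \<Sum>k\<in>?M. \<Sum>j<m. (b k i * \<sigma> (i, \<alpha>)) * (b (?r k) j * \<sigma> (j, \<beta>)))"
        by (intro sum.cong refl sum.swap)
      also have "\<dots> = (\<Sum>k\<in>?M. \<Sum>i<m. \<Sum>j<m. (b k i * \<sigma> (i, \<alpha>)) * (b (?r k) j * \<sigma> (j, \<beta>)))"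
        by (rule sum.swap)
      also have "\<dots> = (\<Sum>k\<in>?M. (\<Sum>i<m. b k i * \<sigma> (i, \<alpha>)) * (\<Sum>j<m. b (?r k) j * \<sigma> (j, \<beta>)))"
        by (simp add: sum_product)
      also have "\<dots> = (\<Sum>k\<in>?M. \<sigma> (k, \<alpha>) * \<sigma> (?r k, \<beta>))"
        using ab by (simp add: b_mult)
      finally show ?thesis .
    qed
    have e': "e (?r i) \<beta> = \<tau> (?r i, \<beta>) - \<sigma> (?r i, \<beta>) + (\<Sum>k\<in>?M. b (?r k) i * \<sigma> (k, \<beta>))" if "i < m" for i \<beta>
    proof -
      have "?r (?r i) = i" using that mn by auto
      then show ?thesis by (simp add: e_def d_def sum_negf)
    qed
    have C: "(\<Sum>i<m. \<Sum>j<m. \<sigma> (i, \<alpha>) * \<sigma> (j, \<beta>) * c (?r i) j)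
      = (\<Sum>i<m. \<sigma> (i, \<alpha>) * \<tau> (?r i, \<beta>)) - (\<Sum>i<m. \<sigma> (i, \<alpha>) * \<sigma> (?r i, \<beta>)) - (\<Sum>k\<in>?M. \<sigma> (?r k, \<alpha>) * \<sigma> (k, \<beta>))"
      if "\<alpha> < m" "\<beta> < m" for \<alpha> \<beta>
    proof -
      have "(\<Sum>i<m. \<Sum>j<m. \<sigma> (i, \<alpha>) * \<sigma> (j, \<beta>) * c (?r i) j) = (\<Sum>i<m. \<sigma> (i, \<alpha>) * (\<Sum>j<m. c (?r i) j * \<sigma> (j, \<beta>)))"
        by (simp add: sum_distrib_left mult_ac)
      also have "\<dots> = (\<Sum>i<m. \<sigma> (i, \<alpha>) * e (?r i) \<beta>)" using that by (simp add: c_mult)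
      also have "\<dots> = (\<Sum>i<m. \<sigma> (i, \<alpha>) * \<tau> (?r i, \<beta>) - \<sigma> (i, \<alpha>) * \<sigma> (?r i, \<beta>)
          + (\<Sum>k\<in>?M. \<sigma> (i, \<alpha>) * (b (?r k) i * \<sigma> (k, \<beta>))))"
        by (intro sum.cong refl, subst e') (auto simp: algebra_simps sum_distrib_left)
      also have "\<dots> = (\<Sum>i<m. \<sigma> (i, \<alpha>) * \<tau> (?r i, \<beta>)) - (\<Sum>i<m. \<sigma> (i, \<alpha>) * \<sigma> (?r i, \<beta>))
          + (\<Sum>i<m. \<Sum>k\<in>?M. \<sigma> (i, \<alpha>) * (b (?r k) i * \<sigma> (k, \<beta>)))"
        by (simp add: sum.distrib sum_subtractf)
      also have "(\<Sum>i<m. \<Sum>k\<in>?M. \<sigma> (i, \<alpha>) * (b (?r k) i * \<sigma> (k, \<beta>))) = (\<Sum>k\<in>?M. (\<Sum>i<m. b (?r k) i * \<sigma> (i, \<alpha>)) * \<sigma> (k, \<beta>))"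
        by (subst sum.swap) (simp add: sum_distrib_left mult_ac)
      also have "\<dots> = - (\<Sum>k\<in>?M. \<sigma> (?r k, \<alpha>) * \<sigma> (k, \<beta>))"
        using that by (simp add: b_mult sum_negf)
      finally show ?thesis by simp
    qed
    have C': "(\<Sum>i<m. \<Sum>j<m. \<sigma> (i, \<alpha>) * \<sigma> (j, \<beta>) * c (?r j) i) = (\<Sum>i<m. \<Sum>j<m. \<sigma> (i, \<beta>) * \<sigma> (j, \<alpha>) * c (?r i) j)"
      by (subst sum.swap) (simp add: mult_ac)
    have M: "(\<Sum>k\<in>?M. \<sigma> (?r k, \<beta>) * \<sigma> (k, \<alpha>)) = (\<Sum>k\<in>?M. \<sigma> (k, \<alpha>) * \<sigma> (?r k, \<beta>))"
      by (simp add: mult.commute)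
    have M': "(\<Sum>k\<in>?M. \<sigma> (?r k, \<alpha>) * \<sigma> (k, \<beta>)) = (\<Sum>k\<in>?M. \<sigma> (k, \<alpha>) * \<sigma> (?r k, \<beta>))"
    proof -
      have "(\<Sum>k\<in>?M. \<sigma> (?r k, \<alpha>) * \<sigma> (k, \<beta>)) = (\<Sum>k\<in>?M. \<sigma> (?r k, \<alpha>) * \<sigma> (?r (?r k), \<beta>))"
        by (rule sum.cong) auto
      also have "\<dots> = (\<Sum>k\<in>?M. \<sigma> (k, \<alpha>) * \<sigma> (?r k, \<beta>))"
        by (rule sum_middle_refl[of "\<lambda>k. \<sigma> (k, \<alpha>) * \<sigma> (?r k, \<beta>)"])
      finally show ?thesis .
    qed
    have T: "quad n \<tau> \<alpha> \<beta> = (\<Sum>i<m. \<sigma> (i, \<alpha>) * \<tau> (?r i, \<beta>)) + (\<Sum>i<m. \<sigma> (i, \<beta>) * \<tau> (?r i, \<alpha>))"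
      unfolding quad_blocks[OF mn] using ab by (simp add: top mid)
    have "(\<Sum>i<m. \<Sum>j<m. \<sigma> (i, \<alpha>) * \<sigma> (j, \<beta>) * (c (?r i) j + c (?r j) i + (\<Sum>k\<in>?M. b k i * b (?r k) j)))
      = quad n \<tau> \<alpha> \<beta> - quad n \<sigma> \<alpha> \<beta>"
      unfolding distrib_left sum.distrib E C' C[OF ab] C[OF ab(2) ab(1)] T M M' quad_blocks[OF mn, of \<sigma>] by simp
    then show "(\<Sum>i<m. \<Sum>j<m. \<sigma> (i, \<alpha>) * \<sigma> (j, \<beta>) * (c (?r i) j + c (?r j) i + (\<Sum>k\<in>?M. b k i * b (?r k) j))) = 0"
      using quad[OF ab] by simp
  qed
  \<comment> \<open>The equation B^T J + J B + B^T J B = 0, which says that 1 + B^T preserves J.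
    Outside the corner the quadratic term vanishes, and the linear terms vanish or cancel by the
    choice of d.\<close>
  have S: "B (?r i) j + B (?r j) i + (\<Sum>k<n. B k i * B (?r k) j) = 0" if ij: "i < n" "j < n" for i j
  proof (cases "i < m \<and> j < m")
    case True
    have "(\<Sum>k<n. B k i * B (?r k) j) = (\<Sum>k\<in>?M. b k i * b (?r k) j)"
    proof -
      have 1: "(\<Sum>k<m. B k i * B (?r k) j) = 0" by (rule sum.neutral) (auto simp: B_def)
      have 2: "(\<Sum>k<m. B (?r k) i * B (?r (?r k)) j) = 0" by (rule sum.neutral) (use mn in \<open>auto simp: B_def\<close>)
      have 3: "(\<Sum>k\<in>?M. B k i * B (?r k) j) = (\<Sum>k\<in>?M. b k i * b (?r k) j)"
        by (rule sum.cong) (use True in \<open>auto simp: B_def\<close>)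
      show ?thesis unfolding sum_three_blocks[OF mn] 1 2 3 by simp
    qed
    moreover have "B (?r i) j = c (?r i) j" "B (?r j) i = c (?r j) i"
      using True mn by (auto simp: B_def)
    ultimately show ?thesis using G[of i j] True by (simp add: add.assoc)
  next
    case False
    have "(\<Sum>k<n. B k i * B (?r k) j) = 0"
      by (rule sum.neutral) (use False ij mn in \<open>auto simp: B_def\<close>)
    moreover have "B (?r i) j + B (?r j) i = 0"
    proof -
      have rr: "?r (?r i) = i" "?r (?r j) = j" using ij by auto
      have zero: "B (?r i) j = 0" if "i < m" "\<not> j < n - m" for i j
        using that mn by (auto simp: B_def)
      have zero': "B (?r i) j = 0" if "\<not> i < m" "\<not> j < m" "i < n" for i j
        using that mn by (auto simp: B_def)
      have zero'': "B (?r i) j = 0" if "\<not> i < n - m" "i < n" for i j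
        using that mn by (auto simp: B_def)
      have mixed: "B (?r i) j = - B (?r j) i" if "i < m" "\<not> j < m" "j < n - m" "?r (?r i) = i" for i j
      proof -
        have "\<not> ?r i < m" "\<not> ?r i < n - m" "\<not> ?r j < m" "?r j < n - m" using that mn by auto
        then show ?thesis using that by (simp add: B_def d_def)
      qed
      consider "i < m" "\<not> j < m" "j < n - m" | "i < m" "\<not> j < n - m" | "j < m" "\<not> i < m" "i < n - m"
        | "j < m" "\<not> i < n - m" | "\<not> i < m" "\<not> j < m"
        using False by linarith
      then show ?thesis
      proof cases
        case 1 then show ?thesis using mixed[OF 1 rr(1)] by simp
      next
        case 2 then show ?thesis using zero[OF 2] zero''[OF 2(2) ij(2)] by simp
      next
        case 3 then show ?thesis using mixed[OF 3 rr(2)] by simp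
      next
        case 4 then show ?thesis using zero[OF 4] zero''[OF 4(2) ij(1)] by simp
      next
        case 5 then show ?thesis using zero'[OF 5 ij(1)] zero'[OF 5(2,1) ij(2)] by simp
      qed
    qed
    ultimately show ?thesis by simp
  qed
  define f where "f i k = (if i = k then 1 else 0) + B k i" for i k
  have u: "mat n n (\<lambda>(i, k). f i k) \<in> unip_orth n"
  proof (rule unip_orthI)
    show "f i i = 1" if "i < n" for i using that by (auto simp: f_def B_def)
    show "f i k = 0" if "k < i" "i < n" for i k using that by (auto simp: f_def B_def)
    fix i j assume ij: "i < n" "j < n"
    have "(\<Sum>k<n. f i k * f j (?r k)) = (\<Sum>k<n. (if k = i then (if j = ?r k then 1 else 0) + B (?r k) j else 0)
       + (if k = ?r j then B k i else 0) + B k i * B (?r k) j)"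
      by (rule sum.cong) (use ij in \<open>auto simp: f_def algebra_simps\<close>)
    also have "\<dots> = (if j = ?r i then 1 else 0) + (B (?r i) j + B (?r j) i + (\<Sum>k<n. B k i * B (?r k) j))"
      using ij by (simp add: sum.distrib)
    also have "\<dots> = (if i + j = n - 1 then 1 else 0)"
      using S[OF ij] ij by auto
    finally show "(\<Sum>k<n. f i k * f j (?r k)) = (if i + j = n - 1 then 1 else 0)" .
  qed
  have "(\<Sum>k<n. f k i * \<sigma> (k, j)) = \<tau> (i, j)" if ij: "i < n" "j < m" for i j
  proof -
    have "(\<Sum>k<n. f k i * \<sigma> (k, j)) = (\<Sum>k<n. (if k = i then \<sigma> (k, j) else 0) + B i k * \<sigma> (k, j))"
      by (rule sum.cong) (auto simp: f_def algebra_simps)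
    also have "\<dots> = \<sigma> (i, j) + (\<Sum>k<n. B i k * \<sigma> (k, j))"
      using ij by (simp add: sum.distrib)
    also have "(\<Sum>k<n. B i k * \<sigma> (k, j)) = (\<Sum>k<m. B i k * \<sigma> (k, j)) + (\<Sum>k\<in>?M. B i k * \<sigma> (k, j))"
    proof -
      have "(\<Sum>k<m. B i (?r k) * \<sigma> (?r k, j)) = 0" by (rule sum.neutral) (use mn in \<open>auto simp: B_def\<close>)
      then show ?thesis unfolding sum_three_blocks[OF mn] by simp
    qed
    also have "\<sigma> (i, j) + \<dots> = \<tau> (i, j)"
    proof -
      consider "i < m" | "m \<le> i" "i < n - m" | "n - m \<le> i" by linarith
      then show ?thesis
      proof cases
        case 1
        then show ?thesis using top ij by (simp add: B_def)
      next
        case 2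
        have "(\<Sum>k<m. B i k * \<sigma> (k, j)) = (\<Sum>k<m. b i k * \<sigma> (k, j))" by (rule sum.cong) (use 2 in \<open>auto simp: B_def\<close>)
        moreover have "(\<Sum>k\<in>?M. B i k * \<sigma> (k, j)) = 0" by (rule sum.neutral) (use 2 in \<open>auto simp: B_def\<close>)
        ultimately show ?thesis using b_mult[OF ij(2), of i] mid[OF 2 ij(2)] by simp
      next
        case 3
        have i: "\<not> i < m" "\<not> i < n - m" using 3 mn by auto
        have "(\<Sum>k<m. B i k * \<sigma> (k, j)) = (\<Sum>k<m. c i k * \<sigma> (k, j))" by (rule sum.cong) (use i in \<open>auto simp: B_def\<close>)
        moreover have "(\<Sum>k\<in>?M. B i k * \<sigma> (k, j)) = (\<Sum>k\<in>?M. d i k * \<sigma> (k, j))" by (rule sum.cong) (use i in \<open>auto simp: B_def\<close>)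
        ultimately show ?thesis using c_mult[OF ij(2), of i] by (simp add: e_def)
      qed
    qed
    finally show ?thesis .
  qed
  then show ?thesis
    by (intro bexI[OF _ u] allI impI) (auto intro!: sum.cong)
qed

section \<open>Prescribing the top block and the quadratic invariants\<close>

text \<open>The canonical point \<open>(t; 0; J t\<^sup>-\<^sup>T s / 2)\<close>, with \<open>q\<close> the inverse of \<open>t\<close>.\<close>

definition section_point ::
  "nat \<Rightarrow> nat \<Rightarrow> (nat \<Rightarrow> nat \<Rightarrow> complex) \<Rightarrow> (nat \<Rightarrow> nat \<Rightarrow> complex) \<Rightarrow> (nat \<Rightarrow> nat \<Rightarrow> complex) \<Rightarrow> nat \<times> nat \<Rightarrow> complex"
where
  "section_point n m t q s = (\<lambda>(i, j). if i < m then t i j else if i < n - m then 0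
     else (\<Sum>l<m. q l (n - 1 - i) * s l j) / 2)"

text \<open>Each outer block contributes s / 2 by q t = 1, the middle rows contribute nothing, and
  the two halves add up because s is symmetric.\<close>

lemma quad_section_point:
  assumes mn: "2 * m \<le> n"
    and q: "\<And>i j. i < m \<Longrightarrow> j < m \<Longrightarrow> (\<Sum>l<m. q i l * t l j) = (if i = j then 1 else 0)"
    and s: "\<And>i j. s i j = s j i" and ij: "i < m" "j < m"
  shows "quad n (section_point n m t q s) i j = s i j"
proof -
  let ?p = "section_point n m t q s"
  have A: "(\<Sum>k<m. ?p (k, i) * ?p (n - 1 - k, j)) = s i j / 2" if "i < m" "j < m" for i j
  proof -
    have "(\<Sum>k<m. ?p (k, i) * ?p (n - 1 - k, j)) = (\<Sum>k<m. \<Sum>l<m. t k i * (q l k * s l j) / 2)"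
    proof (rule sum.cong)
      fix k assume "k \<in> {..<m}"
      then have "k < m" "\<not> n - 1 - k < m" "\<not> n - 1 - k < n - m" "n - 1 - (n - 1 - k) = k" using mn by auto
      then show "?p (k, i) * ?p (n - 1 - k, j) = (\<Sum>l<m. t k i * (q l k * s l j) / 2)"
        by (simp add: section_point_def sum_distrib_left sum_divide_distrib)
    qed simp
    also have "\<dots> = (\<Sum>l<m. (\<Sum>k<m. q l k * t k i) * s l j / 2)"
      by (subst sum.swap) (simp add: sum_distrib_left sum_divide_distrib mult_ac)
    also have "\<dots> = (\<Sum>l<m. if l = i then s l j / 2 else 0)"
      by (rule sum.cong) (use q that in auto)
    finally show ?thesis using that by simp
  qed
  have M: "(\<Sum>k\<in>{m..<n-m}. ?p (k, i) * ?p (n - 1 - k, j)) = 0"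
    by (rule sum.neutral) (auto simp: section_point_def)
  show ?thesis unfolding quad_blocks[OF mn] A[OF ij] A[OF ij(2,1)] M using s[of i j] by simp
qed

text \<open>
  Since \<open>n > 2 m\<close>, the middle rows can absorb a form of rank one, so that the top block
  may drop rank by one: \<open>q t = 1 - v u\<^sup>T\<close>.
\<close>

lemma exists_point_corank_one:
  fixes t q s :: "nat \<Rightarrow> nat \<Rightarrow> complex"
  assumes mn: "2 * m < n"
    and q: "\<And>i j. i < m \<Longrightarrow> j < m \<Longrightarrow> (\<Sum>l<m. q i l * t l j) = (if i = j then 1 else 0) - v i * u j"
    and uv: "(\<Sum>i<m. u i * v i) = 1"
    and s: "\<And>i j. s i j = s j i"
  shows "\<exists>\<sigma>. (\<forall>i<m. \<forall>j<m. \<sigma> (i, j) = t i j) \<and> (\<forall>i<m. \<forall>j<m. quad n \<sigma> i j = s i j)"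
proof -
  \<comment> \<open>Here v is the direction in which t degenerates: q t v = 0. The value v^T s v is
    supplied by the middle rows, so w is scaled to make w . v a square root of it, and s' = s - w
    w^T satisfies v^T s' v = 0.\<close>
  define \<gamma> where "\<gamma> = (\<Sum>i<m. \<Sum>j<m. v i * s i j * v j)"
  define w where "w j = csqrt \<gamma> * u j" for j
  define s' where "s' i j = s i j - w i * w j" for i j
  have s'_sym: "s' i j = s' j i" for i j using s[of i j] by (simp add: s'_def)
  define sv where "sv i = (\<Sum>l<m. s' i l * v l)" for i
  have w: "(\<Sum>l<m. w l * v l) = csqrt \<gamma>"
    using uv by (simp add: w_def mult.assoc flip: sum_distrib_left)
  have vsv: "(\<Sum>i<m. v i * sv i) = 0"
  proof -
    have "(\<Sum>i<m. v i * sv i) = (\<Sum>i<m. \<Sum>j<m. v i * s i j * v j - (w i * v i) * (w j * v j))"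
      by (simp add: sv_def s'_def sum_distrib_left algebra_simps)
    also have "\<dots> = \<gamma> - (\<Sum>i<m. w i * v i) * (\<Sum>j<m. w j * v j)"
      by (simp add: sum_subtractf \<gamma>_def sum_product)
    also have "\<dots> = 0" unfolding w by (simp flip: power2_eq_square)
    finally show ?thesis .
  qed
  \<comment> \<open>With this choice t^T Z equals s' / 2 up to a skew-symmetric term in sv and u,
    which disappears when the two outer blocks are added; v^T s' v = 0 removes the remaining
    error.\<close>
  define Z where "Z i j = (\<Sum>l<m. q l i * (s' l j + sv l * u j)) / 2" for i j
  \<comment> \<open>If n = 2m + 1 the middle row is its own partner and carries w. Otherwise rows m
    and n - 1 - m carry w and w / 2, so that their two products add up to w w^T.\<close>
  define y where "y i j = (if i = m then w j else if i = n - 1 - m then w j / 2 else 0)" for i j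
  define \<sigma> where "\<sigma> = (\<lambda>(i, j). if i < m then t i j else if i < n - m then y i j else Z (n - 1 - i) j)"
  have tZ: "(\<Sum>k<m. t k i * Z k j) = (s' i j + sv i * u j - u i * sv j) / 2" if "i < m" "j < m" for i j
  proof -
    have "(\<Sum>k<m. t k i * Z k j) = (\<Sum>k<m. \<Sum>l<m. t k i * (q l k * (s' l j + sv l * u j)) / 2)"
      by (simp add: Z_def sum_distrib_left sum_divide_distrib)
    also have "\<dots> = (\<Sum>l<m. (\<Sum>k<m. q l k * t k i) * (s' l j + sv l * u j) / 2)"
      by (subst sum.swap) (simp add: sum_distrib_left sum_divide_distrib mult_ac)
    also have "\<dots> = (\<Sum>l<m. (if l = i then (s' l j + sv l * u j) / 2 else 0) - u i * (v l * s' j l + v l * sv l * u j) / 2)"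
    proof (rule sum.cong)
      fix l assume "l \<in> {..<m}"
      then have E: "(\<Sum>k<m. q l k * t k i) = (if l = i then 1 else 0) - v l * u i" using q that by simp
      show "(\<Sum>k<m. q l k * t k i) * (s' l j + sv l * u j) / 2
        = (if l = i then (s' l j + sv l * u j) / 2 else 0) - u i * (v l * s' j l + v l * sv l * u j) / 2"
        unfolding E s'_sym[of l j] by (simp add: algebra_simps diff_divide_distrib add_divide_distrib)
    qed simp
    also have "\<dots> = (s' i j + sv i * u j) / 2 - u i * ((\<Sum>l<m. v l * s' j l) + (\<Sum>l<m. v l * sv l) * u j) / 2"
      using that by (simp add: sum_subtractf sum_distrib_right sum.distrib flip: sum_distrib_left sum_divide_distrib)
    also have "(\<Sum>l<m. v l * s' j l) = sv j" by (simp add: sv_def mult.commute)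
    finally show ?thesis using vsv by (simp add: diff_divide_distrib add_divide_distrib)
  qed
  have mid: "(\<Sum>k\<in>{m..<n-m}. \<sigma> (k, i) * \<sigma> (n - 1 - k, j)) = w i * w j" for i j
  proof -
    have "(\<Sum>k\<in>{m..<n-m}. \<sigma> (k, i) * \<sigma> (n - 1 - k, j)) = (\<Sum>k\<in>{m..<n-m}. y k i * y (n - 1 - k) j)"
      by (rule sum.cong) (auto simp: \<sigma>_def)
    also have "\<dots> = (\<Sum>k\<in>{m, n - 1 - m}. y k i * y (n - 1 - k) j)"
      by (rule sum.mono_neutral_right) (use mn in \<open>auto simp: y_def\<close>)
    also have "\<dots> = w i * w j"
      using mn by (cases "m = n - 1 - m") (auto simp: y_def)
    finally show ?thesis .
  qed
  have top: "(\<Sum>k<m. \<sigma> (k, i) * \<sigma> (n - 1 - k, j)) = (\<Sum>k<m. t k i * Z k j)" for i j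
  proof (rule sum.cong)
    fix k assume "k \<in> {..<m}"
    then have "k < m" "\<not> n - 1 - k < m" "\<not> n - 1 - k < n - m" "n - 1 - (n - 1 - k) = k" using mn by auto
    then show "\<sigma> (k, i) * \<sigma> (n - 1 - k, j) = t k i * Z k j" by (simp add: \<sigma>_def)
  qed simp
  have "quad n \<sigma> i j = s i j" if "i < m" "j < m" for i j
  proof -
    have "2 * m \<le> n" using mn by simp
    from quad_blocks[OF this, of \<sigma> i j] show ?thesis
      unfolding top mid tZ[OF that] tZ[OF that(2,1)]
      using s'_sym[of j i] by (simp add: s'_def field_simps)
  qed
  then show ?thesis by (intro exI[of _ \<sigma>]) (auto simp: \<sigma>_def)
qed

section \<open>Divisibility by the determinant\<close>

text \<open>A polynomial in one further variable x over \<open>polys I\<close>, given through its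
  values. The uniform bound on the degree lets the recursive division stop.\<close>

definition polyfun_coeffs :: "'v set \<Rightarrow> (('v \<Rightarrow> complex) \<Rightarrow> complex poly) \<Rightarrow> bool" where
  "polyfun_coeffs I g \<longleftrightarrow> (\<exists>N. \<forall>\<sigma>. \<forall>k\<ge>N. Polynomial.coeff (g \<sigma>) k = 0) \<and>
     (\<forall>k. polyfun I (\<lambda>\<sigma>. Polynomial.coeff (g \<sigma>) k))"

lemma polyfun_coeffs_linear:
  assumes "polyfun I a" "polyfun I b"
  shows "polyfun_coeffs I (\<lambda>\<sigma>. [:a \<sigma>, b \<sigma>:])"
  unfolding polyfun_coeffs_def
proof (intro conjI exI[of _ 2] allI impI)
  fix k
  show "polyfun I (\<lambda>\<sigma>. Polynomial.coeff [:a \<sigma>, b \<sigma>:] k)"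
  proof -
    consider "k = 0" | "k = 1" | k' where "k = Suc (Suc k')" by (metis One_nat_def not0_implies_Suc)
    then show ?thesis using assms by cases (auto simp: coeff_pCons)
  qed
qed (auto simp: coeff_pCons split: nat.splits)

lemma polyfun_coeffs_const: "polyfun I a \<Longrightarrow> polyfun_coeffs I (\<lambda>\<sigma>. [:a \<sigma>:])"
  using polyfun_coeffs_linear[of I a "\<lambda>_. 0"] by simp

lemma polyfun_coeffs_add:
  assumes "polyfun_coeffs I f" "polyfun_coeffs I g"
  shows "polyfun_coeffs I (\<lambda>\<sigma>. f \<sigma> + g \<sigma>)"
proof -
  obtain N M where "\<forall>\<sigma>. \<forall>k\<ge>N. Polynomial.coeff (f \<sigma>) k = 0" "\<forall>\<sigma>. \<forall>k\<ge>M. Polynomial.coeff (g \<sigma>) k = 0"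
    using assms unfolding polyfun_coeffs_def by blast
  then have "\<forall>\<sigma>. \<forall>k\<ge>max N M. Polynomial.coeff (f \<sigma> + g \<sigma>) k = 0" by simp
  moreover have "\<forall>k. polyfun I (\<lambda>\<sigma>. Polynomial.coeff (f \<sigma> + g \<sigma>) k)"
    using assms unfolding polyfun_coeffs_def by (auto intro: polyfun_add)
  ultimately show ?thesis unfolding polyfun_coeffs_def by blast
qed

lemma polyfun_coeffs_mult:
  assumes "polyfun_coeffs I f" "polyfun_coeffs I g"
  shows "polyfun_coeffs I (\<lambda>\<sigma>. f \<sigma> * g \<sigma>)"
proof -
  obtain N M where NM: "\<And>\<sigma> k. k \<ge> N \<Longrightarrow> Polynomial.coeff (f \<sigma>) k = 0" "\<And>\<sigma> k. k \<ge> M \<Longrightarrow> Polynomial.coeff (g \<sigma>) k = 0"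
    using assms unfolding polyfun_coeffs_def by blast
  have "Polynomial.coeff (f \<sigma> * g \<sigma>) k = 0" if "k \<ge> N + M" for \<sigma> k
    unfolding coeff_mult
  proof (rule sum.neutral, rule ballI)
    fix i
    show "Polynomial.coeff (f \<sigma>) i * Polynomial.coeff (g \<sigma>) (k - i) = 0"
      using NM(1)[of i \<sigma>] NM(2)[of "k - i" \<sigma>] that by (cases "i \<ge> N") auto
  qed
  then show ?thesis using assms unfolding polyfun_coeffs_def coeff_mult
    by (auto intro!: polyfun_sum polyfun_mult)
qed

lemma polyfun_coeffs_sum:
  "(\<And>a. a \<in> A \<Longrightarrow> polyfun_coeffs I (f a)) \<Longrightarrow> polyfun_coeffs I (\<lambda>\<sigma>. \<Sum>a\<in>A. f a \<sigma>)"
proof (induction A rule: infinite_finite_induct)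
  case (insert a A)
  then show ?case by (auto intro!: polyfun_coeffs_add)
qed (use polyfun_coeffs_const[of I "\<lambda>_. 0"] in auto)

lemma polyfun_coeffs_prod:
  "(\<And>a. a \<in> A \<Longrightarrow> polyfun_coeffs I (f a)) \<Longrightarrow> polyfun_coeffs I (\<lambda>\<sigma>. \<Prod>a\<in>A. f a \<sigma>)"
proof (induction A rule: infinite_finite_induct)
  case (insert a A)
  then show ?case by (auto intro!: polyfun_coeffs_mult)
qed (use polyfun_coeffs_const[of I "\<lambda>_. 1"] in \<open>auto simp: one_pCons\<close>)

text \<open>Division by a polynomial that is monic in x introduces no denominators, so quotient and
  remainder again have coefficients polynomial in the parameters.\<close>

lemma polyfun_coeffs_divide:
  assumes g: "polyfun_coeffs I g" and D: "polyfun_coeffs I D"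
    and monic: "\<And>\<sigma>. Polynomial.coeff (D \<sigma>) m = 1" "\<And>\<sigma> k. k > m \<Longrightarrow> Polynomial.coeff (D \<sigma>) k = 0"
  shows "\<exists>q r. polyfun_coeffs I q \<and> polyfun_coeffs I r \<and>
    (\<forall>\<sigma>. g \<sigma> = q \<sigma> * D \<sigma> + r \<sigma> \<and> (\<forall>k\<ge>m. Polynomial.coeff (r \<sigma>) k = 0))"
proof -
  have zero: "polyfun_coeffs I (\<lambda>_. 0)" using polyfun_coeffs_const[of I "\<lambda>_. 0"] by simp
  have "\<exists>q r. polyfun_coeffs I q \<and> polyfun_coeffs I r \<and>
    (\<forall>\<sigma>. g \<sigma> = q \<sigma> * D \<sigma> + r \<sigma> \<and> (\<forall>k\<ge>m. Polynomial.coeff (r \<sigma>) k = 0))"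
    if "\<And>\<sigma> k. k \<ge> N \<Longrightarrow> Polynomial.coeff (g \<sigma>) k = 0" "polyfun_coeffs I g" for N g
    using that
  proof (induction N arbitrary: g)
    case 0
    then have "\<And>\<sigma>. g \<sigma> = 0" by (simp add: poly_eq_iff)
    then show ?case using zero by (intro exI[of _ "\<lambda>_. 0"]) auto
  next
    case (Suc N)
    show ?case
    proof (cases "Suc N \<le> m")
      case True
      then show ?thesis using Suc.prems zero
        by (intro exI[of _ "\<lambda>_. 0"] exI[of _ g]) auto
    next
      case False
      define c where "c \<sigma> = Polynomial.monom (Polynomial.coeff (g \<sigma>) N) (N - m)" for \<sigma>
      have c: "polyfun_coeffs I c"
        unfolding polyfun_coeffs_def
      proof (intro conjI exI[of _ "Suc (N - m)"] allI impI)
        fix k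
        show "polyfun I (\<lambda>\<sigma>. Polynomial.coeff (c \<sigma>) k)"
          using Suc.prems(2) by (cases "k = N - m") (auto simp: c_def polyfun_coeffs_def coeff_monom)
      qed (auto simp: c_def coeff_monom)
      define g' where "g' \<sigma> = g \<sigma> + [:-1:] * (c \<sigma> * D \<sigma>)" for \<sigma>
      have "polyfun_coeffs I g'" unfolding g'_def
        by (intro polyfun_coeffs_add polyfun_coeffs_mult Suc.prems c D polyfun_coeffs_const polyfun_const)
      moreover have "Polynomial.coeff (g' \<sigma>) k = 0" if "k \<ge> N" for \<sigma> k
      proof (cases "k = N")
        case True
        then show ?thesis using False by (simp add: g'_def c_def coeff_monom_mult monic)
      next
        case f: False
        then have "k - (N - m) > m" "k \<ge> Suc N" using that False by auto
        then show ?thesis using Suc.prems(1)[of k \<sigma>] by (simp add: g'_def c_def coeff_monom_mult monic)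
      qed
      ultimately obtain q r where qr: "polyfun_coeffs I q" "polyfun_coeffs I r"
        "\<forall>\<sigma>. g' \<sigma> = q \<sigma> * D \<sigma> + r \<sigma> \<and> (\<forall>k\<ge>m. Polynomial.coeff (r \<sigma>) k = 0)"
        using Suc.IH[of g'] by blast
      have "g \<sigma> = (q \<sigma> + c \<sigma>) * D \<sigma> + r \<sigma>" for \<sigma>
      proof -
        have "g \<sigma> = g' \<sigma> + c \<sigma> * D \<sigma>" by (simp add: g'_def)
        then show ?thesis using qr(3) by (simp add: algebra_simps)
      qed
      then show ?thesis using qr polyfun_coeffs_add[OF qr(1) c]
        by (intro exI[of _ "\<lambda>\<sigma>. q \<sigma> + c \<sigma>"] exI[of _ r]) auto
    qed
  qed
  then show ?thesis using g unfolding polyfun_coeffs_def by blast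
qed

section \<open>The determinant of the pencil t + x 1 and its roots\<close>

lemma det_poly_entries:
  "poly (det (mat m m A)) x = det (mat m m (\<lambda>ij. poly (A ij) x :: 'a::comm_ring_1))"
  unfolding det_def'[OF mat_carrier] poly_sum poly_mult poly_prod
proof (rule sum.cong[OF refl], rule arg_cong2[where f = "(*)"])
  fix p :: "nat \<Rightarrow> nat" assume p: "p \<in> {p. p permutes {0..<m}}"
  show "poly (of_int (sign p)) x = of_int (sign p)" by (simp add: sign_def)
  show "(\<Prod>i = 0..<m. poly (mat m m A $$ (i, p i)) x) = (\<Prod>i = 0..<m. mat m m (\<lambda>ij. poly (A ij) x) $$ (i, p i))"
    by (rule prod.cong) (use p in \<open>auto simp: permutes_in_image\<close>)
qed

text \<open>Schur triangularisation \<open>t = p B q\<close> with \<open>q = p\<^sup>-\<^sup>1\<close>, followed by a change of the diagonal of \<open>B\<close>.\<close>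

lemma triangular_family:
  fixes t :: "nat \<times> nat \<Rightarrow> complex"
  shows "\<exists>p q b. (\<forall>i<m. \<forall>j<m. (\<Sum>k<m. p i k * q k j) = (if i = j then 1 else 0)) \<and>
    (\<forall>\<delta>. det (mat m m (\<lambda>(i, j). t (i, j) + (\<Sum>k<m. p i k * \<delta> k * q k j))) = (\<Prod>i<m. b i + \<delta> i))"
proof -
  let ?A = "mat m m t"
  have A: "?A \<in> carrier_mat m m" by simp
  obtain as where "char_poly ?A = (\<Prod>a\<leftarrow>as. [:- a, 1:])" using char_poly_factorized[OF A] by blast
  then obtain B where B: "B \<in> carrier_mat m m" "upper_triangular B" "similar_mat ?A B"
    using schur_decomposition_exists[OF A] by blast
  obtain P Q where PQ: "P \<in> carrier_mat m m" "Q \<in> carrier_mat m m" "P * Q = 1\<^sub>m m" "?A = P * B * Q"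
    using B(3) unfolding similar_mat_def similar_mat_wit_def Let_def by auto
  have PQ1: "(\<Sum>k<m. P $$ (i, k) * Q $$ (k, j)) = (if i = j then 1 else 0)" if "i < m" "j < m" for i j
    using mat_mult_entry[OF PQ(1,2) that] PQ(3) that by simp
  have dPQ: "det P * det Q = 1"
    using det_mult[OF PQ(1,2)] PQ(3) by simp
  have "det (mat m m (\<lambda>(i, j). t (i, j) + (\<Sum>k<m. P $$ (i, k) * \<delta> k * Q $$ (k, j)))) = (\<Prod>i<m. B $$ (i, i) + \<delta> i)" for \<delta>
  proof -
    let ?D = "mat m m (\<lambda>(i, j). if i = j then \<delta> i else 0)"
    have D: "?D \<in> carrier_mat m m" by simp
    have PD: "(P * ?D) $$ (i, j) = P $$ (i, j) * \<delta> j" if "i < m" "j < m" for i j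
    proof -
      have "(P * ?D) $$ (i, j) = (\<Sum>k<m. if k = j then P $$ (i, k) * \<delta> k else 0)"
        unfolding mat_mult_entry[OF PQ(1) D that] by (rule sum.cong) (use that in auto)
      then show ?thesis using that by simp
    qed
    have "mat m m (\<lambda>(i, j). t (i, j) + (\<Sum>k<m. P $$ (i, k) * \<delta> k * Q $$ (k, j))) = ?A + P * ?D * Q"
    proof (rule eq_matI)
      fix i j assume "i < dim_row (?A + P * ?D * Q)" "j < dim_col (?A + P * ?D * Q)"
      then have ij: "i < m" "j < m" using PQ by auto
      have PDc: "P * ?D \<in> carrier_mat m m" using PQ(1) by simp
      have "(P * ?D * Q) $$ (i, j) = (\<Sum>k<m. P $$ (i, k) * \<delta> k * Q $$ (k, j))"
        unfolding mat_mult_entry[OF PDc PQ(2) ij] by (rule sum.cong) (use PD ij in auto)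
      then show "mat m m (\<lambda>(i, j). t (i, j) + (\<Sum>k<m. P $$ (i, k) * \<delta> k * Q $$ (k, j))) $$ (i, j) = (?A + P * ?D * Q) $$ (i, j)"
        using ij PQ(1,2) by (subst index_add_mat) auto
    qed (use PQ in auto)
    also have "\<dots> = P * (B + ?D) * Q"
    proof -
      have "P * (B + ?D) * Q = (P * B + P * ?D) * Q"
        by (simp only: mult_add_distrib_mat[OF PQ(1) B(1) D])
      also have "\<dots> = P * B * Q + P * ?D * Q"
        by (rule add_mult_distrib_mat[of _ m m]) (use PQ(1,2) B(1) D in auto)
      finally show ?thesis using PQ(4) by simp
    qed
    also have "det \<dots> = det P * det (B + ?D) * det Q"
      using PQ(1,2) B(1) D by (simp add: det_mult[of _ m])
    also have "\<dots> = det (B + ?D)" using dPQ by (simp add: mult_ac)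
    also have "\<dots> = prod_list (diag_mat (B + ?D))"
      by (rule det_upper_triangular[of _ m]) (use B in \<open>auto simp: upper_triangular_def\<close>)
    also have "\<dots> = (\<Prod>i<m. B $$ (i, i) + \<delta> i)"
      using B(1) by (auto simp: prod_list_diag_prod atLeast0LessThan intro!: prod.cong)
    finally show ?thesis .
  qed
  with PQ1 show ?thesis
    by (intro exI[of _ "\<lambda>i k. P $$ (i, k)"] exI[of _ "\<lambda>k j. Q $$ (k, j)"] exI[of _ "\<lambda>i. B $$ (i, i)"]) auto
qed

text \<open>The pencil is x 1 - (- t), so its determinant is the characteristic polynomial of -
  t.\<close>

lemma det_pencil_monic:
  fixes t :: "nat \<times> nat \<Rightarrow> complex" and m :: nat
  defines "D \<equiv> det (mat m m (\<lambda>(i, j). [:t (i, j), if i = j then 1 else 0:]))"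
  shows "Polynomial.coeff D m = 1" "k > m \<Longrightarrow> Polynomial.coeff D k = 0"
proof -
  let ?A = "mat m m (\<lambda>ij. - t ij)"
  have A: "?A \<in> carrier_mat m m" by simp
  have "char_poly_matrix ?A = mat m m (\<lambda>(i, j). [:t (i, j), if i = j then 1 else 0:])"
    by (rule eq_matI) (auto simp: char_poly_matrix_def)
  then have "char_poly ?A = D" by (simp add: char_poly_def D_def)
  with degree_monic_char_poly[OF A] show "Polynomial.coeff D m = 1" "k > m \<Longrightarrow> Polynomial.coeff D k = 0"
    by (auto intro: coeff_eq_0)
qed

lemma polynomial_zero_if_many_roots:
  fixes r :: "complex poly"
  assumes "\<forall>k\<ge>m. Polynomial.coeff r k = 0" "inj_on x {..<m}" "\<And>i. i < m \<Longrightarrow> poly r (x i) = 0"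
  shows "r = 0"
proof (rule ccontr)
  assume r: "r \<noteq> 0"
  have "card {..<m} = card (x ` {..<m})" using assms(2) by (simp add: card_image)
  also have "\<dots> \<le> card {z. poly r z = 0}"
    by (rule card_mono) (use r poly_roots_finite assms(3) in auto)
  also have "\<dots> \<le> Polynomial.degree r" using r by (rule card_poly_roots_bound)
  finally have "Polynomial.coeff r (Polynomial.degree r) = 0" using assms(1) by auto
  then show False using r by simp
qed

text \<open>Two of the perturbed diagonal entries coincide for at most one value of the parameter,
  and there are finitely many pairs.\<close>

lemma finite_bad_perturbations:
  fixes b :: "nat \<Rightarrow> complex"
  shows "finite {\<epsilon>. \<not> inj_on (\<lambda>i. b i + \<epsilon> * of_nat i) {..<m}}"
proof (rule finite_subset)
  show "{\<epsilon>. \<not> inj_on (\<lambda>i. b i + \<epsilon> * of_nat i) {..<m}} \<subseteq> (\<lambda>(i, j). (b j - b i) / (of_nat i - of_nat j)) ` ({..<m} \<times> {..<m})"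
  proof
    fix \<epsilon> assume "\<epsilon> \<in> {\<epsilon>. \<not> inj_on (\<lambda>i. b i + \<epsilon> * of_nat i) {..<m}}"
    then obtain i j where ij: "i < m" "j < m" "i \<noteq> j" "b i + \<epsilon> * of_nat i = b j + \<epsilon> * of_nat j"
      by (auto simp: inj_on_def)
    then have "(of_nat i :: complex) - of_nat j \<noteq> 0" by simp
    then have "\<epsilon> = (b j - b i) / (of_nat i - of_nat j)" using ij(4) by (simp add: field_simps)
    then show "\<epsilon> \<in> (\<lambda>(i, j). (b j - b i) / (of_nat i - of_nat j)) ` ({..<m} \<times> {..<m})"
      using ij by force
  qed
qed simp

text \<open>
  Divide \<open>P (t + x 1, s)\<close> by the monic polynomial \<open>det (t + x 1)\<close> in \<open>x\<close>.  If \<open>t\<close> has \<open>m\<close> distinct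
  eigenvalues then each of them is a zero of the remainder, which therefore vanishes.  By
  Schur triangularisation, every matrix is a limit along a line of such matrices.
\<close>

lemma det_dvd_if_vanishes:
  fixes P :: "((nat \<times> nat) + 'b) cpoly"
  assumes J: "Inl ` ({0..<m} \<times> {0..<m}) \<subseteq> J" and P: "P \<in> polys J"
    and vanish: "\<And>t s e f. det (mat m m t) = 0 \<Longrightarrow> det (mat m m (\<lambda>(i, j). t (i, j) + e i * f j)) \<noteq> 0 \<Longrightarrow>
      ev (case_sum t s) P = 0"
  shows "\<exists>Q\<in>polys J. \<forall>t s. ev (case_sum t s) P = ev (case_sum t s) Q * det (mat m m t)"
proof -
  \<comment> \<open>Moves the matrix variables along the identity, t + x 1, and fixes all other
    variables; \<open>g\<close> is P along this line.\<close>
  define sh where "sh \<sigma> v = (case v of Inl (i, j) \<Rightarrow> [:\<sigma> v, if i = j then 1 else 0:] | Inr x \<Rightarrow> [:\<sigma> v:])"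
    for \<sigma> :: "(nat \<times> nat) + 'b \<Rightarrow> complex" and v
  define g where "g \<sigma> = poly_eval (\<lambda>c. [:c:]) (sh \<sigma>) P" for \<sigma>
  define D where "D \<sigma> = det (mat m m (\<lambda>(i, j). [:\<sigma> (Inl (i, j)), if i = j then 1 else 0:]))"
    for \<sigma> :: "(nat \<times> nat) + 'b \<Rightarrow> complex"
  have sh: "polyfun_coeffs J (\<lambda>\<sigma>. sh \<sigma> v)" if "v \<in> J" for v
    using that unfolding sh_def
    by (cases v) (auto intro!: polyfun_coeffs_linear polyfun_coeffs_const polyfun_var split: prod.splits)
  have "polyfun_coeffs J g"
    unfolding g_def using P
    by (induction P rule: polys_induct)
      (auto simp: upoly.poly_eval_simps intro!: polyfun_coeffs_add polyfun_coeffs_mult sh polyfun_coeffs_const)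
  moreover have "polyfun_coeffs J D"
  proof -
    have "polyfun_coeffs J (\<lambda>_. of_int k)" for k
      using polyfun_coeffs_const[of J "\<lambda>_. of_int k"] by (simp add: of_int_poly)
    moreover have "polyfun_coeffs J (\<lambda>\<sigma>. mat m m (\<lambda>(i, j). [:\<sigma> (Inl (i, j)), if i = j then 1 else 0:]) $$ (i, j))"
      if "i < m" "j < m" for i j
    proof -
      have "Inl (i, j) \<in> J" using J that by auto
      then show ?thesis using that by (auto intro!: polyfun_coeffs_linear polyfun_coeffs_const polyfun_var)
    qed
    ultimately show ?thesis
      unfolding D_def det_def'[OF mat_carrier]
      by (intro polyfun_coeffs_sum polyfun_coeffs_mult polyfun_coeffs_prod) (auto simp: permutes_in_image)
  qed
  moreover have "Polynomial.coeff (D \<sigma>) m = 1" "k > m \<Longrightarrow> Polynomial.coeff (D \<sigma>) k = 0" for \<sigma> k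
    using det_pencil_monic[where t = "\<lambda>ij. \<sigma> (Inl ij)" and m = m] by (auto simp: D_def)
  ultimately obtain q r where q: "polyfun_coeffs J q" and r: "polyfun_coeffs J r"
    and qr: "\<And>\<sigma>. g \<sigma> = q \<sigma> * D \<sigma> + r \<sigma>" and deg: "\<And>\<sigma>. \<forall>k\<ge>m. Polynomial.coeff (r \<sigma>) k = 0"
    using polyfun_coeffs_divide[of J g D m] by blast
  have poly_g: "poly (g (case_sum t s)) x = ev (case_sum (\<lambda>(i, j). t (i, j) + (if i = j then x else 0)) s) P" for t s x
  proof -
    have "(\<lambda>v. poly (sh (case_sum t s) v) x) = case_sum (\<lambda>(i, j). t (i, j) + (if i = j then x else 0)) s"
      by (auto simp: sh_def fun_eq_iff split: sum.splits)
    then show ?thesis by (simp add: g_def poly_upoly)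
  qed
  have poly_D: "poly (D (case_sum t s)) x = det (mat m m (\<lambda>(i, j). t (i, j) + (if i = j then x else 0)))" for t s x
    unfolding D_def by (subst det_poly_entries) (auto intro!: arg_cong[where f = det] eq_matI)
  have r0: "r (case_sum t s) = 0" for t s
  proof -
    obtain p' q' b where pq': "\<forall>i<m. \<forall>j<m. (\<Sum>k<m. p' i k * q' k j) = (if i = j then 1 else 0)"
      and det: "\<forall>\<delta>. det (mat m m (\<lambda>(i, j). t (i, j) + (\<Sum>k<m. p' i k * \<delta> k * q' k j))) = (\<Prod>i<m. b i + \<delta> i)"
      using triangular_family[of m t] by (elim exE conjE) (rule that)
    note pq = pq'[rule_format] and det = det[rule_format]
    \<comment> \<open>In the triangular form this perturbation adds \<epsilon> k to the k-th
      diagonal entry, so the entries become distinct for all but finitely many \<epsilon>.\<close>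
    define d where "d i j = (\<Sum>k<m. p' i k * of_nat k * q' k j)" for i j
    define c where "c \<epsilon> = (\<lambda>(i, j). t (i, j) + \<epsilon> * d i j)" for \<epsilon>
    have zero: "r (case_sum (c \<epsilon>) s) = 0" if inj: "inj_on (\<lambda>i. b i + \<epsilon> * of_nat i) {..<m}" for \<epsilon>
    proof (rule polynomial_zero_if_many_roots[OF deg, where x = "\<lambda>i. - (b i + \<epsilon> * of_nat i)"])
      show "inj_on (\<lambda>i. - (b i + \<epsilon> * of_nat i)) {..<m}" using inj unfolding inj_on_def neg_equal_iff_equal .
      fix l assume l: "l < m"
      \<comment> \<open>The parameter at which the l-th diagonal entry of the shifted triangular
        matrix becomes zero.\<close>
      define x where "x = - (b l + \<epsilon> * of_nat l)"
      let ?t = "\<lambda>(i, j). c \<epsilon> (i, j) + (if i = j then x else 0)"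
      \<comment> \<open>For y = 0 this is the singular member of the pencil. For y = 1 a rank-one
        change sets its l-th diagonal entry to 1 and makes it invertible, which is the certificate
        of corank one that \<open>vanish\<close> asks for.\<close>
      have M: "c \<epsilon> (i, j) + (if i = j then x else 0) + y * (p' i l * q' l j)
          = t (i, j) + (\<Sum>k<m. p' i k * (\<epsilon> * of_nat k + x + (if k = l then y else 0)) * q' k j)"
        if "i < m" "j < m" for i j y
      proof -
        have "(\<Sum>k<m. p' i k * (\<epsilon> * of_nat k + x + (if k = l then y else 0)) * q' k j)
          = (\<Sum>k<m. \<epsilon> * (p' i k * of_nat k * q' k j) + x * (p' i k * q' k j) + (if k = l then y * (p' i k * q' k j) else 0))"
          by (rule sum.cong) (auto simp: algebra_simps)
        also have "\<dots> = \<epsilon> * d i j + x * (\<Sum>k<m. p' i k * q' k j) + y * (p' i l * q' l j)"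
          using l by (simp add: sum.distrib d_def sum_distrib_left)
        finally show ?thesis using that pq by (simp add: c_def)
      qed
      have M0: "c \<epsilon> (i, j) + (if i = j then x else 0) = t (i, j) + (\<Sum>k<m. p' i k * (\<epsilon> * of_nat k + x) * q' k j)"
        if "i < m" "j < m" for i j
        using M[OF that, of 0] by simp
      have M1: "c \<epsilon> (i, j) + (if i = j then x else 0) + p' i l * q' l j
          = t (i, j) + (\<Sum>k<m. p' i k * (\<epsilon> * of_nat k + x + (if k = l then 1 else 0)) * q' k j)"
        if "i < m" "j < m" for i j
        using M[OF that, of 1] by simp
      have "det (mat m m ?t) = (\<Prod>i<m. b i + (\<epsilon> * of_nat i + x))"
        unfolding det[symmetric] by (intro arg_cong[where f = det] eq_matI) (simp_all only: M0 index_mat dim_row_mat dim_col_mat prod.case)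
      also have "\<dots> = 0" using l by (intro prod_zero) (auto simp: x_def intro!: bexI[of _ l])
      finally have d0: "det (mat m m ?t) = 0" .
      have "det (mat m m (\<lambda>(i, j). ?t (i, j) + p' i l * q' l j)) = (\<Prod>i<m. b i + (\<epsilon> * of_nat i + x + (if i = l then 1 else 0)))"
        unfolding det[symmetric] by (intro arg_cong[where f = det] eq_matI) (simp_all only: M1 index_mat dim_row_mat dim_col_mat prod.case)
      also have "\<dots> \<noteq> 0"
      proof -
        have "b i + (\<epsilon> * of_nat i + x + (if i = l then 1 else 0)) \<noteq> 0" if "i < m" for i
          using inj that l by (cases "i = l") (auto simp: x_def inj_on_def algebra_simps)
        then show ?thesis by simp
      qed
      finally have "ev (case_sum ?t s) P = 0" by (rule vanish[OF d0])
      then show "poly (r (case_sum (c \<epsilon>) s)) (- (b l + \<epsilon> * of_nat l)) = 0"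
        using poly_g[of "c \<epsilon>" s x] poly_D[of "c \<epsilon>" s x] d0 qr[of "case_sum (c \<epsilon>) s"] by (simp add: x_def)
    qed
    show ?thesis
    proof (rule poly_eqI)
      fix k
      \<comment> \<open>Each coefficient of the remainder is polynomial in \<epsilon> along the
        perturbation and vanishes for all but finitely many \<epsilon>, hence also at \<epsilon> =
        0.\<close>
      obtain w where w: "\<And>\<epsilon>. Polynomial.coeff (r (\<lambda>v. poly (case_sum (\<lambda>(i, j). [:t (i, j), d i j:]) (\<lambda>x. [:s x:]) v) \<epsilon>)) k = poly w \<epsilon>"
        using polyfun_curve[of J "\<lambda>\<sigma>. Polynomial.coeff (r \<sigma>) k" "case_sum (\<lambda>(i, j). [:t (i, j), d i j:]) (\<lambda>x. [:s x:])"] r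
        unfolding polyfun_coeffs_def by blast
      have "(\<lambda>v. poly (case_sum (\<lambda>(i, j). [:t (i, j), d i j:]) (\<lambda>x. [:s x:]) v) \<epsilon>) = case_sum (c \<epsilon>) s" for \<epsilon>
        by (auto simp: fun_eq_iff c_def split: sum.splits)
      with w have w: "Polynomial.coeff (r (case_sum (c \<epsilon>) s)) k = poly w \<epsilon>" for \<epsilon> by simp
      have "w = 0"
      proof (rule ccontr)
        assume "w \<noteq> 0"
        then have "finite ({\<epsilon>. poly w \<epsilon> = 0} \<union> {\<epsilon>. \<not> inj_on (\<lambda>i. b i + \<epsilon> * of_nat i) {..<m}})"
          using poly_roots_finite finite_bad_perturbations by blast
        moreover have "{\<epsilon>. poly w \<epsilon> = 0} \<union> {\<epsilon>. \<not> inj_on (\<lambda>i. b i + \<epsilon> * of_nat i) {..<m}} = UNIV"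
          using zero w by (metis (mono_tags, lifting) UNIV_eq_I UnCI coeff_0 mem_Collect_eq)
        ultimately show False using infinite_UNIV_char_0[where 'a = complex] by simp
      qed
      moreover have "c 0 = t" by (simp add: c_def)
      ultimately show "Polynomial.coeff (r (case_sum t s)) k = Polynomial.coeff 0 k" using w[of 0] by simp
    qed
  qed
  \<comment> \<open>Setting x = 0 in the quotient gives the quotient of P by det t.\<close>
  have "polyfun J (\<lambda>\<sigma>. Polynomial.coeff (q \<sigma>) 0)" using q by (simp add: polyfun_coeffs_def)
  then obtain Q where Q: "Q \<in> polys J" "\<And>\<sigma>. Polynomial.coeff (q \<sigma>) 0 = ev \<sigma> Q"
    by (auto simp: polyfun_def)
  have "ev (case_sum t s) P = ev (case_sum t s) Q * det (mat m m t)" for t s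
  proof -
    have t: "(\<lambda>(i, j). t (i, j) + (if i = j then 0 else 0)) = t" by auto
    have "poly (g (case_sum t s)) 0 = poly (q (case_sum t s)) 0 * poly (D (case_sum t s)) 0"
      using qr[of "case_sum t s"] r0 by simp
    then show ?thesis
      unfolding poly_g poly_D t using Q(2)[of "case_sum t s"] by (simp add: poly_0_coeff_0)
  qed
  with Q(1) show ?thesis by blast
qed

section \<open>Invariants of the maximal unipotent subgroup\<close>

abbreviation top_vars :: "nat \<Rightarrow> (nat \<times> nat) set" where
  "top_vars m \<equiv> {0..<m} \<times> {0..<m}"

abbreviation sym_vars :: "nat \<Rightarrow> (nat \<times> nat) set" where
  "sym_vars m \<equiv> {(i, j). i \<le> j \<and> j < m}"

section \<open>The group action on values of polynomials\<close>

lemma act_entry: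
  assumes "g \<in> carrier_mat n n" "h \<in> carrier_mat m m" "i < n" "j < m"
  shows "(map_mat const_poly (transpose_mat g) * mat n m var * map_mat const_poly h) $$ (i, j)
    = (\<Sum>l<m. (\<Sum>k<n. const_poly (g $$ (k, i)) * var (k, l)) * const_poly (h $$ (l, j)))"
proof -
  let ?A = "map_mat const_poly (transpose_mat g)" and ?X = "mat n m var" and ?H = "map_mat const_poly h"
  have c: "?A \<in> carrier_mat n n" "?X \<in> carrier_mat n m" "?H \<in> carrier_mat m m" "?A * ?X \<in> carrier_mat n m"
    using assms by auto
  have 1: "(?A * ?X) $$ (i, l) = (\<Sum>k<n. const_poly (g $$ (k, i)) * var (k, l))" if "l < m" for l
    unfolding mat_mult_entry[OF c(1,2) assms(3) that] by (rule sum.cong) (use assms that in auto)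
  show ?thesis
    unfolding mat_mult_entry[OF c(4,3) assms(3,4)] by (rule sum.cong) (use 1 assms in auto)
qed

lemma ev_act:
  assumes f: "f \<in> polys ({0..<n} \<times> {0..<m})" and gh: "g \<in> carrier_mat n n" "h \<in> carrier_mat m m"
  shows "ev \<sigma> (act n m g h f) = ev (\<lambda>(i, j). \<Sum>l<m. (\<Sum>k<n. g $$ (k, i) * \<sigma> (k, l)) * h $$ (l, j)) f"
  unfolding act_def ev_subst
proof (rule ev_cong[OF f])
  fix v assume "v \<in> {0..<n} \<times> {0..<m}"
  then obtain i j where v: "v = (i, j)" "i < n" "j < m" by auto
  show "ev \<sigma> ((map_mat const_poly (transpose_mat g) * mat n m var * map_mat const_poly h) $$ v) =
    (case v of (i, j) \<Rightarrow> \<Sum>l<m. (\<Sum>k<n. g $$ (k, i) * \<sigma> (k, l)) * h $$ (l, j))"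
    using act_entry[OF gh v(2,3)] by (simp add: v(1) ev.poly_eval_simps)
qed

lemma ev_act_left:
  assumes f: "f \<in> polys ({0..<n} \<times> {0..<m})" and u: "u \<in> carrier_mat n n"
  shows "ev \<sigma> (act n m u (1\<^sub>m m) f) = ev (\<lambda>(i, j). \<Sum>k<n. u $$ (k, i) * \<sigma> (k, j)) f"
  unfolding ev_act[OF f u one_carrier_mat]
proof (rule ev_cong[OF f])
  fix v assume "v \<in> {0..<n} \<times> {0..<m}"
  then obtain i j where v: "v = (i, j)" "j < m" by auto
  have "(\<Sum>l<m. (\<Sum>k<n. u $$ (k, i) * \<sigma> (k, l)) * 1\<^sub>m m $$ (l, j)) = (\<Sum>l<m. if l = j then (\<Sum>k<n. u $$ (k, i) * \<sigma> (k, l)) else 0)"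
    by (rule sum.cong) (use v in auto)
  then show "(case v of (i, j) \<Rightarrow> \<Sum>l<m. (\<Sum>k<n. u $$ (k, i) * \<sigma> (k, l)) * 1\<^sub>m m $$ (l, j)) = (case v of (i, j) \<Rightarrow> \<Sum>k<n. u $$ (k, i) * \<sigma> (k, j))"
    using v by simp
qed

text \<open>Invariance becomes an identity between values, so that later arguments move points and
  not polynomials.\<close>

lemma U_invariants_iff:
  "f \<in> U_invariants n m \<longleftrightarrow> f \<in> polys ({0..<n} \<times> {0..<m}) \<and>
    (\<forall>u\<in>unip_orth n. \<forall>\<sigma>. ev (\<lambda>(i, j). \<Sum>k<n. u $$ (k, i) * \<sigma> (k, j)) f = ev \<sigma> f)"
proof -
  have "act n m u (1\<^sub>m m) f = f \<longleftrightarrow> (\<forall>\<sigma>. ev (\<lambda>(i, j). \<Sum>k<n. u $$ (k, i) * \<sigma> (k, j)) f = ev \<sigma> f)"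
    if "f \<in> polys ({0..<n} \<times> {0..<m})" "u \<in> unip_orth n" for u
    using ev_act_left[OF that(1) unip_orthD(1)[OF that(2)]] cpoly_eqI by metis
  then show ?thesis by (auto simp: U_invariants_def polys_def)
qed

text \<open>Summing first over the row index s leaves the entries of u J u^T, which is J.\<close>

lemma quad_unip_orth:
  assumes "u \<in> unip_orth n"
  shows "quad n (\<lambda>(i, j). \<Sum>k<n. u $$ (k, i) * \<sigma> (k, j)) a b = quad n \<sigma> a b"
proof -
  have "quad n (\<lambda>(i, j). \<Sum>k<n. u $$ (k, i) * \<sigma> (k, j)) a b
    = (\<Sum>s<n. \<Sum>k<n. \<Sum>l<n. (u $$ (k, s) * u $$ (l, n - 1 - s)) * (\<sigma> (k, a) * \<sigma> (l, b)))"
    by (simp add: quad_def sum_product mult_ac)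
  also have "\<dots> = (\<Sum>k<n. \<Sum>s<n. \<Sum>l<n. (u $$ (k, s) * u $$ (l, n - 1 - s)) * (\<sigma> (k, a) * \<sigma> (l, b)))"
    by (rule sum.swap)
  also have "\<dots> = (\<Sum>k<n. \<Sum>l<n. \<Sum>s<n. (u $$ (k, s) * u $$ (l, n - 1 - s)) * (\<sigma> (k, a) * \<sigma> (l, b)))"
    by (intro sum.cong refl sum.swap)
  also have "\<dots> = (\<Sum>k<n. \<Sum>l<n. (\<Sum>s<n. u $$ (k, s) * u $$ (l, n - 1 - s)) * (\<sigma> (k, a) * \<sigma> (l, b)))"
    by (simp only: sum_distrib_right)
  also have "\<dots> = (\<Sum>k<n. \<Sum>l<n. if l = n - 1 - k then \<sigma> (k, a) * \<sigma> (l, b) else 0)"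
    by (intro sum.cong refl) (subst unip_orthD(4)[OF assms], auto)
  also have "\<dots> = quad n \<sigma> a b" by (simp add: quad_def)
  finally show ?thesis .
qed

text \<open>The inverse through the adjugate: one factor det t makes each entry polynomial in t. At
  a singular t, division by zero gives 0.\<close>

definition minv :: "nat \<Rightarrow> (nat \<times> nat \<Rightarrow> complex) \<Rightarrow> nat \<Rightarrow> nat \<Rightarrow> complex" where
  "minv m t i j = adj_mat (mat m m t) $$ (i, j) / det (mat m m t)"

lemma minv:
  assumes "det (mat m m t) \<noteq> 0" "i < m" "j < m"
  shows "(\<Sum>l<m. t (i, l) * minv m t l j) = (if i = j then 1 else 0)"
    and "(\<Sum>l<m. minv m t i l * t (l, j)) = (if i = j then 1 else 0)"
proof -
  let ?A = "mat m m t"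
  have A: "?A \<in> carrier_mat m m" by simp
  have "(\<Sum>l<m. t (i, l) * minv m t l j) = (\<Sum>l<m. ?A $$ (i, l) * adj_mat ?A $$ (l, j)) / det ?A"
    unfolding sum_divide_distrib by (rule sum.cong) (use assms in \<open>auto simp: minv_def\<close>)
  also have "\<dots> = (?A * adj_mat ?A) $$ (i, j) / det ?A"
    by (simp only: mat_mult_entry[OF A adj_mat(1)[OF A] assms(2,3)])
  also have "\<dots> = (if i = j then 1 else 0)"
    unfolding adj_mat(2)[OF A] using assms by simp
  finally show "(\<Sum>l<m. t (i, l) * minv m t l j) = (if i = j then 1 else 0)" .
  have "(\<Sum>l<m. minv m t i l * t (l, j)) = (\<Sum>l<m. adj_mat ?A $$ (i, l) * ?A $$ (l, j)) / det ?A"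
    unfolding sum_divide_distrib by (rule sum.cong) (use assms in \<open>auto simp: minv_def\<close>)
  also have "\<dots> = (adj_mat ?A * ?A) $$ (i, j) / det ?A"
    by (simp only: mat_mult_entry[OF adj_mat(1)[OF A] A assms(2,3)])
  also have "\<dots> = (if i = j then 1 else 0)"
    unfolding adj_mat(3)[OF A] using assms by simp
  finally show "(\<Sum>l<m. minv m t i l * t (l, j)) = (if i = j then 1 else 0)" .
qed

lemma polyfun_adj:
  assumes "\<And>\<sigma> i j. i < m \<Longrightarrow> j < m \<Longrightarrow> polyfun I (\<lambda>\<sigma>. A \<sigma> (i, j))" "i < m" "j < m"
  shows "polyfun I (\<lambda>\<sigma>. adj_mat (mat m m (A \<sigma>)) $$ (i, j))"
proof -
  have eq: "adj_mat (mat m m (A \<sigma>)) $$ (i, j) = (-1) ^ (j + i) * det (mat_delete (mat m m (A \<sigma>)) j i)" for \<sigma>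
    using assms by (simp add: adj_mat_def cofactor_def)
  have "polyfun I (\<lambda>\<sigma>. det (mat_delete (mat m m (A \<sigma>)) j i))"
  proof (rule polyfun_det)
    show "mat_delete (mat m m (A \<sigma>)) j i \<in> carrier_mat (m - 1) (m - 1)" for \<sigma>
      by (simp add: mat_delete_def)
    fix a b assume ab: "a < m - 1" "b < m - 1"
    have "mat_delete (mat m m (A \<sigma>)) j i $$ (a, b) = A \<sigma> (if a < j then a else Suc a, if b < i then b else Suc b)" for \<sigma>
      using ab by (auto simp: mat_delete_def)
    then show "polyfun I (\<lambda>\<sigma>. mat_delete (mat m m (A \<sigma>)) j i $$ (a, b))"
      using assms(1) ab by simp
  qed
  then show ?thesis unfolding eq by (intro polyfun_mult) auto
qed

text \<open>A symmetric matrix built from its entries on and above the diagonal, the free parameters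
  indexed by \<open>sym_vars\<close>.\<close>

definition symm :: "(nat \<times> nat \<Rightarrow> 'a) \<Rightarrow> nat \<Rightarrow> nat \<Rightarrow> 'a" where
  "symm s i j = s (min i j, max i j)"

lemma symm_sym: "symm s i j = symm s j i"
  by (simp add: symm_def min.commute max.commute)

definition section_at :: "nat \<Rightarrow> nat \<Rightarrow> (nat \<times> nat \<Rightarrow> complex) \<Rightarrow> (nat \<times> nat \<Rightarrow> complex) \<Rightarrow> nat \<times> nat \<Rightarrow> complex" where
  "section_at n m t s = section_point n m (\<lambda>i j. t (i, j)) (minv m t) (symm s)"

text \<open>\<open>Inl\<close> stands for the entries of the top block, \<open>Inr\<close> for the
  independent values of the quadratic invariants.\<close>

definition norm_vars :: "nat \<Rightarrow> ((nat \<times> nat) + (nat \<times> nat)) set" where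
  "norm_vars m = Inl ` top_vars m \<union> Inr ` sym_vars m"

lemma quad_section_at:
  assumes "2 * m \<le> n" "det (mat m m t) \<noteq> 0" "i < m" "j < m"
  shows "quad n (section_at n m t s) i j = symm s i j"
  unfolding section_at_def
  by (rule quad_section_point[OF assms(1) _ _ assms(3,4)]) (use minv(2)[OF assms(2)] symm_sym in auto)

lemma section_at_top: "i < m \<Longrightarrow> section_at n m t s (i, j) = t (i, j)"
  by (simp add: section_at_def section_point_def)

lemma polyfun_det_top: "polyfun (norm_vars m) (\<lambda>\<rho>. det (mat m m (\<lambda>ij. \<rho> (Inl ij))))"
  by (rule polyfun_det) (auto simp: norm_vars_def intro!: polyfun_var)

text \<open>Each coordinate of the canonical point becomes polynomial after multiplication by det t,
  so some power of det t clears the denominators of any polynomial in these coordinates.\<close>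

lemma section_regular:
  assumes mn: "2 * m \<le> n" and f: "f \<in> polys ({0..<n} \<times> {0..<m})"
  shows "\<exists>k. \<exists>P\<in>polys (norm_vars m). \<forall>t s. det (mat m m t) \<noteq> 0 \<longrightarrow>
    det (mat m m t) ^ k * ev (section_at n m t s) f = ev (case_sum t s) P"
  using f
proof (induction f rule: polys_induct)
  case (const c)
  show ?case
    by (rule exI[of _ 0], rule bexI[of _ "const_poly c"]) (auto simp: ev.poly_eval_simps)
next
  case (add p q)
  then obtain k l P Q where P: "P \<in> polys (norm_vars m)"
    "\<And>t s. det (mat m m t) \<noteq> 0 \<Longrightarrow> det (mat m m t) ^ k * ev (section_at n m t s) p = ev (case_sum t s) P"
    and Q: "Q \<in> polys (norm_vars m)"
    "\<And>t s. det (mat m m t) \<noteq> 0 \<Longrightarrow> det (mat m m t) ^ l * ev (section_at n m t s) q = ev (case_sum t s) Q"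
    by metis
  obtain d where d: "d \<in> polys (norm_vars m)" "\<And>\<rho>. det (mat m m (\<lambda>ij. \<rho> (Inl ij))) = ev \<rho> d"
    using polyfun_det_top by (auto simp: polyfun_def)
  have dt: "ev (case_sum t s) d = det (mat m m t)" for t s
    using d(2)[of "case_sum t s"] by simp
  have R: "d ^ l * P + d ^ k * Q \<in> polys (norm_vars m)"
    by (intro add_in_polys mult_in_polys power_in_polys P Q d)
  show ?case
    by (rule exI[of _ "k + l"], rule bexI[OF _ R])
      (auto simp: ev.poly_eval_simps dt power_add algebra_simps simp flip: P(2) Q(2))
next
  case (var v p)
  then obtain k P where P: "P \<in> polys (norm_vars m)"
    "\<And>t s. det (mat m m t) \<noteq> 0 \<Longrightarrow> det (mat m m t) ^ k * ev (section_at n m t s) p = ev (case_sum t s) P"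
    by metis
  obtain i j where v: "v = (i, j)" "i < n" "j < m" using var by auto
  have "\<exists>Q\<in>polys (norm_vars m). \<forall>t s. det (mat m m t) \<noteq> 0 \<longrightarrow> det (mat m m t) * section_at n m t s (i, j) = ev (case_sum t s) Q"
  proof -
    define X where "X \<rho> = (if i < m then det (mat m m (\<lambda>ij. \<rho> (Inl ij))) * \<rho> (Inl (i, j)) else if i < n - m then 0
      else (\<Sum>l<m. adj_mat (mat m m (\<lambda>ij. \<rho> (Inl ij))) $$ (l, n - 1 - i) * symm (\<lambda>ij. \<rho> (Inr ij)) l j) * (1 / 2))"
      for \<rho> :: "(nat \<times> nat) + (nat \<times> nat) \<Rightarrow> complex"
    have "polyfun (norm_vars m) X"
    proof -
      have "polyfun (norm_vars m) (\<lambda>\<rho>. symm (\<lambda>ij. \<rho> (Inr ij)) l j)" if "l < m" for l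
        unfolding symm_def using that v by (auto intro!: polyfun_var simp: norm_vars_def)
      moreover have "polyfun (norm_vars m) (\<lambda>\<rho>. adj_mat (mat m m (\<lambda>ij. \<rho> (Inl ij))) $$ (l, n - 1 - i))"
        if "\<not> i < m" "\<not> i < n - m" "l < m" for l
        by (rule polyfun_adj) (use that v mn in \<open>auto intro!: polyfun_var simp: norm_vars_def\<close>)
      ultimately have last: "polyfun (norm_vars m) (\<lambda>\<rho>. (\<Sum>l<m. adj_mat (mat m m (\<lambda>ij. \<rho> (Inl ij))) $$ (l, n - 1 - i) *
          symm (\<lambda>ij. \<rho> (Inr ij)) l j) * (1 / 2))" if "\<not> i < m" "\<not> i < n - m"
        using that by (intro polyfun_mult polyfun_sum polyfun_const) auto
      have top: "polyfun (norm_vars m) (\<lambda>\<rho>. det (mat m m (\<lambda>ij. \<rho> (Inl ij))) * \<rho> (Inl (i, j)))" if "i < m"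
        using that v by (intro polyfun_mult polyfun_det_top polyfun_var) (auto simp: norm_vars_def)
      consider "i < m" | "\<not> i < m" "i < n - m" | "\<not> i < m" "\<not> i < n - m" by blast
      then show ?thesis
      proof cases
        case 1
        then have "X = (\<lambda>\<rho>. det (mat m m (\<lambda>ij. \<rho> (Inl ij))) * \<rho> (Inl (i, j)))" by (simp add: X_def fun_eq_iff)
        then show ?thesis using top[OF 1] by simp
      next
        case 2
        then have "X = (\<lambda>\<rho>. 0)" by (simp add: X_def fun_eq_iff)
        then show ?thesis by simp
      next
        case 3
        then have "X = (\<lambda>\<rho>. (\<Sum>l<m. adj_mat (mat m m (\<lambda>ij. \<rho> (Inl ij))) $$ (l, n - 1 - i) *
          symm (\<lambda>ij. \<rho> (Inr ij)) l j) * (1 / 2))" by (simp add: X_def fun_eq_iff)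
        then show ?thesis using last[OF 3] by simp
      qed
    qed
    then obtain Q where Q: "Q \<in> polys (norm_vars m)" "\<And>\<rho>. X \<rho> = ev \<rho> Q" by (auto simp: polyfun_def)
    have "det (mat m m t) * section_at n m t s (i, j) = X (case_sum t s)" if "det (mat m m t) \<noteq> 0" for t s
      using that by (simp add: X_def section_at_def section_point_def minv_def sum_divide_distrib sum_distrib_left)
    then show ?thesis using Q by (intro bexI[of _ Q]) auto
  qed
  then obtain Q where Q: "Q \<in> polys (norm_vars m)"
    "\<And>t s. det (mat m m t) \<noteq> 0 \<Longrightarrow> det (mat m m t) * section_at n m t s (i, j) = ev (case_sum t s) Q" by blast
  show ?case
    by (rule exI[of _ "Suc k"], rule bexI[OF _ mult_in_polys[OF Q(1) P(1)]])
      (auto simp: ev.poly_eval_simps v simp flip: P(2) Q(2))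
qed

text \<open>With q the inverse of t + e f^T and v = q e one has q t = 1 - v f^T. A nonzero kernel
  vector z of t then satisfies z = v (f . z), which gives f . v = 1.\<close>

lemma det_zero_corank_one:
  fixes t :: "nat \<times> nat \<Rightarrow> complex"
  assumes d0: "det (mat m m t) = 0" and d1: "det (mat m m (\<lambda>(i, j). t (i, j) + e i * f j)) \<noteq> 0"
  shows "\<exists>q v. (\<forall>i<m. \<forall>j<m. (\<Sum>l<m. q i l * t (l, j)) = (if i = j then 1 else 0) - v i * f j) \<and> (\<Sum>i<m. f i * v i) = 1"
proof -
  define t' where "t' = (\<lambda>(i, j). t (i, j) + e i * f j)"
  define q where "q = minv m t'"
  define v where "v i = (\<Sum>l<m. q i l * e l)" for i
  have q: "(\<Sum>l<m. q i l * t' (l, j)) = (if i = j then 1 else 0)" if "i < m" "j < m" for i j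
    unfolding q_def using minv(2)[of m t'] d1 that by (simp add: t'_def)
  have qt: "(\<Sum>l<m. q i l * t (l, j)) = (if i = j then 1 else 0) - v i * f j" if "i < m" "j < m" for i j
  proof -
    have "(\<Sum>l<m. q i l * t' (l, j)) = (\<Sum>l<m. q i l * t (l, j)) + v i * f j"
      by (simp add: t'_def v_def distrib_left sum.distrib sum_distrib_right mult.assoc)
    then show ?thesis using q[OF that] by simp
  qed
  obtain z where z: "z \<in> carrier_vec m" "z \<noteq> 0\<^sub>v m" "mat m m t *\<^sub>v z = 0\<^sub>v m"
    using d0 det_0_iff_vec_prod_zero_field[of "mat m m t" m] by auto
  have tz: "(\<Sum>j<m. t (l, j) * z $ j) = 0" if "l < m" for l
  proof -
    have "(mat m m t *\<^sub>v z) $ l = (\<Sum>j<m. t (l, j) * z $ j)"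
      using that z(1) by (auto simp: scalar_prod_def atLeast0LessThan intro!: sum.cong)
    then show ?thesis using z(3) that by simp
  qed
  define c where "c = (\<Sum>j<m. f j * z $ j)"
  have zv: "z $ i = v i * c" if "i < m" for i
  proof -
    have "0 = (\<Sum>l<m. q i l * (\<Sum>j<m. t (l, j) * z $ j))" using tz by simp
    also have "\<dots> = (\<Sum>j<m. (\<Sum>l<m. q i l * t (l, j)) * z $ j)"
      by (simp add: sum_distrib_left sum_distrib_right mult.assoc) (rule sum.swap)
    also have "\<dots> = (\<Sum>j<m. (if j = i then z $ j else 0) - v i * (f j * z $ j))"
      by (rule sum.cong) (auto simp: qt[OF that] left_diff_distrib mult.assoc)
    also have "\<dots> = z $ i - v i * c" using that by (simp add: sum_subtractf c_def sum_distrib_left)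
    finally show ?thesis by simp
  qed
  have "c \<noteq> 0"
  proof
    assume "c = 0"
    then have "z = 0\<^sub>v m" using zv z(1) by (intro eq_vecI) auto
    then show False using z(2) by simp
  qed
  moreover have "c = (\<Sum>j<m. f j * v j) * c"
  proof -
    have "(\<Sum>j<m. f j * z $ j) = (\<Sum>j<m. f j * v j) * c"
      unfolding sum_distrib_right by (rule sum.cong) (auto simp: zv)
    then show ?thesis unfolding c_def[symmetric] .
  qed
  ultimately have "(\<Sum>i<m. f i * v i) = 1" by simp
  then show ?thesis using qt by blast
qed

theorem invariant_expression:
  assumes mn: "2 * m < n" and f: "f \<in> U_invariants n m"
  shows "\<exists>P\<in>polys (norm_vars m). \<forall>\<sigma>. ev \<sigma> f = ev (case_sum \<sigma> (\<lambda>(i, j). quad n \<sigma> i j)) P"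
proof -
  have mn': "2 * m \<le> n" using mn by simp
  have fp: "f \<in> polys ({0..<n} \<times> {0..<m})"
    and inv: "\<And>u \<sigma>. u \<in> unip_orth n \<Longrightarrow> ev (\<lambda>(i, j). \<Sum>k<n. u $$ (k, i) * \<sigma> (k, j)) f = ev \<sigma> f"
    using f by (auto simp: U_invariants_iff)
  let ?Q = "\<lambda>\<sigma>. (\<lambda>(i, j). quad n \<sigma> i j)"
  obtain k P where P: "P \<in> polys (norm_vars m)" and kP: "\<And>t s. det (mat m m t) \<noteq> 0 \<Longrightarrow>
    det (mat m m t) ^ k * ev (section_at n m t s) f = ev (case_sum t s) P"
    using section_regular[OF mn' fp] by blast
  \<comment> \<open>Where the top block is invertible, the group moves the point to the canonical
    point with the same top block and the same quadratic values, and f keeps its value.\<close>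
  have eq_dense: "det (mat m m \<sigma>) ^ k * ev \<sigma> f = ev (case_sum \<sigma> (?Q \<sigma>)) P" if d: "det (mat m m \<sigma>) \<noteq> 0" for \<sigma>
  proof -
    obtain u where u: "u \<in> unip_orth n" "\<And>i j. i < n \<Longrightarrow> j < m \<Longrightarrow> (\<Sum>k<n. u $$ (k, i) * \<sigma> (k, j)) = section_at n m \<sigma> (?Q \<sigma>) (i, j)"
    proof (rule bexE[OF unip_orth_transitive[where \<sigma> = \<sigma> and \<tau> = "section_at n m \<sigma> (?Q \<sigma>)" and q = "minv m \<sigma>", OF mn']])
      show "quad n (section_at n m \<sigma> (?Q \<sigma>)) i j = quad n \<sigma> i j" if "i < m" "j < m" for i j
        using quad_section_at[OF mn' d that] by (auto simp: symm_def min_def max_def quad_sym)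
    qed (use minv[OF d] section_at_top in \<open>auto simp: section_at_def section_point_def\<close>)
    have "ev \<sigma> f = ev (section_at n m \<sigma> (?Q \<sigma>)) f"
      by (rule trans[OF inv[OF u(1), symmetric] ev_cong[OF fp]]) (use u(2) in auto)
    then show ?thesis using kP[OF d] by simp
  qed
  \<comment> \<open>Stated for arbitrary k and P, so that the induction on k removes one factor det
    at a time.\<close>
  have "\<exists>P\<in>polys (norm_vars m). \<forall>\<sigma>. ev \<sigma> f = ev (case_sum \<sigma> (?Q \<sigma>)) P"
    if "P \<in> polys (norm_vars m)" "\<And>\<sigma>. det (mat m m \<sigma>) \<noteq> 0 \<Longrightarrow> det (mat m m \<sigma>) ^ k * ev \<sigma> f = ev (case_sum \<sigma> (?Q \<sigma>)) P" for k P
    using that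
  proof (induction k arbitrary: P)
    have d: "polyfun UNIV (\<lambda>\<sigma>. det (mat m m \<sigma>))" by (rule polyfun_det) (auto intro!: polyfun_var)
    have d1: "det (mat m m (\<lambda>(i, j). if i = j then 1 else 0)) \<noteq> (0::complex)"
    proof -
      have "mat m m (\<lambda>(i, j). if i = j then 1 else 0) = (1\<^sub>m m :: complex mat)" by (rule eq_matI) auto
      then show ?thesis by simp
    qed
    \<comment> \<open>Both sides are polynomial in the point, so the identity extends from
      invertible top blocks to all points.\<close>
    have everywhere: "det (mat m m \<sigma>) ^ k * ev \<sigma> f = ev (case_sum \<sigma> (?Q \<sigma>)) P"
      if "\<And>\<sigma>. det (mat m m \<sigma>) \<noteq> 0 \<Longrightarrow> det (mat m m \<sigma>) ^ k * ev \<sigma> f = ev (case_sum \<sigma> (?Q \<sigma>)) P"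
        "P \<in> polys (norm_vars m)" for k P \<sigma>
    proof -
      have Q: "polyfun UNIV (\<lambda>\<sigma>. quad n \<sigma> i j)" for i j
        unfolding quad_def by (auto intro!: polyfun_sum polyfun_mult polyfun_var)
      have R: "polyfun UNIV (\<lambda>\<sigma>. ev (case_sum \<sigma> (?Q \<sigma>)) P)"
      proof (rule polyfun_compose[OF that(2)])
        show "polyfun UNIV (\<lambda>\<sigma>. case_sum \<sigma> (?Q \<sigma>) v)" for v
          by (cases v) (auto intro: polyfun_var Q)
      qed
      have E: "polyfun UNIV (\<lambda>\<sigma>. ev \<sigma> f)" by (rule polyfun_ev[OF polys_UNIV])
      have W: "polyfun UNIV (\<lambda>\<sigma>. det (mat m m \<sigma>) ^ k)" by (rule polyfun_power[OF d])
      have X: "polyfun UNIV (\<lambda>\<sigma>. det (mat m m \<sigma>) ^ k * ev \<sigma> f - ev (case_sum \<sigma> (?Q \<sigma>)) P)"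
        by (rule polyfun_diff[OF polyfun_mult[OF W E] R])
      have "det (mat m m \<sigma>) ^ k * ev \<sigma> f - ev (case_sum \<sigma> (?Q \<sigma>)) P = 0"
        by (rule polyfun_zero_dense[where f = "\<lambda>\<sigma>. det (mat m m \<sigma>) ^ k * ev \<sigma> f - ev (case_sum \<sigma> (?Q \<sigma>)) P"
              and d = "\<lambda>\<sigma>. det (mat m m \<sigma>)", OF X d d1]) (simp add: that(1))
      then show ?thesis by simp
    qed
    {
      case 0
      then show ?case using everywhere[of 0 P] by auto
    next
      case (Suc k)
      note eq = everywhere[of "Suc k" P, OF Suc.prems(2,1)]
      have "\<exists>Q\<in>polys (norm_vars m). \<forall>t s. ev (case_sum t s) P = ev (case_sum t s) Q * det (mat m m t)"
      proof (rule det_dvd_if_vanishes)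
        fix t s :: "nat \<times> nat \<Rightarrow> complex" and e g
        assume d0: "det (mat m m t) = 0" and d1: "det (mat m m (\<lambda>(i, j). t (i, j) + e i * g j)) \<noteq> 0"
        from det_zero_corank_one[OF this] obtain q v where
          q': "\<forall>i<m. \<forall>j<m. (\<Sum>l<m. q i l * t (l, j)) = (if i = j then 1 else 0) - v i * g j"
          and v: "(\<Sum>i<m. g i * v i) = 1" by (elim exE conjE) (rule that)
        note q = q'[rule_format]
        \<comment> \<open>A point over the singular t with prescribed quadratic values. There the
          left side of the identity contains the factor det t = 0, so P vanishes at (t, s).\<close>
        have "\<exists>\<sigma>. (\<forall>i<m. \<forall>j<m. \<sigma> (i, j) = t (i, j)) \<and> (\<forall>i<m. \<forall>j<m. quad n \<sigma> i j = symm s i j)"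
          by (rule exists_point_corank_one[where t = "\<lambda>i j. t (i, j)", OF mn _ v symm_sym]) (rule q)
        then obtain \<sigma> where \<sigma>': "\<forall>i<m. \<forall>j<m. \<sigma> (i, j) = t (i, j)" "\<forall>i<m. \<forall>j<m. quad n \<sigma> i j = symm s i j"
          by (elim exE conjE) (rule that)
        note \<sigma> = \<sigma>'[rule_format]
        have "mat m m \<sigma> = mat m m t" using \<sigma>(1) by (intro eq_matI) auto
        then have "ev (case_sum \<sigma> (?Q \<sigma>)) P = 0" using eq[of \<sigma>] d0 by simp
        moreover have "ev (case_sum \<sigma> (?Q \<sigma>)) P = ev (case_sum t s) P"
          by (rule ev_cong[OF Suc.prems(1)]) (use \<sigma> in \<open>auto simp: norm_vars_def symm_def\<close>)
        ultimately show "ev (case_sum t s) P = 0" by simp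
      qed (use Suc.prems in \<open>auto simp: norm_vars_def\<close>)
      then obtain Q where Q: "Q \<in> polys (norm_vars m)" "\<And>t s. ev (case_sum t s) P = ev (case_sum t s) Q * det (mat m m t)" by blast
      have "det (mat m m \<sigma>) ^ k * ev \<sigma> f = ev (case_sum \<sigma> (?Q \<sigma>)) Q" if "det (mat m m \<sigma>) \<noteq> 0" for \<sigma>
        using eq[of \<sigma>] Q(2)[of \<sigma> "?Q \<sigma>"] that by simp
      with Q(1) show ?case by (rule Suc.IH)
    }
  qed
  from this[OF P eq_dense] show ?thesis .
qed

section \<open>Expansion in the quadratic invariants\<close>

definition r2_mon :: "nat \<Rightarrow> ((nat \<times> nat) \<Rightarrow>\<^sub>0 nat) \<Rightarrow> (nat \<times> nat) cpoly" where
  "r2_mon n \<alpha> = mon_eval (\<lambda>(i, j). r2 n i j) \<alpha>"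

lemma r2_mon_0 [simp]: "r2_mon n 0 = 1"
  by (simp add: r2_mon_def)

lemma r2_mon_add: "r2_mon n (\<alpha> + \<beta>) = r2_mon n \<alpha> * r2_mon n \<beta>"
  by (simp add: r2_mon_def mon_eval_add)

lemma r2_mon_single [simp]: "r2_mon n (Poly_Mapping.single (i, j) 1) = r2 n i j"
  by (simp add: r2_mon_def)

lemma ev_r2_mon: "ev \<sigma> (r2_mon n \<alpha>) = mon_eval (\<lambda>(i, j). quad n \<sigma> i j) \<alpha>"
  by (simp add: r2_mon_def ev.poly_eval_mon case_prod_unfold ev_r2)

lemma ev_r2_mon_cong:
  assumes "Poly_Mapping.keys \<alpha> \<subseteq> S" "\<And>i j. (i, j) \<in> S \<Longrightarrow> quad n \<sigma> i j = s (i, j)"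
  shows "ev \<sigma> (r2_mon n \<alpha>) = mon_eval s \<alpha>"
  unfolding ev_r2_mon by (rule mon_eval_cong) (use assms in auto)

text \<open>The polynomial of \<open>invariant_expression\<close> is expanded in monomials of its
  \<open>Inr\<close> variables, with coefficients in the \<open>Inl\<close> variables; then the
  quadratic invariants are substituted.\<close>

lemma invariant_normal_form:
  assumes mn: "2 * m < n" and f: "f \<in> U_invariants n m"
  shows "\<exists>A a. finite A \<and> (\<forall>\<alpha>\<in>A. Poly_Mapping.keys \<alpha> \<subseteq> sym_vars m \<and> a \<alpha> \<in> polys (top_vars m)) \<and>
    f = (\<Sum>\<alpha>\<in>A. a \<alpha> * r2_mon n \<alpha>)"
proof -
  let ?\<tau> = "case_sum var (\<lambda>(i, j). r2 n i j)"
  define C where "C p \<longleftrightarrow> (\<exists>A a. finite A \<and> (\<forall>\<alpha>\<in>A. Poly_Mapping.keys \<alpha> \<subseteq> sym_vars m \<and> a \<alpha> \<in> polys (top_vars m)) \<and>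
    p = (\<Sum>\<alpha>\<in>A. a \<alpha> * r2_mon n \<alpha>))" for p
  have C_add: "C (p + q)" if "C p" "C q" for p q
  proof -
    obtain A a where A: "finite A" "\<forall>\<alpha>\<in>A. Poly_Mapping.keys \<alpha> \<subseteq> sym_vars m \<and> a \<alpha> \<in> polys (top_vars m)"
      "p = (\<Sum>\<alpha>\<in>A. a \<alpha> * r2_mon n \<alpha>)" using \<open>C p\<close> unfolding C_def by blast
    obtain B b where B: "finite B" "\<forall>\<alpha>\<in>B. Poly_Mapping.keys \<alpha> \<subseteq> sym_vars m \<and> b \<alpha> \<in> polys (top_vars m)"
      "q = (\<Sum>\<alpha>\<in>B. b \<alpha> * r2_mon n \<alpha>)" using \<open>C q\<close> unfolding C_def by blast
    \<comment> \<open>Missing coefficients count as 0, so that both sums can run over the union of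
      the index sets.\<close>
    let ?c = "\<lambda>\<alpha>. (if \<alpha> \<in> A then a \<alpha> else 0) + (if \<alpha> \<in> B then b \<alpha> else 0)"
    have "p = (\<Sum>\<alpha>\<in>A \<union> B. (if \<alpha> \<in> A then a \<alpha> else 0) * r2_mon n \<alpha>)"
      unfolding A(3) by (rule sum.mono_neutral_cong_left) (use A B in auto)
    moreover have "q = (\<Sum>\<alpha>\<in>A \<union> B. (if \<alpha> \<in> B then b \<alpha> else 0) * r2_mon n \<alpha>)"
      unfolding B(3) by (rule sum.mono_neutral_cong_left) (use A B in auto)
    ultimately have "p + q = (\<Sum>\<alpha>\<in>A \<union> B. ?c \<alpha> * r2_mon n \<alpha>)"
      by (simp only: distrib_right sum.distrib)
    then show ?thesis unfolding C_def using A B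
      by (intro exI[of _ "A \<union> B"] exI[of _ ?c]) (auto intro!: add_in_polys)
  qed
  obtain P where P: "P \<in> polys (norm_vars m)" "\<And>\<sigma>. ev \<sigma> f = ev (case_sum \<sigma> (\<lambda>(i, j). quad n \<sigma> i j)) P"
    using invariant_expression[OF assms] by blast
  have f_eq: "f = poly_eval const_poly ?\<tau> P"
  proof (rule cpoly_eqI)
    fix \<sigma> :: "nat \<times> nat \<Rightarrow> complex"
    have "(\<lambda>v. ev \<sigma> (?\<tau> v)) = case_sum \<sigma> (\<lambda>(i, j). quad n \<sigma> i j)"
      by (auto simp: fun_eq_iff ev.poly_eval_simps ev_r2 split: sum.splits)
    then show "ev \<sigma> f = ev \<sigma> (poly_eval const_poly ?\<tau> P)"
      by (simp add: ev_subst P(2))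
  qed
  have "C (poly_eval const_poly ?\<tau> P)"
    using P(1)
  proof (induction P rule: polys_induct)
    case (const c)
    show ?case unfolding C_def
      by (rule exI[of _ "{0}"], rule exI[of _ "\<lambda>_. const_poly c"]) (auto simp: subst.poly_eval_simps)
  next
    case (add p q)
    then show ?case using C_add by (simp add: subst.poly_eval_add)
  next
    case (var v p)
    then obtain A a where A: "finite A" "\<forall>\<alpha>\<in>A. Poly_Mapping.keys \<alpha> \<subseteq> sym_vars m \<and> a \<alpha> \<in> polys (top_vars m)"
      "poly_eval const_poly ?\<tau> p = (\<Sum>\<alpha>\<in>A. a \<alpha> * r2_mon n \<alpha>)" unfolding C_def by blast
    show ?case
    proof (cases v)
      case (Inl x)
      then have "x \<in> top_vars m" using var by (auto simp: norm_vars_def)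
      then show ?thesis unfolding C_def using A Inl
        by (intro exI[of _ A] exI[of _ "\<lambda>\<alpha>. var x * a \<alpha>"])
          (auto simp: subst.poly_eval_simps sum_distrib_left mult.assoc intro!: mult_in_polys)
    next
      case (Inr x)
      then obtain i j where x: "x = (i, j)" "i \<le> j" "j < m" using var by (auto simp: norm_vars_def)
      let ?e = "Poly_Mapping.single (i, j) (1::nat)"
      have "(\<Sum>\<alpha>\<in>(+) ?e ` A. a (\<alpha> - ?e) * r2_mon n \<alpha>) = (\<Sum>\<alpha>\<in>A. a \<alpha> * r2_mon n (?e + \<alpha>))"
        by (subst sum.reindex) (auto simp: inj_on_def)
      also have "\<dots> = (\<Sum>\<alpha>\<in>A. r2 n i j * (a \<alpha> * r2_mon n \<alpha>))"
        by (simp add: r2_mon_add mult_ac del: One_nat_def)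
      also have "\<dots> = poly_eval const_poly ?\<tau> (var v * p)"
        by (simp add: subst.poly_eval_simps A(3) Inr x sum_distrib_left)
      finally have eq: "poly_eval const_poly ?\<tau> (var v * p) = (\<Sum>\<alpha>\<in>(+) ?e ` A. a (\<alpha> - ?e) * r2_mon n \<alpha>)" ..
      have k: "Poly_Mapping.keys (?e + \<alpha>) \<subseteq> sym_vars m" if "\<alpha> \<in> A" for \<alpha>
        using keys_add[of ?e \<alpha>] A(2) that x by (auto split: if_splits)
      show ?thesis unfolding C_def eq
      proof (rule exI[of _ "(+) ?e ` A"], rule exI[of _ "\<lambda>\<alpha>. a (\<alpha> - ?e)"], intro conjI ballI refl)
        fix \<beta> assume "\<beta> \<in> (+) ?e ` A"
        then obtain \<alpha> where "\<alpha> \<in> A" "\<beta> = ?e + \<alpha>" by blast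
        then show "Poly_Mapping.keys \<beta> \<subseteq> sym_vars m" "a (\<beta> - ?e) \<in> polys (top_vars m)"
          using k A(2) by auto
      qed (use A in auto)
    qed
  qed
  then show ?thesis unfolding f_eq C_def .
qed

text \<open>Over a fixed invertible top block the quadratic values can be chosen freely without
  changing the coefficients, so the sum vanishes as a polynomial in these values. Density removes
  the restriction on the top block.\<close>

lemma normal_form_unique:
  assumes mn: "2 * m \<le> n" and A: "finite A" "\<And>\<alpha>. \<alpha> \<in> A \<Longrightarrow> Poly_Mapping.keys \<alpha> \<subseteq> sym_vars m"
    "\<And>\<alpha>. \<alpha> \<in> A \<Longrightarrow> a \<alpha> \<in> polys (top_vars m)"
    and eq: "(\<Sum>\<alpha>\<in>A. a \<alpha> * r2_mon n \<alpha>) = 0" and \<alpha>: "\<alpha> \<in> A"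
  shows "a \<alpha> = 0"
proof -
  have "polyfun UNIV (\<lambda>\<sigma>. det (mat m m \<sigma>))" by (rule polyfun_det) (auto intro!: polyfun_var)
  then obtain d where d: "\<And>\<sigma>. det (mat m m \<sigma>) = ev \<sigma> d" by (auto simp: polyfun_def)
  have "mat m m (\<lambda>(i, j). if i = j then 1 else 0) = (1\<^sub>m m :: complex mat)" by (rule eq_matI) auto
  then have "det (mat m m (\<lambda>(i, j). if i = j then 1 else (0::complex))) \<noteq> 0" by simp
  with d have "d \<noteq> 0" by (auto simp: ev.poly_eval_0)
  then show ?thesis
  proof (rule cpoly_eqI_dense)
    fix \<sigma> :: "nat \<times> nat \<Rightarrow> complex" assume "ev \<sigma> d \<noteq> 0"
    then have nz: "det (mat m m \<sigma>) \<noteq> 0" by (simp add: d)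
    define p where "p = (\<Sum>\<beta>\<in>A. Poly_Mapping.single \<beta> (ev \<sigma> (a \<beta>)))"
    have "p = 0"
    proof (rule cpoly_eqI)
      fix s :: "nat \<times> nat \<Rightarrow> complex"
      let ?x = "section_at n m \<sigma> s"
      have "0 = ev ?x (\<Sum>\<alpha>\<in>A. a \<alpha> * r2_mon n \<alpha>)" by (simp add: eq ev.poly_eval_0)
      also have "\<dots> = (\<Sum>\<alpha>\<in>A. ev ?x (a \<alpha>) * ev ?x (r2_mon n \<alpha>))" by (simp add: ev.poly_eval_simps)
      also have "\<dots> = (\<Sum>\<alpha>\<in>A. ev \<sigma> (a \<alpha>) * mon_eval s \<alpha>)"
      proof (rule sum.cong[OF refl], rule arg_cong2[where f = "(*)"])
        fix \<beta> assume b: "\<beta> \<in> A"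
        show "ev ?x (a \<beta>) = ev \<sigma> (a \<beta>)"
          by (rule ev_cong[OF A(3)[OF b]]) (auto simp: section_at_top)
        show "ev ?x (r2_mon n \<beta>) = mon_eval s \<beta>"
          by (rule ev_r2_mon_cong[OF A(2)[OF b]]) (auto simp: quad_section_at[OF mn nz] symm_def min_def max_def)
      qed
      also have "\<dots> = ev s p" by (simp add: p_def ev.poly_eval_simps ev.poly_eval_single)
      finally show "ev s p = ev s 0" by (simp add: ev.poly_eval_0)
    qed
    then have "0 = Poly_Mapping.lookup p \<alpha>" by simp
    also have "\<dots> = (\<Sum>\<beta>\<in>A. if \<beta> = \<alpha> then ev \<sigma> (a \<beta>) else 0)"
      by (simp add: p_def lookup_sum lookup_single when_def)
    also have "\<dots> = ev \<sigma> (a \<alpha>)" using A(1) \<alpha> by simp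
    finally show "ev \<sigma> (a \<alpha>) = ev \<sigma> 0" by (simp add: ev.poly_eval_0)
  qed
qed

text \<open>Since u is upper triangular, row i of u^T x involves only the rows k \<le> i of
  x.\<close>

lemma act_unip_orth_top:
  assumes mn: "m \<le> n" and a: "a \<in> polys (top_vars m)" and u: "u \<in> unip_orth n"
  shows "act n m u (1\<^sub>m m) a \<in> polys (top_vars m)"
  unfolding act_def using a
proof (rule subst_in_polys)
  fix v assume "v \<in> top_vars m"
  then obtain i j where v: "v = (i, j)" "i < m" "j < m" by auto
  note uD = unip_orthD[OF u]
  have i: "i < n" using v mn by simp
  show "(map_mat const_poly (transpose_mat u) * mat n m var * map_mat const_poly (1\<^sub>m m)) $$ v \<in> polys (top_vars m)"
    unfolding v(1) act_entry[OF uD(1) one_carrier_mat i v(3)]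
  proof (intro sum_in_polys mult_in_polys[OF sum_in_polys] const_in_polys)
    fix l k assume lk: "l \<in> {..<m}" "k \<in> {..<n}"
    show "const_poly (u $$ (k, i)) * var (k, l) \<in> polys (top_vars m)"
    proof (cases "k \<le> i")
      case True
      then show ?thesis using lk v by (auto intro!: mult_in_polys)
    next
      case False
      then show ?thesis using uD(3)[of i k] lk by simp
    qed
  qed
qed

text \<open>The monomials in the r^2_ij are invariant, so applying u and subtracting gives a
  relation whose coefficients vanish by uniqueness.\<close>

lemma normal_form_invariant:
  assumes mn: "2 * m \<le> n" and A: "finite A" "\<And>\<alpha>. \<alpha> \<in> A \<Longrightarrow> Poly_Mapping.keys \<alpha> \<subseteq> sym_vars m"
    "\<And>\<alpha>. \<alpha> \<in> A \<Longrightarrow> a \<alpha> \<in> polys (top_vars m)"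
    and f: "(\<Sum>\<alpha>\<in>A. a \<alpha> * r2_mon n \<alpha>) \<in> U_invariants n m" and \<alpha>: "\<alpha> \<in> A"
  shows "a \<alpha> \<in> U_invariants n m"
proof -
  have sub: "polys (top_vars m) \<subseteq> polys ({0..<n} \<times> {0..<m})"
    by (rule polys_mono) (use mn in auto)
  have "act n m u (1\<^sub>m m) (a \<alpha>) = a \<alpha>" if u: "u \<in> unip_orth n" for u
  proof -
    let ?b = "\<lambda>\<alpha>. act n m u (1\<^sub>m m) (a \<alpha>) - a \<alpha>"
    have ap: "a \<beta> \<in> polys ({0..<n} \<times> {0..<m})" if "\<beta> \<in> A" for \<beta> using A(3)[OF that] sub by blast
    have "(\<Sum>\<alpha>\<in>A. ?b \<alpha> * r2_mon n \<alpha>) = 0"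
    proof (rule cpoly_eqI)
      fix \<sigma> :: "nat \<times> nat \<Rightarrow> complex"
      let ?us = "\<lambda>(i, j). \<Sum>k<n. u $$ (k, i) * \<sigma> (k, j)"
      have "ev ?us (\<Sum>\<alpha>\<in>A. a \<alpha> * r2_mon n \<alpha>) = ev \<sigma> (\<Sum>\<alpha>\<in>A. a \<alpha> * r2_mon n \<alpha>)"
        using f u by (simp add: U_invariants_iff)
      moreover have "ev ?us (r2_mon n \<beta>) = ev \<sigma> (r2_mon n \<beta>)" for \<beta>
        by (simp add: ev_r2_mon quad_unip_orth[OF u])
      moreover have "ev ?us (a \<beta>) = ev \<sigma> (act n m u (1\<^sub>m m) (a \<beta>))" if "\<beta> \<in> A" for \<beta>
        by (simp add: ev_act_left[OF ap[OF that] unip_orthD(1)[OF u]])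
      ultimately have "(\<Sum>\<alpha>\<in>A. ev \<sigma> (act n m u (1\<^sub>m m) (a \<alpha>)) * ev \<sigma> (r2_mon n \<alpha>)) = (\<Sum>\<alpha>\<in>A. ev \<sigma> (a \<alpha>) * ev \<sigma> (r2_mon n \<alpha>))"
        by (simp add: ev.poly_eval_simps)
      then show "ev \<sigma> (\<Sum>\<alpha>\<in>A. ?b \<alpha> * r2_mon n \<alpha>) = ev \<sigma> 0"
        by (simp add: ev.poly_eval_simps left_diff_distrib sum_subtractf)
    qed
    note eq0 = this
    have "?b \<alpha> = 0"
    proof -
      have "?b \<beta> \<in> polys (top_vars m)" if "\<beta> \<in> A" for \<beta>
        using A(3)[OF that] act_unip_orth_top[OF _ A(3)[OF that] u] mn by (intro diff_in_polys) auto
      then show "?b \<alpha> = 0" by (intro normal_form_unique[where a = ?b, OF mn A(1,2) _ eq0 \<alpha>])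
    qed
    then show ?thesis by simp
  qed
  then show ?thesis using A(3)[OF \<alpha>] sub by (auto simp: U_invariants_def polys_def)
qed

section \<open>The Fischer inner product\<close>

text \<open>The weight of a monomial in the Fischer inner product, chosen so that multiplication by
  a variable becomes adjoint to differentiation.\<close>

definition mfact :: "('v \<Rightarrow>\<^sub>0 nat) \<Rightarrow> complex" where
  "mfact \<mu> = (\<Prod>v\<in>Poly_Mapping.keys \<mu>. fact (Poly_Mapping.lookup \<mu> v))"

text \<open>Monomials are orthogonal; the conjugate on the second factor makes the form positive
  definite over the complex numbers.\<close>

definition fischer :: "'v cpoly \<Rightarrow> 'v cpoly \<Rightarrow> complex" where
  "fischer p q = (\<Sum>\<mu>\<in>Poly_Mapping.keys p. mfact \<mu> * Poly_Mapping.lookup p \<mu> * cnj (Poly_Mapping.lookup q \<mu>))"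

lemma fischer_superset:
  assumes "finite A" "Poly_Mapping.keys p \<subseteq> A"
  shows "fischer p q = (\<Sum>\<mu>\<in>A. mfact \<mu> * Poly_Mapping.lookup p \<mu> * cnj (Poly_Mapping.lookup q \<mu>))"
  unfolding fischer_def by (rule sum.mono_neutral_left) (use assms in \<open>auto simp: in_keys_iff\<close>)

lemma fischer_add_left: "fischer (p + p') q = fischer p q + fischer p' q"
proof -
  let ?A = "Poly_Mapping.keys p \<union> Poly_Mapping.keys p'"
  have "fischer (p + p') q = (\<Sum>\<mu>\<in>?A. mfact \<mu> * Poly_Mapping.lookup (p + p') \<mu> * cnj (Poly_Mapping.lookup q \<mu>))"
    by (rule fischer_superset) (use keys_add[of p p'] in auto)
  also have "\<dots> = fischer p q + fischer p' q"
    by (simp add: fischer_superset[of ?A] lookup_add algebra_simps sum.distrib)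
  finally show ?thesis .
qed

lemma fischer_add_right: "fischer p (q + q') = fischer p q + fischer p q'"
  by (simp add: fischer_def lookup_add algebra_simps sum.distrib)

lemma fischer_0_left [simp]: "fischer 0 q = 0" and fischer_0_right [simp]: "fischer p 0 = 0"
  by (simp_all add: fischer_def)

lemma fischer_sum_left: "fischer (sum f A) q = (\<Sum>a\<in>A. fischer (f a) q)"
  by (induction A rule: infinite_finite_induct) (auto simp: fischer_add_left)

lemma fischer_sum_right: "fischer p (sum f A) = (\<Sum>a\<in>A. fischer p (f a))"
  by (induction A rule: infinite_finite_induct) (auto simp: fischer_add_right)

lemma fischer_single: "fischer (Poly_Mapping.single \<mu> c) q = mfact \<mu> * c * cnj (Poly_Mapping.lookup q \<mu>)"
  using fischer_superset[of "{\<mu>}" "Poly_Mapping.single \<mu> c" q] by simp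

lemma fischer_scale_left: "fischer (const_poly c * p) q = c * fischer p q"
proof -
  have "fischer (const_poly c * p) q = (\<Sum>\<mu>\<in>Poly_Mapping.keys p. mfact \<mu> * Poly_Mapping.lookup (const_poly c * p) \<mu> * cnj (Poly_Mapping.lookup q \<mu>))"
    by (rule fischer_superset) (auto simp: in_keys_iff lookup_const_mult)
  then show ?thesis unfolding lookup_const_mult by (simp add: fischer_def sum_distrib_left mult_ac)
qed

lemma fischer_scale_right: "fischer p (const_poly c * q) = cnj c * fischer p q"
  unfolding fischer_def lookup_const_mult by (simp add: sum_distrib_left mult_ac)

lemma fischer_diff_left: "fischer (p - p') q = fischer p q - fischer p' q"
  using fischer_add_left[of "p - p'" p' q] by simp

lemma mfact_Reals: "cnj (mfact \<mu>) = mfact \<mu>"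
  by (simp add: mfact_def)

lemma fischer_commute: "fischer q p = cnj (fischer p q)"
proof -
  let ?A = "Poly_Mapping.keys p \<union> Poly_Mapping.keys q"
  show ?thesis by (simp add: fischer_superset[of ?A] mfact_Reals mult_ac)
qed

lemma fischer_self_eq_0:
  assumes "fischer p p = 0"
  shows "p = 0"
proof -
  define w where "w \<mu> = (\<Prod>v\<in>Poly_Mapping.keys \<mu>. fact (Poly_Mapping.lookup \<mu> v) :: real)" for \<mu> :: "'a \<Rightarrow>\<^sub>0 nat"
  have w: "mfact \<mu> = of_real (w \<mu>)" "w \<mu> > 0" for \<mu>
    by (simp_all add: mfact_def w_def prod_pos)
  have "fischer p p = of_real (\<Sum>\<mu>\<in>Poly_Mapping.keys p. w \<mu> * (cmod (Poly_Mapping.lookup p \<mu>))\<^sup>2)"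
    unfolding fischer_def of_real_sum
    by (rule sum.cong) (simp_all only: w(1) of_real_mult complex_norm_square mult.assoc)
  with assms have "(\<Sum>\<mu>\<in>Poly_Mapping.keys p. w \<mu> * (cmod (Poly_Mapping.lookup p \<mu>))\<^sup>2) = 0" by (metis of_real_eq_0_iff)
  then have "\<forall>\<mu>\<in>Poly_Mapping.keys p. w \<mu> * (cmod (Poly_Mapping.lookup p \<mu>))\<^sup>2 = 0"
    using w(2) by (subst (asm) sum_nonneg_eq_0_iff) (auto simp: less_imp_le)
  moreover have "w \<mu> \<noteq> 0" for \<mu> using w(2)[of \<mu>] by simp
  ultimately have "\<forall>\<mu>\<in>Poly_Mapping.keys p. Poly_Mapping.lookup p \<mu> = 0" by simp
  then show ?thesis by (intro poly_mapping_eqI) (auto simp: in_keys_iff)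
qed

text \<open>The coefficient form of the derivative, free of the truncated subtraction in its
  definition.\<close>

lemma lookup_pderiv_var:
  "Poly_Mapping.lookup (pderiv_var v q) \<mu> = of_nat (Suc (Poly_Mapping.lookup \<mu> v)) * Poly_Mapping.lookup q (\<mu> + Poly_Mapping.single v 1)"
proof -
  let ?e = "Poly_Mapping.single v (1::nat)"
  have "Poly_Mapping.lookup (pderiv_var v q) \<mu> =
    (\<Sum>\<nu>\<in>Poly_Mapping.keys q. if \<nu> = \<mu> + ?e then of_nat (Poly_Mapping.lookup \<nu> v) * Poly_Mapping.lookup q \<nu> else 0)"
    unfolding pderiv_var_def lookup_sum
  proof (rule sum.cong[OF refl])
    fix \<nu> assume "\<nu> \<in> Poly_Mapping.keys q"
    show "Poly_Mapping.lookup (Poly_Mapping.single (\<nu> - ?e) (of_nat (Poly_Mapping.lookup \<nu> v) * Poly_Mapping.lookup q \<nu>)) \<mu>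
      = (if \<nu> = \<mu> + ?e then of_nat (Poly_Mapping.lookup \<nu> v) * Poly_Mapping.lookup q \<nu> else 0)"
    proof (cases "Poly_Mapping.lookup \<nu> v = 0")
      case False
      have "\<nu> = \<nu> - ?e + ?e"
        by (rule poly_mapping_eqI) (use False in \<open>auto simp: lookup_add lookup_minus lookup_single when_def\<close>)
      then have "\<nu> - ?e = \<mu> \<longleftrightarrow> \<nu> = \<mu> + ?e" by (metis add_diff_cancel_right')
      then show ?thesis by (simp add: lookup_single when_def)
    qed auto
  qed
  also have "\<dots> = of_nat (Poly_Mapping.lookup (\<mu> + ?e) v) * Poly_Mapping.lookup q (\<mu> + ?e)"
    by (auto simp: in_keys_iff)
  finally show ?thesis by (simp add: lookup_add)
qed

lemma mfact_add_single: "mfact (Poly_Mapping.single v 1 + \<mu>) = of_nat (Suc (Poly_Mapping.lookup \<mu> v)) * mfact \<mu>"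
proof -
  let ?e = "Poly_Mapping.single v (1::nat)"
  have sup: "mfact \<nu> = (\<Prod>w\<in>insert v (Poly_Mapping.keys \<mu>). fact (Poly_Mapping.lookup \<nu> w))"
    if "Poly_Mapping.keys \<nu> \<subseteq> insert v (Poly_Mapping.keys \<mu>)" for \<nu>
    unfolding mfact_def by (rule prod.mono_neutral_left) (use that in \<open>auto simp: in_keys_iff\<close>)
  let ?K = "Poly_Mapping.keys \<mu> - {v}"
  have K: "insert v (Poly_Mapping.keys \<mu>) = insert v ?K" by auto
  have "mfact (?e + \<mu>) = (\<Prod>w\<in>insert v ?K. fact (Poly_Mapping.lookup (?e + \<mu>) w))"
    unfolding K[symmetric] by (rule sup) (use keys_add[of ?e \<mu>] in \<open>auto split: if_splits\<close>)
  also have "\<dots> = fact (Suc (Poly_Mapping.lookup \<mu> v)) * (\<Prod>w\<in>?K. fact (Poly_Mapping.lookup (?e + \<mu>) w))"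
    by (subst prod.insert) (auto simp: lookup_add)
  also have "(\<Prod>w\<in>?K. fact (Poly_Mapping.lookup (?e + \<mu>) w)) = (\<Prod>w\<in>?K. fact (Poly_Mapping.lookup \<mu> w) :: complex)"
    by (rule prod.cong) (auto simp: lookup_add lookup_single when_def)
  also have "fact (Suc (Poly_Mapping.lookup \<mu> v)) * \<dots> = of_nat (Suc (Poly_Mapping.lookup \<mu> v)) * (\<Prod>w\<in>insert v ?K. fact (Poly_Mapping.lookup \<mu> w))"
    by (subst prod.insert) (auto simp: fact_Suc)
  also have "(\<Prod>w\<in>insert v ?K. fact (Poly_Mapping.lookup \<mu> w)) = mfact \<mu>"
    unfolding K[symmetric] by (rule sup[symmetric]) auto
  finally show ?thesis .
qed

text \<open>On monomials this is (\<mu> + e_v)! = (\<mu>_v + 1) \<mu>! together with the coefficient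
  formula for the derivative.\<close>

lemma fischer_var_mult: "fischer (var v * p) q = fischer p (pderiv_var v q)"
proof (induction p rule: poly_mapping_additive_induct)
  case (single \<mu> c)
  show ?case
    by (simp add: var_def mult_single fischer_single lookup_pderiv_var mfact_add_single add.commute[of \<mu>] del: of_nat_Suc One_nat_def)
qed (simp_all add: fischer_add_left distrib_left)

section \<open>Harmonic polynomials\<close>

text \<open>Two applications of the adjunction between variables and derivatives, one for each
  factor in a summand of r^2_ij.\<close>

lemma fischer_r2_mult: "fischer (r2 n i j * p) q = fischer p (Laplacian n i j q)"
proof -
  have "r2 n i j * p = (\<Sum>s<n. var (n - 1 - s, j) * (var (s, i) * p))"
    unfolding r2_def sum_distrib_right by (simp add: mult_ac)
  then show ?thesis
    by (simp add: fischer_sum_left fischer_sum_right fischer_var_mult Laplacian_def)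
qed

lemma pderiv_var_diff: "pderiv_var v (p - q) = pderiv_var v p - pderiv_var v q"
  by (rule poly_mapping_eqI) (simp add: lookup_pderiv_var lookup_minus algebra_simps)

lemma Laplacian_diff: "Laplacian n i j (p - q) = Laplacian n i j p - Laplacian n i j q"
  by (simp add: Laplacian_def pderiv_var_diff sum_subtractf)

lemma pderiv_var_in_polys:
  assumes "p \<in> polys I"
  shows "pderiv_var v p \<in> polys I"
  unfolding polys_iff
proof
  fix \<mu> assume "\<mu> \<in> Poly_Mapping.keys (pderiv_var v p)"
  then have "\<mu> + Poly_Mapping.single v 1 \<in> Poly_Mapping.keys p" by (auto simp: in_keys_iff lookup_pderiv_var)
  then have "Poly_Mapping.keys (\<mu> + Poly_Mapping.single v 1) \<subseteq> I" using assms by (auto simp: polys_iff)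
  then show "Poly_Mapping.keys \<mu> \<subseteq> I" by (auto simp: in_keys_iff lookup_add subset_iff)
qed

lemma pderiv_var_eq_0:
  assumes "p \<in> polys I" "v \<notin> I"
  shows "pderiv_var v p = 0"
proof (rule poly_mapping_eqI)
  fix \<mu> :: "'a \<Rightarrow>\<^sub>0 nat"
  have "v \<in> Poly_Mapping.keys (\<mu> + Poly_Mapping.single v 1)" by (simp add: in_keys_iff lookup_add)
  then have "\<mu> + Poly_Mapping.single v 1 \<notin> Poly_Mapping.keys p" using assms by (auto simp: polys_iff)
  then show "Poly_Mapping.lookup (pderiv_var v p) \<mu> = Poly_Mapping.lookup 0 \<mu>"
    by (simp add: lookup_pderiv_var in_keys_iff)
qed

text \<open>The two derivatives in a summand concern the rows s and n - 1 - s, which cannot both be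
  among the top m rows.\<close>

lemma Laplacian_top:
  assumes "2 * m < n" "f \<in> polys (top_vars m)"
  shows "Laplacian n i j f = 0"
  unfolding Laplacian_def
proof (rule sum.neutral, rule ballI)
  fix s assume "s \<in> {..<n}"
  show "pderiv_var (s, i) (pderiv_var (n - 1 - s, j) f) = 0"
  proof (cases "s < m")
    case True
    then have "pderiv_var (n - 1 - s, j) f = 0" using assms(1) by (intro pderiv_var_eq_0[OF assms(2)]) auto
    then show ?thesis by (simp add: pderiv_var_def)
  next
    case False
    then show ?thesis by (intro pderiv_var_eq_0[OF pderiv_var_in_polys[OF assms(2)]]) auto
  qed
qed

text \<open>
  A harmonic polynomial which is congruent to a polynomial \<open>b\<close> in the top block modulo the ideal of
  the \<open>r\<^sup>2\<^sub>i\<^sub>j\<close> equals \<open>b\<close>: the difference is harmonic and in the ideal, hence orthogonal to itself.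
\<close>

lemma harmonic_invariants:
  assumes mn: "2 * m < n"
  shows "harmonics n m \<inter> U_invariants n m = polys (top_vars m) \<inter> U_invariants n m"
proof (intro equalityI subsetI IntI)
  fix f assume "f \<in> polys (top_vars m) \<inter> U_invariants n m"
  then show "f \<in> harmonics n m" "f \<in> U_invariants n m"
    using Laplacian_top[OF mn] by (auto simp: harmonics_def U_invariants_def)
next
  fix f assume f: "f \<in> harmonics n m \<inter> U_invariants n m"
  then show "f \<in> U_invariants n m" by simp
  have "f \<in> U_invariants n m" using f by simp
  from invariant_normal_form[OF mn this] obtain A a where A': "finite A"
    "\<forall>\<alpha>\<in>A. Poly_Mapping.keys \<alpha> \<subseteq> sym_vars m \<and> a \<alpha> \<in> polys (top_vars m)" "f = (\<Sum>\<alpha>\<in>A. a \<alpha> * r2_mon n \<alpha>)"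
    by (elim exE conjE) (rule that)
  then have A: "finite A" "\<And>\<alpha>. \<alpha> \<in> A \<Longrightarrow> Poly_Mapping.keys \<alpha> \<subseteq> sym_vars m"
    "\<And>\<alpha>. \<alpha> \<in> A \<Longrightarrow> a \<alpha> \<in> polys (top_vars m)" "f = (\<Sum>\<alpha>\<in>A. a \<alpha> * r2_mon n \<alpha>)" by auto
  \<comment> \<open>The term of exponent 0 in the normal form, so that f - b lies in the ideal of
    the r^2_ij; it is 0 if this exponent does not occur.\<close>
  define b where "b = (if 0 \<in> A then a 0 else 0)"
  have b: "b \<in> polys (top_vars m)" using A(3) by (auto simp: b_def)
  have fb: "f - b = (\<Sum>\<alpha>\<in>A - {0}. a \<alpha> * r2_mon n \<alpha>)"
    using A(1) by (cases "0 \<in> A") (auto simp: A(4) b_def sum.remove)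
  have harm: "Laplacian n i j (f - b) = 0" if "i \<le> j" "j < m" for i j
    using f that Laplacian_top[OF mn b] by (auto simp: Laplacian_diff harmonics_def)
  have "fischer (a \<alpha> * r2_mon n \<alpha>) (f - b) = 0" if \<alpha>: "\<alpha> \<in> A - {0}" for \<alpha>
  proof -
    have "Poly_Mapping.keys \<alpha> \<noteq> {}" using \<alpha> by auto
    then obtain i j where ij: "(i, j) \<in> Poly_Mapping.keys \<alpha>" by (metis ex_in_conv surj_pair)
    let ?e = "Poly_Mapping.single (i, j) (1::nat)"
    \<comment> \<open>A nonzero exponent allows one factor r^2_ij to be split off; its adjoint is a
      Laplacian, which annihilates f - b.\<close>
    have "\<alpha> = ?e + (\<alpha> - ?e)"
      by (rule poly_mapping_eqI) (use ij in \<open>auto simp: lookup_add lookup_minus lookup_single when_def in_keys_iff\<close>)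
    then have "r2_mon n \<alpha> = r2 n i j * r2_mon n (\<alpha> - ?e)" by (metis r2_mon_add r2_mon_single)
    then have "a \<alpha> * r2_mon n \<alpha> = r2 n i j * (a \<alpha> * r2_mon n (\<alpha> - ?e))" by (simp add: mult_ac)
    then show ?thesis using harm[of i j] A(2)[of \<alpha>] \<alpha> ij by (auto simp: fischer_r2_mult)
  qed
  then have "(\<Sum>\<alpha>\<in>A - {0}. fischer (a \<alpha> * r2_mon n \<alpha>) (f - b)) = 0" by (intro sum.neutral ballI)
  moreover have "fischer (f - b) (f - b) = (\<Sum>\<alpha>\<in>A - {0}. fischer (a \<alpha> * r2_mon n \<alpha>) (f - b))"
    using arg_cong[OF fb, of "\<lambda>x. fischer x (f - b)"] by (simp only: fischer_sum_left)
  ultimately have "fischer (f - b) (f - b) = 0" by simp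
  then have "f = b" using fischer_self_eq_0[of "f - b"] by simp
  with b show "f \<in> polys (top_vars m)" by simp
qed

section \<open>Algebras and their quotients\<close>

lemma class_ring_field: "field (class_ring :: complex ring)"
  by (rule class_field.field_axioms)

lemma poly_alg_simps [simp]:
  "carrier (poly_alg I) = polys I" "monoid.mult (poly_alg I) = (*)" "one (poly_alg I) = 1"
  "zero (poly_alg I) = 0" "add (poly_alg I) = (+)" "module.smult (poly_alg I) = (\<lambda>c p. const_poly c * p)"
  by (simp_all add: poly_alg_def polys_def)

lemma cring_poly_alg: "cring (poly_alg I)"
proof (rule cringI)
  show "abelian_group (poly_alg I)"
  proof (rule abelian_groupI)
    fix x assume "x \<in> carrier (poly_alg I)"
    then show "\<exists>y\<in>carrier (poly_alg I). y \<oplus>\<^bsub>poly_alg I\<^esub> x = \<zero>\<^bsub>poly_alg I\<^esub>"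
      by (intro bexI[of _ "- x"]) (auto intro: uminus_in_polys)
  qed (auto intro: add_in_polys simp: add_ac)
  show "Group.comm_monoid (poly_alg I)"
    by (rule comm_monoidI) (auto intro: mult_in_polys simp: mult_ac)
qed (auto simp: algebra_simps)

lemma algebra_poly_alg: "algebra class_ring (poly_alg I)"
proof (rule algebraI)
  show "cring (class_ring :: complex ring)" by (rule class_cring.cring_axioms)
qed (auto simp: cring_poly_alg const_poly_add const_poly_mult algebra_simps intro: mult_in_polys)

lemma vectorspace_algebra: "algebra class_ring A \<Longrightarrow> vectorspace class_ring (A :: (complex, 'a, 'm) module_scheme)"
  unfolding vectorspace_def using class_ring_field by (simp add: algebra_def)

lemma subspaceI:
  fixes A :: "(complex, 'a) module"
  assumes "vectorspace class_ring A" "S \<subseteq> carrier A" "\<zero>\<^bsub>A\<^esub> \<in> S"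
    "\<And>x y. x \<in> S \<Longrightarrow> y \<in> S \<Longrightarrow> x \<oplus>\<^bsub>A\<^esub> y \<in> S" "\<And>c x. x \<in> S \<Longrightarrow> c \<odot>\<^bsub>A\<^esub> x \<in> S"
  shows "VectorSpace.subspace class_ring S A"
  unfolding VectorSpace.subspace_def LinearCombinations.submodule_def
  using assms by (auto simp: vectorspace_def)

lemma subspaceD:
  fixes A :: "(complex, 'a) module"
  assumes "VectorSpace.subspace class_ring S A"
  shows "S \<subseteq> carrier A" "\<zero>\<^bsub>A\<^esub> \<in> S"
    "\<And>x y. x \<in> S \<Longrightarrow> y \<in> S \<Longrightarrow> x \<oplus>\<^bsub>A\<^esub> y \<in> S" "\<And>c x. x \<in> S \<Longrightarrow> c \<odot>\<^bsub>A\<^esub> x \<in> S"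
  using assms unfolding VectorSpace.subspace_def LinearCombinations.submodule_def by auto

lemma subalgI:
  fixes A :: "(complex, 'a) module"
  assumes A: "algebra class_ring A" and S: "S \<subseteq> carrier A" "\<one>\<^bsub>A\<^esub> \<in> S"
    "\<And>x y. x \<in> S \<Longrightarrow> y \<in> S \<Longrightarrow> x \<oplus>\<^bsub>A\<^esub> y \<in> S" "\<And>x y. x \<in> S \<Longrightarrow> y \<in> S \<Longrightarrow> x \<otimes>\<^bsub>A\<^esub> y \<in> S"
    "\<And>c x. x \<in> S \<Longrightarrow> c \<odot>\<^bsub>A\<^esub> x \<in> S"
  shows "subalg S A"
proof -
  interpret algebra class_ring A by fact
  have neg: "\<ominus>\<^bsub>A\<^esub> x = (-1) \<odot>\<^bsub>A\<^esub> x" if "x \<in> carrier A" for x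
  proof (rule minus_equality)
    have "(-1) \<odot>\<^bsub>A\<^esub> x \<oplus>\<^bsub>A\<^esub> x = (-1) \<odot>\<^bsub>A\<^esub> x \<oplus>\<^bsub>A\<^esub> 1 \<odot>\<^bsub>A\<^esub> x" using smult_one[OF that] by simp
    also have "\<dots> = (-1 + 1) \<odot>\<^bsub>A\<^esub> x" using smult_l_distr[of "-1" 1 x] that by simp
    also have "\<dots> = \<zero>\<^bsub>A\<^esub>" using smult_l_null[OF that] by simp
    finally show "(-1) \<odot>\<^bsub>A\<^esub> x \<oplus>\<^bsub>A\<^esub> x = \<zero>\<^bsub>A\<^esub>" .
  qed (use that smult_closed[of "-1" x] in auto)
  have "0 \<odot>\<^bsub>A\<^esub> \<one>\<^bsub>A\<^esub> = \<zero>\<^bsub>A\<^esub>" using smult_l_null[of "\<one>\<^bsub>A\<^esub>"] by simp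
  then have zero: "\<zero>\<^bsub>A\<^esub> \<in> S" using S(5)[OF S(2), of 0] by simp
  have "subring S A"
  proof (rule subringI)
    show "\<ominus>\<^bsub>A\<^esub> h \<in> S" if "h \<in> S" for h using that S(1) S(5)[OF that, of "-1"] neg by (auto simp: subset_iff)
  qed (use S in auto)
  moreover have "VectorSpace.subspace class_ring S A"
    by (rule subspaceI[OF vectorspace_algebra[OF A]]) (use S zero in auto)
  ultimately show ?thesis by (simp add: subalg_def)
qed

lemma subalg_algebra:
  fixes A :: "(complex, 'a) module"
  assumes A: "algebra class_ring A" and S: "subalg S A"
  shows "algebra class_ring (A\<lparr>carrier := S\<rparr>)"
proof -
  interpret algebra class_ring A by fact
  have "cring (A\<lparr>carrier := S\<rparr>)"
  proof -
    have "subring S A" using S by (simp add: subalg_def)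
    then show ?thesis using subcring_iff[OF subringE(1)] subcringI' by blast
  qed
  moreover have "VectorSpace.subspace class_ring S A" using S by (simp add: subalg_def)
  note sub = subspaceD[OF this]
  ultimately show ?thesis
    by (intro algebraI)
      (use sub smult_l_distr smult_r_distr smult_assoc1 smult_assoc2 smult_one class_cring.cring_axioms in \<open>auto simp: subset_iff\<close>)
qed

text \<open>The multiplication map leads from the tensor product to the invariants, whereas the
  decomposition is stated in the opposite direction.\<close>

lemma alg_iso_inverse:
  assumes "\<phi> \<in> alg_iso A B" "ring A" "\<And>c x. x \<in> carrier A \<Longrightarrow> c \<odot>\<^bsub>A\<^esub> x \<in> carrier A"
  shows "inv_into (carrier A) \<phi> \<in> alg_iso B A"
proof -
  have iso: "\<phi> \<in> ring_iso A B" and sm: "\<And>c x. x \<in> carrier A \<Longrightarrow> \<phi> (c \<odot>\<^bsub>A\<^esub> x) = c \<odot>\<^bsub>B\<^esub> \<phi> x"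
    using assms(1) by (auto simp: alg_iso_def)
  have bij: "bij_betw \<phi> (carrier A) (carrier B)" using iso by (simp add: ring_iso_def)
  have "inv_into (carrier A) \<phi> (c \<odot>\<^bsub>B\<^esub> y) = c \<odot>\<^bsub>A\<^esub> inv_into (carrier A) \<phi> y" if "y \<in> carrier B" for c y
  proof -
    have "y \<in> \<phi> ` carrier A" using bij_betw_imp_surj_on[OF bij] that by simp
    then obtain x where x: "y = \<phi> x" "x \<in> carrier A" by (rule imageE)
    have inj: "inj_on \<phi> (carrier A)" using bij by (rule bij_betw_imp_inj_on)
    show ?thesis
      unfolding x(1) inv_into_f_f[OF inj x(2)] sm[OF x(2), symmetric] by (rule inv_into_f_f[OF inj assms(3)[OF x(2)]])
  qed
  moreover have "inv_into (carrier A) \<phi> \<in> ring_iso B A" using ring_iso_set_sym[OF assms(2) iso] .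
  ultimately show ?thesis by (simp add: alg_iso_def)
qed

section \<open>Quotients by ideals\<close>

lemma quot_alg_simps:
  "carrier (quot_alg A I) = carrier (A Quot I)" "monoid.mult (quot_alg A I) = monoid.mult (A Quot I)"
  "one (quot_alg A I) = one (A Quot I)" "zero (quot_alg A I) = zero (A Quot I)" "add (quot_alg A I) = add (A Quot I)"
  "module.smult (quot_alg A I) = (\<lambda>c X. \<Union>x\<in>X. I +>\<^bsub>A\<^esub> (c \<odot>\<^bsub>A\<^esub> x))"
  by (simp_all add: quot_alg_def)

lemma cring_quot_alg:
  assumes "cring A" "ideal I A"
  shows "cring (quot_alg A I)"
proof -
  have q: "cring (A Quot I)" using ideal.quotient_is_cring[OF assms(2,1)] .
  interpret Q: cring "A Quot I" by fact
  show ?thesis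
  proof (rule cringI)
    show "abelian_group (quot_alg A I)"
    proof (rule abelian_groupI)
      fix x assume "x \<in> carrier (quot_alg A I)"
      then show "\<exists>y\<in>carrier (quot_alg A I). y \<oplus>\<^bsub>quot_alg A I\<^esub> x = \<zero>\<^bsub>quot_alg A I\<^esub>"
        by (auto simp: quot_alg_simps intro!: bexI[of _ "\<ominus>\<^bsub>A Quot I\<^esub> x"] Q.l_neg)
    qed (simp_all add: quot_alg_simps Q.a_ac)
    show "Group.comm_monoid (quot_alg A I)"
      by (rule comm_monoidI) (simp_all add: quot_alg_simps Q.m_ac)
  qed (auto simp: quot_alg_simps Q.l_distr)
qed

lemma coset_iff: "y \<in> I +>\<^bsub>A\<^esub> x \<longleftrightarrow> (\<exists>i\<in>I. y = i \<oplus>\<^bsub>A\<^esub> x)"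
  by (auto simp: a_r_coset_def r_coset_def)

text \<open>A homomorphism \<open>h\<close> with kernel \<open>I\<close> factors through the quotient, with the value \<open>h x\<close> on \<open>I + x\<close>.\<close>

lemma the_elem_image_const:
  assumes "\<And>y. y \<in> Y \<Longrightarrow> h y = v" "y\<^sub>0 \<in> Y"
  shows "the_elem (h ` Y) = v"
proof -
  have "h ` Y = {v}" using assms by auto
  then show ?thesis by simp
qed

lemma hom_on_coset:
  assumes "ideal I A" "x \<in> carrier A" "ring S" "h \<in> Ring.ring_hom A S" "\<And>i. i \<in> I \<Longrightarrow> h i = \<zero>\<^bsub>S\<^esub>"
    and y: "y \<in> I +>\<^bsub>A\<^esub> x"
  shows "y \<in> carrier A" "h y = h x"
proof -
  interpret I: ideal I A by fact
  interpret S: ring S by fact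
  have hx: "h x \<in> carrier S" using assms(2,4) by (rule ring_hom_closed[rotated])
  obtain i where i: "i \<in> I" "y = i \<oplus>\<^bsub>A\<^esub> x" using y by (auto simp: coset_iff)
  have ic: "i \<in> carrier A" using i(1) by (rule I.Icarr)
  show "y \<in> carrier A" unfolding i(2) using ic assms(2) by (rule I.add.m_closed)
  show "h y = h x" unfolding i(2) ring_hom_add[OF assms(4) ic assms(2)] assms(5)[OF i(1)] using hx by (rule S.l_zero)
qed

lemma the_elem_coset:
  assumes "ideal I A" "x \<in> carrier A" "ring S" "h \<in> Ring.ring_hom A S" "\<And>i. i \<in> I \<Longrightarrow> h i = \<zero>\<^bsub>S\<^esub>"
  shows "the_elem (h ` (I +>\<^bsub>A\<^esub> x)) = h x"
proof -
  interpret I: ideal I A by fact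
  have "h ` (I +>\<^bsub>A\<^esub> x) \<subseteq> {h x}" using hom_on_coset(2)[OF assms] by blast
  moreover have "h x \<in> h ` (I +>\<^bsub>A\<^esub> x)" using assms(2) by (intro imageI I.a_rcos_self)
  ultimately have "h ` (I +>\<^bsub>A\<^esub> x) = {h x}" by (intro equalityI) simp_all
  then show ?thesis by simp
qed

text \<open>The isomorphism theorem for rings, extended to scalars. The scalar multiple of a class
  is a union over its representatives, on which h is constant, so \<open>the_elem\<close> picks out
  the right value.\<close>

lemma quot_alg_iso:
  fixes A :: "(complex, 'a) module" and S :: "(complex, 'b) module"
  assumes A: "ring A" and S: "ring S" and h: "h \<in> Ring.ring_hom A S" and I: "ideal I A"
    and ker: "\<And>x. x \<in> carrier A \<Longrightarrow> h x = \<zero>\<^bsub>S\<^esub> \<longleftrightarrow> x \<in> I" and surj: "h ` carrier A = carrier S"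
    and Asm: "\<And>c x. x \<in> carrier A \<Longrightarrow> c \<odot>\<^bsub>A\<^esub> x \<in> carrier A"
    and hsm: "\<And>c x. x \<in> carrier A \<Longrightarrow> h (c \<odot>\<^bsub>A\<^esub> x) = c \<odot>\<^bsub>S\<^esub> h x"
  shows "(\<lambda>X. the_elem (h ` X)) \<in> alg_iso (quot_alg A I) S"
proof -
  interpret I: ideal I A by fact
  interpret h: ring_hom_ring A S h by (rule ring_hom_ringI2[OF A S h])
  have "a_kernel A S h = I"
  proof -
    have "I \<subseteq> carrier A" by (rule I.a_subset)
    then have "{x \<in> carrier A. h x = \<zero>\<^bsub>S\<^esub>} = I" using ker by blast
    then show ?thesis unfolding a_kernel_def' .
  qed
  with h.FactRing_iso_set[OF surj] have iso: "(\<lambda>X. the_elem (h ` X)) \<in> ring_iso (A Quot I) S" by simp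
  then have "(\<lambda>X. the_elem (h ` X)) \<in> ring_iso (quot_alg A I) S"
    unfolding ring_iso_def Ring.ring_hom_def by (simp add: quot_alg_simps)
  moreover have "the_elem (h ` (c \<odot>\<^bsub>quot_alg A I\<^esub> X)) = c \<odot>\<^bsub>S\<^esub> the_elem (h ` X)" if "X \<in> carrier (quot_alg A I)" for c X
  proof -
    have "X \<in> (\<Union>a\<in>carrier A. {I +>\<^bsub>A\<^esub> a})"
      using that by (simp add: quot_alg_simps FactRing_def A_RCOSETS_def')
    then obtain x where x: "x \<in> carrier A" "X \<in> {I +>\<^bsub>A\<^esub> x}" by (rule UN_E)
    from x(2) have "X = I +>\<^bsub>A\<^esub> x" by (rule singletonD)
    note x = x(1) this
    have k: "h i = \<zero>\<^bsub>S\<^esub>" if "i \<in> I" for i using ker[OF I.Icarr[OF that]] that by blast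
    have const: "h y = h z" if "y \<in> I +>\<^bsub>A\<^esub> z" "z \<in> carrier A" for y z
      by (rule hom_on_coset(2)[OF I that(2) S h k that(1)])
    have sub: "y \<in> carrier A" if "y \<in> X" for y
      by (rule hom_on_coset(1)[OF I x(1) S h k that[unfolded x(2)]])
    have "h y = c \<odot>\<^bsub>S\<^esub> h x" if y: "y \<in> (\<Union>x\<in>X. I +>\<^bsub>A\<^esub> (c \<odot>\<^bsub>A\<^esub> x))" for y
    proof -
      obtain z where z: "z \<in> X" "y \<in> I +>\<^bsub>A\<^esub> (c \<odot>\<^bsub>A\<^esub> z)" using y by blast
      have zc: "z \<in> carrier A" using z(1) by (rule sub)
      have "h y = h (c \<odot>\<^bsub>A\<^esub> z)" using z(2) Asm[OF zc] by (rule const)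
      also have "\<dots> = c \<odot>\<^bsub>S\<^esub> h z" by (rule hsm[OF zc])
      also have "h z = h x" using z(1) unfolding x(2) using x(1) by (rule const)
      finally show ?thesis .
    qed
    moreover have "c \<odot>\<^bsub>A\<^esub> x \<in> (\<Union>x\<in>X. I +>\<^bsub>A\<^esub> (c \<odot>\<^bsub>A\<^esub> x))"
    proof (rule UN_I)
      show "x \<in> X" unfolding x(2) using x(1) by (rule I.a_rcos_self)
      show "c \<odot>\<^bsub>A\<^esub> x \<in> I +>\<^bsub>A\<^esub> (c \<odot>\<^bsub>A\<^esub> x)" using Asm[OF x(1)] by (rule I.a_rcos_self)
    qed
    ultimately have "the_elem (h ` (\<Union>x\<in>X. I +>\<^bsub>A\<^esub> (c \<odot>\<^bsub>A\<^esub> x))) = c \<odot>\<^bsub>S\<^esub> h x"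
      by (rule the_elem_image_const)
    moreover have "the_elem (h ` X) = h x" unfolding x(2) by (rule the_elem_coset[OF I x(1) S h k])
    ultimately show ?thesis by (simp add: quot_alg_simps)
  qed
  ultimately show ?thesis by (simp add: alg_iso_def)
qed

section \<open>Tensor products\<close>

lemma finsupp_induct [consumes 1, case_names zero single add]:
  fixes f :: "'k \<Rightarrow>\<^sub>0 'b::comm_monoid_add"
  assumes "Poly_Mapping.keys f \<subseteq> K" "P 0" "\<And>k c. k \<in> K \<Longrightarrow> P (Poly_Mapping.single k c)"
    "\<And>p q. Poly_Mapping.keys p \<subseteq> K \<Longrightarrow> Poly_Mapping.keys q \<subseteq> K \<Longrightarrow> P p \<Longrightarrow> P q \<Longrightarrow> P (p + q)"
  shows "P f"
proof -
  have "P (\<Sum>\<mu>\<in>A. Poly_Mapping.single \<mu> (Poly_Mapping.lookup f \<mu>)) \<and>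
    Poly_Mapping.keys (\<Sum>\<mu>\<in>A. Poly_Mapping.single \<mu> (Poly_Mapping.lookup f \<mu>)) \<subseteq> K"
    if "finite A" "A \<subseteq> Poly_Mapping.keys f" for A
    using that
  proof (induction A)
    case (insert k A)
    have "Poly_Mapping.keys (Poly_Mapping.single k (Poly_Mapping.lookup f k)) \<subseteq> K" using insert assms(1) by auto
    moreover have "P (Poly_Mapping.single k (Poly_Mapping.lookup f k))" using insert assms(1,3) by auto
    ultimately show ?case using insert
      by (auto intro!: assms(4) dest!: keys_add[THEN subsetD])
  qed (simp add: assms(2))
  from this[of "Poly_Mapping.keys f"] show ?thesis
    using poly_mapping_sum_singles[of f] by simp
qed

definition pair_mult :: "(complex, 'a) module \<Rightarrow> (complex, 'b) module \<Rightarrow> 'a \<times> 'b \<Rightarrow> 'a \<times> 'b \<Rightarrow> 'a \<times> 'b" where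
  "pair_mult A B k l = (fst k \<otimes>\<^bsub>A\<^esub> fst l, snd k \<otimes>\<^bsub>B\<^esub> snd l)"

lemma free_pairs_simps:
  "carrier (free_pairs_alg A B) = {f. Poly_Mapping.keys f \<subseteq> carrier A \<times> carrier B}"
  "one (free_pairs_alg A B) = Poly_Mapping.single (\<one>\<^bsub>A\<^esub>, \<one>\<^bsub>B\<^esub>) 1" "zero (free_pairs_alg A B) = 0"
  "add (free_pairs_alg A B) = (+)" "module.smult (free_pairs_alg A B) = (\<lambda>c f. Poly_Mapping.map ((*) c) f)"
  "monoid.mult (free_pairs_alg A B) f g = (\<Sum>k\<in>Poly_Mapping.keys f. \<Sum>l\<in>Poly_Mapping.keys g.
    Poly_Mapping.single (pair_mult A B k l) (Poly_Mapping.lookup f k * Poly_Mapping.lookup g l))"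
  by (simp_all add: free_pairs_alg_def pair_mult_def case_prod_unfold)

lemma free_pairs_mult_superset:
  assumes "finite K" "finite L" "Poly_Mapping.keys f \<subseteq> K" "Poly_Mapping.keys g \<subseteq> L"
  shows "f \<otimes>\<^bsub>free_pairs_alg A B\<^esub> g =
    (\<Sum>k\<in>K. \<Sum>l\<in>L. Poly_Mapping.single (pair_mult A B k l) (Poly_Mapping.lookup f k * Poly_Mapping.lookup g l))"
proof -
  have "(\<Sum>l\<in>Poly_Mapping.keys g. Poly_Mapping.single (pair_mult A B k l) (Poly_Mapping.lookup f k * Poly_Mapping.lookup g l))
    = (\<Sum>l\<in>L. Poly_Mapping.single (pair_mult A B k l) (Poly_Mapping.lookup f k * Poly_Mapping.lookup g l))" for k
    by (rule sum.mono_neutral_left) (use assms in \<open>auto simp: in_keys_iff\<close>)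
  then show ?thesis unfolding free_pairs_simps
    by simp (rule sum.mono_neutral_left, use assms in \<open>auto simp: in_keys_iff\<close>)
qed

lemma free_pairs_add_mult:
  "(f + f') \<otimes>\<^bsub>free_pairs_alg A B\<^esub> g = f \<otimes>\<^bsub>free_pairs_alg A B\<^esub> g + f' \<otimes>\<^bsub>free_pairs_alg A B\<^esub> g"
proof -
  let ?K = "Poly_Mapping.keys f \<union> Poly_Mapping.keys f'" and ?L = "Poly_Mapping.keys g"
  have "Poly_Mapping.keys (f + f') \<subseteq> ?K" by (rule keys_add)
  then show ?thesis
    by (simp add: free_pairs_mult_superset[of ?K ?L] lookup_add distrib_right single_add sum.distrib)
qed

lemma free_pairs_mult_add:
  "g \<otimes>\<^bsub>free_pairs_alg A B\<^esub> (f + f') = g \<otimes>\<^bsub>free_pairs_alg A B\<^esub> f + g \<otimes>\<^bsub>free_pairs_alg A B\<^esub> f'"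
proof -
  let ?K = "Poly_Mapping.keys f \<union> Poly_Mapping.keys f'" and ?L = "Poly_Mapping.keys g"
  have "Poly_Mapping.keys (f + f') \<subseteq> ?K" by (rule keys_add)
  then show ?thesis
    by (simp add: free_pairs_mult_superset[of ?L ?K] lookup_add distrib_left single_add sum.distrib)
qed

lemma free_pairs_mult_single:
  "Poly_Mapping.single k c \<otimes>\<^bsub>free_pairs_alg A B\<^esub> Poly_Mapping.single l d = Poly_Mapping.single (pair_mult A B k l) (c * d)"
  using free_pairs_mult_superset[of "{k}" "{l}" "Poly_Mapping.single k c" "Poly_Mapping.single l d" A B] by simp

lemma free_pairs_mult_0: "0 \<otimes>\<^bsub>free_pairs_alg A B\<^esub> g = 0" "g \<otimes>\<^bsub>free_pairs_alg A B\<^esub> 0 = 0"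
  by (simp_all add: free_pairs_simps)

lemmas free_pairs_mult_simps = free_pairs_add_mult free_pairs_mult_add free_pairs_mult_single free_pairs_mult_0

text \<open>This is the monoid algebra of the product of the multiplicative monoids of A and B, so
  each axiom reduces to single pairs.\<close>

lemma cring_free_pairs:
  assumes "cring A" "cring B"
  shows "cring (free_pairs_alg A B)"
proof -
  interpret A: cring A by fact
  interpret B: cring B by fact
  let ?K = "carrier A \<times> carrier B" and ?F = "free_pairs_alg A B"
  have pm: "pair_mult A B k l \<in> ?K" "pair_mult A B k l = pair_mult A B l k" if "k \<in> ?K" "l \<in> ?K" for k l
    using that by (auto simp: pair_mult_def A.m_comm B.m_comm)
  have pa: "pair_mult A B (pair_mult A B k l) r = pair_mult A B k (pair_mult A B l r)"
    if "k \<in> ?K" "l \<in> ?K" "r \<in> ?K" for k l r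
    using that by (auto simp: pair_mult_def A.m_assoc B.m_assoc)
  have p1: "pair_mult A B (\<one>\<^bsub>A\<^esub>, \<one>\<^bsub>B\<^esub>) k = k" if "k \<in> ?K" for k using that by (auto simp: pair_mult_def)
  have closed_add: "Poly_Mapping.keys (f + g) \<subseteq> ?K" if "Poly_Mapping.keys f \<subseteq> ?K" "Poly_Mapping.keys g \<subseteq> ?K" for f g :: "('a \<times> 'b) \<Rightarrow>\<^sub>0 complex"
    using keys_add[of f g] that by blast
  have closed: "Poly_Mapping.keys (f \<otimes>\<^bsub>?F\<^esub> g) \<subseteq> ?K" if f: "Poly_Mapping.keys f \<subseteq> ?K" and g: "Poly_Mapping.keys g \<subseteq> ?K" for f g
    using f
  proof (induction f rule: finsupp_induct)
    case (single k c)
    show ?case using g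
    proof (induction g rule: finsupp_induct)
      case (single l d)
      then show ?case using pm(1)[OF \<open>k \<in> ?K\<close> single] by (simp add: free_pairs_mult_simps)
    qed (simp_all add: free_pairs_mult_simps closed_add)
  qed (simp_all add: free_pairs_mult_simps closed_add)
  have comm: "f \<otimes>\<^bsub>?F\<^esub> g = g \<otimes>\<^bsub>?F\<^esub> f" if f: "Poly_Mapping.keys f \<subseteq> ?K" and g: "Poly_Mapping.keys g \<subseteq> ?K" for f g
    using f
  proof (induction f rule: finsupp_induct)
    case (single k c)
    show ?case using g
    proof (induction g rule: finsupp_induct)
      case (single l d)
      then show ?case using pm(2)[OF \<open>k \<in> ?K\<close> single] by (simp add: free_pairs_mult_simps mult.commute)
    qed (simp_all add: free_pairs_mult_simps)
  qed (simp_all add: free_pairs_mult_simps)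
  have assoc: "(f \<otimes>\<^bsub>?F\<^esub> g) \<otimes>\<^bsub>?F\<^esub> h = f \<otimes>\<^bsub>?F\<^esub> (g \<otimes>\<^bsub>?F\<^esub> h)"
    if f: "Poly_Mapping.keys f \<subseteq> ?K" and g: "Poly_Mapping.keys g \<subseteq> ?K" and h: "Poly_Mapping.keys h \<subseteq> ?K" for f g h
    using f
  proof (induction f rule: finsupp_induct)
    case (single k c)
    note k = single
    show ?case using g
    proof (induction g rule: finsupp_induct)
      case (single l d)
      note l = single
      show ?case using h
      proof (induction h rule: finsupp_induct)
        case (single r e)
        then show ?case using pa[OF k l single] by (simp add: free_pairs_mult_simps mult.assoc)
      qed (simp_all add: free_pairs_mult_simps)
    qed (simp_all add: free_pairs_mult_simps)
  qed (simp_all add: free_pairs_mult_simps)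
  have one: "Poly_Mapping.single (\<one>\<^bsub>A\<^esub>, \<one>\<^bsub>B\<^esub>) 1 \<otimes>\<^bsub>?F\<^esub> f = f" if "Poly_Mapping.keys f \<subseteq> ?K" for f
    using that by (induction f rule: finsupp_induct) (simp_all add: free_pairs_mult_simps p1)
  show ?thesis
  proof (rule cringI)
    show "abelian_group ?F"
    proof (rule abelian_groupI)
      fix x assume "x \<in> carrier ?F"
      then show "\<exists>y\<in>carrier ?F. y \<oplus>\<^bsub>?F\<^esub> x = \<zero>\<^bsub>?F\<^esub>"
        by (intro bexI[of _ "- x"]) (auto simp: free_pairs_simps in_keys_iff)
    qed (auto simp: free_pairs_simps(1-5) add_ac closed_add)
    show "Group.comm_monoid ?F"
      by (rule comm_monoidI) (use closed comm assoc one in \<open>auto simp: free_pairs_simps(1-5)\<close>)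
  qed (auto simp: free_pairs_simps(1-5) free_pairs_add_mult)
qed

text \<open>When a scalar acts as multiplication by a ring element e, independence of the
  representative follows from the ideal property.\<close>

lemma quot_alg_smult:
  assumes A: "cring A" and I: "ideal I A" and e: "e \<in> carrier A" and x: "x \<in> carrier A"
    and sm: "\<And>x. x \<in> carrier A \<Longrightarrow> c \<odot>\<^bsub>A\<^esub> x = e \<otimes>\<^bsub>A\<^esub> x"
  shows "c \<odot>\<^bsub>quot_alg A I\<^esub> (I +>\<^bsub>A\<^esub> x) = I +>\<^bsub>A\<^esub> (e \<otimes>\<^bsub>A\<^esub> x)"
proof -
  interpret A: cring A by fact
  interpret I: ideal I A by fact
  have ex: "e \<otimes>\<^bsub>A\<^esub> x \<in> carrier A" using e x by (rule A.m_closed)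
  have "I +>\<^bsub>A\<^esub> (c \<odot>\<^bsub>A\<^esub> y) = I +>\<^bsub>A\<^esub> (e \<otimes>\<^bsub>A\<^esub> x)" if y: "y \<in> I +>\<^bsub>A\<^esub> x" for y
  proof -
    obtain i where i: "i \<in> I" "y = i \<oplus>\<^bsub>A\<^esub> x" using y by (auto simp: coset_iff)
    have ic: "i \<in> carrier A" using i(1) by (rule I.Icarr)
    have yc: "y \<in> carrier A" unfolding i(2) using ic x by (rule A.a_closed)
    have "e \<otimes>\<^bsub>A\<^esub> y = e \<otimes>\<^bsub>A\<^esub> i \<oplus>\<^bsub>A\<^esub> e \<otimes>\<^bsub>A\<^esub> x" unfolding i(2) by (rule A.r_distr[OF ic x e])
    then have "e \<otimes>\<^bsub>A\<^esub> y \<in> I +>\<^bsub>A\<^esub> (e \<otimes>\<^bsub>A\<^esub> x)" using I.I_l_closed[OF i(1) e] by (auto simp: coset_iff)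
    from I.a_repr_independence'[OF this ex] show ?thesis unfolding sm[OF yc] by (rule sym)
  qed
  moreover have "x \<in> I +>\<^bsub>A\<^esub> x" using x by (rule I.a_rcos_self)
  ultimately show ?thesis unfolding quot_alg_simps by auto
qed

lemma quot_alg_carrierE:
  assumes "X \<in> carrier (quot_alg A I)"
  obtains x where "x \<in> carrier A" "X = I +>\<^bsub>A\<^esub> x"
proof -
  have "X \<in> (\<Union>a\<in>carrier A. {I +>\<^bsub>A\<^esub> a})"
    using assms by (simp add: quot_alg_simps FactRing_def A_RCOSETS_def')
  then obtain x where x: "x \<in> carrier A" "X \<in> {I +>\<^bsub>A\<^esub> x}" by (rule UN_E)
  from x(2) have "X = I +>\<^bsub>A\<^esub> x" by (rule singletonD)
  with x(1) show ?thesis by (rule that)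
qed

lemma quot_alg_carrierI: "x \<in> carrier A \<Longrightarrow> I +>\<^bsub>A\<^esub> x \<in> carrier (quot_alg A I)"
  by (auto simp: quot_alg_simps FactRing_def A_RCOSETS_def')

lemma quot_alg_smult_closed:
  assumes A: "cring A" and I: "ideal I A" and e: "e \<in> carrier A"
    and sm: "\<And>x. x \<in> carrier A \<Longrightarrow> c \<odot>\<^bsub>A\<^esub> x = e \<otimes>\<^bsub>A\<^esub> x" and X: "X \<in> carrier (quot_alg A I)"
  shows "c \<odot>\<^bsub>quot_alg A I\<^esub> X \<in> carrier (quot_alg A I)"
proof -
  interpret A: cring A by fact
  from X obtain x where x: "x \<in> carrier A" "X = I +>\<^bsub>A\<^esub> x" by (rule quot_alg_carrierE)
  have "c \<odot>\<^bsub>quot_alg A I\<^esub> X = I +>\<^bsub>A\<^esub> (e \<otimes>\<^bsub>A\<^esub> x)"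
    unfolding x(2) by (rule quot_alg_smult[OF A I e x(1)]) (rule sm)
  then show ?thesis using quot_alg_carrierI[OF A.m_closed[OF e x(1)]] by simp
qed

lemma quot_alg_ops:
  assumes "ideal I A" "x \<in> carrier A" "y \<in> carrier A"
  shows "(I +>\<^bsub>A\<^esub> x) \<oplus>\<^bsub>quot_alg A I\<^esub> (I +>\<^bsub>A\<^esub> y) = I +>\<^bsub>A\<^esub> (x \<oplus>\<^bsub>A\<^esub> y)"
    "(I +>\<^bsub>A\<^esub> x) \<otimes>\<^bsub>quot_alg A I\<^esub> (I +>\<^bsub>A\<^esub> y) = I +>\<^bsub>A\<^esub> (x \<otimes>\<^bsub>A\<^esub> y)"
  using ideal.a_rcos_sum[OF assms] ideal.rcoset_mult_add[OF assms]
  by (simp_all add: quot_alg_simps FactRing_def)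

lemma lookup_map_scale:
  "Poly_Mapping.lookup (Poly_Mapping.map ((*) c) f) k = (c :: complex) * Poly_Mapping.lookup f k"
  by (simp add: Poly_Mapping.map.rep_eq when_def)

text \<open>Provides the ring element through which scalars act: c times the unit pair.\<close>

lemma free_pairs_smult:
  assumes "cring A" "cring B" "f \<in> carrier (free_pairs_alg A B)"
  shows "c \<odot>\<^bsub>free_pairs_alg A B\<^esub> f = Poly_Mapping.single (\<one>\<^bsub>A\<^esub>, \<one>\<^bsub>B\<^esub>) c \<otimes>\<^bsub>free_pairs_alg A B\<^esub> f"
proof -
  interpret A: cring A by fact
  interpret B: cring B by fact
  have "Poly_Mapping.keys f \<subseteq> carrier A \<times> carrier B" using assms(3) by (simp add: free_pairs_simps)
  then have "Poly_Mapping.map ((*) c) f = Poly_Mapping.single (\<one>\<^bsub>A\<^esub>, \<one>\<^bsub>B\<^esub>) c \<otimes>\<^bsub>free_pairs_alg A B\<^esub> f"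
  proof (induction f rule: finsupp_induct)
    case zero
    show ?case unfolding free_pairs_mult_0 by (rule poly_mapping_eqI) (simp add: lookup_map_scale)
  next
    case (single k d)
    then show ?case unfolding free_pairs_mult_single by (auto simp: pair_mult_def)
  next
    case (add p q)
    have "Poly_Mapping.map ((*) c) (p + q) = Poly_Mapping.map ((*) c) p + Poly_Mapping.map ((*) c) q"
      by (rule poly_mapping_eqI) (simp add: lookup_map_scale lookup_add distrib_left)
    then show ?case using add.IH by (simp add: free_pairs_mult_add)
  qed
  then show ?thesis by (simp add: free_pairs_simps(5))
qed

text \<open>The multiplication map, a tensor b to a \<gamma>(b), extended linearly to the free space
  before the relations are imposed.\<close>

definition tensor_ev :: "('b \<Rightarrow> 'v cpoly) \<Rightarrow> (('v cpoly \<times> 'b) \<Rightarrow>\<^sub>0 complex) \<Rightarrow> 'v cpoly" where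
  "tensor_ev \<gamma> f = (\<Sum>k\<in>Poly_Mapping.keys f. const_poly (Poly_Mapping.lookup f k) * (fst k * \<gamma> (snd k)))"

lemma tensor_ev_superset:
  assumes "finite K" "Poly_Mapping.keys f \<subseteq> K"
  shows "tensor_ev \<gamma> f = (\<Sum>k\<in>K. const_poly (Poly_Mapping.lookup f k) * (fst k * \<gamma> (snd k)))"
  unfolding tensor_ev_def by (rule sum.mono_neutral_left) (use assms in \<open>auto simp: in_keys_iff\<close>)

lemma tensor_ev_0: "tensor_ev \<gamma> 0 = 0"
  by (simp add: tensor_ev_def)

lemma tensor_ev_add: "tensor_ev \<gamma> (f + g) = tensor_ev \<gamma> f + tensor_ev \<gamma> g"
proof -
  let ?K = "Poly_Mapping.keys f \<union> Poly_Mapping.keys g"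
  have "Poly_Mapping.keys (f + g) \<subseteq> ?K" by (rule keys_add)
  then show ?thesis
    by (simp add: tensor_ev_superset[of ?K] lookup_add const_poly_add distrib_right sum.distrib)
qed

lemma tensor_ev_single: "tensor_ev \<gamma> (Poly_Mapping.single (a, b) c) = const_poly c * (a * \<gamma> b)"
  using tensor_ev_superset[of "{(a, b)}" "Poly_Mapping.single (a, b) c" \<gamma>] by simp

lemma tensor_ev_diff: "tensor_ev \<gamma> (f - g) = tensor_ev \<gamma> f - tensor_ev \<gamma> g"
  using tensor_ev_add[of \<gamma> "f - g" g] by simp

lemma tensor_ev_sum: "tensor_ev \<gamma> (sum f A) = (\<Sum>a\<in>A. tensor_ev \<gamma> (f a))"
  by (induction A rule: infinite_finite_induct) (auto simp: tensor_ev_0 tensor_ev_add)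

lemma subalg_polysD:
  assumes "subalg S (poly_alg I)"
  shows "S \<subseteq> polys I" "0 \<in> S" "1 \<in> S" "\<And>x y. x \<in> S \<Longrightarrow> y \<in> S \<Longrightarrow> x + y \<in> S"
    "\<And>x y. x \<in> S \<Longrightarrow> y \<in> S \<Longrightarrow> x * y \<in> S" "\<And>c x. x \<in> S \<Longrightarrow> const_poly c * x \<in> S"
proof -
  have r: "subring S (poly_alg I)" and s: "VectorSpace.subspace class_ring S (poly_alg I)"
    using assms by (auto simp: subalg_def)
  show "S \<subseteq> polys I" "0 \<in> S" "\<And>x y. x \<in> S \<Longrightarrow> y \<in> S \<Longrightarrow> x + y \<in> S" "\<And>c x. x \<in> S \<Longrightarrow> const_poly c * x \<in> S"
    using subspaceD[OF s] by simp_all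
  show "1 \<in> S" "\<And>x y. x \<in> S \<Longrightarrow> y \<in> S \<Longrightarrow> x * y \<in> S"
    using subringE(3,6)[OF r] by simp_all
qed

text \<open>
  If the \<open>b\<^sub>\<alpha>\<close> span \<open>B\<close>, every element of the tensor product is a sum of elements \<open>a\<^sub>\<alpha> \<otimes> b\<^sub>\<alpha>\<close>, so that
  independence of the images of the \<open>b\<^sub>\<alpha>\<close> over \<open>T\<close> makes the multiplication map injective.
\<close>

lemma tensor_alg_iso:
  fixes B :: "(complex, 'b) module" and S T :: "'v cpoly set" and \<gamma> :: "'b \<Rightarrow> 'v cpoly" and b :: "'k \<Rightarrow> 'b" and I :: "'v set"
  defines "A \<equiv> (poly_alg I)\<lparr>carrier := T\<rparr>" and "C \<equiv> (poly_alg I)\<lparr>carrier := S\<rparr>"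
  assumes S: "subalg S (poly_alg I)" and T: "subalg T (poly_alg I)" and TS: "T \<subseteq> S"
    and B: "cring B" and Bsm: "\<And>c x. x \<in> carrier B \<Longrightarrow> c \<odot>\<^bsub>B\<^esub> x \<in> carrier B"
    and \<gamma>_in: "\<And>x. x \<in> carrier B \<Longrightarrow> \<gamma> x \<in> S" and \<gamma>_one: "\<gamma> \<one>\<^bsub>B\<^esub> = 1"
    and \<gamma>_add: "\<And>x y. x \<in> carrier B \<Longrightarrow> y \<in> carrier B \<Longrightarrow> \<gamma> (x \<oplus>\<^bsub>B\<^esub> y) = \<gamma> x + \<gamma> y"
    and \<gamma>_mult: "\<And>x y. x \<in> carrier B \<Longrightarrow> y \<in> carrier B \<Longrightarrow> \<gamma> (x \<otimes>\<^bsub>B\<^esub> y) = \<gamma> x * \<gamma> y"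
    and \<gamma>_smult: "\<And>c x. x \<in> carrier B \<Longrightarrow> \<gamma> (c \<odot>\<^bsub>B\<^esub> x) = const_poly c * \<gamma> x"
    and b: "\<And>\<alpha>. \<alpha> \<in> \<Lambda> \<Longrightarrow> b \<alpha> \<in> carrier B"
    and span: "\<And>X. X \<subseteq> carrier B \<Longrightarrow> (\<And>\<alpha>. \<alpha> \<in> \<Lambda> \<Longrightarrow> b \<alpha> \<in> X) \<Longrightarrow> (\<And>x y. x \<in> X \<Longrightarrow> y \<in> X \<Longrightarrow> x \<oplus>\<^bsub>B\<^esub> y \<in> X) \<Longrightarrow>
      (\<And>c x. x \<in> X \<Longrightarrow> c \<odot>\<^bsub>B\<^esub> x \<in> X) \<Longrightarrow> carrier B \<subseteq> X"
    and gen: "\<And>f. f \<in> S \<Longrightarrow> \<exists>L a. finite L \<and> L \<subseteq> \<Lambda> \<and> (\<forall>\<alpha>\<in>L. a \<alpha> \<in> T) \<and> f = (\<Sum>\<alpha>\<in>L. a \<alpha> * \<gamma> (b \<alpha>))"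
    and indep: "\<And>L a \<alpha>. finite L \<Longrightarrow> L \<subseteq> \<Lambda> \<Longrightarrow> (\<And>\<alpha>. \<alpha> \<in> L \<Longrightarrow> a \<alpha> \<in> T) \<Longrightarrow> (\<Sum>\<alpha>\<in>L. a \<alpha> * \<gamma> (b \<alpha>)) = 0 \<Longrightarrow> \<alpha> \<in> L \<Longrightarrow> a \<alpha> = 0"
  shows "alg_iso C (tensor_alg A B) \<noteq> {}"
proof -
  let ?F = "free_pairs_alg A B" and ?rel = "bilinear_relations A B"
  define J where "J = Idl\<^bsub>?F\<^esub> ?rel"
  let ?s = "\<lambda>a y c. Poly_Mapping.single (a, y) (c::complex)"
  note SD = subalg_polysD[OF S] and TD = subalg_polysD[OF T]
  have crA: "cring A" and crC: "cring C"
    using algebra.axioms(2)[OF subalg_algebra[OF algebra_poly_alg T]] algebra.axioms(2)[OF subalg_algebra[OF algebra_poly_alg S]]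
    unfolding A_def C_def by simp_all
  have A_simps: "carrier A = T" "add A = (+)" "monoid.mult A = (*)" "one A = 1" "zero A = 0" "module.smult A = (\<lambda>c p. const_poly c * p)"
    and C_simps: "carrier C = S" "add C = (+)" "monoid.mult C = (*)" "one C = 1" "zero C = 0" "module.smult C = (\<lambda>c p. const_poly c * p)"
    by (simp_all add: A_def C_def)
  interpret F: cring ?F by (rule cring_free_pairs[OF crA B])
  interpret B: cring B by fact
  have Fc: "f \<in> carrier ?F \<longleftrightarrow> Poly_Mapping.keys f \<subseteq> T \<times> carrier B" for f
    by (simp add: free_pairs_simps A_simps)
  have Fs: "?s a y c \<in> carrier ?F" if "a \<in> T" "y \<in> carrier B" for a y c
    using that by (simp add: Fc)
  have F_add: "f + g \<in> carrier ?F" if "f \<in> carrier ?F" "g \<in> carrier ?F" for f g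
    using F.add.m_closed[OF that] by (simp add: free_pairs_simps)
  have F_diff: "f - g \<in> carrier ?F" if "f \<in> carrier ?F" "g \<in> carrier ?F" for f g
  proof -
    have "Poly_Mapping.keys (f - g) \<subseteq> Poly_Mapping.keys f \<union> Poly_Mapping.keys g"
      by (auto simp: in_keys_iff lookup_minus)
    then show ?thesis using that unfolding Fc by blast
  qed
  have F_sum: "sum f L \<in> carrier ?F" if "\<And>x. x \<in> L \<Longrightarrow> f x \<in> carrier ?F" for f and L :: "'k set"
    using that
  proof (induction L rule: infinite_finite_induct)
    case (insert x L)
    then show ?case by (auto intro!: F_add)
  qed (simp_all add: Fc)
  have rel: "?rel \<subseteq> carrier ?F"
    unfolding bilinear_relations_def A_simps
    using TD(4,6) by (auto intro!: F_diff Fs Bsm simp: Fc)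
  have J: "ideal J ?F" unfolding J_def by (rule F.genideal_ideal[OF rel])
  interpret J: ideal J ?F by fact
  have relJ: "?rel \<subseteq> J" unfolding J_def by (rule F.genideal_self[OF rel])
  have J_add: "f + g \<in> J" if "f \<in> J" "g \<in> J" for f g
    using J.a_closed[OF that] by (simp add: free_pairs_simps)
  have J_0: "0 \<in> J" using J.zero_closed by (simp add: free_pairs_simps)
  have J_neg: "- f \<in> J" if "f \<in> J" for f
  proof -
    have fc: "f \<in> carrier ?F" using that by (rule J.Icarr)
    then have nc: "- f \<in> carrier ?F" using F_diff[of 0 f] by (simp add: Fc)
    have "\<ominus>\<^bsub>?F\<^esub> f = - f" by (rule F.minus_equality[OF _ fc nc]) (simp add: free_pairs_simps)
    then show ?thesis using J.a_inv_closed[OF that] by simp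
  qed
  have J_diff: "f - g \<in> J" if "f \<in> J" "g \<in> J" for f g
    using J_add[OF that(1) J_neg[OF that(2)]] by simp
  have J_sum: "sum f L \<in> J" if "\<And>x. x \<in> L \<Longrightarrow> f x \<in> J" for f and L :: "'k set"
    using that by (induction L rule: infinite_finite_induct) (auto intro: J_add J_0)
  have rel1: "?s (a + a') y 1 - ?s a y 1 - ?s a' y 1 \<in> J" if "a \<in> T" "a' \<in> T" "y \<in> carrier B" for a a' y
    using that by (intro subsetD[OF relJ]) (auto simp: bilinear_relations_def A_simps)
  have rel2: "?s a (y \<oplus>\<^bsub>B\<^esub> y') 1 - ?s a y 1 - ?s a y' 1 \<in> J" if "a \<in> T" "y \<in> carrier B" "y' \<in> carrier B" for a y y'
    using that by (intro subsetD[OF relJ]) (auto simp: bilinear_relations_def A_simps)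
  have rel3: "?s (const_poly c * a) y 1 - ?s a y c \<in> J" if "a \<in> T" "y \<in> carrier B" for a y c
    using that by (intro subsetD[OF relJ]) (auto simp: bilinear_relations_def A_simps)
  have rel4: "?s a (c \<odot>\<^bsub>B\<^esub> y) 1 - ?s a y c \<in> J" if "a \<in> T" "y \<in> carrier B" for a y c
    using that by (intro subsetD[OF relJ]) (auto simp: bilinear_relations_def A_simps)
  \<comment> \<open>From additivity in the first factor, applied to 0 + 0.\<close>
  have zeroJ: "?s 0 y 1 \<in> J" if "y \<in> carrier B" for y
    using J_neg[OF rel1[OF TD(2) TD(2) that]] by simp

  have ev_in: "tensor_ev \<gamma> f \<in> S" if "f \<in> carrier ?F" for f
    using that unfolding Fc
  proof (induction f rule: finsupp_induct)
    case (single k c)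
    then show ?case using TS \<gamma>_in SD by (cases k) (auto simp: tensor_ev_single)
  qed (auto simp: tensor_ev_0 tensor_ev_add SD)
  have ev_mult: "tensor_ev \<gamma> (f \<otimes>\<^bsub>?F\<^esub> g) = tensor_ev \<gamma> f * tensor_ev \<gamma> g" if f: "f \<in> carrier ?F" and g: "g \<in> carrier ?F" for f g
    using f unfolding Fc
  proof (induction f rule: finsupp_induct)
    case (single k c)
    show ?case using g unfolding Fc
    proof (induction g rule: finsupp_induct)
      case (single l d)
      obtain a y a' y' where kl: "k = (a, y)" "l = (a', y')" by (cases k, cases l)
      have "y \<in> carrier B" "y' \<in> carrier B" using \<open>k \<in> _\<close> single kl by auto
      then show ?case
        by (simp add: kl free_pairs_mult_simps pair_mult_def tensor_ev_single A_simps \<gamma>_mult const_poly_mult mult_ac)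
    qed (simp_all add: free_pairs_mult_simps tensor_ev_0 tensor_ev_add distrib_left)
  qed (simp_all add: free_pairs_mult_simps tensor_ev_0 tensor_ev_add distrib_right)
  have hom: "tensor_ev \<gamma> \<in> Ring.ring_hom ?F C"
    by (rule ring_hom_memI)
      (use ev_in ev_mult in \<open>auto simp: C_simps free_pairs_simps(2-4) tensor_ev_add tensor_ev_single A_simps \<gamma>_one\<close>)
  interpret h: ring_hom_ring ?F C "tensor_ev \<gamma>"
    by (rule ring_hom_ringI2[OF F.ring_axioms cring.axioms(1)[OF crC] hom])
  \<comment> \<open>The multiplication map respects the relations, so the ideal they generate lies
    in its kernel.\<close>
  have "J \<subseteq> a_kernel ?F C (tensor_ev \<gamma>)"
    unfolding J_def
  proof (rule F.genideal_minimal[OF h.kernel_is_ideal])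
    have "tensor_ev \<gamma> f = 0" if "f \<in> ?rel" for f
      using that unfolding bilinear_relations_def A_simps
      by (auto simp: tensor_ev_diff tensor_ev_single \<gamma>_add \<gamma>_smult distrib_left distrib_right mult_ac)
    then show "?rel \<subseteq> a_kernel ?F C (tensor_ev \<gamma>)"
      using rel unfolding a_kernel_def' C_simps by blast
  qed
  then have evJ: "tensor_ev \<gamma> f = 0" if "f \<in> J" for f
    using that unfolding a_kernel_def' C_simps by blast

  \<comment> \<open>\<open>N f\<close>: modulo the relations, f is a finite sum of elements
    a_\<alpha> tensor b_\<alpha> with one coefficient in T for each index.\<close>
  define N where "N f \<longleftrightarrow> (\<exists>L a. finite L \<and> L \<subseteq> \<Lambda> \<and> (\<forall>\<alpha>\<in>L. a \<alpha> \<in> T) \<and> f - (\<Sum>\<alpha>\<in>L. ?s (a \<alpha>) (b \<alpha>) 1) \<in> J)" for f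
  have N_cong: "N f" if "f - g \<in> J" "N g" for f g
  proof -
    obtain L a where L: "finite L" "L \<subseteq> \<Lambda>" "\<forall>\<alpha>\<in>L. a \<alpha> \<in> T" "g - (\<Sum>\<alpha>\<in>L. ?s (a \<alpha>) (b \<alpha>) 1) \<in> J"
      using \<open>N g\<close> unfolding N_def by (elim exE conjE) (rule that)
    have "f - (\<Sum>\<alpha>\<in>L. ?s (a \<alpha>) (b \<alpha>) 1) \<in> J" using J_add[OF \<open>f - g \<in> J\<close> L(4)] by simp
    with L show ?thesis unfolding N_def by (intro exI[of _ L] exI[of _ a]) simp
  qed
  have N_0: "N 0" unfolding N_def using J_0 by (intro exI[of _ "{}"]) simp
  have N_add: "N (f + g)" if "N f" "N g" for f g
  proof -
    obtain L a where L: "finite L" "L \<subseteq> \<Lambda>" "\<forall>\<alpha>\<in>L. a \<alpha> \<in> T" "f - (\<Sum>\<alpha>\<in>L. ?s (a \<alpha>) (b \<alpha>) 1) \<in> J"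
      using \<open>N f\<close> unfolding N_def by (elim exE conjE) (rule that)
    obtain M d where M: "finite M" "M \<subseteq> \<Lambda>" "\<forall>\<alpha>\<in>M. d \<alpha> \<in> T" "g - (\<Sum>\<alpha>\<in>M. ?s (d \<alpha>) (b \<alpha>) 1) \<in> J"
      using \<open>N g\<close> unfolding N_def by (elim exE conjE) (rule that)
    \<comment> \<open>Both sums are extended to the common index set by coefficients 0, which
      changes them only by terms 0 tensor b_\<alpha> in J.\<close>
    define a' where "a' \<alpha> = (if \<alpha> \<in> L then a \<alpha> else 0)" for \<alpha>
    define d' where "d' \<alpha> = (if \<alpha> \<in> M then d \<alpha> else 0)" for \<alpha>
    have T': "a' \<alpha> \<in> T" "d' \<alpha> \<in> T" for \<alpha> using L M TD(2) by (auto simp: a'_def d'_def)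
    have bB: "b \<alpha> \<in> carrier B" if "\<alpha> \<in> L \<union> M" for \<alpha> using that L M b by auto
    have ext: "(\<Sum>\<alpha>\<in>L \<union> M. ?s (e' \<alpha>) (b \<alpha>) 1) - (\<Sum>\<alpha>\<in>K. ?s (e \<alpha>) (b \<alpha>) 1) \<in> J"
      if "K \<subseteq> L \<union> M" "\<And>\<alpha>. e' \<alpha> = (if \<alpha> \<in> K then e \<alpha> else 0)" for K e' e
    proof -
      have fin: "finite (L \<union> M)" using L M by simp
      have "(\<Sum>\<alpha>\<in>L \<union> M. ?s (e' \<alpha>) (b \<alpha>) 1) = (\<Sum>\<alpha>\<in>L \<union> M - K. ?s (e' \<alpha>) (b \<alpha>) 1) + (\<Sum>\<alpha>\<in>K. ?s (e' \<alpha>) (b \<alpha>) 1)"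
        by (rule sum.subset_diff[OF that(1) fin])
      also have "(\<Sum>\<alpha>\<in>K. ?s (e' \<alpha>) (b \<alpha>) 1) = (\<Sum>\<alpha>\<in>K. ?s (e \<alpha>) (b \<alpha>) 1)"
        by (rule sum.cong) (auto simp: that(2))
      finally have "(\<Sum>\<alpha>\<in>L \<union> M. ?s (e' \<alpha>) (b \<alpha>) 1) - (\<Sum>\<alpha>\<in>K. ?s (e \<alpha>) (b \<alpha>) 1) = (\<Sum>\<alpha>\<in>L \<union> M - K. ?s (e' \<alpha>) (b \<alpha>) 1)"
        by simp
      also have "\<dots> \<in> J" by (rule J_sum) (use zeroJ bB that(2) in auto)
      finally show ?thesis .
    qed
    have 1: "(\<Sum>\<alpha>\<in>L \<union> M. ?s (a' \<alpha>) (b \<alpha>) 1) - (\<Sum>\<alpha>\<in>L. ?s (a \<alpha>) (b \<alpha>) 1) \<in> J" by (rule ext) (auto simp: a'_def)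
    have 2: "(\<Sum>\<alpha>\<in>L \<union> M. ?s (d' \<alpha>) (b \<alpha>) 1) - (\<Sum>\<alpha>\<in>M. ?s (d \<alpha>) (b \<alpha>) 1) \<in> J" by (rule ext) (auto simp: d'_def)
    have 3: "(\<Sum>\<alpha>\<in>L \<union> M. ?s (a' \<alpha> + d' \<alpha>) (b \<alpha>) 1 - ?s (a' \<alpha>) (b \<alpha>) 1 - ?s (d' \<alpha>) (b \<alpha>) 1) \<in> J"
      by (rule J_sum) (use rel1 T' bB in auto)
    have "f + g - (\<Sum>\<alpha>\<in>L \<union> M. ?s (a' \<alpha> + d' \<alpha>) (b \<alpha>) 1) \<in> J"
      using J_diff[OF J_diff[OF J_diff[OF J_add[OF L(4) M(4)] 1] 2] 3[unfolded sum_subtractf]] by (simp add: algebra_simps)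
    then show ?thesis unfolding N_def
      using L M T' TD(4) by (intro exI[of _ "L \<union> M"] exI[of _ "\<lambda>\<alpha>. a' \<alpha> + d' \<alpha>"]) auto
  qed
  have N_single1: "N (?s a y 1)" if "a \<in> T" "y \<in> carrier B" for a y
  proof -
    \<comment> \<open>The second factors y for which every a tensor y has a normal form. They
      include the b_\<alpha> and are closed under sums and scalars, hence they are all of B.\<close>
    let ?X = "{y \<in> carrier B. \<forall>a\<in>T. N (?s a y 1)}"
    have "carrier B \<subseteq> ?X"
    proof (rule span)
      show "b \<alpha> \<in> ?X" if "\<alpha> \<in> \<Lambda>" for \<alpha>
      proof -
        have "N (?s a (b \<alpha>) 1)" if "a \<in> T" for a unfolding N_def
          using that \<open>\<alpha> \<in> \<Lambda>\<close> J_0 by (intro exI[of _ "{\<alpha>}"] exI[of _ "\<lambda>_. a"]) simp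
        then show ?thesis using b[OF that] by simp
      qed
      show "x \<oplus>\<^bsub>B\<^esub> y \<in> ?X" if "x \<in> ?X" "y \<in> ?X" for x y
      proof -
        have xy: "x \<in> carrier B" "y \<in> carrier B" using that by auto
        have "N (?s a (x \<oplus>\<^bsub>B\<^esub> y) 1)" if "a \<in> T" for a
        proof (rule N_cong)
          show "?s a (x \<oplus>\<^bsub>B\<^esub> y) 1 - (?s a x 1 + ?s a y 1) \<in> J" using rel2[OF that xy] by (simp add: algebra_simps)
          show "N (?s a x 1 + ?s a y 1)" using \<open>x \<in> ?X\<close> \<open>y \<in> ?X\<close> that by (intro N_add) auto
        qed
        then show ?thesis using xy by simp
      qed
      show "c \<odot>\<^bsub>B\<^esub> x \<in> ?X" if "x \<in> ?X" for c x
      proof -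
        have x: "x \<in> carrier B" using that by auto
        have "N (?s a (c \<odot>\<^bsub>B\<^esub> x) 1)" if "a \<in> T" for a
        proof (rule N_cong)
          show "?s a (c \<odot>\<^bsub>B\<^esub> x) 1 - ?s (const_poly c * a) x 1 \<in> J"
            using J_diff[OF rel4[OF that x] rel3[OF that x], of c c] by simp
          show "N (?s (const_poly c * a) x 1)" using \<open>x \<in> ?X\<close> TD(6)[OF that] by auto
        qed
        then show ?thesis using x Bsm by simp
      qed
    qed auto
    then show ?thesis using that by auto
  qed
  have N_all: "N f" if "f \<in> carrier ?F" for f
    using that unfolding Fc
  proof (induction f rule: finsupp_induct)
    case (single k c)
    obtain a y where k: "k = (a, y)" "a \<in> T" "y \<in> carrier B" using single by auto
    show ?case unfolding k(1)
    proof (rule N_cong)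
      show "?s a y c - ?s (const_poly c * a) y 1 \<in> J" using J_neg[OF rel3[OF k(2,3), of c]] by simp
      show "N (?s (const_poly c * a) y 1)" by (rule N_single1[OF TD(6)[OF k(2)] k(3)])
    qed
  qed (simp_all add: N_0 N_add)
  \<comment> \<open>The multiplication map takes the normal form to a T-combination of the
    independent \<gamma>(b_\<alpha>). If this vanishes, all coefficients are 0 and the normal form
    itself lies in J.\<close>
  have kernel: "f \<in> J" if f: "f \<in> carrier ?F" and f0: "tensor_ev \<gamma> f = 0" for f
  proof -
    obtain L a where L: "finite L" "L \<subseteq> \<Lambda>" "\<forall>\<alpha>\<in>L. a \<alpha> \<in> T" "f - (\<Sum>\<alpha>\<in>L. ?s (a \<alpha>) (b \<alpha>) 1) \<in> J"
      using N_all[OF f] unfolding N_def by (elim exE conjE) (rule that)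
    have "0 = tensor_ev \<gamma> f - tensor_ev \<gamma> (f - (\<Sum>\<alpha>\<in>L. ?s (a \<alpha>) (b \<alpha>) 1))" using f0 evJ[OF L(4)] by simp
    also have "\<dots> = (\<Sum>\<alpha>\<in>L. a \<alpha> * \<gamma> (b \<alpha>))" by (simp add: tensor_ev_diff tensor_ev_sum tensor_ev_single)
    finally have "a \<alpha> = 0" if "\<alpha> \<in> L" for \<alpha> using indep[OF L(1,2) _ _ that, of a] L(3) by simp
    then have "(\<Sum>\<alpha>\<in>L. ?s (a \<alpha>) (b \<alpha>) 1) \<in> J" using L b zeroJ by (intro J_sum) auto
    from J_add[OF L(4) this] show ?thesis by simp
  qed
  have "(\<lambda>X. the_elem (tensor_ev \<gamma> ` X)) \<in> alg_iso (quot_alg ?F J) C"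
  proof (rule quot_alg_iso[OF F.ring_axioms cring.axioms(1)[OF crC] hom J])
    show "tensor_ev \<gamma> f = \<zero>\<^bsub>C\<^esub> \<longleftrightarrow> f \<in> J" if "f \<in> carrier ?F" for f
      using kernel[OF that] evJ[of f] by (auto simp: C_simps)
    show "tensor_ev \<gamma> ` carrier ?F = carrier C"
    proof (intro equalityI subsetI)
      fix f assume "f \<in> carrier C"
      then have "f \<in> S" by (simp add: C_simps)
      from gen[OF this] obtain L a where L: "finite L" "L \<subseteq> \<Lambda>" "\<forall>\<alpha>\<in>L. a \<alpha> \<in> T" "f = (\<Sum>\<alpha>\<in>L. a \<alpha> * \<gamma> (b \<alpha>))"
        by (elim exE conjE) (rule that)
      have "f = tensor_ev \<gamma> (\<Sum>\<alpha>\<in>L. ?s (a \<alpha>) (b \<alpha>) 1)" by (simp add: L(4) tensor_ev_sum tensor_ev_single)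
      moreover have "(\<Sum>\<alpha>\<in>L. ?s (a \<alpha>) (b \<alpha>) 1) \<in> carrier ?F" using L b by (intro F_sum Fs) auto
      ultimately show "f \<in> tensor_ev \<gamma> ` carrier ?F" by (rule image_eqI)
    qed (use ev_in in \<open>auto simp: C_simps\<close>)
    fix c f assume f: "f \<in> carrier ?F"
    show "c \<odot>\<^bsub>?F\<^esub> f \<in> carrier ?F" using f by (auto simp: free_pairs_simps in_keys_iff lookup_map_scale)
    have "tensor_ev \<gamma> (Poly_Mapping.map ((*) c) f) = (\<Sum>k\<in>Poly_Mapping.keys f. const_poly (Poly_Mapping.lookup (Poly_Mapping.map ((*) c) f) k) * (fst k * \<gamma> (snd k)))"
      by (rule tensor_ev_superset) (auto simp: in_keys_iff lookup_map_scale)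
    also have "\<dots> = const_poly c * tensor_ev \<gamma> f"
      unfolding tensor_ev_def sum_distrib_left
      by (rule sum.cong) (auto simp: lookup_map_scale const_poly_mult mult.assoc)
    finally show "tensor_ev \<gamma> (c \<odot>\<^bsub>?F\<^esub> f) = c \<odot>\<^bsub>C\<^esub> tensor_ev \<gamma> f"
      by (simp add: C_simps free_pairs_simps)
  qed
  then have "inv_into (carrier (quot_alg ?F J)) (\<lambda>X. the_elem (tensor_ev \<gamma> ` X)) \<in> alg_iso C (quot_alg ?F J)"
  proof (rule alg_iso_inverse)
    show "ring (quot_alg ?F J)" by (rule cring.axioms(1)[OF cring_quot_alg[OF F.is_cring J]])
    fix c X assume "X \<in> carrier (quot_alg ?F J)"
    then show "c \<odot>\<^bsub>quot_alg ?F J\<^esub> X \<in> carrier (quot_alg ?F J)"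
      by (rule quot_alg_smult_closed[OF F.is_cring J _ free_pairs_smult[OF crA B], rotated -1])
        (use TD(3) in \<open>simp_all add: Fc A_simps\<close>)
  qed
  then show ?thesis unfolding tensor_alg_def J_def by blast
qed

text \<open>The span is the least subspace containing the generators, and its elements with property
  \<open>Q\<close> form such a subspace.\<close>

lemma module_span_induct:
  fixes A :: "(complex, 'a) module"
  assumes A: "vectorspace class_ring A" and R: "R \<subseteq> carrier A"
    and x: "x \<in> LinearCombinations.module.span class_ring A R"
    and Q: "Q \<zero>\<^bsub>A\<^esub>" "\<And>r. r \<in> R \<Longrightarrow> Q r"
      "\<And>x y. x \<in> LinearCombinations.module.span class_ring A R \<Longrightarrow> y \<in> LinearCombinations.module.span class_ring A R \<Longrightarrow>
        Q x \<Longrightarrow> Q y \<Longrightarrow> Q (x \<oplus>\<^bsub>A\<^esub> y)"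
      "\<And>c x. x \<in> LinearCombinations.module.span class_ring A R \<Longrightarrow> Q x \<Longrightarrow> Q (c \<odot>\<^bsub>A\<^esub> x)"
  shows "Q x"
proof -
  interpret vectorspace class_ring A by fact
  have sp: "VectorSpace.subspace class_ring (span R) A"
    unfolding VectorSpace.subspace_def using A span_is_submodule[OF R] by simp
  note D = subspaceD[OF sp]
  have "VectorSpace.subspace class_ring {x \<in> span R. Q x} A"
    by (rule subspaceI[OF A]) (use D Q in auto)
  then have "span R \<subseteq> {x \<in> span R. Q x}"
    by (intro span_is_subset) (use in_own_span[OF R] Q(2) in \<open>auto simp: VectorSpace.subspace_def\<close>)
  then show ?thesis using x by blast
qed

lemma module_span_subspace:
  fixes A :: "(complex, 'a) module"
  assumes A: "vectorspace class_ring A" and R: "R \<subseteq> carrier A"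
  shows "VectorSpace.subspace class_ring (LinearCombinations.module.span class_ring A R) A"
    "R \<subseteq> LinearCombinations.module.span class_ring A R"
proof -
  interpret vectorspace class_ring A by fact
  show "VectorSpace.subspace class_ring (span R) A"
    unfolding VectorSpace.subspace_def using A span_is_submodule[OF R] by simp
  show "R \<subseteq> span R" by (rule in_own_span[OF R])
qed

section \<open>The tensor product decomposition\<close>

lemma U_invariants_polys: "f \<in> U_invariants n m \<Longrightarrow> f \<in> polys ({0..<n} \<times> {0..<m})"
  by (simp add: U_invariants_iff)

lemma subalg_U_invariants: "subalg (U_invariants n m) (P_mat n m)"
  by (rule subalgI[OF algebra_poly_alg])
    (auto simp: U_invariants_iff ev.poly_eval_simps intro: add_in_polys mult_in_polys)

lemma subalg_top_invariants:
  assumes "m \<le> n"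
  shows "subalg (polys (top_vars m) \<inter> U_invariants n m) (P_mat n m)"
proof -
  have "polys (top_vars m) \<subseteq> polys ({0..<n} \<times> {0..<m})" by (rule polys_mono) (use assms in auto)
  then show ?thesis
    by (intro subalgI[OF algebra_poly_alg])
      (auto simp: U_invariants_iff ev.poly_eval_simps intro: add_in_polys mult_in_polys)
qed

lemma r2_invariant:
  assumes "i < m" "j < m"
  shows "r2 n i j \<in> U_invariants n m"
proof -
  have "r2 n i j \<in> polys ({0..<n} \<times> {0..<m})"
    unfolding r2_def using assms by (intro sum_in_polys mult_in_polys var_in_polys) auto
  then show ?thesis by (simp add: U_invariants_iff ev_r2 quad_unip_orth)
qed

lemma sp20_vectorspace: "vectorspace class_ring (P_mat n m)"
  by (rule vectorspace_algebra[OF algebra_poly_alg])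

lemma sp20_gen: "{r2 n i j | i j. i \<le> j \<and> j < m} \<subseteq> carrier (P_mat n m)"
  using U_invariants_polys[OF r2_invariant] by force

lemma sp20_subspace: "VectorSpace.subspace class_ring (sp20 n m) (P_mat n m)"
  unfolding sp20_def by (rule module_span_subspace(1)[OF sp20_vectorspace sp20_gen])

lemma r2_in_sp20: "i \<le> j \<Longrightarrow> j < m \<Longrightarrow> r2 n i j \<in> sp20 n m"
  using module_span_subspace(2)[OF sp20_vectorspace sp20_gen, of n m] unfolding sp20_def by blast

lemma sp20_induct [consumes 1, case_names zero r2 add scale]:
  assumes "v \<in> sp20 n m" "Q 0" "\<And>i j. i \<le> j \<Longrightarrow> j < m \<Longrightarrow> Q (r2 n i j)"
    "\<And>v w. v \<in> sp20 n m \<Longrightarrow> w \<in> sp20 n m \<Longrightarrow> Q v \<Longrightarrow> Q w \<Longrightarrow> Q (v + w)"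
    "\<And>c v. v \<in> sp20 n m \<Longrightarrow> Q v \<Longrightarrow> Q (const_poly c * v)"
  shows "Q v"
  by (rule module_span_induct[OF sp20_vectorspace sp20_gen assms(1)[unfolded sp20_def]])
    (use assms(2-) in \<open>auto simp: sp20_def\<close>)

lemma sp20_invariant:
  assumes "v \<in> sp20 n m"
  shows "v \<in> U_invariants n m"
  using assms
proof (induction v rule: sp20_induct)
  case (r2 i j)
  then show ?case by (intro r2_invariant) auto
qed (use subalg_polysD[OF subalg_U_invariants[of n m]] in auto)

text \<open>The b_\<alpha> of the tensor criterion are the classes of monomials in the symbols of
  the generators r^2_ij. Existence of the normal form supplies generation, and its uniqueness
  supplies independence over the coefficient ring.\<close>

theorem PU_tensor_iso:
  assumes mn: "2 * m < n"
  shows "alg_iso (PU_alg n m) (tensor_alg (HU_alg n m) (sym_alg (sp20_space n m))) \<noteq> {}"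
proof -
  let ?S = "sp20 n m" and ?U = "U_invariants n m"
  let ?R = "poly_alg ?S" and ?rel = "linear_relations (sp20_space n m)"
  define J where "J = Idl\<^bsub>?R\<^esub> ?rel"
  let ?C = "P_mat n m\<lparr>carrier := ?U\<rparr>"
  \<comment> \<open>Replaces the symbol of each vector by the vector itself, which is here a
    polynomial; \<gamma> is the map induced on classes.\<close>
  let ?ev = "poly_eval const_poly (\<lambda>v. v) :: (nat \<times> nat) cpoly cpoly \<Rightarrow> (nat \<times> nat) cpoly"
  define mon where "mon \<alpha> = mon_eval (\<lambda>(i, j). var (r2 n i j)) \<alpha>" for \<alpha>
  define \<Lambda> :: "((nat \<times> nat) \<Rightarrow>\<^sub>0 nat) set" where "\<Lambda> = {\<alpha>. Poly_Mapping.keys \<alpha> \<subseteq> sym_vars m}"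
  define \<gamma> where "\<gamma> X = the_elem (?ev ` X)" for X
  define cl where "cl q = J +>\<^bsub>?R\<^esub> q" for q
  note UD = subalg_polysD[OF subalg_U_invariants[of n m]]
  note SD = subspaceD[OF sp20_subspace[of n m], simplified]
  interpret R: cring ?R by (rule cring_poly_alg)
  have V: "carrier (sp20_space n m) = ?S" "add (sp20_space n m) = (+)" "module.smult (sp20_space n m) = (\<lambda>c p. const_poly c * p)"
    by (simp_all add: sp20_space_def)
  have rel: "?rel \<subseteq> carrier ?R"
    unfolding linear_relations_def V using SD(3,4)
    by (auto intro!: diff_in_polys var_in_polys mult_in_polys)
  have J: "ideal J ?R" unfolding J_def by (rule R.genideal_ideal[OF rel])
  interpret J: ideal J ?R by fact
  have relJ: "?rel \<subseteq> J" unfolding J_def by (rule R.genideal_self[OF rel])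
  have Jl: "q * i \<in> J" if "i \<in> J" "q \<in> polys ?S" for i q using J.I_l_closed[of i q] that by simp
  have Jadd: "i + j \<in> J" if "i \<in> J" "j \<in> J" for i j using J.a_closed[of i j] that by simp
  have rel_add: "var (v + w) - var v - var w \<in> J" if "v \<in> ?S" "w \<in> ?S" for v w
    using that by (intro subsetD[OF relJ]) (auto simp: linear_relations_def V)
  have rel_scale: "var (const_poly c * v) - const_poly c * var v \<in> J" if "v \<in> ?S" for v c
    using that by (intro subsetD[OF relJ]) (auto simp: linear_relations_def V)
  have cl_eq: "cl p = cl q" if "p - q \<in> J" "q \<in> polys ?S" for p q
  proof -
    have "p \<in> J +>\<^bsub>?R\<^esub> q" using that(1) by (auto simp: coset_iff intro!: bexI[of _ "p - q"])
    then show ?thesis unfolding cl_def using J.a_repr_independence'[of p q] that(2) by simp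
  qed
  let ?B = "sym_alg (sp20_space n m)"
  have B_def: "?B = quot_alg ?R J" by (simp add: sym_alg_def V J_def)
  have crC: "cring ?C" by (rule algebra.axioms(2)[OF subalg_algebra[OF algebra_poly_alg subalg_U_invariants]])
  have ev_in: "?ev q \<in> ?U" if "q \<in> polys ?S" for q
    using that
  proof (induction q rule: polys_induct)
    case (const c)
    show ?case using UD(6)[OF UD(3), of c] by (simp add: subst.poly_eval_simps)
  qed (auto simp: subst.poly_eval_simps intro: UD sp20_invariant)
  have hom: "?ev \<in> Ring.ring_hom ?R ?C"
    by (rule ring_hom_memI) (auto simp: ev_in subst.poly_eval_simps)
  interpret h: ring_hom_ring ?R ?C ?ev
    by (rule ring_hom_ringI2[OF R.ring_axioms cring.axioms(1)[OF crC] hom])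
  have "J \<subseteq> a_kernel ?R ?C ?ev"
    unfolding J_def
  proof (rule R.genideal_minimal[OF h.kernel_is_ideal])
    have "?ev q = 0" if "q \<in> ?rel" for q
      using that unfolding linear_relations_def V by (auto simp: subst.poly_eval_simps)
    then show "?rel \<subseteq> a_kernel ?R ?C ?ev"
      using rel unfolding a_kernel_def' by auto
  qed
  then have evJ: "?ev q = \<zero>\<^bsub>?C\<^esub>" if "q \<in> J" for q
    using that unfolding a_kernel_def' by blast
  have \<gamma>_cl: "\<gamma> (cl q) = ?ev q" if "q \<in> polys ?S" for q
    unfolding \<gamma>_def cl_def by (rule the_elem_coset[OF J _ cring.axioms(1)[OF crC] hom evJ]) (use that in auto)
  have clE: "\<exists>q\<in>polys ?S. X = cl q" if "X \<in> carrier ?B" for X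
    using that unfolding B_def by (rule quot_alg_carrierE) (auto simp: cl_def)
  have clI: "cl q \<in> carrier ?B" if "q \<in> polys ?S" for q
    unfolding B_def cl_def by (rule quot_alg_carrierI) (use that in simp)
  have cl_add: "cl p \<oplus>\<^bsub>?B\<^esub> cl q = cl (p + q)" and cl_mult: "cl p \<otimes>\<^bsub>?B\<^esub> cl q = cl (p * q)"
    if "p \<in> polys ?S" "q \<in> polys ?S" for p q
    using quot_alg_ops[OF J, of p q] that by (simp_all add: B_def cl_def)
  have cl_smult: "c \<odot>\<^bsub>?B\<^esub> cl q = cl (const_poly c * q)" if "q \<in> polys ?S" for c q
    using quot_alg_smult[OF R.is_cring J, of "const_poly c" q c] that by (simp add: B_def cl_def)
  have cl_one: "\<one>\<^bsub>?B\<^esub> = cl 1" by (simp add: B_def cl_def quot_alg_simps FactRing_def)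
  have mon_in: "mon \<alpha> \<in> polys ?S" if "\<alpha> \<in> \<Lambda>" for \<alpha>
    unfolding mon_def using that by (intro mon_in_polys) (auto simp: \<Lambda>_def intro!: var_in_polys r2_in_sp20)
  have \<gamma>_mon: "\<gamma> (cl (mon \<alpha>)) = r2_mon n \<alpha>" if "\<alpha> \<in> \<Lambda>" for \<alpha>
  proof -
    have "?ev (mon \<alpha>) = r2_mon n \<alpha>"
      unfolding mon_def r2_mon_def subst.poly_eval_mon by (rule mon_eval_cong) (auto simp: subst.poly_eval_var)
    then show ?thesis using \<gamma>_cl[OF mon_in[OF that]] by simp
  qed
  have HU: "HU_alg n m = P_mat n m\<lparr>carrier := polys (top_vars m) \<inter> ?U\<rparr>"
    by (simp add: HU_alg_def harmonic_invariants[OF mn])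
  have mn': "2 * m \<le> n" "m \<le> n" using mn by auto
  show ?thesis unfolding PU_alg_def HU
  proof (rule tensor_alg_iso[where \<gamma> = \<gamma> and b = "\<lambda>\<alpha>. cl (mon \<alpha>)" and \<Lambda> = \<Lambda>])
    show "subalg ?U (P_mat n m)" by (rule subalg_U_invariants)
    show "subalg (polys (top_vars m) \<inter> ?U) (P_mat n m)" by (rule subalg_top_invariants[OF mn'(2)])
    show "cring ?B" unfolding B_def by (rule cring_quot_alg[OF R.is_cring J])
    show "c \<odot>\<^bsub>?B\<^esub> X \<in> carrier ?B" if "X \<in> carrier ?B" for c X
      using clE[OF that] by (auto simp: cl_smult intro!: clI mult_in_polys)
    show "\<gamma> X \<in> ?U" if "X \<in> carrier ?B" for X using clE[OF that] by (auto simp: \<gamma>_cl ev_in)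
    show "\<gamma> \<one>\<^bsub>?B\<^esub> = 1" by (simp add: cl_one \<gamma>_cl subst.poly_eval_simps)
    show "\<gamma> (X \<oplus>\<^bsub>?B\<^esub> Y) = \<gamma> X + \<gamma> Y" "\<gamma> (X \<otimes>\<^bsub>?B\<^esub> Y) = \<gamma> X * \<gamma> Y" if "X \<in> carrier ?B" "Y \<in> carrier ?B" for X Y
      using clE[OF that(1)] clE[OF that(2)]
      by (auto simp: cl_add cl_mult \<gamma>_cl add_in_polys mult_in_polys subst.poly_eval_simps)
    show "\<gamma> (c \<odot>\<^bsub>?B\<^esub> X) = const_poly c * \<gamma> X" if "X \<in> carrier ?B" for c X
      using clE[OF that] by (auto simp: cl_smult \<gamma>_cl mult_in_polys subst.poly_eval_simps)
    show "cl (mon \<alpha>) \<in> carrier ?B" if "\<alpha> \<in> \<Lambda>" for \<alpha> using that by (intro clI mon_in)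
    show "\<exists>L a. finite L \<and> L \<subseteq> \<Lambda> \<and> (\<forall>\<alpha>\<in>L. a \<alpha> \<in> polys (top_vars m) \<inter> ?U) \<and> f = (\<Sum>\<alpha>\<in>L. a \<alpha> * \<gamma> (cl (mon \<alpha>)))"
      if f: "f \<in> ?U" for f
    proof -
      from invariant_normal_form[OF mn f] obtain L a where L: "finite L"
        "\<forall>\<alpha>\<in>L. Poly_Mapping.keys \<alpha> \<subseteq> sym_vars m \<and> a \<alpha> \<in> polys (top_vars m)" "f = (\<Sum>\<alpha>\<in>L. a \<alpha> * r2_mon n \<alpha>)"
        by (elim exE conjE) (rule that)
      have LL: "L \<subseteq> \<Lambda>" using L(2) by (auto simp: \<Lambda>_def)
      have "a \<alpha> \<in> ?U" if "\<alpha> \<in> L" for \<alpha>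
        by (rule normal_form_invariant[OF mn'(1) L(1) _ _ _ that]) (use L f in auto)
      moreover have "f = (\<Sum>\<alpha>\<in>L. a \<alpha> * \<gamma> (cl (mon \<alpha>)))"
        unfolding L(3) by (rule sum.cong) (use LL \<gamma>_mon in auto)
      ultimately show ?thesis using L LL by (intro exI[of _ L] exI[of _ a]) auto
    qed
    show "a \<alpha> = 0" if "finite L" "L \<subseteq> \<Lambda>" "\<And>\<alpha>. \<alpha> \<in> L \<Longrightarrow> a \<alpha> \<in> polys (top_vars m) \<inter> ?U"
      "(\<Sum>\<alpha>\<in>L. a \<alpha> * \<gamma> (cl (mon \<alpha>))) = 0" "\<alpha> \<in> L" for L a \<alpha>
    proof (rule normal_form_unique[OF mn'(1) that(1) _ _ _ that(5)])
      show "Poly_Mapping.keys \<beta> \<subseteq> sym_vars m" if "\<beta> \<in> L" for \<beta> using that \<open>L \<subseteq> \<Lambda>\<close> by (auto simp: \<Lambda>_def)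
      show "a \<beta> \<in> polys (top_vars m)" if "\<beta> \<in> L" for \<beta> using \<open>\<And>\<alpha>. \<alpha> \<in> L \<Longrightarrow> a \<alpha> \<in> _\<close>[OF that] by simp
      have "(\<Sum>\<alpha>\<in>L. a \<alpha> * r2_mon n \<alpha>) = (\<Sum>\<alpha>\<in>L. a \<alpha> * \<gamma> (cl (mon \<alpha>)))"
        by (rule sum.cong) (use that(2) \<gamma>_mon in auto)
      then show "(\<Sum>\<alpha>\<in>L. a \<alpha> * r2_mon n \<alpha>) = 0" using that(4) by simp
    qed
    fix X assume X: "X \<subseteq> carrier ?B" "\<And>\<alpha>. \<alpha> \<in> \<Lambda> \<Longrightarrow> cl (mon \<alpha>) \<in> X"
      "\<And>x y. x \<in> X \<Longrightarrow> y \<in> X \<Longrightarrow> x \<oplus>\<^bsub>?B\<^esub> y \<in> X" "\<And>c x. x \<in> X \<Longrightarrow> c \<odot>\<^bsub>?B\<^esub> x \<in> X"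
    have X_add: "cl (p + q) \<in> X" if "cl p \<in> X" "cl q \<in> X" "p \<in> polys ?S" "q \<in> polys ?S" for p q
      using X(3)[OF that(1,2)] cl_add[OF that(3,4)] by simp
    have X_scale: "cl (const_poly c * q) \<in> X" if "cl q \<in> X" "q \<in> polys ?S" for c q
      using X(4)[OF that(1), of c] cl_smult[OF that(2)] by simp
    \<comment> \<open>Carrying an arbitrary monomial factor through the induction lets a new symbol
      be absorbed: the symbol of a generator raises the exponent, and the linear relations reduce a
      general vector to generators.\<close>
    have all: "\<forall>\<alpha>\<in>\<Lambda>. cl (q * mon \<alpha>) \<in> X" if "q \<in> polys ?S" for q
      using that
    proof (induction q rule: polys_induct)
      case (const c)
      then show ?case using X(2) mon_in X_scale by simp
    next
      case (add p q)
      then show ?case using X_add mult_in_polys[OF _ mon_in] by (simp add: distrib_right)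
    next
      case (var v p)
      have in_S: "p * mon \<alpha> \<in> polys ?S" if "\<alpha> \<in> \<Lambda>" for \<alpha> using var(2) mon_in[OF that] by (rule mult_in_polys)
      have "\<forall>\<alpha>\<in>\<Lambda>. cl (var v * (p * mon \<alpha>)) \<in> X"
        using var(1)
      proof (induction v rule: sp20_induct)
        case zero
        \<comment> \<open>The symbol of the zero vector is a nonzero polynomial; it is a relation by
          scaling with 0.\<close>
        have "var 0 \<in> J" using rel_scale[OF SD(2), of 0] by simp
        have "cl (var 0 * (p * mon \<alpha>)) = cl (const_poly 0 * (p * mon \<alpha>))" if "\<alpha> \<in> \<Lambda>" for \<alpha>
          by (rule cl_eq) (use Jl[OF \<open>var 0 \<in> J\<close> in_S[OF that]] in \<open>simp_all add: mult.commute\<close>)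
        then show ?case using var(3) X_scale[OF _ in_S, of _ 0] by (simp add: mult.assoc)
      next
        case (r2 i j)
        let ?e = "Poly_Mapping.single (i, j) (1::nat)"
        have "var (r2 n i j) * (p * mon \<alpha>) = p * mon (?e + \<alpha>)" for \<alpha>
          by (simp add: mon_def mon_eval_add mult_ac del: One_nat_def)
        moreover have "?e + \<alpha> \<in> \<Lambda>" if "\<alpha> \<in> \<Lambda>" for \<alpha>
          using that r2 keys_add[of ?e \<alpha>] by (auto simp: \<Lambda>_def split: if_splits)
        ultimately show ?case using var(3) by simp
      next
        case (add v w)
        have "cl (var (v + w) * (p * mon \<alpha>)) = cl (var v * (p * mon \<alpha>) + var w * (p * mon \<alpha>))" if "\<alpha> \<in> \<Lambda>" for \<alpha>
        proof (rule cl_eq)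
          show "var (v + w) * (p * mon \<alpha>) - (var v * (p * mon \<alpha>) + var w * (p * mon \<alpha>)) \<in> J"
            using Jl[OF rel_add[OF add(1,2)] in_S[OF that]] by (simp add: algebra_simps)
        qed (use add in_S[OF that] in \<open>auto intro!: add_in_polys mult_in_polys\<close>)
        then show ?case using add X_add in_S by (simp add: mult_in_polys)
      next
        case (scale c v)
        have "cl (var (const_poly c * v) * (p * mon \<alpha>)) = cl (const_poly c * (var v * (p * mon \<alpha>)))" if "\<alpha> \<in> \<Lambda>" for \<alpha>
        proof (rule cl_eq)
          show "var (const_poly c * v) * (p * mon \<alpha>) - const_poly c * (var v * (p * mon \<alpha>)) \<in> J"
            using Jl[OF rel_scale[OF scale(1), of c] in_S[OF that]] by (simp add: algebra_simps)
        qed (use scale in_S[OF that] in \<open>auto intro!: mult_in_polys\<close>)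
        then show ?case using scale X_scale in_S by (simp add: mult_in_polys)
      qed
      then show ?case by (simp add: mult.assoc)
    qed
    show "carrier ?B \<subseteq> X"
    proof
      fix x assume "x \<in> carrier ?B"
      then obtain q where q: "q \<in> polys ?S" "x = cl q" using clE by auto
      have "0 \<in> \<Lambda>" by (simp add: \<Lambda>_def)
      with all[OF q(1)] have "cl (q * mon 0) \<in> X" by blast
      then show "x \<in> X" by (simp add: q(2) mon_def)
    qed
  qed simp
qed

section \<open>The general linear group\<close>

lemma GL_simps [simp]: "monoid.mult (GL m) = (*)" "one (GL m) = 1\<^sub>m m"
  by (simp_all add: GL_def units_of_def ring_mat_def)

lemma GL_group: "group (GL m)"
proof -
  interpret ring "ring_mat TYPE(complex) m ()" by (rule ring_mat)
  show ?thesis unfolding GL_def by (rule units_group)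
qed

abbreviation GL_inv :: "nat \<Rightarrow> complex mat \<Rightarrow> complex mat" where
  "GL_inv m g \<equiv> inv\<^bsub>GL m\<^esub> g"

lemma GL_inv:
  assumes "g \<in> carrier (GL m)"
  shows "GL_inv m g \<in> carrier (GL m)" "GL_inv m g \<in> carrier_mat m m" "g \<in> carrier_mat m m"
    "g * GL_inv m g = 1\<^sub>m m" "GL_inv m g * g = 1\<^sub>m m" "GL_inv m (GL_inv m g) = g"
proof -
  interpret group "GL m" by (rule GL_group)
  show "GL_inv m g \<in> carrier (GL m)" using assms by simp
  then show "GL_inv m g \<in> carrier_mat m m" by (simp add: GL_carrier)
  show "g \<in> carrier_mat m m" using assms by (simp add: GL_carrier)
  show "g * GL_inv m g = 1\<^sub>m m" "GL_inv m g * g = 1\<^sub>m m" "GL_inv m (GL_inv m g) = g"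
    using r_inv[OF assms] l_inv[OF assms] inv_inv[OF assms] by simp_all
qed

lemma GL_mult: "g \<in> carrier (GL m) \<Longrightarrow> h \<in> carrier (GL m) \<Longrightarrow> g * h \<in> carrier (GL m)"
  using group.is_monoid[OF GL_group, of m] monoid.m_closed by fastforce

lemma GL_one: "1\<^sub>m m \<in> carrier (GL m)"
  by (simp add: GL_carrier)

lemma GL_inv_mult: "g \<in> carrier (GL m) \<Longrightarrow> h \<in> carrier (GL m) \<Longrightarrow> GL_inv m (g * h) = GL_inv m h * GL_inv m g"
  using group.inv_mult_group[OF GL_group, of g m h] by simp

lemma GL_inv_unique:
  assumes "g \<in> carrier_mat m m" "h \<in> carrier_mat m m" "g * h = 1\<^sub>m m"
  shows "g \<in> carrier (GL m)" "h \<in> carrier (GL m)" "GL_inv m g = h"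
proof -
  have hg: "h * g = 1\<^sub>m m" by (rule mat_mult_left_right_inverse[OF assms])
  have "det g * det h = 1" using det_mult[OF assms(1,2)] assms(3) by simp
  then show g: "g \<in> carrier (GL m)" and h: "h \<in> carrier (GL m)" using assms by (auto simp: GL_carrier)
  interpret group "GL m" by (rule GL_group)
  show "GL_inv m g = h" using inv_equality[of h g] hg g h by simp
qed

lemma GL_inv_adj:
  assumes g: "g \<in> carrier (GL m)" and ij: "i < m" "j < m"
  shows "GL_inv m g $$ (i, j) = adj_mat g $$ (i, j) / det g"
proof -
  note G = GL_inv[OF g]
  have d: "det g \<noteq> 0" using g by (simp add: GL_carrier)
  have "adj_mat g = (GL_inv m g * g) * adj_mat g" using G adj_mat(1)[OF G(3)] by simp
  also have "\<dots> = GL_inv m g * (g * adj_mat g)" by (rule assoc_mult_mat[OF G(2,3) adj_mat(1)[OF G(3)]])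
  also have "\<dots> = GL_inv m g * (det g \<cdot>\<^sub>m 1\<^sub>m m)" by (simp add: adj_mat(2)[OF G(3)])
  also have "\<dots> = det g \<cdot>\<^sub>m GL_inv m g" using G(2) by (subst mult_smult_distrib[of _ m m _ m]) auto
  finally have "adj_mat g $$ (i, j) = det g * GL_inv m g $$ (i, j)" using G(2) ij by simp
  then show ?thesis using d by simp
qed

lemma unip_iff:
  "u \<in> unip m \<longleftrightarrow> u \<in> carrier_mat m m \<and> (\<forall>i<m. u $$ (i, i) = 1) \<and> (\<forall>i<m. \<forall>k<i. u $$ (i, k) = 0)"
proof
  assume "u \<in> unip m"
  then show "u \<in> carrier_mat m m \<and> (\<forall>i<m. u $$ (i, i) = 1) \<and> (\<forall>i<m. \<forall>k<i. u $$ (i, k) = 0)"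
    by (auto simp: unip_def GL_carrier upper_triangular_def)
next
  assume u: "u \<in> carrier_mat m m \<and> (\<forall>i<m. u $$ (i, i) = 1) \<and> (\<forall>i<m. \<forall>k<i. u $$ (i, k) = 0)"
  then have ut: "upper_triangular u" by (auto simp: upper_triangular_def)
  have "det u = 1" using det_upper_unitriangular[OF ut] u by blast
  then show "u \<in> unip m" using u ut by (auto simp: unip_def GL_carrier)
qed

lemma unip_GL: "u \<in> unip m \<Longrightarrow> u \<in> carrier (GL m)"
  by (simp add: unip_def)

text \<open>Back substitution in u w = 1: beginning with the last row, the entries of w on and below
  the diagonal are determined.\<close>

lemma unip_inv:
  assumes u: "u \<in> unip m"
  shows "GL_inv m u \<in> unip m"
proof -
  note U = GL_inv[OF unip_GL[OF u]]
  define w where "w i j = GL_inv m u $$ (i, j)" for i j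
  have u0: "u $$ (i, i) = 1" "k < i \<Longrightarrow> u $$ (i, k) = 0" if "i < m" for i k
    using u that by (auto simp: unip_iff)
  have uw: "(\<Sum>l<m. u $$ (i, l) * w l j) = (if i = j then 1 else 0)" if "i < m" "j < m" for i j
    using mat_mult_entry[OF U(3,2) that] that U(4) by (simp add: w_def)
  have w: "w i j = (if i = j then 1 else 0)" if "i < m" "j \<le> i" for i j
    using that
  proof (induction "m - i" arbitrary: i rule: less_induct)
    case less
    have "(\<Sum>l<m. u $$ (i, l) * w l j) = (\<Sum>l<m. if l = i then w i j else 0)"
    proof (rule sum.cong)
      fix l assume l: "l \<in> {..<m}"
      consider "l < i" | "l = i" | "i < l" by linarith
      then show "u $$ (i, l) * w l j = (if l = i then w i j else 0)"
      proof cases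
        case 3
        then have "w l j = 0" using less.hyps[of l] less.prems l by auto
        then show ?thesis using 3 by simp
      qed (use u0 less.prems in auto)
    qed simp
    then show ?case using uw[of i j] less.prems by simp
  qed
  show ?thesis unfolding unip_iff using U(2) w by (auto simp: w_def)
qed

text \<open>The extension is block diagonal with blocks u, 1 and J u^-T J; in the orthogonality
  relation the last block compensates the first.\<close>

lemma unip_extend:
  assumes mn: "2 * m \<le> n" and u: "u \<in> unip m"
  shows "\<exists>u'\<in>unip_orth n. \<forall>i<m. \<forall>k<m. u' $$ (i, k) = u $$ (i, k)"
proof -
  let ?w = "GL_inv m u"
  let ?r = "\<lambda>i. n - 1 - i"
  note U = GL_inv[OF unip_GL[OF u]]
  have u0: "u $$ (i, i) = 1" "k < i \<Longrightarrow> u $$ (i, k) = 0" if "i < m" for i k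
    using u that by (auto simp: unip_iff)
  have w0: "?w $$ (i, i) = 1" "k < i \<Longrightarrow> ?w $$ (i, k) = 0" if "i < m" for i k
    using unip_inv[OF u] that by (auto simp: unip_iff)
  have uw: "(\<Sum>l<m. u $$ (i, l) * ?w $$ (l, j)) = (if i = j then 1 else 0)" if "i < m" "j < m" for i j
    using mat_mult_entry[OF U(3,2) that] that U(4) by simp
  define f where "f i k = (if i < m then if k < m then u $$ (i, k) else 0 else if i < n - m then if i = k then 1 else 0
    else if n - m \<le> k then ?w $$ (?r k, ?r i) else 0)" for i k
  have "mat n n (\<lambda>(i, k). f i k) \<in> unip_orth n"
  proof (rule unip_orthI)
    show "f i i = 1" if "i < n" for i
    proof -
      have "?r i < m" if "\<not> i < m" "\<not> i < n - m" using that \<open>i < n\<close> mn by auto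
      then show ?thesis using u0 w0 that by (auto simp: f_def)
    qed
    show "f i k = 0" if "k < i" "i < n" for i k
    proof -
      have "?r k < m \<and> ?r i < ?r k" if "n - m \<le> k" using that \<open>k < i\<close> \<open>i < n\<close> mn by auto
      then show ?thesis using u0 w0 that by (auto simp: f_def)
    qed
    fix i j assume ij: "i < n" "j < n"
    have last: "\<not> ?r k < m" "\<not> ?r k < n - m" "n - m \<le> ?r k" "?r (?r k) = k" "\<not> n - m \<le> k" if "k < m" for k
      using that mn by auto
    have bl: "(\<Sum>k<n. f i k * f j (?r k)) = (\<Sum>k<m. f i k * f j (?r k)) + (\<Sum>k\<in>{m..<n-m}. f i k * f j (?r k))
        + (\<Sum>k<m. f i (?r k) * f j k)"
      unfolding sum_three_blocks[OF mn] using last by simp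
    consider "i < m" | "\<not> i < m" "i < n - m" | "\<not> i < m" "\<not> i < n - m" by blast
    then show "(\<Sum>k<n. f i k * f j (?r k)) = (if i + j = n - 1 then 1 else 0)"
    proof cases
      case 1
      have "(\<Sum>k\<in>{m..<n-m}. f i k * f j (?r k)) = 0" "(\<Sum>k<m. f i (?r k) * f j k) = 0"
        by (rule sum.neutral, use 1 last in \<open>auto simp: f_def\<close>)+
      moreover have "(\<Sum>k<m. f i k * f j (?r k)) = (if i + j = n - 1 then 1 else 0)"
      proof (cases "j < n - m")
        case True
        have "(\<Sum>k<m. f i k * f j (?r k)) = 0"
          by (rule sum.neutral) (use True last in \<open>auto simp: f_def\<close>)
        then show ?thesis using True 1 ij by auto
      next
        case False
        then have j: "?r j < m" "\<not> j < m" using ij mn by auto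
        have "(\<Sum>k<m. f i k * f j (?r k)) = (\<Sum>k<m. u $$ (i, k) * ?w $$ (k, ?r j))"
          by (rule sum.cong) (use 1 False j last in \<open>auto simp: f_def\<close>)
        also have "\<dots> = (if i = ?r j then 1 else 0)" by (rule uw[OF 1 j(1)])
        finally show ?thesis using ij by auto
      qed
      ultimately show ?thesis unfolding bl by simp
    next
      case 2
      have "(\<Sum>k<m. f i k * f j (?r k)) = 0" "(\<Sum>k<m. f i (?r k) * f j k) = 0"
        by (rule sum.neutral, use 2 last in \<open>auto simp: f_def\<close>)+
      moreover have "(\<Sum>k\<in>{m..<n-m}. f i k * f j (?r k)) = (\<Sum>k\<in>{m..<n-m}. if k = i then f j (?r k) else 0)"
        by (rule sum.cong) (use 2 in \<open>auto simp: f_def\<close>)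
      moreover have "\<dots> = f j (?r i)" using 2 by simp
      moreover have "f j (?r i) = (if i + j = n - 1 then 1 else 0)"
      proof -
        have "\<not> ?r i < m" "\<not> n - m \<le> ?r i" using 2 ij by auto
        then show ?thesis using 2 ij by (auto simp: f_def)
      qed
      ultimately show ?thesis unfolding bl by simp
    next
      case 3
      then have i: "?r i < m" using ij mn by auto
      have "(\<Sum>k\<in>{m..<n-m}. f i k * f j (?r k)) = 0" "(\<Sum>k<m. f i k * f j (?r k)) = 0"
        by (rule sum.neutral, use 3 last in \<open>auto simp: f_def\<close>)+
      moreover have "(\<Sum>k<m. f i (?r k) * f j k) = (if i + j = n - 1 then 1 else 0)"
      proof (cases "j < m")
        case True
        have "(\<Sum>k<m. f i (?r k) * f j k) = (\<Sum>k<m. u $$ (j, k) * ?w $$ (k, ?r i))"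
          by (rule sum.cong) (use 3 True last in \<open>auto simp: f_def\<close>)
        also have "\<dots> = (if j = ?r i then 1 else 0)" by (rule uw[OF True i])
        finally show ?thesis using ij by auto
      next
        case False
        have "(\<Sum>k<m. f i (?r k) * f j k) = 0"
          by (rule sum.neutral) (use False last in \<open>auto simp: f_def\<close>)
        then show ?thesis using False i ij by auto
      qed
      ultimately show ?thesis unfolding bl by simp
    qed
  qed
  then show ?thesis
    by (rule bexI[rotated]) (use mn in \<open>auto simp: f_def\<close>)
qed

section \<open>Polynomials on the square matrices\<close>

text \<open>The ring L of the overview: polynomials in the square block t invariant under t -> u^T
  t, described by \<open>unip m\<close> alone.\<close>

definition low_inv :: "nat \<Rightarrow> (nat \<times> nat) cpoly set" where
  "low_inv m = {f \<in> polys (top_vars m). \<forall>u\<in>unip m. \<forall>\<sigma>. ev (\<lambda>(i, j). \<Sum>k<m. u $$ (k, i) * \<sigma> (k, j)) f = ev \<sigma> f}"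

lemma low_inv_polys: "f \<in> low_inv m \<Longrightarrow> f \<in> polys (top_vars m)"
  by (simp add: low_inv_def)

text \<open>An upper triangular group element acts on the top block through its own top left block,
  and every element of U_m occurs as such a block.\<close>

lemma top_invariants_eq_low_inv:
  assumes mn: "2 * m \<le> n"
  shows "polys (top_vars m) \<inter> U_invariants n m = low_inv m"
proof -
  have sub: "polys (top_vars m) \<subseteq> polys ({0..<n} \<times> {0..<m})" by (rule polys_mono) (use mn in auto)
  have restrict: "ev (\<lambda>(i, j). \<Sum>k<n. u' $$ (k, i) * \<sigma> (k, j)) f = ev (\<lambda>(i, j). \<Sum>k<m. u $$ (k, i) * \<sigma> (k, j)) f"
    if f: "f \<in> polys (top_vars m)" and u': "u' \<in> unip_orth n" and u: "\<And>i k. i < m \<Longrightarrow> k < m \<Longrightarrow> u' $$ (i, k) = u $$ (i, k)" for f u u' \<sigma>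
  proof (rule ev_cong[OF f])
    fix v assume "v \<in> top_vars m"
    then obtain i j where v: "v = (i, j)" "i < m" "j < m" by auto
    have "(\<Sum>k<n. u' $$ (k, i) * \<sigma> (k, j)) = (\<Sum>k<m. u' $$ (k, i) * \<sigma> (k, j))"
      by (rule sum.mono_neutral_right) (use mn v unip_orthD(3)[OF u'] in auto)
    also have "\<dots> = (\<Sum>k<m. u $$ (k, i) * \<sigma> (k, j))" by (rule sum.cong) (use u v in auto)
    finally show "(case v of (i, j) \<Rightarrow> \<Sum>k<n. u' $$ (k, i) * \<sigma> (k, j)) = (case v of (i, j) \<Rightarrow> \<Sum>k<m. u $$ (k, i) * \<sigma> (k, j))"
      using v by simp
  qed
  show ?thesis
  proof (intro equalityI subsetI)
    fix f assume f: "f \<in> polys (top_vars m) \<inter> U_invariants n m"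
    have "ev (\<lambda>(i, j). \<Sum>k<m. u $$ (k, i) * \<sigma> (k, j)) f = ev \<sigma> f" if u: "u \<in> unip m" for u \<sigma>
    proof -
      obtain u' where u': "u' \<in> unip_orth n" "\<forall>i<m. \<forall>k<m. u' $$ (i, k) = u $$ (i, k)"
        using unip_extend[OF mn u] by (elim bexE) (rule that)
      have "ev (\<lambda>(i, j). \<Sum>k<n. u' $$ (k, i) * \<sigma> (k, j)) f = ev \<sigma> f" using f u'(1) by (simp add: U_invariants_iff)
      then show ?thesis using restrict[OF _ u'(1), of f u \<sigma>] f u'(2) by simp
    qed
    then show "f \<in> low_inv m" using f by (simp add: low_inv_def)
  next
    fix f assume f: "f \<in> low_inv m"
    have "ev (\<lambda>(i, j). \<Sum>k<n. u' $$ (k, i) * \<sigma> (k, j)) f = ev \<sigma> f" if u': "u' \<in> unip_orth n" for u' \<sigma>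
    proof -
      let ?u = "mat m m (\<lambda>(i, k). u' $$ (i, k))"
      have "?u \<in> unip m" unfolding unip_iff using unip_orthD[OF u'] mn by auto
      then have "ev (\<lambda>(i, j). \<Sum>k<m. ?u $$ (k, i) * \<sigma> (k, j)) f = ev \<sigma> f" using f by (simp add: low_inv_def)
      then show ?thesis using restrict[OF low_inv_polys[OF f] u', of ?u \<sigma>] by simp
    qed
    then show "f \<in> polys (top_vars m) \<inter> U_invariants n m"
      using low_inv_polys[OF f] sub by (auto simp: U_invariants_iff)
  qed
qed

text \<open>The action x -> x h of GL_m as a substitution for single variables, the form suited to
  induction over polynomials and to the chain rule.\<close>

definition tr :: "nat \<Rightarrow> complex mat \<Rightarrow> (nat \<times> nat) cpoly \<Rightarrow> (nat \<times> nat) cpoly" where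
  "tr m h f = poly_eval const_poly (\<lambda>(i, j). \<Sum>l<m. const_poly (h $$ (l, j)) * var (i, l)) f"

lemma ev_tr: "ev \<sigma> (tr m h f) = ev (\<lambda>(i, j). \<Sum>l<m. \<sigma> (i, l) * h $$ (l, j)) f"
  unfolding tr_def ev_subst
  by (rule arg_cong[where f = "\<lambda>s. ev s f"]) (auto simp: fun_eq_iff ev.poly_eval_simps mult.commute)

lemma act_eq_tr:
  assumes f: "f \<in> polys ({0..<n} \<times> {0..<m})" and h: "h \<in> carrier_mat m m"
  shows "act n m (1\<^sub>m n) h f = tr m h f"
proof (rule cpoly_eqI)
  fix \<sigma> :: "nat \<times> nat \<Rightarrow> complex"
  show "ev \<sigma> (act n m (1\<^sub>m n) h f) = ev \<sigma> (tr m h f)"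
    unfolding ev_act[OF f one_carrier_mat h] ev_tr
  proof (rule ev_cong[OF f])
    fix v assume "v \<in> {0..<n} \<times> {0..<m}"
    then obtain i j where v: "v = (i, j)" "i < n" by auto
    have "(\<Sum>k<n. 1\<^sub>m n $$ (k, i) * \<sigma> (k, l)) = (\<Sum>k<n. if k = i then \<sigma> (k, l) else 0)" for l
      by (rule sum.cong) (use v in auto)
    then show "(case v of (i, j) \<Rightarrow> \<Sum>l<m. (\<Sum>k<n. 1\<^sub>m n $$ (k, i) * \<sigma> (k, l)) * h $$ (l, j)) = (case v of (i, j) \<Rightarrow> \<Sum>l<m. \<sigma> (i, l) * h $$ (l, j))"
      using v by simp
  qed
qed

lemma tr_in_polys: "f \<in> polys (top_vars m) \<Longrightarrow> tr m h f \<in> polys (top_vars m)"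
  unfolding tr_def by (rule subst_in_polys) (auto intro!: sum_in_polys mult_in_polys)

lemma tr_simps:
  "tr m h 0 = 0" "tr m h 1 = 1" "tr m h (p + q) = tr m h p + tr m h q" "tr m h (p * q) = tr m h p * tr m h q"
  "tr m h (const_poly c) = const_poly c" "tr m h (var (i, j)) = (\<Sum>l<m. const_poly (h $$ (l, j)) * var (i, l))"
  by (simp_all add: tr_def subst.poly_eval_simps)

text \<open>Left and right multiplication of matrices commute.\<close>

lemma tr_low_inv:
  assumes f: "f \<in> low_inv m"
  shows "tr m h f \<in> low_inv m"
  unfolding low_inv_def
proof (intro CollectI conjI ballI allI tr_in_polys low_inv_polys[OF f])
  fix u \<sigma> assume u: "u \<in> unip m"
  have "(\<lambda>(i, j). \<Sum>l<m. (\<Sum>k<m. u $$ (k, i) * \<sigma> (k, l)) * h $$ (l, j)) =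
    (\<lambda>(i, j). \<Sum>k<m. u $$ (k, i) * (\<Sum>l<m. \<sigma> (k, l) * h $$ (l, j)))"
    by (auto simp: fun_eq_iff sum_distrib_left sum_distrib_right mult.assoc intro: sum.swap)
  moreover have "ev (\<lambda>(i, j). \<Sum>k<m. u $$ (k, i) * (\<lambda>(i, j). \<Sum>l<m. \<sigma> (i, l) * h $$ (l, j)) (k, j)) f
      = ev (\<lambda>(i, j). \<Sum>l<m. \<sigma> (i, l) * h $$ (l, j)) f"
    using f u unfolding low_inv_def by blast
  ultimately show "ev (\<lambda>(i, j). \<Sum>k<m. u $$ (k, i) * \<sigma> (k, j)) (tr m h f) = ev \<sigma> (tr m h f)"
    unfolding ev_tr by simp
qed

lemma tr_mult:
  assumes "f \<in> polys (top_vars m)" "g \<in> carrier_mat m m" "h \<in> carrier_mat m m"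
  shows "tr m (g * h) f = tr m g (tr m h f)"
proof (rule cpoly_eqI)
  fix \<sigma> :: "nat \<times> nat \<Rightarrow> complex"
  show "ev \<sigma> (tr m (g * h) f) = ev \<sigma> (tr m g (tr m h f))"
    unfolding ev_tr
  proof (rule ev_cong[OF assms(1)])
    fix v assume "v \<in> top_vars m"
    then obtain i j where v: "v = (i, j)" "j < m" by auto
    have "(\<Sum>l<m. \<sigma> (i, l) * (g * h) $$ (l, j)) = (\<Sum>l<m. \<sigma> (i, l) * (\<Sum>k<m. g $$ (l, k) * h $$ (k, j)))"
      by (rule sum.cong) (use mat_mult_entry[OF assms(2,3)] v in auto)
    also have "\<dots> = (\<Sum>k<m. (\<Sum>l<m. \<sigma> (i, l) * g $$ (l, k)) * h $$ (k, j))"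
      unfolding sum_distrib_left sum_distrib_right mult.assoc by (rule sum.swap)
    finally show "(case v of (i, j) \<Rightarrow> \<Sum>l<m. \<sigma> (i, l) * (g * h) $$ (l, j)) =
      (case v of (i, j) \<Rightarrow> \<Sum>l<m. (case (i, l) of (i, j) \<Rightarrow> \<Sum>l<m. \<sigma> (i, l) * g $$ (l, j)) * h $$ (l, j))"
      using v by simp
  qed
qed

lemma tr_one:
  assumes "f \<in> polys (top_vars m)"
  shows "tr m (1\<^sub>m m) f = f"
proof (rule cpoly_eqI)
  fix \<sigma> :: "nat \<times> nat \<Rightarrow> complex"
  show "ev \<sigma> (tr m (1\<^sub>m m) f) = ev \<sigma> f"
    unfolding ev_tr
  proof (rule ev_cong[OF assms])
    fix v assume "v \<in> top_vars m"
    then obtain i j where v: "v = (i, j)" "j < m" by auto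
    have "(\<Sum>l<m. \<sigma> (i, l) * 1\<^sub>m m $$ (l, j)) = (\<Sum>l<m. if l = j then \<sigma> (i, l) else 0)"
      by (rule sum.cong) (use v in auto)
    then show "(case v of (i, j) \<Rightarrow> \<Sum>l<m. \<sigma> (i, l) * 1\<^sub>m m $$ (l, j)) = \<sigma> v" using v by simp
  qed
qed

section \<open>Regular functions on \<open>GL\<^sub>m / U\<^sub>m\<close>\<close>

lemma R_GL_simps:
  "carrier (R_GL m) = {f \<in> extensional (carrier (GL m)). \<exists>p\<in>polys (top_vars m). \<exists>k. \<forall>g\<in>carrier (GL m). f g = ev (\<lambda>ij. g $$ ij) p / det g ^ k}"
  "monoid.mult (R_GL m) = (\<lambda>f f'. \<lambda>g\<in>carrier (GL m). f g * f' g)" "one (R_GL m) = (\<lambda>g\<in>carrier (GL m). 1)"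
  "zero (R_GL m) = (\<lambda>g\<in>carrier (GL m). 0)" "add (R_GL m) = (\<lambda>f f'. \<lambda>g\<in>carrier (GL m). f g + f' g)"
  "module.smult (R_GL m) = (\<lambda>c f. \<lambda>g\<in>carrier (GL m). c * f g)"
  by (simp_all add: R_GL_def ev_def)

definition regular :: "nat \<Rightarrow> (complex mat \<Rightarrow> complex) \<Rightarrow> bool" where
  "regular m f \<longleftrightarrow> (\<exists>p\<in>polys (top_vars m). \<exists>k. \<forall>g\<in>carrier (GL m). f g = ev (\<lambda>ij. g $$ ij) p / det g ^ k)"

text \<open>A polynomial representing det, by which fractions are brought to a common
  denominator.\<close>

lemma polyfun_det_square: "\<exists>d\<in>polys (top_vars m). \<forall>g\<in>carrier_mat m m. det g = ev (\<lambda>ij. g $$ ij) d"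
proof -
  have "polyfun (top_vars m) (\<lambda>\<sigma>. det (mat m m \<sigma>))" by (rule polyfun_det) (auto intro!: polyfun_var)
  then obtain d where d: "d \<in> polys (top_vars m)" "\<And>\<sigma>. det (mat m m \<sigma>) = ev \<sigma> d" by (auto simp: polyfun_def)
  have "mat m m (\<lambda>ij. g $$ ij) = g" if "g \<in> carrier_mat m m" for g :: "complex mat"
    using that by (intro eq_matI) auto
  then have "det g = ev (\<lambda>ij. g $$ ij) d" if "g \<in> carrier_mat m m" for g using d(2)[of "\<lambda>ij. g $$ ij"] that by simp
  with d(1) show ?thesis by blast
qed

lemma regular_const: "regular m (\<lambda>g. c)"
  unfolding regular_def by (rule bexI[of _ "const_poly c"], rule exI[of _ 0]) (auto simp: ev.poly_eval_simps)

lemma regular_cong: "regular m f \<Longrightarrow> (\<And>g. g \<in> carrier (GL m) \<Longrightarrow> f g = f' g) \<Longrightarrow> regular m f'"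
  unfolding regular_def by simp

lemma regular_mult:
  assumes "regular m f" "regular m f'"
  shows "regular m (\<lambda>g. f g * f' g)"
proof -
  obtain p k q l where "p \<in> polys (top_vars m)" "\<forall>g\<in>carrier (GL m). f g = ev (\<lambda>ij. g $$ ij) p / det g ^ k"
    "q \<in> polys (top_vars m)" "\<forall>g\<in>carrier (GL m). f' g = ev (\<lambda>ij. g $$ ij) q / det g ^ l"
    using assms unfolding regular_def by (elim bexE exE) (rule that)
  then show ?thesis unfolding regular_def
    by (intro bexI[of _ "p * q"] exI[of _ "k + l"]) (auto simp: ev.poly_eval_simps power_add intro: mult_in_polys)
qed

lemma regular_add:
  assumes "regular m f" "regular m f'"
  shows "regular m (\<lambda>g. f g + f' g)"
proof -
  obtain p k q l where p: "p \<in> polys (top_vars m)" "\<forall>g\<in>carrier (GL m). f g = ev (\<lambda>ij. g $$ ij) p / det g ^ k"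
    and q: "q \<in> polys (top_vars m)" "\<forall>g\<in>carrier (GL m). f' g = ev (\<lambda>ij. g $$ ij) q / det g ^ l"
    using assms unfolding regular_def by (elim bexE exE) (rule that)
  obtain d where d: "d \<in> polys (top_vars m)" "\<forall>g\<in>carrier_mat m m. det g = ev (\<lambda>ij. g $$ ij) d"
    using polyfun_det_square[of m] by (elim bexE) (rule that)
  have "f g + f' g = ev (\<lambda>ij. g $$ ij) (d ^ l * p + d ^ k * q) / det g ^ (k + l)" if g: "g \<in> carrier (GL m)" for g
  proof -
    have "det g \<noteq> 0" "ev (\<lambda>ij. g $$ ij) d = det g" using g d(2) by (auto simp: GL_carrier)
    then show ?thesis using p(2) q(2) g
      by (simp add: ev.poly_eval_simps power_add divide_simps) (simp add: algebra_simps)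
  qed
  moreover have "d ^ l * p + d ^ k * q \<in> polys (top_vars m)"
    by (intro add_in_polys mult_in_polys power_in_polys d p q)
  ultimately show ?thesis unfolding regular_def by blast
qed

lemma R_GL_carrier: "f \<in> carrier (R_GL m) \<longleftrightarrow> f \<in> extensional (carrier (GL m)) \<and> regular m f"
  by (simp add: R_GL_simps regular_def)

lemma R_GL_restrict: "regular m f \<Longrightarrow> restrict f (carrier (GL m)) \<in> carrier (R_GL m)"
  by (auto simp: R_GL_carrier intro: regular_cong)

lemma algebra_R_GL: "algebra class_ring (R_GL m)"
proof -
  have ext: "f = g" if "f \<in> carrier (R_GL m)" "g \<in> carrier (R_GL m)" "\<And>x. x \<in> carrier (GL m) \<Longrightarrow> f x = g x" for f g
    using that by (auto simp: R_GL_carrier intro: extensionalityI)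
  have reg: "regular m f" if "f \<in> carrier (R_GL m)" for f using that by (simp add: R_GL_carrier)
  have cl: "f \<oplus>\<^bsub>R_GL m\<^esub> g \<in> carrier (R_GL m)" "f \<otimes>\<^bsub>R_GL m\<^esub> g \<in> carrier (R_GL m)"
    "c \<odot>\<^bsub>R_GL m\<^esub> f \<in> carrier (R_GL m)" if "f \<in> carrier (R_GL m)" "g \<in> carrier (R_GL m)" for f g c
    unfolding R_GL_simps(2-) using that reg
    by (auto intro!: R_GL_restrict regular_add regular_mult regular_const)
  have cl0: "\<zero>\<^bsub>R_GL m\<^esub> \<in> carrier (R_GL m)" "\<one>\<^bsub>R_GL m\<^esub> \<in> carrier (R_GL m)"
    unfolding R_GL_simps(2-) by (auto intro!: R_GL_restrict regular_const)
  note clos = cl cl0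
  show ?thesis
  proof (rule algebraI)
    show "cring (R_GL m)"
    proof (rule cringI)
      show "abelian_group (R_GL m)"
      proof (rule abelian_groupI)
        fix f assume f: "f \<in> carrier (R_GL m)"
        show "\<exists>g\<in>carrier (R_GL m). g \<oplus>\<^bsub>R_GL m\<^esub> f = \<zero>\<^bsub>R_GL m\<^esub>"
          by (rule bexI[OF _ cl(3)[OF f f, of "-1"]]) (auto simp: R_GL_simps(2-))
      qed (use clos in \<open>auto intro!: ext simp: R_GL_simps(2-) simp del: restrict_apply\<close>,
          (auto simp: R_GL_simps(2-) R_GL_carrier add_ac fun_eq_iff extensional_def)?)
      show "Group.comm_monoid (R_GL m)"
        by (rule comm_monoidI) (use clos in \<open>auto simp: R_GL_simps(2-) R_GL_carrier mult_ac fun_eq_iff extensional_def\<close>)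
    qed (auto simp: R_GL_simps(2-) R_GL_carrier algebra_simps fun_eq_iff extensional_def)
  qed (use clos in \<open>auto simp: R_GL_simps(2-) R_GL_carrier algebra_simps fun_eq_iff extensional_def class_cring.cring_axioms\<close>)
qed

lemma R_mod_U_carrier:
  "F \<in> carrier (R_GL_mod_U m) \<longleftrightarrow> F \<in> extensional (carrier (GL m)) \<and> regular m F \<and>
    (\<forall>g\<in>carrier (GL m). \<forall>u\<in>unip m. F (g * u) = F g)"
  by (auto simp: R_GL_mod_U_def R_GL_carrier)

lemma R_mod_U_simps:
  "monoid.mult (R_GL_mod_U m) = (\<lambda>f f'. \<lambda>g\<in>carrier (GL m). f g * f' g)" "one (R_GL_mod_U m) = (\<lambda>g\<in>carrier (GL m). 1)"
  "zero (R_GL_mod_U m) = (\<lambda>g\<in>carrier (GL m). 0)" "add (R_GL_mod_U m) = (\<lambda>f f'. \<lambda>g\<in>carrier (GL m). f g + f' g)"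
  "module.smult (R_GL_mod_U m) = (\<lambda>c f. \<lambda>g\<in>carrier (GL m). c * f g)"
  by (simp_all add: R_GL_mod_U_def R_GL_simps)

lemma algebra_R_mod_U: "algebra class_ring (R_GL_mod_U m)"
proof -
  have gu: "g * u \<in> carrier (GL m)" if "g \<in> carrier (GL m)" "u \<in> unip m" for g u
    by (rule GL_mult[OF that(1) unip_GL[OF that(2)]])
  interpret algebra class_ring "R_GL m" by (rule algebra_R_GL)
  have "subalg (carrier (R_GL_mod_U m)) (R_GL m)"
  proof (rule subalgI[OF algebra_R_GL])
    fix c x y assume x: "x \<in> carrier (R_GL_mod_U m)"
    have xR: "x \<in> carrier (R_GL m)" using x by (simp add: R_GL_mod_U_def)
    show "c \<odot>\<^bsub>R_GL m\<^esub> x \<in> carrier (R_GL_mod_U m)"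
      using smult_closed[of c x] xR x gu by (auto simp: R_GL_mod_U_def R_GL_simps(2-))
    assume y: "y \<in> carrier (R_GL_mod_U m)"
    have yR: "y \<in> carrier (R_GL m)" using y by (simp add: R_GL_mod_U_def)
    show "x \<oplus>\<^bsub>R_GL m\<^esub> y \<in> carrier (R_GL_mod_U m)" "x \<otimes>\<^bsub>R_GL m\<^esub> y \<in> carrier (R_GL_mod_U m)"
      using a_closed[OF xR yR] m_closed[OF xR yR] x y gu by (auto simp: R_GL_mod_U_def R_GL_simps(2-))
  qed (use gu one_closed in \<open>auto simp: R_GL_mod_U_def R_GL_simps(2-)\<close>)
  from subalg_algebra[OF algebra_R_GL this] show ?thesis by (simp add: R_GL_mod_U_def)
qed

section \<open>From invariant polynomials to regular functions\<close>

text \<open>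
  The polynomial \<open>f\<close> is sent to \<open>g \<mapsto> f (J g\<^sup>-\<^sup>1)\<close>: the inverse turns right translation of the argument of
  \<open>f\<close> into left translation, and \<open>J\<close> turns lower into upper unipotent matrices.
\<close>

definition gl_map :: "nat \<Rightarrow> (nat \<times> nat) cpoly \<Rightarrow> complex mat \<Rightarrow> complex" where
  "gl_map m f = (\<lambda>g\<in>carrier (GL m). ev (\<lambda>(i, j). GL_inv m g $$ (m - 1 - i, j)) f)"

lemma regular_inv_entry:
  assumes "i < m" "j < m"
  shows "regular m (\<lambda>g. GL_inv m g $$ (i, j))"
proof -
  have "polyfun (top_vars m) (\<lambda>\<sigma>. adj_mat (mat m m (\<lambda>ij. \<sigma> ij)) $$ (i, j))"
    by (rule polyfun_adj[OF _ assms]) (auto intro!: polyfun_var)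
  then obtain p where p: "p \<in> polys (top_vars m)" "\<And>\<sigma>. adj_mat (mat m m \<sigma>) $$ (i, j) = ev \<sigma> p" by (auto simp: polyfun_def)
  have "GL_inv m g $$ (i, j) = ev (\<lambda>ij. g $$ ij) p / det g ^ 1" if g: "g \<in> carrier (GL m)" for g
  proof -
    have "mat m m (\<lambda>ij. g $$ ij) = g" using GL_inv(3)[OF g] by (intro eq_matI) auto
    then show ?thesis using p(2)[of "\<lambda>ij. g $$ ij"] GL_inv_adj[OF g assms] by simp
  qed
  with p(1) show ?thesis unfolding regular_def by blast
qed

lemma regular_gl_map:
  assumes "f \<in> polys (top_vars m)"
  shows "regular m (\<lambda>g. ev (\<lambda>(i, j). GL_inv m g $$ (m - 1 - i, j)) f)"
  using assms
proof (induction f rule: polys_induct)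
  case (var v p)
  obtain i j where v: "v = (i, j)" "i < m" "j < m" using var by auto
  have "regular m (\<lambda>g. GL_inv m g $$ (m - 1 - i, j) * ev (\<lambda>(i, j). GL_inv m g $$ (m - 1 - i, j)) p)"
    by (rule regular_mult[OF regular_inv_entry var(3)]) (use v in auto)
  then show ?case by (simp add: ev.poly_eval_simps v)
qed (auto simp: ev.poly_eval_simps intro: regular_const regular_add)

text \<open>Conjugation of \<open>u\<^sup>T\<close> by \<open>J\<close>.\<close>

definition flip :: "nat \<Rightarrow> complex mat \<Rightarrow> complex mat" where
  "flip m u = mat m m (\<lambda>(a, b). u $$ (m - 1 - b, m - 1 - a))"

lemma flip_unip: "u \<in> unip m \<Longrightarrow> flip m u \<in> unip m"
  unfolding unip_iff flip_def by auto

lemma flip_flip: "u \<in> carrier_mat m m \<Longrightarrow> flip m (flip m u) = u"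
  unfolding flip_def by (rule eq_matI) auto

text \<open>The identity J u = (flip u)^T J, applied to w and read entry by entry.\<close>

lemma flip_mult_entry:
  assumes "u \<in> carrier_mat m m" "w \<in> carrier_mat m m" "i < m" "j < m"
  shows "(u * w) $$ (m - 1 - i, j) = (\<Sum>k<m. flip m u $$ (k, i) * w $$ (m - 1 - k, j))"
proof -
  have "(u * w) $$ (m - 1 - i, j) = (\<Sum>k<m. (\<lambda>l. u $$ (m - 1 - i, l) * w $$ (l, j)) k)"
    by (rule mat_mult_entry) (use assms in auto)
  also have "\<dots> = (\<Sum>k<m. u $$ (m - 1 - i, m - 1 - k) * w $$ (m - 1 - k, j))"
    by (rule sum_lessThan_refl[symmetric])
  also have "\<dots> = (\<Sum>k<m. flip m u $$ (k, i) * w $$ (m - 1 - k, j))"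
    by (rule sum.cong) (use assms in \<open>auto simp: flip_def\<close>)
  finally show ?thesis .
qed

text \<open>J (g u)^-1 = J u^-1 g^-1 = u'^T J g^-1, where u' is the flip of u^-1, and f is invariant
  under multiplication by u'^T.\<close>

lemma gl_map_carrier:
  assumes f: "f \<in> low_inv m"
  shows "gl_map m f \<in> carrier (R_GL_mod_U m)"
  unfolding R_mod_U_carrier
proof (intro conjI ballI)
  show "gl_map m f \<in> extensional (carrier (GL m))" by (simp add: gl_map_def)
  show "regular m (gl_map m f)"
    by (rule regular_cong[OF regular_gl_map[OF low_inv_polys[OF f]]]) (simp add: gl_map_def)
  fix g u assume g: "g \<in> carrier (GL m)" and u: "u \<in> unip m"
  have uG: "u \<in> carrier (GL m)" and guG: "g * u \<in> carrier (GL m)" using u g GL_mult unip_GL by auto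
  let ?s = "\<lambda>(i, j). GL_inv m g $$ (m - 1 - i, j)"
  have "gl_map m f (g * u) = ev (\<lambda>(i, j). (GL_inv m u * GL_inv m g) $$ (m - 1 - i, j)) f"
    using guG by (simp add: gl_map_def GL_inv_mult[OF g uG])
  also have "\<dots> = ev (\<lambda>(i, j). \<Sum>k<m. flip m (GL_inv m u) $$ (k, i) * ?s (k, j)) f"
    by (rule ev_cong[OF low_inv_polys[OF f]]) (use flip_mult_entry[OF GL_inv(2)[OF uG] GL_inv(2)[OF g]] in auto)
  also have "\<dots> = ev ?s f"
    using f flip_unip[OF unip_inv[OF u]] unfolding low_inv_def by blast
  also have "\<dots> = gl_map m f g" using g by (simp add: gl_map_def)
  finally show "gl_map m f (g * u) = gl_map m f g" .
qed

lemma exists_GL_point: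
  fixes \<sigma> :: "nat \<times> nat \<Rightarrow> complex"
  assumes "det (mat m m (\<lambda>(i, j). \<sigma> (m - 1 - i, j))) \<noteq> 0"
  shows "\<exists>g\<in>carrier (GL m). \<forall>i<m. \<forall>j<m. GL_inv m g $$ (m - 1 - i, j) = \<sigma> (i, j)"
proof -
  let ?G = "mat m m (\<lambda>(i, j). \<sigma> (m - 1 - i, j))"
  have G: "?G \<in> carrier (GL m)" using assms by (simp add: GL_carrier)
  show ?thesis by (rule bexI[OF _ GL_inv(1)[OF G]]) (unfold GL_inv(6)[OF G], auto)
qed

text \<open>The witness of nonvanishing is J: reversing its rows gives the identity.\<close>

lemma polyfun_det_flip:
  "polyfun UNIV (\<lambda>\<sigma>. det (mat m m (\<lambda>(i, j). \<sigma> (m - 1 - i, j))))"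
  "det (mat m m (\<lambda>(i, j). (\<lambda>(i, j). if i + j = m - 1 then 1 else 0) (m - 1 - i, j))) \<noteq> (0::complex)"
proof -
  show "polyfun UNIV (\<lambda>\<sigma>. det (mat m m (\<lambda>(i, j). \<sigma> (m - 1 - i, j))))"
    by (rule polyfun_det) (auto intro!: polyfun_var)
  have "mat m m (\<lambda>(i, j). (\<lambda>(i, j). if i + j = m - 1 then 1 else 0) (m - 1 - i, j)) = (1\<^sub>m m :: complex mat)"
    by (rule eq_matI) auto
  then show "det (mat m m (\<lambda>(i, j). (\<lambda>(i, j). if i + j = m - 1 then 1 else 0) (m - 1 - i, j))) \<noteq> (0::complex)" by simp
qed

text \<open>The points J g^-1 are all the invertible matrices, hence dense.\<close>

lemma polyfun_eq_on_GL:
  assumes f: "polyfun UNIV f" and zero: "\<And>g \<sigma>. g \<in> carrier (GL m) \<Longrightarrow> (\<And>i j. i < m \<Longrightarrow> j < m \<Longrightarrow> \<sigma> (i, j) = GL_inv m g $$ (m - 1 - i, j)) \<Longrightarrow> f \<sigma> = 0"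
  shows "f \<sigma> = 0"
proof (rule polyfun_zero_dense[where d = "\<lambda>\<sigma>. det (mat m m (\<lambda>(i, j). \<sigma> (m - 1 - i, j)))", OF f polyfun_det_flip])
  fix \<sigma> :: "nat \<times> nat \<Rightarrow> complex"
  assume "det (mat m m (\<lambda>(i, j). \<sigma> (m - 1 - i, j))) \<noteq> 0"
  from exists_GL_point[OF this] obtain g where g: "g \<in> carrier (GL m)"
    "\<forall>i<m. \<forall>j<m. GL_inv m g $$ (m - 1 - i, j) = \<sigma> (i, j)" by (elim bexE) (rule that)
  show "f \<sigma> = 0" by (rule zero[OF g(1)]) (use g(2) in simp)
qed

lemma gl_map_inj:
  assumes "f \<in> polys (top_vars m)" "f' \<in> polys (top_vars m)" "gl_map m f = gl_map m f'"
  shows "f = f'"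
proof (rule cpoly_eqI)
  fix \<sigma> :: "nat \<times> nat \<Rightarrow> complex"
  have "polyfun UNIV (\<lambda>\<sigma>. ev \<sigma> (f - f'))" by (rule polyfun_ev[OF polys_UNIV])
  then have "ev \<sigma> (f - f') = 0"
  proof (rule polyfun_eq_on_GL[where f = "\<lambda>\<sigma>. ev \<sigma> (f - f')"])
    fix g and \<sigma> :: "nat \<times> nat \<Rightarrow> complex"
    assume g: "g \<in> carrier (GL m)" and s: "\<And>i j. i < m \<Longrightarrow> j < m \<Longrightarrow> \<sigma> (i, j) = GL_inv m g $$ (m - 1 - i, j)"
    have "ev \<sigma> p = ev (\<lambda>(i, j). GL_inv m g $$ (m - 1 - i, j)) p" if "p \<in> polys (top_vars m)" for p
      by (rule ev_cong[OF that]) (use s in auto)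
    then show "ev \<sigma> (f - f') = 0"
      using fun_cong[OF assms(3), of g] g assms(1,2) by (simp add: gl_map_def ev.poly_eval_simps)
  qed
  then show "ev \<sigma> f = ev \<sigma> f'" by (simp add: ev.poly_eval_simps)
qed

text \<open>Constancy on the cosets g U_m is the invariance of f at the points J g^-1, and density
  carries it to all matrices.\<close>

lemma gl_map_surj:
  assumes F: "F \<in> carrier (R_GL_mod_U m)" and p: "p \<in> polys (top_vars m)"
    and Fp: "\<And>g. g \<in> carrier (GL m) \<Longrightarrow> F g = ev (\<lambda>ij. GL_inv m g $$ ij) p"
  shows "\<exists>f\<in>low_inv m. F = gl_map m f"
proof -
  define f where "f = poly_eval const_poly (\<lambda>(i, j). var (m - 1 - i, j)) p"
  have f: "f \<in> polys (top_vars m)" unfolding f_def by (rule subst_in_polys[OF p]) auto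
  have Ff: "F g = ev (\<lambda>(i, j). GL_inv m g $$ (m - 1 - i, j)) f" if "g \<in> carrier (GL m)" for g
    unfolding Fp[OF that] f_def ev_subst
    by (rule ev_cong[OF p]) (auto simp: ev.poly_eval_simps)
  have "f \<in> low_inv m" unfolding low_inv_def
  proof (intro CollectI conjI f ballI allI)
    fix u and \<sigma> :: "nat \<times> nat \<Rightarrow> complex" assume u: "u \<in> unip m"
    have uc: "u \<in> carrier_mat m m" using u by (simp add: unip_iff)
    \<comment> \<open>Chosen so that J (g w)^-1 = J (flip u) g^-1 = u^T J g^-1; flipping twice gives
      u back.\<close>
    define w where "w = GL_inv m (flip m u)"
    have fuG: "flip m u \<in> carrier (GL m)" using flip_unip[OF u] by (rule unip_GL)
    have w: "w \<in> unip m" "GL_inv m w = flip m u" "w \<in> carrier (GL m)"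
      unfolding w_def using unip_inv[OF flip_unip[OF u]] GL_inv(6)[OF fuG] GL_inv(1)[OF fuG] by auto
    let ?h = "\<lambda>\<sigma>. ev (\<lambda>(i, j). \<Sum>k<m. u $$ (k, i) * \<sigma> (k, j)) f - ev \<sigma> f"
    have "polyfun UNIV (\<lambda>\<sigma>. ev (\<lambda>(i, j). \<Sum>k<m. u $$ (k, i) * \<sigma> (k, j)) f)"
      by (rule polyfun_compose[OF f]) (auto intro!: polyfun_sum polyfun_mult polyfun_var)
    then have "polyfun UNIV ?h" by (rule polyfun_diff[OF _ polyfun_ev[OF polys_UNIV]])
    then have "?h \<sigma> = 0"
    proof (rule polyfun_eq_on_GL[where f = ?h])
      fix g and \<sigma> :: "nat \<times> nat \<Rightarrow> complex"
      assume g: "g \<in> carrier (GL m)" and s: "\<And>i j. i < m \<Longrightarrow> j < m \<Longrightarrow> \<sigma> (i, j) = GL_inv m g $$ (m - 1 - i, j)"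
      have gw: "g * w \<in> carrier (GL m)" using g w(3) by (rule GL_mult)
      have "ev \<sigma> f = ev (\<lambda>(i, j). GL_inv m g $$ (m - 1 - i, j)) f" by (rule ev_cong[OF f]) (use s in auto)
      also have "\<dots> = F (g * w)" using F g w(1) Ff[OF g] by (simp add: R_mod_U_carrier)
      also have "\<dots> = ev (\<lambda>(i, j). (flip m u * GL_inv m g) $$ (m - 1 - i, j)) f"
        using Ff[OF gw] by (simp add: GL_inv_mult[OF g w(3)] w(2))
      also have "\<dots> = ev (\<lambda>(i, j). \<Sum>k<m. u $$ (k, i) * \<sigma> (k, j)) f"
      proof (rule ev_cong[OF f])
        fix v assume "v \<in> top_vars m"
        then obtain i j where v: "v = (i, j)" "i < m" "j < m" by auto
        have "(flip m u * GL_inv m g) $$ (m - 1 - i, j) = (\<Sum>k<m. flip m (flip m u) $$ (k, i) * GL_inv m g $$ (m - 1 - k, j))"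
          by (rule flip_mult_entry[OF _ GL_inv(2)[OF g] v(2,3)]) (simp add: flip_def)
        also have "\<dots> = (\<Sum>k<m. u $$ (k, i) * \<sigma> (k, j))"
          by (rule sum.cong) (use s v flip_flip[OF uc] in auto)
        finally show "(case v of (i, j) \<Rightarrow> (flip m u * GL_inv m g) $$ (m - 1 - i, j)) = (case v of (i, j) \<Rightarrow> \<Sum>k<m. u $$ (k, i) * \<sigma> (k, j))"
          using v by simp
      qed
      finally show "?h \<sigma> = 0" by simp
    qed
    then show "ev (\<lambda>(i, j). \<Sum>k<m. u $$ (k, i) * \<sigma> (k, j)) f = ev \<sigma> f" by simp
  qed
  moreover have "F = gl_map m f"
    using F Ff by (intro extensionalityI[of _ "carrier (GL m)"]) (auto simp: R_mod_U_carrier gl_map_def)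
  ultimately show ?thesis by blast
qed

text \<open>(h^-1 g)^-1 = g^-1 h, so translating g on the left translates the argument of f on the
  right.\<close>

lemma left_translation_gl_map:
  assumes f: "f \<in> polys (top_vars m)" and h: "h \<in> carrier (GL m)"
  shows "left_translation m h (gl_map m f) = gl_map m (tr m h f)"
proof (rule extensionalityI[of _ "carrier (GL m)"])
  fix g assume g: "g \<in> carrier (GL m)"
  have hg: "GL_inv m h * g \<in> carrier (GL m)" using GL_inv(1)[OF h] g by (rule GL_mult)
  have inv: "GL_inv m (GL_inv m h * g) = GL_inv m g * h"
    using GL_inv_mult[OF GL_inv(1)[OF h] g] GL_inv(6)[OF h] by simp
  have "left_translation m h (gl_map m f) g = ev (\<lambda>(i, j). (GL_inv m g * h) $$ (m - 1 - i, j)) f"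
    using g hg by (simp add: left_translation_def gl_map_def inv)
  also have "\<dots> = ev (\<lambda>(i, j). \<Sum>l<m. (\<lambda>(i, j). GL_inv m g $$ (m - 1 - i, j)) (i, l) * h $$ (l, j)) f"
    by (rule ev_cong[OF f]) (use mat_mult_entry[OF GL_inv(2)[OF g] GL_inv(3)[OF h]] in auto)
  also have "\<dots> = gl_map m (tr m h f) g" using g by (simp add: gl_map_def ev_tr)
  finally show "left_translation m h (gl_map m f) g = gl_map m (tr m h f) g" .
qed (auto simp: left_translation_def gl_map_def)

lemma gl_map_ops:
  "gl_map m (f + f') = gl_map m f \<oplus>\<^bsub>R_GL_mod_U m\<^esub> gl_map m f'"
  "gl_map m (f * f') = gl_map m f \<otimes>\<^bsub>R_GL_mod_U m\<^esub> gl_map m f'"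
  "gl_map m (const_poly c * f) = c \<odot>\<^bsub>R_GL_mod_U m\<^esub> gl_map m f"
  "gl_map m 0 = \<zero>\<^bsub>R_GL_mod_U m\<^esub>" "gl_map m 1 = \<one>\<^bsub>R_GL_mod_U m\<^esub>"
  by (auto simp: gl_map_def R_mod_U_simps ev.poly_eval_simps fun_eq_iff restrict_def)

section \<open>Orthogonal projection\<close>

text \<open>Polynomials as a vector space on a type, which gives access to bases and dimensions of
  finite-dimensional subspaces.\<close>

interpretation cp: Vector_Spaces.vector_space "\<lambda>c (p :: 'v cpoly). const_poly c * p"
  by unfold_locales (auto simp: const_poly_add const_poly_mult algebra_simps)

lemma cp_subspace_iff:
  "cp.subspace W \<longleftrightarrow> 0 \<in> W \<and> (\<forall>x\<in>W. \<forall>y\<in>W. x + y \<in> W) \<and> (\<forall>c. \<forall>x\<in>W. const_poly c * x \<in> W)"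
  by (simp add: cp.subspace_def)

lemma cp_finite_basis:
  assumes W: "cp.subspace W" "W \<subseteq> cp.span S" "finite S"
  shows "\<exists>b. finite b \<and> b \<subseteq> W \<and> W = cp.span b \<and> cp.independent b \<and> card b = cp.dim W"
proof -
  obtain b where b: "b \<subseteq> W" "cp.independent b" "W \<subseteq> cp.span b" "card b = cp.dim W"
    by (rule cp.basis_exists)
  have "b \<subseteq> cp.span S" using b(1) W(2) by (rule subset_trans)
  then have "finite b" using cp.independent_span_bound[OF W(3) b(2)] by simp
  moreover have "cp.span b \<subseteq> W" using b(1) W(1) by (rule cp.span_minimal)
  ultimately show ?thesis using b by (intro exI[of _ b]) auto
qed

lemma cp_dim_less:
  assumes A: "cp.subspace A" and B: "cp.subspace B" "B \<subseteq> cp.span S" "finite S" and AB: "A \<subset> B"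
  shows "cp.dim A < cp.dim B"
proof -
  have AS: "A \<subseteq> cp.span S" using AB B(2) by blast
  obtain a where a: "finite a" "a \<subseteq> A" "A = cp.span a" "cp.independent a" "card a = cp.dim A"
    using cp_finite_basis[OF A AS B(3)] by (elim exE conjE) (rule that)
  obtain b where b: "finite b" "b \<subseteq> B" "B = cp.span b" "cp.independent b" "card b = cp.dim B"
    using cp_finite_basis[OF B] by (elim exE conjE) (rule that)
  obtain x where x: "x \<in> B" "x \<notin> A" using AB by blast
  have "cp.independent (insert x a)" using x(2) a(3,4) by (intro cp.independent_insertI) auto
  moreover have "insert x a \<subseteq> cp.span b" using x(1) a(2) AB b(3) by auto
  ultimately have "card (insert x a) \<le> card b" using cp.independent_span_bound[OF b(1)] by blast
  moreover have "x \<notin> a" using x(2) a(2) by auto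
  ultimately show ?thesis using a b by simp
qed

text \<open>Gram-Schmidt: a new generator x is replaced by its component y orthogonal to the old
  span, and the projection onto the line of y is added.\<close>

lemma fischer_projection:
  assumes "finite S"
  shows "\<exists>w\<in>cp.span S. \<forall>s\<in>cp.span S. fischer (v - w) s = 0"
  using assms
proof (induction S arbitrary: v)
  case empty
  show ?case by (rule bexI[of _ 0]) auto
next
  case (insert x S)
  obtain wx where wx: "wx \<in> cp.span S" "\<forall>s\<in>cp.span S. fischer (x - wx) s = 0"
    using insert.IH[of x] by (elim bexE) (rule that)
  obtain w0 where w0: "w0 \<in> cp.span S" "\<forall>s\<in>cp.span S. fischer (v - w0) s = 0"
    using insert.IH[of v] by (elim bexE) (rule that)
  show ?case
  proof (cases "x - wx = 0")
    case True
    then have "x \<in> cp.span S" using wx(1) by simp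
    then show ?thesis using cp.span_redundant[of x S] w0 by auto
  next
    case False
    define y where "y = x - wx"
    have yy: "fischer y y \<noteq> 0" using fischer_self_eq_0[of y] False by (auto simp: y_def)
    define c where "c = fischer (v - w0) y / fischer y y"
    have sub: "cp.span S \<subseteq> cp.span (insert x S)" by (rule cp.span_mono) auto
    have y_in: "y \<in> cp.span (insert x S)" unfolding y_def
    proof (rule cp.span_diff)
      show "x \<in> cp.span (insert x S)" by (rule cp.span_base) simp
      show "wx \<in> cp.span (insert x S)" using sub wx(1) by (rule subsetD)
    qed
    show ?thesis
    proof (rule bexI[of _ "w0 + const_poly c * y"], rule ballI)
      fix s assume "s \<in> cp.span (insert x S)"
      then obtain k where k: "s - const_poly k * x \<in> cp.span S" by (auto simp: cp.span_breakdown_eq)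
      define s1 where "s1 = s - const_poly k * x + const_poly k * wx"
      \<comment> \<open>With s = s1 + k y and s1 in the old span, orthogonality need only be tested
        on s1 and on y.\<close>
      have s1: "s1 \<in> cp.span S" unfolding s1_def using k wx(1) by (intro cp.span_add cp.span_scale)
      have s: "s = s1 + const_poly k * y" by (simp add: s1_def y_def algebra_simps)
      have d: "v - (w0 + const_poly c * y) = (v - w0) - const_poly c * y" by simp
      have "fischer (v - (w0 + const_poly c * y)) s1 = 0"
        unfolding d fischer_diff_left fischer_scale_left using w0(2) wx(2) s1 by (simp add: y_def fischer_diff_left)
      moreover have "fischer (v - (w0 + const_poly c * y)) y = 0"
        unfolding d fischer_diff_left[of "v - w0"] fischer_scale_left using yy by (simp add: c_def)
      ultimately show "fischer (v - (w0 + const_poly c * y)) s = 0"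
        unfolding s fischer_add_right fischer_scale_right by simp
    qed (use w0(1) sub y_in in \<open>auto intro!: cp.span_add cp.span_scale\<close>)
  qed
qed

text \<open>The representing element is built one generator at a time, along the same
  orthogonalisation as the projection.\<close>

lemma fischer_riesz:
  assumes "finite S" and add: "\<And>p q. p \<in> cp.span S \<Longrightarrow> q \<in> cp.span S \<Longrightarrow> \<psi> (p + q) = \<psi> p + \<psi> q"
    and scale: "\<And>c p. p \<in> cp.span S \<Longrightarrow> \<psi> (const_poly c * p) = c * \<psi> p"
  shows "\<exists>w\<in>cp.span S. \<forall>s\<in>cp.span S. \<psi> s = fischer s w"
  using assms
proof (induction S)
  case empty
  have "\<psi> 0 = 0" using empty(2)[of 0 0] by simp
  then show ?case by (intro bexI[of _ 0]) auto
next
  case (insert x S)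
  have sub: "cp.span S \<subseteq> cp.span (insert x S)" by (rule cp.span_mono) auto
  have "\<exists>w\<in>cp.span S. \<forall>s\<in>cp.span S. \<psi> s = fischer s w"
  proof (rule insert.IH)
    show "\<psi> (p + q) = \<psi> p + \<psi> q" if "p \<in> cp.span S" "q \<in> cp.span S" for p q
      by (rule insert.prems(1)) (use that sub in blast)+
    show "\<psi> (const_poly c * p) = c * \<psi> p" if "p \<in> cp.span S" for c p
      by (rule insert.prems(2)) (use that sub in blast)
  qed
  then obtain w0 where w0: "w0 \<in> cp.span S" "\<forall>s\<in>cp.span S. \<psi> s = fischer s w0" by (elim bexE) (rule that)
  obtain wx where wx: "wx \<in> cp.span S" "\<forall>s\<in>cp.span S. fischer (x - wx) s = 0"
    using fischer_projection[OF insert.hyps(1), of x] by (elim bexE) (rule that)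
  show ?case
  proof (cases "x - wx = 0")
    case True
    then have "x \<in> cp.span S" using wx(1) by simp
    then show ?thesis using cp.span_redundant[of x S] w0 by auto
  next
    case False
    define y where "y = x - wx"
    have yy: "fischer y y \<noteq> 0" using fischer_self_eq_0[of y] False by (auto simp: y_def)
    have y_in: "y \<in> cp.span (insert x S)" unfolding y_def
    proof (rule cp.span_diff)
      show "x \<in> cp.span (insert x S)" by (rule cp.span_base) simp
      show "wx \<in> cp.span (insert x S)" using sub wx(1) by (rule subsetD)
    qed
    have y_orth: "fischer y s = 0" "fischer s y = 0" if "s \<in> cp.span S" for s
      using wx(2) that fischer_commute[of y s] by (auto simp: y_def)
    \<comment> \<open>This coefficient enters conjugated below, since the form is conjugate linear
      in its second argument.\<close>
    define c where "c = \<psi> y / fischer y y"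
    show ?thesis
    proof (rule bexI[of _ "w0 + const_poly (cnj c) * y"], rule ballI)
      fix s assume "s \<in> cp.span (insert x S)"
      then obtain k where k: "s - const_poly k * x \<in> cp.span S" by (auto simp: cp.span_breakdown_eq)
      define s1 where "s1 = s - const_poly k * x + const_poly k * wx"
      have s1: "s1 \<in> cp.span S" unfolding s1_def using k wx(1) by (intro cp.span_add cp.span_scale)
      have s: "s = s1 + const_poly k * y" by (simp add: s1_def y_def algebra_simps)
      have "\<psi> s = \<psi> s1 + k * \<psi> y"
        unfolding s using insert.prems(1)[of s1 "const_poly k * y"] insert.prems(2)[OF y_in] s1 sub y_in
        by (auto intro: cp.span_scale)
      also have "\<dots> = fischer s (w0 + const_poly (cnj c) * y)"
        unfolding s fischer_add_right fischer_scale_right fischer_add_left fischer_scale_left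
        using w0 s1 y_orth yy by (simp add: c_def)
      finally show "\<psi> s = fischer s (w0 + const_poly (cnj c) * y)" .
    qed (use w0(1) sub y_in in \<open>auto intro!: cp.span_add cp.span_scale\<close>)
  qed
qed

section \<open>The adjoint of a substitution\<close>

lemma pderiv_var_add: "pderiv_var v (p + q) = pderiv_var v p + pderiv_var v q"
  by (rule poly_mapping_eqI) (simp add: lookup_pderiv_var lookup_add algebra_simps)

lemma pderiv_var_0 [simp]: "pderiv_var v 0 = 0"
  by (rule poly_mapping_eqI) (simp add: lookup_pderiv_var)

lemma pderiv_var_sum: "pderiv_var v (sum f A) = (\<Sum>a\<in>A. pderiv_var v (f a))"
  by (induction A rule: infinite_finite_induct) (auto simp: pderiv_var_add)

lemma pderiv_var_scale: "pderiv_var v (const_poly c * p) = const_poly c * pderiv_var v p"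
  by (rule poly_mapping_eqI) (simp add: lookup_pderiv_var lookup_const_mult)

lemma pderiv_var_const: "pderiv_var v (const_poly c) = 0"
  by (rule pderiv_var_eq_0[of _ "{}"]) auto

lemma pderiv_var_single:
  "pderiv_var v (Poly_Mapping.single \<mu> c) = Poly_Mapping.single (\<mu> - Poly_Mapping.single v 1) (of_nat (Poly_Mapping.lookup \<mu> v) * c)"
  by (simp add: pderiv_var_def)

lemma pderiv_var_var_mult: "pderiv_var v (var w * p) = (if v = w then p else 0) + var w * pderiv_var v p"
proof (induction p rule: poly_mapping_additive_induct)
  case (single \<mu> c)
  let ?ev = "Poly_Mapping.single v (1::nat)" and ?ew = "Poly_Mapping.single w (1::nat)"
  have L: "pderiv_var v (var w * Poly_Mapping.single \<mu> c) =
      Poly_Mapping.single (?ew + \<mu> - ?ev) (of_nat (Poly_Mapping.lookup (?ew + \<mu>) v) * c)"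
    unfolding var_def mult_single pderiv_var_single by simp
  have R: "var w * pderiv_var v (Poly_Mapping.single \<mu> c) = Poly_Mapping.single (?ew + (\<mu> - ?ev)) (of_nat (Poly_Mapping.lookup \<mu> v) * c)"
    unfolding var_def mult_single pderiv_var_single by simp
  \<comment> \<open>Truncated subtraction commutes with this addition when v occurs in \<mu>; when
    it does not, the derivative of the monomial is 0 and the rule is checked directly.\<close>
  have shift: "?ew + \<mu> - ?ev = ?ew + (\<mu> - ?ev)" if "Poly_Mapping.lookup \<mu> v \<noteq> 0"
    by (rule poly_mapping_eqI) (use that in \<open>auto simp: lookup_add lookup_minus lookup_single when_def\<close>)
  show ?case
  proof (cases "v = w")
    case True
    have e: "?ev + \<mu> - ?ev = \<mu>" by simp
    show ?thesis
    proof (cases "Poly_Mapping.lookup \<mu> v = 0")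
      case True
      then show ?thesis unfolding L R using \<open>v = w\<close> e by (simp add: lookup_add)
    next
      case False
      then have "?ev + (\<mu> - ?ev) = \<mu>" using shift \<open>v = w\<close> e by simp
      then show ?thesis unfolding L R using \<open>v = w\<close> e by (simp add: lookup_add single_add distrib_right)
    qed
  next
    case False
    then show ?thesis unfolding L R using shift
      by (cases "Poly_Mapping.lookup \<mu> v = 0") (auto simp: lookup_add lookup_single when_def)
  qed
qed (simp_all add: pderiv_var_add distrib_left)

text \<open>The chain rule: x -> x h sends the variables of row s to linear forms in row s, so the
  derivatives within that row are mixed by h.\<close>

lemma pderiv_var_tr:
  assumes q: "q \<in> polys (top_vars m)" and j: "j < m"
  shows "pderiv_var (s, j) (tr m h q) = (\<Sum>k<m. const_poly (h $$ (j, k)) * tr m h (pderiv_var (s, k) q))"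
  using q
proof (induction q rule: polys_induct)
  case (const c)
  show ?case by (simp add: tr_simps pderiv_var_const)
next
  case (add p q)
  then show ?case by (simp add: tr_simps pderiv_var_add distrib_left sum.distrib)
next
  case (var v q)
  obtain a b where v: "v = (a, b)" "a < m" "b < m" using var by auto
  let ?L = "\<Sum>l<m. const_poly (h $$ (l, b)) * var (a, l)"
  have T: "tr m h (var v * q) = (\<Sum>l<m. const_poly (h $$ (l, b)) * (var (a, l) * tr m h q))"
    by (simp add: v(1) tr_simps sum_distrib_right mult.assoc)
  have "pderiv_var (s, j) (tr m h (var v * q)) =
    (\<Sum>l<m. const_poly (h $$ (l, b)) * ((if (s, j) = (a, l) then tr m h q else 0) + var (a, l) * pderiv_var (s, j) (tr m h q)))"
    by (simp only: T pderiv_var_sum pderiv_var_scale pderiv_var_var_mult)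
  also have "\<dots> = (\<Sum>l<m. if l = j then (if s = a then const_poly (h $$ (j, b)) * tr m h q else 0) else 0) + ?L * pderiv_var (s, j) (tr m h q)"
    unfolding distrib_left sum.distrib sum_distrib_right mult.assoc
    by (intro arg_cong2[where f = "(+)"] sum.cong refl) auto
  also have "\<dots> = (if s = a then const_poly (h $$ (j, b)) * tr m h q else 0) + ?L * pderiv_var (s, j) (tr m h q)"
    using j by simp
  also have "\<dots> = (\<Sum>k<m. if k = b then (if s = a then const_poly (h $$ (j, k)) * tr m h q else 0) else 0)
      + (\<Sum>k<m. const_poly (h $$ (j, k)) * (?L * tr m h (pderiv_var (s, k) q)))"
    unfolding var(3) using v(3) by (simp add: sum_distrib_left mult_ac)
  also have "\<dots> = (\<Sum>k<m. const_poly (h $$ (j, k)) * tr m h (pderiv_var (s, k) (var v * q)))"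
    unfolding sum.distrib[symmetric]
    by (rule sum.cong) (auto simp: v(1) pderiv_var_var_mult tr_simps distrib_left)
  finally show ?case .
qed

lemma lookup_0_eq_ev: "Poly_Mapping.lookup q 0 = ev (\<lambda>_. 0) q"
proof (induction q rule: poly_mapping_additive_induct)
  case (single \<mu> c)
  show ?case
  proof (cases "\<mu> = 0")
    case False
    then obtain v where "v \<in> Poly_Mapping.keys \<mu>" by (metis all_not_in_conv keys_eq_empty)
    then have "mon_eval (\<lambda>_. 0::complex) \<mu> = 0" unfolding mon_eval_def
      by (intro prod_zero) (auto simp: in_keys_iff)
    then show ?thesis using False by (simp add: ev.poly_eval_single lookup_single)
  qed (simp add: ev.poly_eval_single)
qed (simp_all add: lookup_add ev.poly_eval_simps)

definition ctrans :: "nat \<Rightarrow> complex mat \<Rightarrow> complex mat" where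
  "ctrans m h = mat m m (\<lambda>(i, j). cnj (h $$ (j, i)))"

text \<open>A variable on the left becomes a derivative on the right, and the chain rule for the
  conjugate transpose produces the same sum with conjugated coefficients. For constants only the
  value of q at 0 matters, which the substitution preserves.\<close>

lemma fischer_tr:
  assumes "f \<in> polys (top_vars m)" "q \<in> polys (top_vars m)"
  shows "fischer (tr m h f) q = fischer f (tr m (ctrans m h) q)"
  using assms
proof (induction f arbitrary: q rule: polys_induct)
  case (const c)
  have "fischer (const_poly c) q = c * cnj (Poly_Mapping.lookup q 0)" for q :: "(nat \<times> nat) cpoly"
    by (simp add: const_poly_def fischer_single mfact_def)
  then show ?case by (simp add: tr_simps lookup_0_eq_ev ev_tr case_prod_unfold)
next
  case (add p p')
  then show ?case by (simp add: tr_simps fischer_add_left)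
next
  case (var v f)
  obtain s j where v: "v = (s, j)" "j < m" using var by auto
  have "fischer (tr m h (var v * f)) q = (\<Sum>l<m. h $$ (l, j) * fischer (tr m h f) (pderiv_var (s, l) q))"
    by (simp add: v(1) tr_simps sum_distrib_right mult.assoc fischer_sum_left fischer_scale_left fischer_var_mult)
  also have "\<dots> = (\<Sum>l<m. h $$ (l, j) * fischer f (tr m (ctrans m h) (pderiv_var (s, l) q)))"
    by (simp add: var(3)[OF pderiv_var_in_polys[OF var(4)]])
  also have "\<dots> = (\<Sum>l<m. fischer f (const_poly (ctrans m h $$ (j, l)) * tr m (ctrans m h) (pderiv_var (s, l) q)))"
    by (rule sum.cong) (use v in \<open>auto simp: fischer_scale_right ctrans_def\<close>)
  also have "\<dots> = fischer (var v * f) (tr m (ctrans m h) q)"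
    by (simp add: v(1) fischer_var_mult pderiv_var_tr[OF var(4) v(2)] fischer_sum_right)
  finally show ?case .
qed

lemma ctrans_GL:
  assumes h: "h \<in> carrier (GL m)"
  shows "ctrans m h \<in> carrier (GL m)"
proof (rule GL_inv_unique(1))
  let ?g = "GL_inv m h"
  note H = GL_inv[OF h]
  show c: "ctrans m h \<in> carrier_mat m m" "ctrans m ?g \<in> carrier_mat m m" by (simp_all add: ctrans_def)
  show "ctrans m h * ctrans m ?g = 1\<^sub>m m"
  proof (rule eq_matI)
    fix i j assume "i < dim_row (1\<^sub>m m :: complex mat)" "j < dim_col (1\<^sub>m m :: complex mat)"
    then have ij: "i < m" "j < m" by auto
    have "(ctrans m h * ctrans m ?g) $$ (i, j) = (\<Sum>k<m. cnj (?g $$ (j, k) * h $$ (k, i)))"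
      unfolding mat_mult_entry[OF c ij] by (rule sum.cong) (use ij in \<open>auto simp: ctrans_def\<close>)
    also have "\<dots> = cnj ((?g * h) $$ (j, i))" unfolding mat_mult_entry[OF H(2,3) ij(2,1)] by simp
    also have "\<dots> = 1\<^sub>m m $$ (i, j)" unfolding H(5) using ij by simp
    finally show "(ctrans m h * ctrans m ?g) $$ (i, j) = 1\<^sub>m m $$ (i, j)" .
  qed (auto simp: ctrans_def)
qed

text \<open>These pairings serve as the matrix coefficients of the action. Each variable of f
  contributes entries of h, while the adjoint derivative moves to q.\<close>

lemma fischer_tr_poly:
  assumes "f \<in> polys (top_vars m)"
  shows "\<exists>p\<in>polys (top_vars m). \<forall>h. fischer (tr m h f) q = ev (\<lambda>ij. h $$ ij) p"
  using assms
proof (induction f arbitrary: q rule: polys_induct)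
  case (const c)
  show ?case by (rule bexI[of _ "const_poly (fischer (const_poly c) q)"]) (auto simp: tr_simps ev.poly_eval_simps)
next
  case (add f f')
  obtain p where p: "p \<in> polys (top_vars m)" "\<forall>h. fischer (tr m h f) q = ev (\<lambda>ij. h $$ ij) p"
    using add(3)[of q] by (elim bexE) (rule that)
  obtain p' where p': "p' \<in> polys (top_vars m)" "\<forall>h. fischer (tr m h f') q = ev (\<lambda>ij. h $$ ij) p'"
    using add(4)[of q] by (elim bexE) (rule that)
  show ?case by (rule bexI[OF _ add_in_polys[OF p(1) p'(1)]]) (simp add: tr_simps fischer_add_left ev.poly_eval_simps p(2) p'(2))
next
  case (var v f)
  obtain s j where v: "v = (s, j)" "j < m" using var by auto
  have "\<forall>l. \<exists>p. p \<in> polys (top_vars m) \<and> (\<forall>h. fischer (tr m h f) (pderiv_var (s, l) q) = ev (\<lambda>ij. h $$ ij) p)"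
    using var(3) by blast
  then obtain P where P: "\<forall>l. P l \<in> polys (top_vars m) \<and> (\<forall>h. fischer (tr m h f) (pderiv_var (s, l) q) = ev (\<lambda>ij. h $$ ij) (P l))"
    by (rule choice[THEN exE])
  have "fischer (tr m h (var v * f)) q = ev (\<lambda>ij. h $$ ij) (\<Sum>l<m. var (l, j) * P l)" for h
    using P by (simp add: v(1) tr_simps sum_distrib_right mult.assoc fischer_sum_left fischer_scale_left fischer_var_mult ev.poly_eval_simps)
  moreover have "(\<Sum>l<m. var (l, j) * P l) \<in> polys (top_vars m)"
    using P v by (intro sum_in_polys mult_in_polys) auto
  ultimately show ?case by blast
qed

section \<open>Polynomials of bounded degree\<close>

definition tdeg :: "('v \<Rightarrow>\<^sub>0 nat) \<Rightarrow> nat" where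
  "tdeg \<mu> = (\<Sum>v\<in>Poly_Mapping.keys \<mu>. Poly_Mapping.lookup \<mu> v)"

text \<open>The filtration by total degree, stable under the action, cuts the infinite-dimensional
  ring into finite-dimensional invariant pieces.\<close>

definition deg_le :: "nat \<Rightarrow> 'v cpoly \<Rightarrow> bool" where
  "deg_le N p \<longleftrightarrow> (\<forall>\<mu>\<in>Poly_Mapping.keys p. tdeg \<mu> \<le> N)"

lemma tdeg_superset:
  assumes "finite V" "Poly_Mapping.keys \<mu> \<subseteq> V"
  shows "tdeg \<mu> = (\<Sum>v\<in>V. Poly_Mapping.lookup \<mu> v)"
  unfolding tdeg_def by (rule sum.mono_neutral_left) (use assms in \<open>auto simp: in_keys_iff\<close>)

lemma tdeg_add: "tdeg (\<mu> + \<nu>) = tdeg \<mu> + tdeg \<nu>"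
proof -
  let ?V = "Poly_Mapping.keys \<mu> \<union> Poly_Mapping.keys \<nu>"
  have "Poly_Mapping.keys (\<mu> + \<nu>) \<subseteq> ?V" by (rule keys_add)
  then show ?thesis by (simp add: tdeg_superset[of ?V] lookup_add sum.distrib)
qed

lemma deg_le_0 [simp]: "deg_le N 0"
  by (simp add: deg_le_def)

lemma deg_le_add: "deg_le N p \<Longrightarrow> deg_le N q \<Longrightarrow> deg_le N (p + q)"
  using keys_add[of p q] by (auto simp: deg_le_def)

lemma deg_le_sum: "(\<And>a. a \<in> A \<Longrightarrow> deg_le N (f a)) \<Longrightarrow> deg_le N (sum f A)"
  by (induction A rule: infinite_finite_induct) (auto intro: deg_le_add)

lemma deg_le_mult:
  assumes "deg_le M p" "deg_le N q"
  shows "deg_le (M + N) (p * q)"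
  unfolding deg_le_def
proof
  fix \<mu> assume "\<mu> \<in> Poly_Mapping.keys (p * q)"
  then obtain a b where "a \<in> Poly_Mapping.keys p" "b \<in> Poly_Mapping.keys q" "\<mu> = a + b"
    using keys_mult[of p q] by blast
  then show "tdeg \<mu> \<le> M + N" using assms by (auto simp: deg_le_def tdeg_add intro: add_mono)
qed

lemma deg_le_const: "deg_le 0 (const_poly c)"
  by (simp add: deg_le_def const_poly_def tdeg_def)

lemma deg_le_scale: "deg_le N p \<Longrightarrow> deg_le N (const_poly c * p)"
  using deg_le_mult[OF deg_le_const, of N p c] by simp

lemma deg_le_var: "deg_le 1 (var v)"
  by (simp add: deg_le_def var_def tdeg_def)

lemma deg_le_power: "deg_le 1 p \<Longrightarrow> deg_le k (p ^ k)"
proof (induction k)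
  case 0
  show ?case using deg_le_const[of 1] by simp
next
  case (Suc k)
  then show ?case using deg_le_mult[of 1 p k "p ^ k"] by simp
qed

lemma deg_le_mon:
  assumes "\<And>v. deg_le 1 (\<tau> v)"
  shows "deg_le (tdeg \<mu>) (mon_eval \<tau> \<mu>)"
proof -
  have "deg_le (\<Sum>v\<in>A. Poly_Mapping.lookup \<mu> v) (\<Prod>v\<in>A. \<tau> v ^ Poly_Mapping.lookup \<mu> v)" if "finite A" for A
    using that
  proof induction
    case empty
    show ?case using deg_le_const[of 1] by simp
  next
    case (insert v A)
    then show ?case using deg_le_mult[OF deg_le_power[OF assms]] by simp
  qed
  then show ?thesis by (simp add: tdeg_def mon_eval_def)
qed

lemma deg_le_mono: "deg_le M p \<Longrightarrow> M \<le> N \<Longrightarrow> deg_le N p"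
  by (auto simp: deg_le_def)

lemma deg_le_tr:
  assumes "deg_le N p"
  shows "deg_le N (tr m h p)"
  unfolding tr_def poly_eval_eq
proof (intro deg_le_sum deg_le_scale)
  fix \<mu> assume "\<mu> \<in> Poly_Mapping.keys p"
  then have "tdeg \<mu> \<le> N" using assms by (simp add: deg_le_def)
  moreover have "deg_le (tdeg \<mu>) (mon_eval (\<lambda>(i, j). \<Sum>l<m. const_poly (h $$ (l, j)) * var (i, l)) \<mu>)"
    by (rule deg_le_mon) (auto intro!: deg_le_sum deg_le_scale deg_le_var[unfolded One_nat_def])
  ultimately show "deg_le N (mon_eval (\<lambda>(i, j). \<Sum>l<m. const_poly (h $$ (l, j)) * var (i, l)) \<mu>)"
    by (rule deg_le_mono[rotated])
qed

lemma exists_deg_le: "\<exists>N. deg_le N p"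
proof -
  have "tdeg \<mu> \<le> (\<Sum>\<nu>\<in>Poly_Mapping.keys p. tdeg \<nu>)" if "\<mu> \<in> Poly_Mapping.keys p" for \<mu>
    using that by (intro member_le_sum) auto
  then show ?thesis unfolding deg_le_def by blast
qed

lemma finite_bounded_monomials:
  assumes "finite V"
  shows "finite {\<mu> :: 'v \<Rightarrow>\<^sub>0 nat. Poly_Mapping.keys \<mu> \<subseteq> V \<and> tdeg \<mu> \<le> N}"
proof (rule finite_imageD)
  have "Poly_Mapping.lookup \<mu> v \<le> N" if "Poly_Mapping.keys \<mu> \<subseteq> V" "tdeg \<mu> \<le> N" for \<mu> :: "'v \<Rightarrow>\<^sub>0 nat" and v
  proof (cases "v \<in> V")
    case True
    have "Poly_Mapping.lookup \<mu> v \<le> (\<Sum>v\<in>V. Poly_Mapping.lookup \<mu> v)"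
      using True assms by (intro member_le_sum) auto
    then show ?thesis using that tdeg_superset[OF assms that(1)] by simp
  next
    case False
    then have "Poly_Mapping.lookup \<mu> v = 0" using that(1) by (auto simp: in_keys_iff)
    then show ?thesis by simp
  qed
  moreover have "Poly_Mapping.lookup \<mu> v = 0" if "Poly_Mapping.keys \<mu> \<subseteq> V" "v \<notin> V" for \<mu> :: "'v \<Rightarrow>\<^sub>0 nat" and v
    using that by (auto simp: in_keys_iff)
  ultimately have "Poly_Mapping.lookup ` {\<mu>. Poly_Mapping.keys \<mu> \<subseteq> V \<and> tdeg \<mu> \<le> N}
      \<subseteq> {f. \<forall>v. (v \<in> V \<longrightarrow> f v \<in> {..N}) \<and> (v \<notin> V \<longrightarrow> f v = 0)}"
    by (intro image_subsetI) simp
  moreover have "finite {f :: 'v \<Rightarrow> nat. \<forall>v. (v \<in> V \<longrightarrow> f v \<in> {..N}) \<and> (v \<notin> V \<longrightarrow> f v = 0)}"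
    by (rule finite_set_of_finite_funs) (use assms in auto)
  ultimately show "finite (Poly_Mapping.lookup ` {\<mu> :: 'v \<Rightarrow>\<^sub>0 nat. Poly_Mapping.keys \<mu> \<subseteq> V \<and> tdeg \<mu> \<le> N})"
    by (rule finite_subset)
  show "inj_on Poly_Mapping.lookup {\<mu> :: 'v \<Rightarrow>\<^sub>0 nat. Poly_Mapping.keys \<mu> \<subseteq> V \<and> tdeg \<mu> \<le> N}"
    by (rule inj_onI, rule poly_mapping_eqI) simp
qed

lemma bounded_degree_span:
  assumes "finite V"
  shows "\<exists>S. finite S \<and> {p \<in> polys V. deg_le N p} \<subseteq> cp.span S"
proof -
  let ?S = "(\<lambda>\<mu>. mon_eval var \<mu>) ` {\<mu>. Poly_Mapping.keys \<mu> \<subseteq> V \<and> tdeg \<mu> \<le> N}"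
  have "p \<in> cp.span ?S" if "p \<in> polys V" "deg_le N p" for p
  proof -
    have "p = (\<Sum>\<mu>\<in>Poly_Mapping.keys p. const_poly (Poly_Mapping.lookup p \<mu>) * mon_eval var \<mu>)"
      using subst_var[of p] by (simp add: poly_eval_eq)
    moreover have "\<dots> \<in> cp.span ?S"
      using that by (intro cp.span_sum cp.span_scale cp.span_base) (auto simp: polys_iff deg_le_def)
    ultimately show ?thesis by simp
  qed
  moreover have "finite ?S" using finite_bounded_monomials[OF assms] by simp
  ultimately show ?thesis by blast
qed

section \<open>Complete reducibility\<close>

definition tr_invariant :: "nat \<Rightarrow> (nat \<times> nat) cpoly set \<Rightarrow> bool" where
  "tr_invariant m W \<longleftrightarrow> cp.subspace W \<and> W \<subseteq> polys (top_vars m) \<and> (\<forall>h\<in>carrier (GL m). \<forall>f\<in>W. tr m h f \<in> W)"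

definition tr_irreducible :: "nat \<Rightarrow> (nat \<times> nat) cpoly set \<Rightarrow> bool" where
  "tr_irreducible m W \<longleftrightarrow> tr_invariant m W \<and> W \<noteq> {0} \<and> (\<forall>W'. tr_invariant m W' \<and> W' \<subseteq> W \<longrightarrow> W' = {0} \<or> W' = W)"

text \<open>
  Unitarian trick: as the group is stable under conjugate transposition, the Fischer orthogonal
  complement of an invariant subspace is invariant.
\<close>

lemma complement_invariant:
  assumes V: "tr_invariant m V" and W: "tr_invariant m W"
  shows "tr_invariant m {f \<in> V. \<forall>w\<in>W. fischer f w = 0}"
proof -
  have V': "cp.subspace V" "V \<subseteq> polys (top_vars m)" "\<And>h f. h \<in> carrier (GL m) \<Longrightarrow> f \<in> V \<Longrightarrow> tr m h f \<in> V"
    and W': "W \<subseteq> polys (top_vars m)" "\<And>h f. h \<in> carrier (GL m) \<Longrightarrow> f \<in> W \<Longrightarrow> tr m h f \<in> W"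
    using V W by (auto simp: tr_invariant_def)
  have "fischer (tr m h f) w = 0" if "h \<in> carrier (GL m)" "f \<in> V" "\<forall>w\<in>W. fischer f w = 0" "w \<in> W" for h f w
  proof -
    have "fischer (tr m h f) w = fischer f (tr m (ctrans m h) w)" using that V'(2) W'(1) by (intro fischer_tr) auto
    then show ?thesis using that(3) W'(2)[OF ctrans_GL[OF that(1)] that(4)] by simp
  qed
  then show ?thesis using V' unfolding tr_invariant_def cp_subspace_iff
    by (auto simp: fischer_add_left fischer_scale_left)
qed

text \<open>A nonzero invariant subspace of least dimension is irreducible, and its orthogonal
  complement in V is an invariant space of smaller dimension, to which induction applies.\<close>

theorem complete_reducibility:
  assumes "tr_invariant m V" "V \<subseteq> cp.span S" "finite S"
  shows "V \<subseteq> cp.span (\<Union>{W. tr_irreducible m W \<and> W \<subseteq> V})"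
  using assms(1,2)
proof (induction "cp.dim V" arbitrary: V rule: less_induct)
  case less
  note V = less.prems
  have Vs: "cp.subspace V" using V(1) by (simp add: tr_invariant_def)
  show ?case
  proof (cases "V = {0}")
    case True
    then show ?thesis using cp.span_zero by auto
  next
    case False
    let ?P = "\<lambda>W. tr_invariant m W \<and> W \<noteq> {0} \<and> W \<subseteq> V"
    have "?P V" using V False by simp
    then have "\<exists>W. ?P W \<and> (\<forall>W'. ?P W' \<longrightarrow> cp.dim W \<le> cp.dim W')"
      by (rule ex_has_least_nat)
    then obtain W where "?P W \<and> (\<forall>W'. ?P W' \<longrightarrow> cp.dim W \<le> cp.dim W')" ..
    then have W: "tr_invariant m W" "W \<noteq> {0}" "W \<subseteq> V" and least: "\<And>W'. ?P W' \<Longrightarrow> cp.dim W \<le> cp.dim W'" by auto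
    have Ws: "cp.subspace W" and WS: "W \<subseteq> cp.span S" using W V by (auto simp: tr_invariant_def)
    have "tr_irreducible m W" unfolding tr_irreducible_def
    proof (intro conjI W allI impI)
      fix W' assume W': "tr_invariant m W' \<and> W' \<subseteq> W"
      show "W' = {0} \<or> W' = W"
      proof (rule ccontr)
        assume "\<not> (W' = {0} \<or> W' = W)"
        then have "W' \<subset> W" "W' \<noteq> {0}" using W' by auto
        moreover have "cp.subspace W'" using W' by (simp add: tr_invariant_def)
        ultimately have "cp.dim W' < cp.dim W" using cp_dim_less[OF _ Ws WS assms(3)] by blast
        moreover have "cp.dim W \<le> cp.dim W'" using least[of W'] W' W(3) \<open>W' \<noteq> {0}\<close> by auto
        ultimately show False by simp
      qed
    qed
    then have W_span: "W \<subseteq> cp.span (\<Union>{W. tr_irreducible m W \<and> W \<subseteq> V})"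
      using W(3) by (intro subsetI cp.span_base) blast
    define C where "C = {f \<in> V. \<forall>w\<in>W. fischer f w = 0}"
    have C: "tr_invariant m C" unfolding C_def by (rule complement_invariant[OF V(1) W(1)])
    have CV: "C \<subseteq> V" by (auto simp: C_def)
    have "C \<noteq> V"
    proof
      assume "C = V"
      have "w = 0" if "w \<in> W" for w using that \<open>C = V\<close> W(3) fischer_self_eq_0[of w] by (auto simp: C_def)
      then show False using W(2) Ws by (auto simp: cp_subspace_iff)
    qed
    then have "C \<subset> V" using CV by auto
    moreover have "cp.subspace C" using C by (simp add: tr_invariant_def)
    ultimately have "cp.dim C < cp.dim V" using cp_dim_less[OF _ Vs V(2) assms(3)] by blast
    from less.hyps[OF this C] CV V(2) have "C \<subseteq> cp.span (\<Union>{W. tr_irreducible m W \<and> W \<subseteq> C})" by auto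
    also have "\<dots> \<subseteq> cp.span (\<Union>{W. tr_irreducible m W \<and> W \<subseteq> V})"
      using CV by (intro cp.span_mono) auto
    finally have C_span: "C \<subseteq> cp.span (\<Union>{W. tr_irreducible m W \<and> W \<subseteq> V})" .
    obtain b where b: "finite b" "W = cp.span b"
      using cp_finite_basis[OF Ws WS assms(3)] by (elim exE conjE) (rule that)
    show ?thesis
    proof
      fix v assume v: "v \<in> V"
      obtain w where w: "w \<in> W" "\<forall>s\<in>W. fischer (v - w) s = 0"
        using fischer_projection[OF b(1), of v] unfolding b(2)[symmetric] by (elim bexE) (rule that)
      have "v - w \<in> C" using v w W(3) cp.subspace_diff[OF Vs] by (auto simp: C_def)
      then have "(v - w) + w \<in> cp.span (\<Union>{W. tr_irreducible m W \<and> W \<subseteq> V})"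
        using C_span W_span w(1) by (intro cp.span_add) auto
      then show "v \<in> cp.span (\<Union>{W. tr_irreducible m W \<and> W \<subseteq> V})" by simp
    qed
  qed
qed

section \<open>The polynomial part of the functions on \<open>GL\<^sub>m / U\<^sub>m\<close>\<close>

lemma vectorspace_R_mod_U: "vectorspace class_ring (R_GL_mod_U m)"
  by (rule vectorspace_algebra[OF algebra_R_mod_U])

lemma linear_map_restrict:
  fixes A :: "(complex, 'a) module" and B :: "(complex, 'b) module"
  assumes "vectorspace class_ring A" "vectorspace class_ring B" "\<And>x. x \<in> carrier A \<Longrightarrow> \<phi> x \<in> carrier B"
    "\<And>x y. x \<in> carrier A \<Longrightarrow> y \<in> carrier A \<Longrightarrow> \<phi> (x \<oplus>\<^bsub>A\<^esub> y) = \<phi> x \<oplus>\<^bsub>B\<^esub> \<phi> y"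
    "\<And>c x. x \<in> carrier A \<Longrightarrow> \<phi> (c \<odot>\<^bsub>A\<^esub> x) = c \<odot>\<^bsub>B\<^esub> \<phi> x"
  shows "linear_map class_ring A B \<phi>"
  unfolding linear_map_def mod_hom_def mod_hom_axioms_def LinearCombinations.module_hom_def
  using assms by (auto simp: vectorspace_def)

lemma left_translation_rep:
  assumes X: "VectorSpace.subspace class_ring X (R_GL_mod_U m)"
    and inv: "\<And>h F. h \<in> carrier (GL m) \<Longrightarrow> F \<in> X \<Longrightarrow> left_translation m h F \<in> X"
  shows "representation (GL m) (R_GL_mod_U m\<lparr>carrier := X\<rparr>) (left_translation m)"
proof -
  let ?V = "R_GL_mod_U m\<lparr>carrier := X\<rparr>"
  have vs: "vectorspace class_ring ?V" by (rule vectorspace.subspace_is_vs[OF vectorspace_R_mod_U X])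
  have hg: "GL_inv m h * g \<in> carrier (GL m)" if "h \<in> carrier (GL m)" "g \<in> carrier (GL m)" for h g
    using GL_inv(1)[OF that(1)] that(2) by (rule GL_mult)
  have ext: "F \<in> extensional (carrier (GL m))" if "F \<in> X" for F
    using subspaceD(1)[OF X] that by (auto simp: R_mod_U_carrier)
  show ?thesis unfolding representation_def
  proof (intro conjI ballI)
    fix h assume h: "h \<in> carrier (GL m)"
    show "linear_map class_ring ?V ?V (left_translation m h)"
      by (rule linear_map_restrict[OF vs vs])
        (use inv[OF h] hg[OF h] in \<open>auto simp: left_translation_def R_mod_U_simps fun_eq_iff restrict_def\<close>)
  next
    fix F assume F: "F \<in> carrier ?V"
    have "GL_inv m (1\<^sub>m m) = 1\<^sub>m m" by (rule GL_inv_unique(3)) auto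
    then show "left_translation m \<one>\<^bsub>GL m\<^esub> F = F"
      using ext[of F] F
      by (intro extensionalityI[of _ "carrier (GL m)"]) (auto simp: left_translation_def GL_carrier)
    fix h k assume h: "h \<in> carrier (GL m)" and k: "k \<in> carrier (GL m)"
    show "left_translation m (h \<otimes>\<^bsub>GL m\<^esub> k) F = left_translation m h (left_translation m k F)"
    proof (rule extensionalityI[of _ "carrier (GL m)"])
      fix g assume g: "g \<in> carrier (GL m)"
      have "GL_inv m k * GL_inv m h * g = GL_inv m k * (GL_inv m h * g)"
        using GL_inv(2)[OF h] GL_inv(2)[OF k] g by (simp add: assoc_mult_mat[of _ m m _ m _ m] GL_carrier)
      then show "left_translation m (h \<otimes>\<^bsub>GL m\<^esub> k) F g = left_translation m h (left_translation m k F) g"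
        using g hg[OF h g] by (simp add: left_translation_def GL_inv_mult[OF h k])
    qed (auto simp: left_translation_def)
  qed
qed

lemma gl_map_image_subspace:
  assumes "cp.subspace W" "W \<subseteq> low_inv m"
  shows "VectorSpace.subspace class_ring (gl_map m ` W) (R_GL_mod_U m)"
proof (rule subspaceI[OF vectorspace_R_mod_U])
  show "gl_map m ` W \<subseteq> carrier (R_GL_mod_U m)" using assms(2) gl_map_carrier by auto
  show "\<zero>\<^bsub>R_GL_mod_U m\<^esub> \<in> gl_map m ` W"
    using assms(1) by (auto simp: cp_subspace_iff simp flip: gl_map_ops)
qed (use assms(1) in \<open>auto simp: cp_subspace_iff simp flip: gl_map_ops\<close>)

lemma low_inv_subspace: "cp.subspace (low_inv m)"
  unfolding cp_subspace_iff low_inv_def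
  by (auto simp: ev.poly_eval_simps intro: add_in_polys mult_in_polys)

text \<open>A subrepresentation of the image is pulled back along the injective equivariant map
  \<open>gl_map\<close> to an invariant subspace of W, which is {0} or W.\<close>

lemma gl_map_irreducible:
  assumes irr: "tr_irreducible m W" and W: "W \<subseteq> low_inv m"
  shows "irreducible_rep (GL m) (R_GL_mod_U m\<lparr>carrier := gl_map m ` W\<rparr>) (left_translation m)"
proof -
  have inv: "tr_invariant m W" and W0: "W \<noteq> {0}"
    and min: "\<And>W'. tr_invariant m W' \<Longrightarrow> W' \<subseteq> W \<Longrightarrow> W' = {0} \<or> W' = W"
    using irr by (auto simp: tr_irreducible_def)
  have sub: "cp.subspace W" and trW: "\<And>h f. h \<in> carrier (GL m) \<Longrightarrow> f \<in> W \<Longrightarrow> tr m h f \<in> W" and Wp: "W \<subseteq> polys (top_vars m)"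
    using inv by (auto simp: tr_invariant_def)
  let ?X = "gl_map m ` W"
  have X: "VectorSpace.subspace class_ring ?X (R_GL_mod_U m)" by (rule gl_map_image_subspace[OF sub W])
  have LT: "left_translation m h (gl_map m f) = gl_map m (tr m h f)" if "h \<in> carrier (GL m)" "f \<in> W" for h f
    using that Wp by (intro left_translation_gl_map) auto
  have inj: "f = f'" if "f \<in> W" "f' \<in> W" "gl_map m f = gl_map m f'" for f f'
    by (rule gl_map_inj[OF _ _ that(3)]) (use that Wp in auto)
  have zero: "0 \<in> W" using sub by (simp add: cp_subspace_iff)
  show ?thesis unfolding irreducible_rep_def
  proof (intro conjI allI impI)
    show "representation (GL m) (R_GL_mod_U m\<lparr>carrier := ?X\<rparr>) (left_translation m)"
      by (rule left_translation_rep[OF X]) (use LT trW in auto)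
    show "carrier (R_GL_mod_U m\<lparr>carrier := ?X\<rparr>) \<noteq> {\<zero>\<^bsub>R_GL_mod_U m\<lparr>carrier := ?X\<rparr>\<^esub>}"
    proof
      assume "carrier (R_GL_mod_U m\<lparr>carrier := ?X\<rparr>) = {\<zero>\<^bsub>R_GL_mod_U m\<lparr>carrier := ?X\<rparr>\<^esub>}"
      then have "?X = {gl_map m 0}" by (simp add: gl_map_ops)
      then have "f = 0" if "f \<in> W" for f using inj[OF that zero] that by blast
      then show False using W0 zero by auto
    qed
    fix Y assume Y: "VectorSpace.subspace class_ring Y (R_GL_mod_U m\<lparr>carrier := ?X\<rparr>) \<and>
      (\<forall>g\<in>carrier (GL m). left_translation m g ` Y \<subseteq> Y)"
    have "VectorSpace.subspace class_ring Y (R_GL_mod_U m\<lparr>carrier := ?X\<rparr>)" using Y by simp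
    note D = subspaceD[OF this, simplified]
    let ?W = "{f \<in> W. gl_map m f \<in> Y}"
    have "tr_invariant m ?W"
      unfolding tr_invariant_def cp_subspace_iff
    proof (intro conjI ballI allI)
      show "0 \<in> ?W" using zero D(2) by (simp add: gl_map_ops)
      show "?W \<subseteq> polys (top_vars m)" using Wp by auto
      fix h f assume h: "h \<in> carrier (GL m)" and f: "f \<in> ?W"
      have "left_translation m h (gl_map m f) \<in> Y" using Y h f by blast
      then show "tr m h f \<in> ?W" using LT[OF h] trW[OF h] f by simp
    qed (use D(3,4) sub in \<open>auto simp: gl_map_ops(1,3,4) cp_subspace_iff\<close>)
    then have "?W = {0} \<or> ?W = W" by (rule min) auto
    moreover have YW: "Y = gl_map m ` ?W" using D(1) by auto
    ultimately show "Y = {\<zero>\<^bsub>R_GL_mod_U m\<lparr>carrier := ?X\<rparr>\<^esub>} \<or> Y = carrier (R_GL_mod_U m\<lparr>carrier := ?X\<rparr>)"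
      by (elim disjE) (simp_all add: gl_map_ops)
  qed
qed

text \<open>Through \<open>gl_map\<close> a functional on the image becomes a Fischer product with
  some w, so its matrix coefficients are the functions h -> \<open>fischer (tr m h f) w\<close>,
  polynomial in h.\<close>

lemma gl_map_polynomial_rep:
  assumes inv: "tr_invariant m W" and W: "W \<subseteq> low_inv m" and fin: "W \<subseteq> cp.span S" "finite S"
  shows "polynomial_rep m (R_GL_mod_U m\<lparr>carrier := gl_map m ` W\<rparr>) (left_translation m)"
proof -
  have sub: "cp.subspace W" and trW: "\<And>h f. h \<in> carrier (GL m) \<Longrightarrow> f \<in> W \<Longrightarrow> tr m h f \<in> W" and Wp: "W \<subseteq> polys (top_vars m)"
    using inv by (auto simp: tr_invariant_def)
  let ?X = "gl_map m ` W" and ?V = "R_GL_mod_U m\<lparr>carrier := gl_map m ` W\<rparr>"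
  have X: "VectorSpace.subspace class_ring ?X (R_GL_mod_U m)" by (rule gl_map_image_subspace[OF sub W])
  have vs: "vectorspace class_ring ?V" by (rule vectorspace.subspace_is_vs[OF vectorspace_R_mod_U X])
  have LT: "left_translation m h (gl_map m f) = gl_map m (tr m h f)" if "h \<in> carrier (GL m)" "f \<in> W" for h f
    using that Wp by (intro left_translation_gl_map) auto
  obtain b where b: "finite b" "b \<subseteq> W" "W = cp.span b"
    using cp_finite_basis[OF sub fin] by (elim exE conjE) (rule that)
  show ?thesis unfolding polynomial_rep_def
  proof (intro conjI ballI)
    show "representation (GL m) ?V (left_translation m)"
      by (rule left_translation_rep[OF X]) (use LT trW in auto)
    have bX: "gl_map m ` b \<subseteq> carrier ?V" using b(2) by auto
    let ?sp = "LinearCombinations.module.span class_ring ?V (gl_map m ` b)"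
    have spsub: "VectorSpace.subspace class_ring ?sp ?V" "gl_map m ` b \<subseteq> ?sp"
      by (rule module_span_subspace[OF vs bX])+
    note D = subspaceD[OF spsub(1), simplified]
    \<comment> \<open>The preimage of the span is a subspace containing b, hence contains W; so the
      images of b span the representation.\<close>
    have "cp.subspace {f. gl_map m f \<in> ?sp}"
      unfolding cp_subspace_iff using D(2-4) by (auto simp: gl_map_ops(1,3,4))
    then have "cp.span b \<subseteq> {f. gl_map m f \<in> ?sp}" using spsub(2) by (intro cp.span_minimal) auto
    then have "carrier ?V \<subseteq> ?sp" using b(3) by auto
    then have "?sp = carrier ?V" using D(1) by auto
    then show "vectorspace.fin_dim class_ring ?V"
      unfolding vectorspace.fin_dim_def[OF vs] using b(1) bX by (intro exI[of _ "gl_map m ` b"]) simp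
    fix \<phi> F assume \<phi>: "\<phi> \<in> LinearCombinations.module_hom class_ring ?V complex_line" and F: "F \<in> carrier ?V"
    obtain f where f: "f \<in> W" "F = gl_map m f" using F by auto
    have \<phi>_add: "\<phi> (x \<oplus>\<^bsub>R_GL_mod_U m\<^esub> y) = \<phi> x + \<phi> y" if "x \<in> ?X" "y \<in> ?X" for x y
      using \<phi> that by (auto simp: LinearCombinations.module_hom_def complex_line_def)
    have \<phi>_smult: "\<phi> (c \<odot>\<^bsub>R_GL_mod_U m\<^esub> x) = c * \<phi> x" if "x \<in> ?X" for c x
      using \<phi> that by (auto simp: LinearCombinations.module_hom_def complex_line_def)
    have "\<exists>w\<in>cp.span b. \<forall>s\<in>cp.span b. \<phi> (gl_map m s) = fischer s w"
      by (rule fischer_riesz[OF b(1)]) (use \<phi>_add \<phi>_smult b(3) in \<open>auto simp: gl_map_ops(1,3,4)\<close>)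
    then obtain w where w: "\<forall>s\<in>W. \<phi> (gl_map m s) = fischer s w" unfolding b(3) by auto
    obtain p where p: "p \<in> polys (top_vars m)" "\<forall>h. fischer (tr m h f) w = ev (\<lambda>ij. h $$ ij) p"
      using fischer_tr_poly[of f m w] f(1) Wp by auto
    have "\<phi> (left_translation m h F) = ev (\<lambda>ij. h $$ ij) p" if "h \<in> carrier (GL m)" for h
      using LT[OF that f(1)] w trW[OF that f(1)] p(2) by (simp add: f(2))
    then show "\<exists>p\<in>carrier (poly_alg (top_vars m)). \<forall>h\<in>carrier (GL m). \<phi> (left_translation m h F) = poly_eval id (\<lambda>ij. h $$ ij) p"
      using p(1) by (auto simp: ev_def)
  qed
qed

theorem R_plus_eq: "R_plus m = gl_map m ` low_inv m"
proof -
  let ?R = "R_GL_mod_U m"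
  let ?irr = "{W. VectorSpace.subspace class_ring W ?R \<and> irreducible_rep (GL m) (?R\<lparr>carrier := W\<rparr>) (left_translation m) \<and>
    polynomial_rep m (?R\<lparr>carrier := W\<rparr>) (left_translation m)}"
  have irr_sub: "\<Union>?irr \<subseteq> carrier ?R" using subspaceD(1) by blast
  have RP: "VectorSpace.subspace class_ring (gl_map m ` low_inv m) ?R"
    by (rule gl_map_image_subspace[OF low_inv_subspace order_refl])
  show ?thesis
  proof (intro equalityI)
    interpret vectorspace class_ring ?R by (rule vectorspace_R_mod_U)
    have "W \<subseteq> gl_map m ` low_inv m" if W: "VectorSpace.subspace class_ring W ?R"
      "polynomial_rep m (?R\<lparr>carrier := W\<rparr>) (left_translation m)" for W
    proof
      fix F assume F: "F \<in> W"
      let ?\<phi> = "\<lambda>F :: complex mat \<Rightarrow> complex. F (1\<^sub>m m)"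
      have "?\<phi> \<in> LinearCombinations.module_hom class_ring (?R\<lparr>carrier := W\<rparr>) complex_line"
        by (auto simp: LinearCombinations.module_hom_def complex_line_def R_mod_U_simps GL_one)
      then obtain p where p: "p \<in> polys (top_vars m)"
        "\<forall>h\<in>carrier (GL m). left_translation m h F (1\<^sub>m m) = ev (\<lambda>ij. h $$ ij) p"
        using W(2) F unfolding polynomial_rep_def ev_def by fastforce
      have "F g = ev (\<lambda>ij. GL_inv m g $$ ij) p" if g: "g \<in> carrier (GL m)" for g
      proof -
        note G = GL_inv[OF g]
        have "left_translation m (GL_inv m g) F (1\<^sub>m m) = F g"
          using G(3,6) GL_one by (simp add: left_translation_def)
        then show ?thesis using p(2) G(1) by simp
      qed
      moreover have "F \<in> carrier ?R" using F subspaceD(1)[OF W(1)] by auto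
      ultimately show "F \<in> gl_map m ` low_inv m" using gl_map_surj[OF _ p(1)] by blast
    qed
    then have "\<Union>?irr \<subseteq> gl_map m ` low_inv m" by blast
    then show "R_plus m \<subseteq> gl_map m ` low_inv m" unfolding R_plus_def
      by (rule span_is_subset) (use RP in \<open>simp add: VectorSpace.subspace_def\<close>)
  next
    have sp: "VectorSpace.subspace class_ring (R_plus m) ?R" "\<Union>?irr \<subseteq> R_plus m"
      unfolding R_plus_def by (rule module_span_subspace[OF vectorspace_R_mod_U irr_sub])+
    note D = subspaceD[OF sp(1)]
    have cps: "cp.subspace {f. gl_map m f \<in> R_plus m}"
      unfolding cp_subspace_iff using D(2-4) by (auto simp: gl_map_ops(1,3,4))
    show "gl_map m ` low_inv m \<subseteq> R_plus m"
    proof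
      fix F assume "F \<in> gl_map m ` low_inv m"
      then obtain f where f: "f \<in> low_inv m" "F = gl_map m f" by auto
      obtain N where N: "deg_le N f" using exists_deg_le[of f] by blast
      \<comment> \<open>Bounding the degree gives a finite-dimensional invariant space that contains
        f, to which complete reducibility applies.\<close>
      let ?V = "{p \<in> low_inv m. deg_le N p}"
      obtain S where S: "finite S" "{p \<in> polys (top_vars m). deg_le N p} \<subseteq> cp.span S"
        using bounded_degree_span[of "top_vars m" N] by auto
      have VS: "?V \<subseteq> cp.span S" using S(2) low_inv_polys by auto
      have V: "tr_invariant m ?V"
        using low_inv_subspace[of m] low_inv_polys
        unfolding tr_invariant_def cp_subspace_iff
        by (auto intro: tr_low_inv deg_le_tr deg_le_add deg_le_scale)
      have "f \<in> cp.span (\<Union>{W. tr_irreducible m W \<and> W \<subseteq> ?V})"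
        using complete_reducibility[OF V VS S(1)] f(1) N by auto
      also have "\<dots> \<subseteq> {f. gl_map m f \<in> R_plus m}"
      proof (rule cp.span_minimal[OF _ cps])
        show "\<Union>{W. tr_irreducible m W \<and> W \<subseteq> ?V} \<subseteq> {f. gl_map m f \<in> R_plus m}"
        proof (intro Union_least subsetI CollectI)
          fix W p assume W: "W \<in> {W. tr_irreducible m W \<and> W \<subseteq> ?V}" and p: "p \<in> W"
          have WL: "W \<subseteq> low_inv m" and WS: "W \<subseteq> cp.span S" and Wi: "tr_irreducible m W" using W VS by auto
          then have Wt: "tr_invariant m W" by (simp add: tr_irreducible_def)
          then have Wsub: "cp.subspace W" by (simp add: tr_invariant_def)
          have "gl_map m ` W \<in> ?irr"
            using gl_map_image_subspace[OF Wsub WL] gl_map_irreducible[OF Wi WL] gl_map_polynomial_rep[OF Wt WL WS S(1)] by blast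
          then show "gl_map m p \<in> R_plus m" using sp(2) p by blast
        qed
      qed
      finally show "F \<in> R_plus m" using f(2) by simp
    qed
  qed
qed

section \<open>The main theorem\<close>

text \<open>The closure properties of \<open>low_inv\<close> are transported along
  \<open>gl_map\<close>, which respects all operations.\<close>

lemma subalg_R_plus: "subalg (R_plus m) (R_GL_mod_U m)"
proof (rule subalgI[OF algebra_R_mod_U])
  have one: "1 \<in> low_inv m" by (simp add: low_inv_def ev.poly_eval_simps)
  have mult: "f * g \<in> low_inv m" if "f \<in> low_inv m" "g \<in> low_inv m" for f g
    using that by (auto simp: low_inv_def ev.poly_eval_simps intro: mult_in_polys)
  have sub: "f + g \<in> low_inv m" "const_poly c * f \<in> low_inv m" if "f \<in> low_inv m" "g \<in> low_inv m" for f g c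
    using low_inv_subspace[of m] that by (auto simp: cp_subspace_iff)
  show "R_plus m \<subseteq> carrier (R_GL_mod_U m)" unfolding R_plus_eq using gl_map_carrier by auto
  show "\<one>\<^bsub>R_GL_mod_U m\<^esub> \<in> R_plus m"
    unfolding R_plus_eq using one by (auto simp flip: gl_map_ops)
  fix x y c assume x: "x \<in> R_plus m"
  show "c \<odot>\<^bsub>R_GL_mod_U m\<^esub> x \<in> R_plus m"
    using x unfolding R_plus_eq by (auto simp flip: gl_map_ops intro!: imageI sub(2))
  assume y: "y \<in> R_plus m"
  show "x \<oplus>\<^bsub>R_GL_mod_U m\<^esub> y \<in> R_plus m" "x \<otimes>\<^bsub>R_GL_mod_U m\<^esub> y \<in> R_plus m"
    using x y unfolding R_plus_eq by (auto simp flip: gl_map_ops intro!: imageI sub mult)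
qed

theorem theorem9p1:
  fixes n m :: nat
  assumes "n > 2 * m"
  shows "subalg (harmonics n m \<inter> U_invariants n m) (P_mat n m)
    \<and> alg_iso (PU_alg n m) (tensor_alg (HU_alg n m) (sym_alg (sp20_space n m))) \<noteq> {}
    \<and> subalg (R_plus m) (R_GL_mod_U m)
    \<and> (\<exists>\<phi>. \<phi> \<in> alg_iso (HU_alg n m) (R_plus_alg m)
          \<and> \<phi> \<in> rep_iso (GL m) (HU_alg n m) (act n m (1\<^sub>m n)) (R_plus_alg m) (left_translation m))"
proof -
  have mn: "2 * m \<le> n" "m \<le> n" using assms by auto
  have H: "harmonics n m \<inter> U_invariants n m = low_inv m"
    using harmonic_invariants[OF assms] top_invariants_eq_low_inv[OF mn(1)] by simp
  have subH: "subalg (low_inv m) (P_mat n m)"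
    using subalg_top_invariants[OF mn(2)] top_invariants_eq_low_inv[OF mn(1)] by simp
  have HU: "HU_alg n m = P_mat n m\<lparr>carrier := low_inv m\<rparr>" by (simp add: HU_alg_def H)
  have lp: "low_inv m \<subseteq> polys ({0..<n} \<times> {0..<m})" using subalg_polysD(1)[OF subH] .
  have act: "act n m (1\<^sub>m n) h f = tr m h f" if "h \<in> carrier (GL m)" "f \<in> low_inv m" for h f
    using that lp by (intro act_eq_tr) (auto simp: GL_carrier)
  have vsH: "vectorspace class_ring (HU_alg n m)" and vsR: "vectorspace class_ring (R_plus_alg m)"
    unfolding HU R_plus_alg_def
    by (rule vectorspace_algebra[OF subalg_algebra[OF algebra_poly_alg subH]],
        rule vectorspace_algebra[OF subalg_algebra[OF algebra_R_mod_U subalg_R_plus]])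
  have bij: "bij_betw (gl_map m) (low_inv m) (R_plus m)"
    unfolding bij_betw_def R_plus_eq by (auto intro!: inj_onI gl_map_inj low_inv_polys)
  have in_R: "gl_map m f \<in> R_plus m" if "f \<in> low_inv m" for f using that by (simp add: R_plus_eq)
  have LT: "left_translation m h (gl_map m f) = gl_map m (tr m h f)" if "h \<in> carrier (GL m)" "f \<in> low_inv m" for h f
    using that low_inv_polys by (intro left_translation_gl_map) auto
  have "gl_map m \<in> alg_iso (HU_alg n m) (R_plus_alg m)"
    unfolding alg_iso_def ring_iso_def Ring.ring_hom_def HU R_plus_alg_def
    using bij in_R gl_map_ops(3)[of m] by (auto simp: gl_map_ops(1,2,5))
  moreover have "gl_map m \<in> rep_iso (GL m) (HU_alg n m) (act n m (1\<^sub>m n)) (R_plus_alg m) (left_translation m)"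
    unfolding rep_iso_def
  proof (intro CollectI conjI ballI)
    show "representation (GL m) (HU_alg n m) (act n m (1\<^sub>m n))"
      unfolding representation_def
    proof (intro conjI ballI)
      fix h assume h: "h \<in> carrier (GL m)"
      show "linear_map class_ring (HU_alg n m) (HU_alg n m) (act n m (1\<^sub>m n) h)"
        by (rule linear_map_restrict[OF vsH vsH])
          (use subalg_polysD[OF subH] in \<open>auto simp: HU act[OF h] tr_low_inv tr_simps\<close>)
    next
      fix f assume f: "f \<in> carrier (HU_alg n m)"
      then have f': "f \<in> low_inv m" by (simp add: HU)
      show "act n m (1\<^sub>m n) \<one>\<^bsub>GL m\<^esub> f = f"
        using act[OF GL_one f'] tr_one[OF low_inv_polys[OF f']] by simp
      fix h k assume h: "h \<in> carrier (GL m)" and k: "k \<in> carrier (GL m)"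
      show "act n m (1\<^sub>m n) (h \<otimes>\<^bsub>GL m\<^esub> k) f = act n m (1\<^sub>m n) h (act n m (1\<^sub>m n) k f)"
        using act[OF GL_mult[OF h k] f'] act[OF k f'] act[OF h tr_low_inv[OF f']] tr_mult[OF low_inv_polys[OF f']] h k
        by (simp add: GL_carrier)
    qed
    show "representation (GL m) (R_plus_alg m) (left_translation m)"
      unfolding R_plus_alg_def
    proof (rule left_translation_rep)
      show "VectorSpace.subspace class_ring (R_plus m) (R_GL_mod_U m)"
        using subalg_R_plus by (simp add: subalg_def)
      show "left_translation m h F \<in> R_plus m" if "h \<in> carrier (GL m)" "F \<in> R_plus m" for h F
        using that LT tr_low_inv by (auto simp: R_plus_eq)
    qed
    show "linear_map class_ring (HU_alg n m) (R_plus_alg m) (gl_map m)"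
      by (rule linear_map_restrict[OF vsH vsR]) (use in_R in \<open>auto simp: HU R_plus_alg_def gl_map_ops(1,3,4)\<close>)
    show "bij_betw (gl_map m) (carrier (HU_alg n m)) (carrier (R_plus_alg m))"
      using bij by (simp add: HU R_plus_alg_def)
    show "gl_map m (act n m (1\<^sub>m n) h f) = left_translation m h (gl_map m f)"
      if "h \<in> carrier (GL m)" "f \<in> carrier (HU_alg n m)" for h f
      using that act LT by (simp add: HU)
  qed
  ultimately have "\<exists>\<phi>. \<phi> \<in> alg_iso (HU_alg n m) (R_plus_alg m)
      \<and> \<phi> \<in> rep_iso (GL m) (HU_alg n m) (act n m (1\<^sub>m n)) (R_plus_alg m) (left_translation m)" by blast
  moreover have "subalg (harmonics n m \<inter> U_invariants n m) (P_mat n m)" unfolding H by (rule subH)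
  ultimately show ?thesis using PU_tensor_iso[OF assms] subalg_R_plus by blast
qed

end
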